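(* The assignments $(\mathcal G,\epsilon)\mapsto(\mathcal R_G,\mathcal L_G;\Gamma_G)$ on inductive groupoids and $F\mapsto(F_1,F_2)$ on inductive functors constitute a functor $\mathbb C:\mathbf{IG}\to\mathbf{CC}$ from the category of inductive groupoids to the category of cross-connections.
   Context: All composition of maps and morphisms is written left to right. For a small category $\mathcal C$, $v\mathcal C$ is its object set, $\mathcal C$ also denotes its set of morphisms, $\mathcal C(c,d)$ is the set of morphisms from $c$ to $d$. PART 1: THE CATEGORY $\mathbf{IG}$. Biordered sets. Let $E$ be a set with a partial binary operation (juxtaposition, the basic product) with domain $D_E\subseteq E\times E$. Put $e\leqslant_\ell f$ iff $(e,f)\in D_E$ and $ef=e$; $e\leqslant_r f$ iff $(f,e)\in D_E$ and $fe=e$; $\mathscr L=\leqslant_\ell\cap(\leqslant_\ell)^{-1}$, $\mathscr R=\leqslant_r\cap(\leqslant_r)^{-1}$, $\leqslant=\leqslant_\ell\cap\leqslant_r$. $E$ is a biordered set if for all $e,f,g\in E$: (B1) $\leqslant_\ell,\leqslant_r$ are preorders and $D_E=\leqslant_\ell\cup\leqslant_r\cup(\leqslant_\ell\cup\leqslant_r)^{-1}$; (B2) $e\leqslant_\ell f$ implies $e\mathrel{\mathscr L}fe\leqslant f$, and $e\leqslant_r f$ implies $e\mathrel{\mathscr R}ef\leqslant f$; (B3) if $f,g\leqslant_r e$ and $f\leqslant_\ell g$ then $fe\leqslant_\ell ge$ and $(gf)e=(ge)(fe)$; if $f,g\leqslant_\ell e$ and $f\leqslant_r g$ then $ef\leqslant_r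 eg$ and $e(fg)=(ef)(eg)$; (B4) $e\leqslant_\ell f\leqslant_\ell g$ implies $f(ge)=fe$; $e\leqslant_r f\leqslant_r g$ implies $(eg)f=ef$; (B5) if $f,g\leqslant_\ell e$ and $ef\leqslant_r eg$, there is $f'\in E$ with $f'\leqslant_r g$, $f'\leqslant_\ell e$, $ef'=ef$; if $f,g\leqslant_r e$ and $fe\leqslant_\ell ge$, there is $f'\in E$ with $f'\leqslant_\ell g$, $f'\leqslant_r e$, $f'e=fe$. The sandwich set $\mathcal S(e,f)$ consists of all $h$ with $h\leqslant_\ell e$, $h\leqslant_r f$ such that every $g$ with $g\leqslant_\ell e$, $g\leqslant_r f$ satisfies $gf\leqslant_\ell hf$ and $eg\leqslant_r eh$. $E$ is regular if all $\mathcal S(e,f)$ are non-empty. A bimorphism $\theta:E\to E'$ is a map such that $(e,f)\in D_E$ implies $(e\theta,f\theta)\in D_{E'}$ and $(ef)\theta=(e\theta)(f\theta)$; it is regular (for $E$ regular) if $(\mathcal S(e,f))\theta\subseteq\mathcal S'(e\theta,f\theta)$ for all $e,f\in E$, where $\mathcal S'$ denotes sandwich sets in $E'$. Ordered groupoids. A groupoid $\mathcal G$ (domain and codomain maps $\mathbf d,\mathbf r$) with a partial order $\le$ on its morphisms is an ordered groupoid if: (OG1) $u\le x$, $v\le y$, $\mathbf r(u)=\mathbf d(v)$, $\mathbf r(x)=\mathbf d(y)$ imply $uv\le xy$; (OG2) $x\le y$ implies $x^{-1}\le y^{-1}$; (OG3) if $1_e\le 1_{\mathbf d(x)}$ there is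 a unique morphism $e{\downharpoonleft}x\le x$ with domain $e$; (OG3* ) if $1_f\le1_{\mathbf r(x)}$ there is a unique morphism $x{\downharpoonright}f\le x$ with codomain $f$. The order on identities gives an order on $v\mathcal G$. A $v$-isomorphism of ordered groupoids is an order preserving functor whose object map is an order isomorphism. $E$-chains. An $E$-path is a sequence $(e_1,\dots,e_n)$ in $E$ with $e_i\mathrel{(\mathscr R\cup\mathscr L)}e_{i+1}$; $e_i$ is inessential if $e_{i-1}\mathrel{\mathscr R}e_i\mathrel{\mathscr R}e_{i+1}$ or $e_{i-1}\mathrel{\mathscr L}e_i\mathrel{\mathscr L}e_{i+1}$. $E$-chains are classes of $E$-paths with the same endpoints modulo adding/removing inessential elements (and $(e,e)$ is identified with $(e)$). They form a groupoid $\mathcal G(E)$ with object set $E$: $(e_1,\dots,e_n)$ goes from $e_1$ to $e_n$, composition is concatenation. It is an ordered groupoid under: $(e_1,\dots,e_n)\le_E(f_1,\dots,f_m)$ iff $e_1\leqslant f_1$ and $(e_1,\dots,e_n)$ equals the chain $(h_1,\dots,h_m)$, with $h_1=e_1$, $h_i=(f_ih_{i-1})f_i$. An $E$-square $\left[\begin{smallmatrix} e & f \\ g & h \end{smallmatrix}\right]$ requires $e\mathrel{\mathscr R}f\mathrel{\mathscr L}h\mathrel{\mathscr R}g\mathrel{\mathscr L}e$. Singular squares: $\left[\begin{smallmatrix} g & h \\ eg & eh \end{smallmatrix}\right]$ with $g,h\leqslant_\ell e$, $g\mathrel{\mathscr R}h$ (row-singular), and $\left[\begin{smallmatrix} g &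 ge \\ h & he \end{smallmatrix}\right]$ with $g,h\leqslant_r e$, $g\mathrel{\mathscr L}h$ (column-singular). Inductive groupoids. Let $E$ be a regular biordered set, $\mathcal G$ an ordered groupoid and $\epsilon:\mathcal G(E)\to\mathcal G$ a $v$-isomorphism (evaluation functor); identify $v\mathcal G$ with $E$ via $v\epsilon$. $(\mathcal G,\epsilon)$ is an inductive groupoid if: (IG1) whenever $x\in\mathcal G$, $e_i,f_i\in E$ ($i=1,2$), $e_i\leqslant\mathbf d(x)$, $f_i=\mathbf r(e_i{\downharpoonleft}x)$: if $e_1\leqslant_r e_2$, then $f_1\leqslant_r f_2$ and $\epsilon(e_1,e_1e_2)\,(e_1e_2{\downharpoonleft}x)=(e_1{\downharpoonleft}x)\,\epsilon(f_1,f_1f_2)$; and dually if $e_1\leqslant_\ell e_2$, then $f_1\leqslant_\ell f_2$ and $\epsilon(e_1,e_2e_1)\,(e_2e_1{\downharpoonleft}x)=(e_1{\downharpoonleft}x)\,\epsilon(f_1,f_2f_1)$; (IG2) every singular $E$-square $\left[\begin{smallmatrix} e & f \\ g & h \end{smallmatrix}\right]$ satisfies $\epsilon(e,f)\epsilon(f,h)=\epsilon(e,g)\epsilon(g,h)$. An inductive functor $(\mathcal G,\epsilon)\to(\mathcal G',\epsilon')$ is an order preserving functor $F:\mathcal G\to\mathcal G'$ whose object map $vF:E\to E'$ is a regular bimorphism and such that $F(\epsilon(\mathfrak c))=\epsilon'(\mathcal G(vF)(\mathfrak c))$ for every $E$-chain $\mathfrak c$, where $\mathcal G(vF)(e_1,\dots,e_n)=(vF(e_1),\dots,vF(e_n))$.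 $\mathbf{IG}$ is the category of inductive groupoids and inductive functors. PART 2: THE CATEGORY $\mathbf{CC}$. Normal categories. A category with subobjects is a small category $\mathcal C$ with a subcategory $\mathcal P$, $v\mathcal P=v\mathcal C$, that is a strict preorder (at most one morphism between two objects, only identities are isomorphisms), such that every $f\in\mathcal P$ is a monomorphism of $\mathcal C$, and $f=hg$ with $f,g\in\mathcal P$, $h\in\mathcal C$ implies $h\in\mathcal P$. Morphisms of $\mathcal P$ are inclusions; $c'\subseteq c$ means there is an inclusion $j(c',c):c'\to c$; it splits if $j(c',c)q=1_{c'}$ for some $q:c\to c'$, then called a retraction. A normal factorization of $f:c\to d$ is $f=quj$ with $q:c\to c'$ a retraction ($c'\subseteq c$), $u:c'\to d'$ an isomorphism, $j=j(d',d)$ an inclusion; $f^\circ=qu$ is the epimorphic component (uniquely determined by $f$). A cone with apex $d\in v\mathcal C$ is a map $\gamma:v\mathcal C\to\mathcal C$ with $\gamma(c)\in\mathcal C(c,d)$ for all $c$, $j(c,c')\gamma(c')=\gamma(c)$ whenever $c\subseteq c'$, and $\gamma(c)$ an isomorphism for some $c$. The apex is denoted $c_\gamma$; $\gamma$ is idempotent if $\gamma(c_\gamma)=1_{c_\gamma}$. For an epimorphism $f:c_\gamma\to d$, $\gamma*f$ is the cone $a\mapsto\gamma(a)f$. A category with subobjects is normal if every morphism has a normal factorization, every inclusion splits, and each object is the apex of an idempotent cone. Normal dual. For a cone $\gamma$ in a normal category $\mathcal C$, the $H$-functor $H(\gamma;-):\mathcal C\to\mathbf{Set}$ is $H(\gamma;c)=\{\gamma*f^\circ: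 f\in\mathcal C(c_\gamma,c)\}$, and $H(\gamma;g):\gamma*f^\circ\mapsto\gamma*(fg)^\circ$ for $g\in\mathcal C(c,d)$. There is a natural isomorphism $\eta_\gamma:H(\gamma;-)\to\mathcal C(c_\gamma,-)$, $\gamma*f^\circ\mapsto f$. The normal dual $N^*\mathcal C$ is the full subcategory of the functor category from $\mathcal C$ to $\mathbf{Set}$ whose objects are the $H$-functors; it is a normal category (its inclusions being the natural transformations all of whose components are set inclusions). The $M$-set is $MH(\gamma;-)=M\gamma=\{c\in v\mathcal C:\gamma(c)\text{ is an isomorphism}\}$ (it depends only on the functor). Cross-connections. The ideal $\langle c\rangle$ is the full subcategory of $\mathcal C$ on $\{d: d\subseteq c\}$. A functor $F$ between normal categories is a local isomorphism if it is inclusion preserving, fully faithful, and for each $c$ restricts to an isomorphism of $\langle c\rangle$ onto $\langle F(c)\rangle$. A cross-connection from $\mathcal D$ to $\mathcal C$ (normal categories) is a triple $(\mathcal D,\mathcal C;\Gamma)$ with $\Gamma:\mathcal D\to N^*\mathcal C$ a local isomorphism such that every $c\in v\mathcal C$ lies in $M\Gamma(d)$ for some $d\in v\mathcal D$. Put $E_\Gamma=\{(c,d)\in v\mathcal C\times v\mathcal D: c\in M\Gamma(d)\}$. There is a unique dual cross-connection $(\mathcal C,\mathcal D;\Delta)$ from $\mathcal C$ to $\mathcal D$ such that $(c,d)\in E_\Gamma$ iff $(d,c)\in E_\Delta$. For $(c,d)\in E_\Gamma$, $\gamma(c,d)$ is the unique idempotent cone in $\mathcal C$ with apex $c$ and $H(\gamma(c,d);-)=\Gamma(d)$;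 similarly $\delta(c,d)$ is the unique idempotent cone in $\mathcal D$ with apex $d$ and $H(\delta(c,d);-)=\Delta(c)$. For $(c,d),(c',d')\in E_\Gamma$, $f\in\mathcal C(c,c')$ and $f^*\in\mathcal D(d',d)$, the morphism $f^*$ is the transpose of $f$ if $\eta_{\delta(c,d)}\,\mathcal D(f^*,-)=\Delta(f)\,\eta_{\delta(c',d')}$ as natural transformations $\Delta(c)\to\mathcal D(d',-)$, where $\mathcal D(f^*,-):\mathcal D(d,-)\to\mathcal D(d',-)$ is $h\mapsto f^*h$. A morphism of cross-connections $(\mathcal D,\mathcal C;\Gamma)\to(\mathcal D',\mathcal C';\Gamma')$ is a pair $m=(F_m,G_m)$ of inclusion preserving functors $F_m:\mathcal C\to\mathcal C'$, $G_m:\mathcal D\to\mathcal D'$ such that: (M1) if $(c,d)\in E_\Gamma$ then $(F_m(c),G_m(d))\in E_{\Gamma'}$ and $F_m(\gamma(c,d)(c'))=\gamma(F_m(c),G_m(d))(F_m(c'))$ for all $c'\in v\mathcal C$; (M2) if $(c,d),(c',d')\in E_\Gamma$ and $f^*:d'\to d$ is the transpose of $f:c\to c'$, then $G_m(f^* )$ is the transpose of $F_m(f)$. $\mathbf{CC}$ is the category of cross-connections with these morphisms. PART 3: THE ASSIGNMENTS. Let $(\mathcal G,\epsilon)$ be an inductive groupoid with regular biordered set $E$. For $\alpha,\beta\in\mathcal G$ and $h\in\mathcal S(\mathbf r(\alpha),\mathbf d(\beta))$ put $(\alpha\circ\beta)_h=(\alpha{\downharpoonright}\mathbf r(\alpha)h)\,\epsilon(\mathbf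 r(\alpha)h,h)\,\epsilon(h,h\mathbf d(\beta))\,(h\mathbf d(\beta){\downharpoonleft}\beta)$. Let $p$ be the equivalence relation on $\mathcal G$ given by: $\alpha\,p\,\beta$ iff $\mathbf d(\alpha)\mathrel{\mathscr R}\mathbf d(\beta)$, $\mathbf r(\alpha)\mathrel{\mathscr L}\mathbf r(\beta)$ and $\alpha\,\epsilon(\mathbf r(\alpha),\mathbf r(\beta))=\epsilon(\mathbf d(\alpha),\mathbf d(\beta))\,\beta$; $\overline\alpha$ is the $p$-class of $\alpha$. The category $\mathcal L_G$. All categories here have object set $E/\mathscr L$; $\overleftarrow e$ is the $\mathscr L$-class of $e$, and $\overleftarrow e\leq_L\overleftarrow f$ iff $e\leqslant_\ell f$. $\mathcal P_L$ is the preorder category of $(E/\mathscr L,\leq_L)$, with morphisms $j_{\mathcal L}(e,f):\overleftarrow e\to\overleftarrow f$ for $e\leqslant_\ell f$. $\mathcal G_L$: put $\alpha\sim_L\beta$ iff $\mathbf d(\alpha)\mathrel{\mathscr L}\mathbf d(\beta)$, $\mathbf r(\alpha)\mathrel{\mathscr L}\mathbf r(\beta)$ and $\alpha\,\epsilon(\mathbf r(\alpha),\mathbf r(\beta))=\epsilon(\mathbf d(\alpha),\mathbf d(\beta))\,\beta$; the $\sim_L$-class $\overleftarrow\alpha$ of $\alpha\in\mathcal G(e,f)$ is a morphism $\overleftarrow e\to\overleftarrow f$, and $\overleftarrow\alpha\,\overleftarrow\beta=\overleftarrow{\alpha\,\epsilon(\mathbf r(\alpha),\mathbf d(\beta))\,\beta}$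 when $\mathbf r(\alpha)\mathrel{\mathscr L}\mathbf d(\beta)$. $\mathcal Q_L$: for $u\leqslant e$ there is a morphism $q_{\mathcal L}(e,u):\overleftarrow e\to\overleftarrow u$, with $q_{\mathcal L}(e,u)=q_{\mathcal L}(g,v)$ iff $e\mathrel{\mathscr L}g$ and $v=gu$; $q_{\mathcal L}(e,u)\,q_{\mathcal L}(f,v)=q_{\mathcal L}(e,uv)$ when $u\mathrel{\mathscr L}f$. $\mathcal E_L$: on the pairs $(q,\overleftarrow\alpha)\in\mathcal Q_L\times\mathcal G_L$ with $\mathbf r(q)=\mathbf d(\overleftarrow\alpha)$ let $(q_{\mathcal L}(e,u),\overleftarrow\alpha)\sim_{\mathcal E}(q_{\mathcal L}(f,v),\overleftarrow\beta)$ iff $e\mathrel{\mathscr L}f$, $u\mathrel{\mathscr R}v$ and $\overleftarrow\alpha=\overleftarrow{\epsilon(u,v)}\,\overleftarrow\beta$. Morphisms of $\mathcal E_L$ are the $\sim_{\mathcal E}$-classes; each is represented by a right epi $[e,\alpha\rangle=(q_{\mathcal L}(e,u),\overleftarrow\alpha)$ with $\mathbf d(\alpha)=u$, going from $\overleftarrow e$ to $\overleftarrow{\mathbf r(\alpha)}$, and $[e,\alpha\rangle$ stands for the class $\{(q_{\mathcal L}(f,v),\overleftarrow\theta): f\mathrel{\mathscr L}e,\ v\mathrel{\mathscr R}\mathbf d(\alpha),\ \overleftarrow\theta=\overleftarrow{\epsilon(v,\mathbf d(\alpha))\,\alpha}\}$. Thus $[e,\alpha\rangle=[f,\beta\rangle$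 iff $e\mathrel{\mathscr L}f$ and $\overline\alpha=\overline\beta$. Morphisms of $\mathcal L_G$ are the pairs $(\varepsilon,j)\in\mathcal E_L\times\mathcal P_L$ with $\mathbf r(\varepsilon)=\mathbf d(j)$; if $\varepsilon=[e,\alpha\rangle$ and $\overleftarrow f=\mathbf r(j)$, the pair is written $[e,\alpha,f\rangle$, a morphism from $\overleftarrow e$ to $\overleftarrow f$. Thus $[e,\alpha,f\rangle=[g,\beta,h\rangle$ iff $e\mathrel{\mathscr L}g$, $\overline\alpha=\overline\beta$ and $f\mathrel{\mathscr L}h$. If $\overleftarrow{g_1}=\overleftarrow{e_2}$, then $[e_1,\alpha,g_1\rangle\,[e_2,\beta,g_2\rangle=[e_1,(\alpha\circ\beta)_h,g_2\rangle$ for $h\in\mathcal S(\mathbf r(\alpha),\mathbf d(\beta))$. The inclusions of $\mathcal L_G$ are the morphisms $[e,1_e,f\rangle$ with $e\leqslant_\ell f$ (identified with $j_{\mathcal L}(e,f)$). The category $\mathcal R_G$. All categories here have object set $E/\mathscr R$; $\overrightarrow e$ is the $\mathscr R$-class of $e$, and $\overrightarrow e\leq_R\overrightarrow f$ iff $e\leqslant_r f$. $\mathcal P_R$ is the preorder category of $(E/\mathscr R,\leq_R)$, with morphisms $j_{\mathcal R}(e,f):\overrightarrow e\to\overrightarrow f$ for $e\leqslant_r f$. $\mathcal G_R$: put $\alpha\sim_R\beta$ iff $\mathbf d(\alpha)\mathrel{\mathscr R}\mathbf d(\beta)$, $\mathbf r(\alpha)\mathrel{\mathscr R}\mathbf r(\beta)$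 and $\alpha\,\epsilon(\mathbf r(\alpha),\mathbf r(\beta))=\epsilon(\mathbf d(\alpha),\mathbf d(\beta))\,\beta$; the $\sim_R$-class $\overrightarrow\alpha$ of $\alpha\in\mathcal G(e,f)$ is a morphism from $\overrightarrow f$ to $\overrightarrow e$, and $\overrightarrow\alpha\,\overrightarrow\beta=\overrightarrow{\beta\,\epsilon(\mathbf r(\beta),\mathbf d(\alpha))\,\alpha}$ when $\mathbf d(\alpha)\mathrel{\mathscr R}\mathbf r(\beta)$. $\mathcal Q_R$: for $u\leqslant e$ there is a morphism $q_{\mathcal R}(e,u):\overrightarrow e\to\overrightarrow u$, with (dually) $q_{\mathcal R}(e,u)=q_{\mathcal R}(g,v)$ iff $e\mathrel{\mathscr R}g$ and $v=ug$; $q_{\mathcal R}(e,u)\,q_{\mathcal R}(f,v)=q_{\mathcal R}(e,vu)$ when $u\mathrel{\mathscr R}f$. $\mathcal E_R$: on the pairs $(q,\overrightarrow\alpha)\in\mathcal Q_R\times\mathcal G_R$ with $\mathbf r(q)=\mathbf d(\overrightarrow\alpha)$ let $(q_{\mathcal R}(e,u),\overrightarrow\alpha)\sim_{\mathcal E}(q_{\mathcal R}(f,v),\overrightarrow\beta)$ iff $e\mathrel{\mathscr R}f$, $u\mathrel{\mathscr L}v$ and $\overrightarrow\alpha=\overrightarrow{\epsilon(v,u)}\,\overrightarrow\beta$. Morphisms of $\mathcal E_R$ are the $\sim_{\mathcal E}$-classes; each is represented by a left epi $\langle e,\alpha]=(q_{\mathcal R}(e,u),\overrightarrow\alpha)$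 with $\mathbf r(\alpha)=u$, going from $\overrightarrow e$ to $\overrightarrow{\mathbf d(\alpha)}$, and $\langle e,\alpha]$ stands for the class $\{(q_{\mathcal R}(f,v),\overrightarrow\theta): f\mathrel{\mathscr R}e,\ v\mathrel{\mathscr L}\mathbf r(\alpha),\ \overrightarrow\theta=\overrightarrow{\alpha\,\epsilon(\mathbf r(\alpha),v)}\}$. Morphisms of $\mathcal R_G$ are the pairs $(\varepsilon,j)\in\mathcal E_R\times\mathcal P_R$ with $\mathbf r(\varepsilon)=\mathbf d(j)$; if $\varepsilon=\langle e,\alpha]$ and $\overrightarrow f=\mathbf r(j)$, the pair is written $\langle e,\alpha,f]$, a morphism from $\overrightarrow e$ to $\overrightarrow f$. Thus $\langle e,\alpha,f]=\langle g,\beta,h]$ iff $e\mathrel{\mathscr R}g$, $\overline\alpha=\overline\beta$ and $f\mathrel{\mathscr R}h$. If $\overrightarrow{g_1}=\overrightarrow{e_2}$, then $\langle e_1,\alpha,g_1]\,\langle e_2,\beta,g_2]=\langle e_1,(\beta\circ\alpha)_h,g_2]$ for $h\in\mathcal S(\mathbf r(\beta),\mathbf d(\alpha))$. The inclusions of $\mathcal R_G$ are the morphisms $\langle e,1_e,f]$ with $e\leqslant_r f$ (identified with $j_{\mathcal R}(e,f)$). The functor $\Gamma_G$: for $e\in E$ let $r^e$ be the idempotent cone in $\mathcal L_G$ with apex $\overleftarrow e$ given by $r^e(\overleftarrow g)=[g,(1_g\circ1_e)_h,e\rangle$, $h\in\mathcal S(g,e)$. Then $\Gamma_G:\mathcal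 R_G\to N^*\mathcal L_G$ is defined by $\Gamma_G(\overrightarrow e)=H(r^e;-)$ on objects and $\Gamma_G(\langle e,\alpha,f])=\eta_{r^e}\,\mathcal L_G([f,\alpha,e\rangle,-)\,\eta_{r^f}^{-1}$ on morphisms $\langle e,\alpha,f]\in\mathcal R_G(\overrightarrow e,\overrightarrow f)$. For an inductive functor $F:(\mathcal G,\epsilon)\to(\mathcal G',\epsilon')$, define $F_1:\mathcal L_G\to\mathcal L_{G'}$ by $\overleftarrow e\mapsto\overleftarrow{F(e)}$, $[e,\alpha,f\rangle\mapsto[F(e),F(\alpha),F(f)\rangle$, and $F_2:\mathcal R_G\to\mathcal R_{G'}$ by $\overrightarrow e\mapsto\overrightarrow{F(e)}$, $\langle e,\alpha,f]\mapsto\langle F(e),F(\alpha),F(f)]$.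
   Formalization: The dual (C,D;Δ) must also have the same transposes as Γ, with δ(c,d)(d') the transpose of γ(c',d')(c), as E_Γ alone does not determine it; [e,α⟩ and ⟨e,α] are the explicit classes, since the stated criterion with equal p-classes fails when the first idempotents differ. *)

theory Defs
  imports "HOL-Library.FuncSet"
begin

section \<open>Categories, functors, natural transformations\<close>

text \<open>
  Composition is written left to right throughout.  All structure maps are extensional (they are
  \<^const>\<open>undefined\<close> outside their mathematical domain), so that HOL equality of categories,
  functors, cones and transformations is equality of the mathematical objects.
\<close>

record ('o, 'm) cat =
  Obj :: "'o set"
  Mor :: "'m set"
  Dom :: "'m \<Rightarrow> 'o"
  Cod :: "'m \<Rightarrow> 'o"
  Idn :: "'o \<Rightarrow> 'm"
  Cmp :: "'m \<Rightarrow> 'm \<Rightarrow> 'm" (infixl "\<cdot>\<index>" 70)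

definition hom :: "('o, 'm, 'z) cat_scheme \<Rightarrow> 'o \<Rightarrow> 'o \<Rightarrow> 'm set" where
  "hom C a b = {f \<in> Mor C. Dom C f = a \<and> Cod C f = b}"

definition category :: "('o, 'm, 'z) cat_scheme \<Rightarrow> bool" where
  "category C \<longleftrightarrow>
     Dom C \<in> Mor C \<rightarrow>\<^sub>E Obj C \<and>
     Cod C \<in> Mor C \<rightarrow>\<^sub>E Obj C \<and>
     Idn C \<in> (\<Pi>\<^sub>E a\<in>Obj C. hom C a a) \<and>
     Cmp C \<in> (\<Pi>\<^sub>E f\<in>Mor C. \<Pi>\<^sub>E g\<in>{g \<in> Mor C. Dom C g = Cod C f}. hom C (Dom C f) (Cod C g)) \<and>
     (\<forall>f\<in>Mor C. Idn C (Dom C f) \<cdot>\<^bsub>C\<^esub> f = f \<and> f \<cdot>\<^bsub>C\<^esub> Idn C (Cod C f) = f) \<and>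
     (\<forall>f\<in>Mor C. \<forall>g\<in>Mor C. \<forall>h\<in>Mor C. Cod C f = Dom C g \<and> Cod C g = Dom C h \<longrightarrow>
        (f \<cdot>\<^bsub>C\<^esub> g) \<cdot>\<^bsub>C\<^esub> h = f \<cdot>\<^bsub>C\<^esub> (g \<cdot>\<^bsub>C\<^esub> h))"

definition is_iso :: "('o, 'm, 'z) cat_scheme \<Rightarrow> 'm \<Rightarrow> bool" where
  "is_iso C f \<longleftrightarrow> f \<in> Mor C \<and>
     (\<exists>g\<in>hom C (Cod C f) (Dom C f). f \<cdot>\<^bsub>C\<^esub> g = Idn C (Dom C f) \<and> g \<cdot>\<^bsub>C\<^esub> f = Idn C (Cod C f))"

definition monic :: "('o, 'm, 'z) cat_scheme \<Rightarrow> 'm \<Rightarrow> bool" where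
  "monic C f \<longleftrightarrow> f \<in> Mor C \<and>
     (\<forall>g\<in>Mor C. \<forall>h\<in>Mor C. Cod C g = Dom C f \<and> Cod C h = Dom C f \<and> Dom C g = Dom C h \<and>
        g \<cdot>\<^bsub>C\<^esub> f = h \<cdot>\<^bsub>C\<^esub> f \<longrightarrow> g = h)"

definition full_sub :: "('o, 'm, 'z) cat_scheme \<Rightarrow> 'o set \<Rightarrow> ('o, 'm) cat" where
  "full_sub C A =
     (let M = {f \<in> Mor C. Dom C f \<in> A \<and> Cod C f \<in> A} in
      \<lparr> Obj = A, Mor = M, Dom = restrict (Dom C) M, Cod = restrict (Cod C) M,
        Idn = restrict (Idn C) A,
        Cmp = (\<lambda>f\<in>M. \<lambda>g\<in>{g \<in> M. Dom C g = Cod C f}. f \<cdot>\<^bsub>C\<^esub> g) \<rparr>)"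

record ('o, 'm, 'p, 'q) func =
  FO :: "'o \<Rightarrow> 'p"
  FM :: "'m \<Rightarrow> 'q"

definition is_functor ::
  "('o, 'm, 'z) cat_scheme \<Rightarrow> ('p, 'q, 'y) cat_scheme \<Rightarrow> ('o, 'm, 'p, 'q) func \<Rightarrow> bool" where
  "is_functor C D F \<longleftrightarrow> category C \<and> category D \<and>
     FO F \<in> Obj C \<rightarrow>\<^sub>E Obj D \<and>
     FM F \<in> (\<Pi>\<^sub>E f\<in>Mor C. hom D (FO F (Dom C f)) (FO F (Cod C f))) \<and>
     (\<forall>a\<in>Obj C. FM F (Idn C a) = Idn D (FO F a)) \<and>
     (\<forall>f\<in>Mor C. \<forall>g\<in>Mor C. Cod C f = Dom C g \<longrightarrow> FM F (f \<cdot>\<^bsub>C\<^esub> g) = FM F f \<cdot>\<^bsub>D\<^esub> FM F g)"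

definition id_func :: "('o, 'm, 'z) cat_scheme \<Rightarrow> ('o, 'm, 'o, 'm) func" where
  "id_func C = \<lparr> FO = (\<lambda>a\<in>Obj C. a), FM = (\<lambda>f\<in>Mor C. f) \<rparr>"

definition comp_func ::
  "('o, 'm, 'z) cat_scheme \<Rightarrow> ('o, 'm, 'p, 'q) func \<Rightarrow> ('p, 'q, 'r, 's) func \<Rightarrow> ('o, 'm, 'r, 's) func" where
  "comp_func C F G = \<lparr> FO = (\<lambda>a\<in>Obj C. FO G (FO F a)), FM = (\<lambda>f\<in>Mor C. FM G (FM F f)) \<rparr>"

definition restrict_func :: "('o, 'm, 'z) cat_scheme \<Rightarrow> ('o, 'm, 'p, 'q) func \<Rightarrow> ('o, 'm, 'p, 'q) func" where
  "restrict_func C F = \<lparr> FO = restrict (FO F) (Obj C), FM = restrict (FM F) (Mor C) \<rparr>"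

definition cat_isomorphism ::
  "('o, 'm, 'z) cat_scheme \<Rightarrow> ('p, 'q, 'y) cat_scheme \<Rightarrow> ('o, 'm, 'p, 'q) func \<Rightarrow> bool" where
  "cat_isomorphism C D F \<longleftrightarrow> is_functor C D F \<and>
     bij_betw (FO F) (Obj C) (Obj D) \<and> bij_betw (FM F) (Mor C) (Mor D)"

definition fully_faithful ::
  "('o, 'm, 'z) cat_scheme \<Rightarrow> ('p, 'q, 'y) cat_scheme \<Rightarrow> ('o, 'm, 'p, 'q) func \<Rightarrow> bool" where
  "fully_faithful C D F \<longleftrightarrow>
     (\<forall>a\<in>Obj C. \<forall>b\<in>Obj C. bij_betw (FM F) (hom C a b) (hom D (FO F a) (FO F b)))"

text \<open>A natural transformation is a triple of source, target and family of components.\<close>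

type_synonym ('o, 'm, 'p, 'q) natt =
  "('o, 'm, 'p, 'q) func \<times> ('o, 'm, 'p, 'q) func \<times> ('o \<Rightarrow> 'q)"

definition is_natt ::
  "('o, 'm, 'z) cat_scheme \<Rightarrow> ('p, 'q, 'y) cat_scheme \<Rightarrow> ('o, 'm, 'p, 'q) natt \<Rightarrow> bool" where
  "is_natt C D t \<longleftrightarrow> (case t of (S, T, \<tau>) \<Rightarrow>
     is_functor C D S \<and> is_functor C D T \<and>
     \<tau> \<in> (\<Pi>\<^sub>E a\<in>Obj C. hom D (FO S a) (FO T a)) \<and>
     (\<forall>f\<in>Mor C. FM S f \<cdot>\<^bsub>D\<^esub> \<tau> (Cod C f) = \<tau> (Dom C f) \<cdot>\<^bsub>D\<^esub> FM T f))"

definition functor_cat ::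
  "('o, 'm, 'z) cat_scheme \<Rightarrow> ('p, 'q, 'y) cat_scheme \<Rightarrow>
   (('o, 'm, 'p, 'q) func, ('o, 'm, 'p, 'q) natt) cat" where
  "functor_cat C D =
     (let M = {t. is_natt C D t} in
      \<lparr> Obj = {F. is_functor C D F}, Mor = M,
        Dom = (\<lambda>t\<in>M. fst t), Cod = (\<lambda>t\<in>M. fst (snd t)),
        Idn = (\<lambda>F\<in>{F. is_functor C D F}. (F, F, \<lambda>a\<in>Obj C. Idn D (FO F a))),
        Cmp = (\<lambda>s\<in>M. \<lambda>t\<in>{t \<in> M. fst t = fst (snd s)}.
                 (fst s, fst (snd t), \<lambda>a\<in>Obj C. snd (snd s) a \<cdot>\<^bsub>D\<^esub> snd (snd t) a)) \<rparr>)"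

text \<open>The category of sets, the elements of the sets being taken from a type.\<close>

type_synonym 'x setmap = "'x set \<times> 'x set \<times> ('x \<Rightarrow> 'x)"

definition Sets :: "('x set, 'x setmap) cat" where
  "Sets =
     (let M = {(A, B, f). f \<in> A \<rightarrow>\<^sub>E B} in
      \<lparr> Obj = UNIV, Mor = M,
        Dom = (\<lambda>f\<in>M. fst f), Cod = (\<lambda>f\<in>M. fst (snd f)),
        Idn = (\<lambda>A. (A, A, \<lambda>x\<in>A. x)),
        Cmp = (\<lambda>f\<in>M. \<lambda>g\<in>{g \<in> M. fst g = fst (snd f)}.
                 (fst f, fst (snd g), \<lambda>x\<in>fst f. snd (snd g) (snd (snd f) x))) \<rparr>)"

type_synonym ('o, 'm, 'x) setfunctor = "('o, 'm, 'x set, 'x setmap) func"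
type_synonym ('o, 'm, 'x) setnatt = "('o, 'm, 'x set, 'x setmap) natt"

definition natt_app :: "('o, 'm, 'x) setnatt \<Rightarrow> 'o \<Rightarrow> 'x \<Rightarrow> 'x" where
  "natt_app t a = snd (snd (snd (snd t) a))"


section \<open>Biordered sets\<close>

record 'e biord =
  carr :: "'e set"
  bdom :: "('e \<times> 'e) set"
  bmul :: "'e \<Rightarrow> 'e \<Rightarrow> 'e" (infixl "\<odot>\<index>" 70)

definition lle :: "'e biord \<Rightarrow> 'e \<Rightarrow> 'e \<Rightarrow> bool" where
  "lle E e f \<longleftrightarrow> (e, f) \<in> bdom E \<and> e \<odot>\<^bsub>E\<^esub> f = e"

definition rle :: "'e biord \<Rightarrow> 'e \<Rightarrow> 'e \<Rightarrow> bool" where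
  "rle E e f \<longleftrightarrow> (f, e) \<in> bdom E \<and> f \<odot>\<^bsub>E\<^esub> e = e"

definition Leq :: "'e biord \<Rightarrow> 'e \<Rightarrow> 'e \<Rightarrow> bool" where
  "Leq E e f \<longleftrightarrow> lle E e f \<and> lle E f e"

definition Req :: "'e biord \<Rightarrow> 'e \<Rightarrow> 'e \<Rightarrow> bool" where
  "Req E e f \<longleftrightarrow> rle E e f \<and> rle E f e"

definition nle :: "'e biord \<Rightarrow> 'e \<Rightarrow> 'e \<Rightarrow> bool" where
  "nle E e f \<longleftrightarrow> lle E e f \<and> rle E e f"

definition biordered_set :: "'e biord \<Rightarrow> bool" where
  "biordered_set E \<longleftrightarrow>
     bdom E \<subseteq> carr E \<times> carr E \<and>
     (\<forall>(e, f)\<in>bdom E. e \<odot>\<^bsub>E\<^esub> f \<in> carr E) \<and>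
     (\<forall>e f. (e, f) \<notin> bdom E \<longrightarrow> e \<odot>\<^bsub>E\<^esub> f = undefined) \<and>
     (\<forall>e\<in>carr E. lle E e e \<and> rle E e e) \<and>
     (\<forall>e f g. lle E e f \<and> lle E f g \<longrightarrow> lle E e g) \<and>
     (\<forall>e f g. rle E e f \<and> rle E f g \<longrightarrow> rle E e g) \<and>
     bdom E = {(e, f). lle E e f \<or> rle E e f \<or> lle E f e \<or> rle E f e} \<and>
     (\<forall>e f. lle E e f \<longrightarrow> Leq E e (f \<odot>\<^bsub>E\<^esub> e) \<and> nle E (f \<odot>\<^bsub>E\<^esub> e) f) \<and>
     (\<forall>e f. rle E e f \<longrightarrow> Req E e (e \<odot>\<^bsub>E\<^esub> f) \<and> nle E (e \<odot>\<^bsub>E\<^esub> f) f) \<and>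
     (\<forall>e f g. rle E f e \<and> rle E g e \<and> lle E f g \<longrightarrow>
        lle E (f \<odot>\<^bsub>E\<^esub> e) (g \<odot>\<^bsub>E\<^esub> e) \<and>
        (g \<odot>\<^bsub>E\<^esub> f) \<odot>\<^bsub>E\<^esub> e = (g \<odot>\<^bsub>E\<^esub> e) \<odot>\<^bsub>E\<^esub> (f \<odot>\<^bsub>E\<^esub> e)) \<and>
     (\<forall>e f g. lle E f e \<and> lle E g e \<and> rle E f g \<longrightarrow>
        rle E (e \<odot>\<^bsub>E\<^esub> f) (e \<odot>\<^bsub>E\<^esub> g) \<and>
        e \<odot>\<^bsub>E\<^esub> (f \<odot>\<^bsub>E\<^esub> g) = (e \<odot>\<^bsub>E\<^esub> f) \<odot>\<^bsub>E\<^esub> (e \<odot>\<^bsub>E\<^esub> g)) \<and>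
     (\<forall>e f g. lle E e f \<and> lle E f g \<longrightarrow> f \<odot>\<^bsub>E\<^esub> (g \<odot>\<^bsub>E\<^esub> e) = f \<odot>\<^bsub>E\<^esub> e) \<and>
     (\<forall>e f g. rle E e f \<and> rle E f g \<longrightarrow> (e \<odot>\<^bsub>E\<^esub> g) \<odot>\<^bsub>E\<^esub> f = e \<odot>\<^bsub>E\<^esub> f) \<and>
     (\<forall>e f g. lle E f e \<and> lle E g e \<and> rle E (e \<odot>\<^bsub>E\<^esub> f) (e \<odot>\<^bsub>E\<^esub> g) \<longrightarrow>
        (\<exists>f'\<in>carr E. rle E f' g \<and> lle E f' e \<and> e \<odot>\<^bsub>E\<^esub> f' = e \<odot>\<^bsub>E\<^esub> f)) \<and>
     (\<forall>e f g. rle E f e \<and> rle E g e \<and> lle E (f \<odot>\<^bsub>E\<^esub> e) (g \<odot>\<^bsub>E\<^esub> e) \<longrightarrow>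
        (\<exists>f'\<in>carr E. lle E f' g \<and> rle E f' e \<and> f' \<odot>\<^bsub>E\<^esub> e = f \<odot>\<^bsub>E\<^esub> e))"

definition sandwich :: "'e biord \<Rightarrow> 'e \<Rightarrow> 'e \<Rightarrow> 'e set" where
  "sandwich E e f =
     {h \<in> carr E. lle E h e \<and> rle E h f \<and>
        (\<forall>g. lle E g e \<and> rle E g f \<longrightarrow>
           lle E (g \<odot>\<^bsub>E\<^esub> f) (h \<odot>\<^bsub>E\<^esub> f) \<and> rle E (e \<odot>\<^bsub>E\<^esub> g) (e \<odot>\<^bsub>E\<^esub> h))}"

definition regular_biordered_set :: "'e biord \<Rightarrow> bool" where
  "regular_biordered_set E \<longleftrightarrow>
     biordered_set E \<and> (\<forall>e\<in>carr E. \<forall>f\<in>carr E. sandwich E e f \<noteq> {})"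

definition bimorphism :: "'e biord \<Rightarrow> 'f biord \<Rightarrow> ('e \<Rightarrow> 'f) \<Rightarrow> bool" where
  "bimorphism E E' \<theta> \<longleftrightarrow> \<theta> \<in> carr E \<rightarrow> carr E' \<and>
     (\<forall>(e, f)\<in>bdom E. (\<theta> e, \<theta> f) \<in> bdom E' \<and> \<theta> (e \<odot>\<^bsub>E\<^esub> f) = \<theta> e \<odot>\<^bsub>E'\<^esub> \<theta> f)"

definition regular_bimorphism :: "'e biord \<Rightarrow> 'f biord \<Rightarrow> ('e \<Rightarrow> 'f) \<Rightarrow> bool" where
  "regular_bimorphism E E' \<theta> \<longleftrightarrow> bimorphism E E' \<theta> \<and>
     (\<forall>e\<in>carr E. \<forall>f\<in>carr E. \<theta> ` sandwich E e f \<subseteq> sandwich E' (\<theta> e) (\<theta> f))"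


section \<open>Ordered groupoids\<close>

record ('o, 'm) ogpd = "('o, 'm) cat" +
  ole :: "('m \<times> 'm) set"

definition groupoid :: "('o, 'm, 'z) cat_scheme \<Rightarrow> bool" where
  "groupoid G \<longleftrightarrow> category G \<and> (\<forall>x\<in>Mor G. is_iso G x)"

definition minv :: "('o, 'm, 'z) cat_scheme \<Rightarrow> 'm \<Rightarrow> 'm" where
  "minv G x = (THE y. y \<in> hom G (Cod G x) (Dom G x) \<and>
     x \<cdot>\<^bsub>G\<^esub> y = Idn G (Dom G x) \<and> y \<cdot>\<^bsub>G\<^esub> x = Idn G (Cod G x))"

definition vle :: "('o, 'm) ogpd \<Rightarrow> 'o \<Rightarrow> 'o \<Rightarrow> bool" where
  "vle G e f \<longleftrightarrow> (Idn G e, Idn G f) \<in> ole G"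

definition ordered_groupoid :: "('o, 'm) ogpd \<Rightarrow> bool" where
  "ordered_groupoid G \<longleftrightarrow> groupoid G \<and>
     ole G \<subseteq> Mor G \<times> Mor G \<and> (\<forall>x\<in>Mor G. (x, x) \<in> ole G) \<and> trans (ole G) \<and> antisym (ole G) \<and>
     (\<forall>u v x y. (u, x) \<in> ole G \<and> (v, y) \<in> ole G \<and> Cod G u = Dom G v \<and> Cod G x = Dom G y \<longrightarrow>
        (u \<cdot>\<^bsub>G\<^esub> v, x \<cdot>\<^bsub>G\<^esub> y) \<in> ole G) \<and>
     (\<forall>x y. (x, y) \<in> ole G \<longrightarrow> (minv G x, minv G y) \<in> ole G) \<and>
     (\<forall>x\<in>Mor G. \<forall>e\<in>Obj G. vle G e (Dom G x) \<longrightarrow> (\<exists>!y. (y, x) \<in> ole G \<and> Dom G y = e)) \<and>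
     (\<forall>x\<in>Mor G. \<forall>f\<in>Obj G. vle G f (Cod G x) \<longrightarrow> (\<exists>!y. (y, x) \<in> ole G \<and> Cod G y = f))"

definition restr_dom :: "('o, 'm) ogpd \<Rightarrow> 'o \<Rightarrow> 'm \<Rightarrow> 'm" where
  "restr_dom G e x = (THE y. (y, x) \<in> ole G \<and> Dom G y = e)"

definition restr_cod :: "('o, 'm) ogpd \<Rightarrow> 'm \<Rightarrow> 'o \<Rightarrow> 'm" where
  "restr_cod G x f = (THE y. (y, x) \<in> ole G \<and> Cod G y = f)"

definition order_preserving :: "('o, 'm) ogpd \<Rightarrow> ('p, 'q) ogpd \<Rightarrow> ('o, 'm, 'p, 'q) func \<Rightarrow> bool" where
  "order_preserving G G' F \<longleftrightarrow> (\<forall>(x, y)\<in>ole G. (FM F x, FM F y) \<in> ole G')"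

definition v_isomorphism :: "('o, 'm) ogpd \<Rightarrow> ('p, 'q) ogpd \<Rightarrow> ('o, 'm, 'p, 'q) func \<Rightarrow> bool" where
  "v_isomorphism G G' F \<longleftrightarrow> is_functor G G' F \<and> order_preserving G G' F \<and>
     bij_betw (FO F) (Obj G) (Obj G') \<and>
     (\<forall>e\<in>Obj G. \<forall>f\<in>Obj G. vle G e f \<longleftrightarrow> vle G' (FO F e) (FO F f))"


section \<open>The groupoid of E-chains\<close>

definition is_path :: "'e biord \<Rightarrow> 'e list \<Rightarrow> bool" where
  "is_path E p \<longleftrightarrow> p \<noteq> [] \<and> set p \<subseteq> carr E \<and> successively (\<lambda>e f. Req E e f \<or> Leq E e f) p"

text \<open>One removal of an inessential element, or the replacement of (e, e) by (e).\<close>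

inductive path_step :: "'e biord \<Rightarrow> 'e list \<Rightarrow> 'e list \<Rightarrow> bool" for E where
  inessential_R: "is_path E (p @ [a, x, b] @ q) \<Longrightarrow> Req E a x \<Longrightarrow> Req E x b \<Longrightarrow>
     path_step E (p @ [a, x, b] @ q) (p @ [a, b] @ q)"
| inessential_L: "is_path E (p @ [a, x, b] @ q) \<Longrightarrow> Leq E a x \<Longrightarrow> Leq E x b \<Longrightarrow>
     path_step E (p @ [a, x, b] @ q) (p @ [a, b] @ q)"
| diagonal: "is_path E [e, e] \<Longrightarrow> path_step E [e, e] [e]"

definition echain :: "'e biord \<Rightarrow> 'e list \<Rightarrow> 'e list set" where
  "echain E p = {q. equivclp (path_step E) p q}"

text \<open>The path h1, ..., hm with h1 = h and hi = (fi h(i-1)) fi, for the path f1, ..., fm with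
  tail fs.\<close>

fun descend :: "'e biord \<Rightarrow> 'e \<Rightarrow> 'e list \<Rightarrow> 'e list" where
  "descend E h [] = [h]"
| "descend E h (f # fs) = h # descend E ((f \<odot>\<^bsub>E\<^esub> h) \<odot>\<^bsub>E\<^esub> f) fs"

definition chain_groupoid :: "'e biord \<Rightarrow> ('e, 'e list set) ogpd" where
  "chain_groupoid E =
     (let M = {echain E p | p. is_path E p};
          rep = (\<lambda>c. SOME p. p \<in> c) in
      \<lparr> Obj = carr E, Mor = M,
        Dom = (\<lambda>c\<in>M. hd (rep c)), Cod = (\<lambda>c\<in>M. last (rep c)),
        Idn = (\<lambda>e\<in>carr E. echain E [e]),
        Cmp = (\<lambda>c\<in>M. \<lambda>c'\<in>{c' \<in> M. hd (rep c') = last (rep c)}. echain E (rep c @ tl (rep c'))),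
        ole = {(echain E p, echain E q) | p q. is_path E p \<and> is_path E q \<and>
                 nle E (hd p) (hd q) \<and> echain E p = echain E (descend E (hd p) (tl q))} \<rparr>)"

definition singular_square :: "'e biord \<Rightarrow> 'e \<Rightarrow> 'e \<Rightarrow> 'e \<Rightarrow> 'e \<Rightarrow> bool" where
  "singular_square E a b c d \<longleftrightarrow>
     (\<exists>e g h. lle E g e \<and> lle E h e \<and> Req E g h \<and>
        a = g \<and> b = h \<and> c = e \<odot>\<^bsub>E\<^esub> g \<and> d = e \<odot>\<^bsub>E\<^esub> h) \<or>
     (\<exists>e g h. rle E g e \<and> rle E h e \<and> Leq E g h \<and>
        a = g \<and> b = g \<odot>\<^bsub>E\<^esub> e \<and> c = h \<and> d = h \<odot>\<^bsub>E\<^esub> e)"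


section \<open>The category of inductive groupoids\<close>

text \<open>The vertex set of the groupoid is identified with the biordered set along the object map of
  the evaluation functor, which therefore is the identity; \<open>ige\<close> is its morphism map.\<close>

record ('e, 'm) indgpd =
  igb :: "'e biord"
  igg :: "('e, 'm) ogpd"
  ige :: "'e list set \<Rightarrow> 'm"

definition eps :: "('e, 'm) indgpd \<Rightarrow> 'e \<Rightarrow> 'e \<Rightarrow> 'm" where
  "eps X e f = ige X (echain (igb X) [e, f])"

definition inductive_groupoid :: "('e, 'm) indgpd \<Rightarrow> bool" where
  "inductive_groupoid X \<longleftrightarrow> (let E = igb X; G = igg X in
     regular_biordered_set E \<and> ordered_groupoid G \<and> Obj G = carr E \<and>
     v_isomorphism (chain_groupoid E) G \<lparr> FO = (\<lambda>e\<in>carr E. e), FM = ige X \<rparr> \<and>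
     (\<forall>x\<in>Mor G. \<forall>e1 e2 f1 f2. nle E e1 (Dom G x) \<and> nle E e2 (Dom G x) \<and>
        f1 = Cod G (restr_dom G e1 x) \<and> f2 = Cod G (restr_dom G e2 x) \<longrightarrow>
        (rle E e1 e2 \<longrightarrow> rle E f1 f2 \<and>
           eps X e1 (e1 \<odot>\<^bsub>E\<^esub> e2) \<cdot>\<^bsub>G\<^esub> restr_dom G (e1 \<odot>\<^bsub>E\<^esub> e2) x
           = restr_dom G e1 x \<cdot>\<^bsub>G\<^esub> eps X f1 (f1 \<odot>\<^bsub>E\<^esub> f2)) \<and>
        (lle E e1 e2 \<longrightarrow> lle E f1 f2 \<and>
           eps X e1 (e2 \<odot>\<^bsub>E\<^esub> e1) \<cdot>\<^bsub>G\<^esub> restr_dom G (e2 \<odot>\<^bsub>E\<^esub> e1) x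
           = restr_dom G e1 x \<cdot>\<^bsub>G\<^esub> eps X f1 (f2 \<odot>\<^bsub>E\<^esub> f1))) \<and>
     (\<forall>e f g h. singular_square E e f g h \<longrightarrow>
        eps X e f \<cdot>\<^bsub>G\<^esub> eps X f h = eps X e g \<cdot>\<^bsub>G\<^esub> eps X g h))"

definition inductive_functor ::
  "('e, 'm) indgpd \<Rightarrow> ('f, 'n) indgpd \<Rightarrow> ('e, 'm, 'f, 'n) func \<Rightarrow> bool" where
  "inductive_functor X Y F \<longleftrightarrow>
     is_functor (igg X) (igg Y) F \<and> order_preserving (igg X) (igg Y) F \<and>
     regular_bimorphism (igb X) (igb Y) (FO F) \<and>
     (\<forall>p. is_path (igb X) p \<longrightarrow>
        FM F (ige X (echain (igb X) p)) = ige Y (echain (igb Y) (map (FO F) p)))"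

text \<open>All inductive groupoids over the universe given by the types of vertices and of morphisms.  A
  morphism is a triple of source, target and functor.\<close>

type_synonym ('e, 'm) igmor = "('e, 'm) indgpd \<times> ('e, 'm) indgpd \<times> ('e, 'm, 'e, 'm) func"

definition IG :: "(('e, 'm) indgpd, ('e, 'm) igmor) cat" where
  "IG =
     (let M = {(X, Y, F). inductive_groupoid X \<and> inductive_groupoid Y \<and> inductive_functor X Y F} in
      \<lparr> Obj = {X. inductive_groupoid X}, Mor = M,
        Dom = (\<lambda>m\<in>M. fst m), Cod = (\<lambda>m\<in>M. fst (snd m)),
        Idn = (\<lambda>X\<in>{X. inductive_groupoid X}. (X, X, id_func (igg X))),
        Cmp = (\<lambda>m\<in>M. \<lambda>n\<in>{n \<in> M. fst n = fst (snd m)}.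
                 (fst m, fst (snd n), comp_func (igg (fst m)) (snd (snd m)) (snd (snd n)))) \<rparr>)"


section \<open>Normal categories\<close>

record ('o, 'm) scat = "('o, 'm) cat" +
  Incl :: "'m set"

definition category_with_subobjects :: "('o, 'm) scat \<Rightarrow> bool" where
  "category_with_subobjects C \<longleftrightarrow> category C \<and>
     Incl C \<subseteq> Mor C \<and> (\<forall>c\<in>Obj C. Idn C c \<in> Incl C) \<and>
     (\<forall>f\<in>Incl C. \<forall>g\<in>Incl C. Cod C f = Dom C g \<longrightarrow> f \<cdot>\<^bsub>C\<^esub> g \<in> Incl C) \<and>
     (\<forall>f\<in>Incl C. \<forall>g\<in>Incl C. Dom C f = Dom C g \<and> Cod C f = Cod C g \<longrightarrow> f = g) \<and>
     (\<forall>f\<in>Incl C. \<forall>g\<in>Incl C. Cod C f = Dom C g \<and> Cod C g = Dom C f \<and>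
        f \<cdot>\<^bsub>C\<^esub> g = Idn C (Dom C f) \<and> g \<cdot>\<^bsub>C\<^esub> f = Idn C (Cod C f) \<longrightarrow> f = Idn C (Dom C f)) \<and>
     (\<forall>f\<in>Incl C. monic C f) \<and>
     (\<forall>f\<in>Incl C. \<forall>g\<in>Incl C. \<forall>h\<in>Mor C. Cod C h = Dom C g \<and> f = h \<cdot>\<^bsub>C\<^esub> g \<longrightarrow> h \<in> Incl C)"

definition subobj :: "('o, 'm) scat \<Rightarrow> 'o \<Rightarrow> 'o \<Rightarrow> bool" where
  "subobj C c d \<longleftrightarrow> (\<exists>j\<in>Incl C. j \<in> hom C c d)"

definition splits :: "('o, 'm) scat \<Rightarrow> 'm \<Rightarrow> 'm \<Rightarrow> bool" where
  "splits C j q \<longleftrightarrow> j \<in> Incl C \<and> q \<in> hom C (Cod C j) (Dom C j) \<and> j \<cdot>\<^bsub>C\<^esub> q = Idn C (Dom C j)"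

definition retraction :: "('o, 'm) scat \<Rightarrow> 'm \<Rightarrow> bool" where
  "retraction C q \<longleftrightarrow> (\<exists>j. splits C j q)"

definition normal_factorization :: "('o, 'm) scat \<Rightarrow> 'm \<Rightarrow> 'm \<Rightarrow> 'm \<Rightarrow> 'm \<Rightarrow> bool" where
  "normal_factorization C f q u j \<longleftrightarrow> retraction C q \<and> is_iso C u \<and> j \<in> Incl C \<and>
     Cod C q = Dom C u \<and> Cod C u = Dom C j \<and> f = (q \<cdot>\<^bsub>C\<^esub> u) \<cdot>\<^bsub>C\<^esub> j"

definition epi_component :: "('o, 'm) scat \<Rightarrow> 'm \<Rightarrow> 'm" where
  "epi_component C f = (THE g. \<exists>q u j. normal_factorization C f q u j \<and> g = q \<cdot>\<^bsub>C\<^esub> u)"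

definition is_cone :: "('o, 'm) scat \<Rightarrow> 'o \<Rightarrow> ('o \<Rightarrow> 'm) \<Rightarrow> bool" where
  "is_cone C d \<gamma> \<longleftrightarrow> d \<in> Obj C \<and> \<gamma> \<in> (\<Pi>\<^sub>E c\<in>Obj C. hom C c d) \<and>
     (\<forall>j\<in>Incl C. j \<cdot>\<^bsub>C\<^esub> \<gamma> (Cod C j) = \<gamma> (Dom C j)) \<and>
     (\<exists>c\<in>Obj C. is_iso C (\<gamma> c))"

definition cone :: "('o, 'm) scat \<Rightarrow> ('o \<Rightarrow> 'm) \<Rightarrow> bool" where
  "cone C \<gamma> \<longleftrightarrow> (\<exists>d. is_cone C d \<gamma>)"

definition apex :: "('o, 'm) scat \<Rightarrow> ('o \<Rightarrow> 'm) \<Rightarrow> 'o" where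
  "apex C \<gamma> = (THE d. is_cone C d \<gamma>)"

definition idempotent_cone :: "('o, 'm) scat \<Rightarrow> ('o \<Rightarrow> 'm) \<Rightarrow> bool" where
  "idempotent_cone C \<gamma> \<longleftrightarrow> cone C \<gamma> \<and> \<gamma> (apex C \<gamma>) = Idn C (apex C \<gamma>)"

definition cone_comp :: "('o, 'm) scat \<Rightarrow> ('o \<Rightarrow> 'm) \<Rightarrow> 'm \<Rightarrow> ('o \<Rightarrow> 'm)" where
  "cone_comp C \<gamma> f = (\<lambda>a\<in>Obj C. \<gamma> a \<cdot>\<^bsub>C\<^esub> f)"

definition normal_category :: "('o, 'm) scat \<Rightarrow> bool" where
  "normal_category C \<longleftrightarrow> category_with_subobjects C \<and>
     (\<forall>f\<in>Mor C. \<exists>q u j. normal_factorization C f q u j) \<and>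
     (\<forall>j\<in>Incl C. \<exists>q. splits C j q) \<and>
     (\<forall>c\<in>Obj C. \<exists>\<gamma>. idempotent_cone C \<gamma> \<and> apex C \<gamma> = c)"


section \<open>The normal dual\<close>

definition H_set :: "('o, 'm) scat \<Rightarrow> ('o \<Rightarrow> 'm) \<Rightarrow> 'o \<Rightarrow> ('o \<Rightarrow> 'm) set" where
  "H_set C \<gamma> c = {cone_comp C \<gamma> (epi_component C f) | f. f \<in> hom C (apex C \<gamma>) c}"

definition eta :: "('o, 'm) scat \<Rightarrow> ('o \<Rightarrow> 'm) \<Rightarrow> 'o \<Rightarrow> ('o \<Rightarrow> 'm) \<Rightarrow> 'm" where
  "eta C \<gamma> c \<sigma> = (THE f. f \<in> hom C (apex C \<gamma>) c \<and> cone_comp C \<gamma> (epi_component C f) = \<sigma>)"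

definition H_functor :: "('o, 'm) scat \<Rightarrow> ('o \<Rightarrow> 'm) \<Rightarrow> ('o, 'm, 'o \<Rightarrow> 'm) setfunctor" where
  "H_functor C \<gamma> =
     \<lparr> FO = (\<lambda>c\<in>Obj C. H_set C \<gamma> c),
       FM = (\<lambda>g\<in>Mor C. (H_set C \<gamma> (Dom C g), H_set C \<gamma> (Cod C g),
               \<lambda>\<sigma>\<in>H_set C \<gamma> (Dom C g).
                 cone_comp C \<gamma> (epi_component C (eta C \<gamma> (Dom C g) \<sigma> \<cdot>\<^bsub>C\<^esub> g)))) \<rparr>"

definition normal_dual ::
  "('o, 'm) scat \<Rightarrow> (('o, 'm, 'o \<Rightarrow> 'm) setfunctor, ('o, 'm, 'o \<Rightarrow> 'm) setnatt) scat" where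
  "normal_dual C =
     (let N = full_sub (functor_cat C Sets) {H_functor C \<gamma> | \<gamma>. cone C \<gamma>} in
      cat.extend N
        \<lparr> Incl = {(S, T, \<tau>). (S, T, \<tau>) \<in> Mor N \<and>
            (\<forall>c\<in>Obj C. FO S c \<subseteq> FO T c \<and> \<tau> c = (FO S c, FO T c, \<lambda>\<sigma>\<in>FO S c. \<sigma>))} \<rparr>)"

definition M_set :: "('o, 'm) scat \<Rightarrow> ('o, 'm, 'o \<Rightarrow> 'm) setfunctor \<Rightarrow> 'o set" where
  "M_set C S = {c \<in> Obj C. \<exists>\<gamma>. cone C \<gamma> \<and> H_functor C \<gamma> = S \<and> is_iso C (\<gamma> c)}"


section \<open>The category of cross-connections\<close>

definition ideal :: "('o, 'm) scat \<Rightarrow> 'o \<Rightarrow> ('o, 'm) cat" where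
  "ideal C c = full_sub C {d. subobj C d c}"

definition inclusion_preserving :: "('o, 'm) scat \<Rightarrow> ('p, 'q) scat \<Rightarrow> ('o, 'm, 'p, 'q) func \<Rightarrow> bool" where
  "inclusion_preserving C D F \<longleftrightarrow> (\<forall>j\<in>Incl C. FM F j \<in> Incl D)"

definition local_isomorphism :: "('o, 'm) scat \<Rightarrow> ('p, 'q) scat \<Rightarrow> ('o, 'm, 'p, 'q) func \<Rightarrow> bool" where
  "local_isomorphism C D F \<longleftrightarrow> is_functor C D F \<and> inclusion_preserving C D F \<and>
     fully_faithful C D F \<and>
     (\<forall>c\<in>Obj C. cat_isomorphism (ideal C c) (ideal D (FO F c)) (restrict_func (ideal C c) F))"

text \<open>The triple (D, C; \<open>\<Gamma>\<close>) is \<open>\<lparr>xD = D, xC = C, xG = \<Gamma>\<rparr>\<close>.\<close>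

record ('p, 'q, 'o, 'm) xconn =
  xD :: "('p, 'q) scat"
  xC :: "('o, 'm) scat"
  xG :: "('p, 'q, ('o, 'm, 'o \<Rightarrow> 'm) setfunctor, ('o, 'm, 'o \<Rightarrow> 'm) setnatt) func"

definition cross_connection :: "('p, 'q, 'o, 'm) xconn \<Rightarrow> bool" where
  "cross_connection X \<longleftrightarrow> normal_category (xD X) \<and> normal_category (xC X) \<and>
     local_isomorphism (xD X) (normal_dual (xC X)) (xG X) \<and>
     (\<forall>c\<in>Obj (xC X). \<exists>d\<in>Obj (xD X). c \<in> M_set (xC X) (FO (xG X) d))"

definition xE :: "('p, 'q, 'o, 'm) xconn \<Rightarrow> ('o \<times> 'p) set" where
  "xE X = {(c, d). c \<in> Obj (xC X) \<and> d \<in> Obj (xD X) \<and> c \<in> M_set (xC X) (FO (xG X) d)}"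

definition xcone :: "('p, 'q, 'o, 'm) xconn \<Rightarrow> 'o \<Rightarrow> 'p \<Rightarrow> ('o \<Rightarrow> 'm)" where
  "xcone X c d = (THE \<gamma>. idempotent_cone (xC X) \<gamma> \<and> apex (xC X) \<gamma> = c \<and>
     H_functor (xC X) \<gamma> = FO (xG X) d)"

text \<open>For \<open>f : c \<rightarrow> c'\<close> in C and \<open>g : d' \<rightarrow> d\<close> in D: the equation
  \<open>\<eta>\<^bsub>\<gamma>(c',d')\<^esub> C(f,-) = \<Gamma>(g) \<eta>\<^bsub>\<gamma>(c,d)\<^esub>\<close> between natural transformations
  \<open>\<Gamma>(d') \<rightarrow> C(c,-)\<close>, componentwise.\<close>

definition linked ::
  "('p, 'q, 'o, 'm) xconn \<Rightarrow> 'o \<Rightarrow> 'p \<Rightarrow> 'o \<Rightarrow> 'p \<Rightarrow> 'm \<Rightarrow> 'q \<Rightarrow> bool" where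
  "linked X c d c' d' f g \<longleftrightarrow>
     (\<forall>a\<in>Obj (xC X). \<forall>\<sigma>\<in>FO (FO (xG X) d') a.
        f \<cdot>\<^bsub>xC X\<^esub> eta (xC X) (xcone X c' d') a \<sigma>
        = eta (xC X) (xcone X c d) a (natt_app (FM (xG X) g) a \<sigma>))"

text \<open>
  The dual of a cross-connection (D, C; \<open>\<Gamma>\<close>) is the cross-connection (C, D; \<open>\<Delta>\<close>) with the same
  pairs (c, d) in which transposition with respect to \<open>\<Delta>\<close> agrees with transposition with respect to
  \<open>\<Gamma>\<close>, and in which \<open>\<delta>(c,d)(d')\<close> is the transpose of \<open>\<gamma>(c',d')(c)\<close>.  The last two clauses are needed:
  the set of pairs alone does not determine \<open>\<Delta>\<close>.  (For a completely simple semigroup it is the set of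
  all pairs, whatever the sandwich matrix.)
\<close>

definition is_dual :: "('p, 'q, 'o, 'm) xconn \<Rightarrow> ('o, 'm, 'p, 'q) xconn \<Rightarrow> bool" where
  "is_dual X Y \<longleftrightarrow> cross_connection Y \<and> xD Y = xC X \<and> xC Y = xD X \<and>
     (\<forall>c\<in>Obj (xC X). \<forall>d\<in>Obj (xD X). (c, d) \<in> xE X \<longleftrightarrow> (d, c) \<in> xE Y) \<and>
     (\<forall>(c, d)\<in>xE X. \<forall>(c', d')\<in>xE X.
        (\<forall>f\<in>hom (xC X) c c'. \<forall>g\<in>hom (xD X) d' d.
           linked Y d' c' d c g f \<longleftrightarrow> linked X c d c' d' f g) \<and>
        linked X c d c' d' (xcone X c' d' c) (xcone Y d c d'))"

definition dual :: "('p, 'q, 'o, 'm) xconn \<Rightarrow> ('o, 'm, 'p, 'q) xconn" where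
  "dual X = (THE Y. is_dual X Y)"

text \<open>\<open>g : d' \<rightarrow> d\<close> is the transpose of \<open>f : c \<rightarrow> c'\<close>; unfolding the definition of \<open>linked\<close> for the dual,
  the equation is \<open>\<eta>\<^bsub>\<delta>(c,d)\<^esub> D(g,-) = \<Delta>(f) \<eta>\<^bsub>\<delta>(c',d')\<^esub>\<close>.\<close>

definition is_transpose ::
  "('p, 'q, 'o, 'm) xconn \<Rightarrow> 'o \<Rightarrow> 'p \<Rightarrow> 'o \<Rightarrow> 'p \<Rightarrow> 'm \<Rightarrow> 'q \<Rightarrow> bool" where
  "is_transpose X c d c' d' f g \<longleftrightarrow> (c, d) \<in> xE X \<and> (c', d') \<in> xE X \<and>
     f \<in> hom (xC X) c c' \<and> g \<in> hom (xD X) d' d \<and> linked (dual X) d' c' d c g f"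

definition xconn_morphism ::
  "('p, 'q, 'o, 'm) xconn \<Rightarrow> ('p2, 'q2, 'o2, 'm2) xconn \<Rightarrow>
   ('o, 'm, 'o2, 'm2) func \<Rightarrow> ('p, 'q, 'p2, 'q2) func \<Rightarrow> bool" where
  "xconn_morphism X Y F G \<longleftrightarrow>
     is_functor (xC X) (xC Y) F \<and> inclusion_preserving (xC X) (xC Y) F \<and>
     is_functor (xD X) (xD Y) G \<and> inclusion_preserving (xD X) (xD Y) G \<and>
     (\<forall>(c, d)\<in>xE X. (FO F c, FO G d) \<in> xE Y \<and>
        (\<forall>c'\<in>Obj (xC X). FM F (xcone X c d c') = xcone Y (FO F c) (FO G d) (FO F c'))) \<and>
     (\<forall>(c, d)\<in>xE X. \<forall>(c', d')\<in>xE X. \<forall>f\<in>hom (xC X) c c'. \<forall>g\<in>hom (xD X) d' d.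
        is_transpose X c d c' d' f g \<longrightarrow>
        is_transpose Y (FO F c) (FO G d) (FO F c') (FO G d') (FM F f) (FM G g))"

type_synonym ('p, 'q, 'o, 'm) ccmor =
  "('p, 'q, 'o, 'm) xconn \<times> ('p, 'q, 'o, 'm) xconn \<times> ('o, 'm, 'o, 'm) func \<times> ('p, 'q, 'p, 'q) func"

definition CC :: "(('p, 'q, 'o, 'm) xconn, ('p, 'q, 'o, 'm) ccmor) cat" where
  "CC =
     (let M = {(X, Y, F, G). cross_connection X \<and> cross_connection Y \<and> xconn_morphism X Y F G} in
      \<lparr> Obj = {X. cross_connection X}, Mor = M,
        Dom = (\<lambda>m\<in>M. fst m), Cod = (\<lambda>m\<in>M. fst (snd m)),
        Idn = (\<lambda>X\<in>{X. cross_connection X}. (X, X, id_func (xC X), id_func (xD X))),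
        Cmp = (\<lambda>m\<in>M. \<lambda>n\<in>{n \<in> M. fst n = fst (snd m)}.
                 (fst m, fst (snd n),
                  comp_func (xC (fst m)) (fst (snd (snd m))) (fst (snd (snd n))),
                  comp_func (xD (fst m)) (snd (snd (snd m))) (snd (snd (snd n))))) \<rparr>)"


section \<open>The cross-connection of an inductive groupoid\<close>

abbreviation igd :: "('e, 'm) indgpd \<Rightarrow> 'm \<Rightarrow> 'e" where
  "igd X \<equiv> Dom (igg X)"

abbreviation igr :: "('e, 'm) indgpd \<Rightarrow> 'm \<Rightarrow> 'e" where
  "igr X \<equiv> Cod (igg X)"

abbreviation igone :: "('e, 'm) indgpd \<Rightarrow> 'e \<Rightarrow> 'm" where
  "igone X \<equiv> Idn (igg X)"

text \<open>\<open>circ X \<alpha> \<beta> h\<close> is \<open>(\<alpha> \<circ> \<beta>)\<^sub>h\<close>, for h in the sandwich set of \<open>r(\<alpha>)\<close> and \<open>d(\<beta>)\<close>.\<close>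

definition circ :: "('e, 'm) indgpd \<Rightarrow> 'm \<Rightarrow> 'm \<Rightarrow> 'e \<Rightarrow> 'm" where
  "circ X \<alpha> \<beta> h =
     (let G = igg X; rh = igr X \<alpha> \<odot>\<^bsub>igb X\<^esub> h; hd = h \<odot>\<^bsub>igb X\<^esub> igd X \<beta> in
      ((restr_cod G \<alpha> rh \<cdot>\<^bsub>G\<^esub> eps X rh h) \<cdot>\<^bsub>G\<^esub> eps X h hd) \<cdot>\<^bsub>G\<^esub> restr_dom G hd \<beta>)"

subsection \<open>The category \<open>L\<^sub>G\<close>\<close>

definition lcl :: "('e, 'm) indgpd \<Rightarrow> 'e \<Rightarrow> 'e set" where
  "lcl X e = {f. Leq (igb X) f e}"

definition simL :: "('e, 'm) indgpd \<Rightarrow> 'm \<Rightarrow> 'm \<Rightarrow> bool" where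
  "simL X \<alpha> \<beta> \<longleftrightarrow> \<alpha> \<in> Mor (igg X) \<and> \<beta> \<in> Mor (igg X) \<and>
     Leq (igb X) (igd X \<alpha>) (igd X \<beta>) \<and> Leq (igb X) (igr X \<alpha>) (igr X \<beta>) \<and>
     \<alpha> \<cdot>\<^bsub>igg X\<^esub> eps X (igr X \<alpha>) (igr X \<beta>) = eps X (igd X \<alpha>) (igd X \<beta>) \<cdot>\<^bsub>igg X\<^esub> \<beta>"

definition clsL :: "('e, 'm) indgpd \<Rightarrow> 'm \<Rightarrow> 'm set" where
  "clsL X \<alpha> = {\<beta>. simL X \<alpha> \<beta>}"

text \<open>\<open>q(e,u)\<close>, for \<open>u \<le> e\<close>, is encoded as the set of all (g, v) with \<open>q(g,v) = q(e,u)\<close>.\<close>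

definition qL :: "('e, 'm) indgpd \<Rightarrow> 'e \<Rightarrow> 'e \<Rightarrow> ('e \<times> 'e) set" where
  "qL X e u = {(g, v). Leq (igb X) g e \<and> v = g \<odot>\<^bsub>igb X\<^esub> u}"

text \<open>The morphism \<open>[e,\<alpha>\<rangle>\<close>, as a class of pairs of a quotient and an isomorphism.  It contains
  \<open>(q(e,u), \<alpha>)\<close> if \<open>u = d(\<alpha>) \<le> e\<close>, but it makes sense whenever \<open>d(\<alpha>)\<close> is below e in the right
  preorder; the functor \<open>\<Gamma>\<^sub>G\<close> uses it in that generality.\<close>

definition repi :: "('e, 'm) indgpd \<Rightarrow> 'e \<Rightarrow> 'm \<Rightarrow> (('e \<times> 'e) set \<times> 'm set) set" where
  "repi X e \<alpha> = {(qL X f v, clsL X \<theta>) | f v \<theta>.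
     Leq (igb X) f e \<and> nle (igb X) v f \<and> Req (igb X) v (igd X \<alpha>) \<and> \<theta> \<in> Mor (igg X) \<and>
     clsL X \<theta> = clsL X (eps X v (igd X \<alpha>) \<cdot>\<^bsub>igg X\<^esub> \<alpha>)}"

type_synonym ('e, 'm) tmor = "(('e \<times> 'e) set \<times> 'm set) set \<times> ('e set \<times> 'e set)"

text \<open>\<open>[e,\<alpha>,f\<rangle>\<close>; the second component is the morphism of the preorder category on the classes.\<close>

definition lmor :: "('e, 'm) indgpd \<Rightarrow> 'e \<Rightarrow> 'm \<Rightarrow> 'e \<Rightarrow> ('e, 'm) tmor" where
  "lmor X e \<alpha> f = (repi X e \<alpha>, (lcl X (igr X \<alpha>), lcl X f))"

definition lrep :: "('e, 'm) indgpd \<Rightarrow> 'e \<Rightarrow> 'm \<Rightarrow> 'e \<Rightarrow> ('e, 'm) tmor \<Rightarrow> bool" where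
  "lrep X e \<alpha> f m \<longleftrightarrow> e \<in> carr (igb X) \<and> f \<in> carr (igb X) \<and> \<alpha> \<in> Mor (igg X) \<and>
     nle (igb X) (igd X \<alpha>) e \<and> lle (igb X) (igr X \<alpha>) f \<and> m = lmor X e \<alpha> f"

definition LG :: "('e, 'm) indgpd \<Rightarrow> ('e set, ('e, 'm) tmor) scat" where
  "LG X =
     (let E = igb X;
          M = {m. \<exists>e \<alpha> f. lrep X e \<alpha> f m};
          dm = (\<lambda>m. THE A. \<exists>e \<alpha> f. lrep X e \<alpha> f m \<and> A = lcl X e);
          cm = (\<lambda>m. THE A. \<exists>e \<alpha> f. lrep X e \<alpha> f m \<and> A = lcl X f) in
      \<lparr> Obj = lcl X ` carr E, Mor = M,
        Dom = restrict dm M, Cod = restrict cm M,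
        Idn = (\<lambda>A\<in>lcl X ` carr E. THE m. \<exists>e\<in>A. m = lmor X e (igone X e) e),
        Cmp = (\<lambda>m\<in>M. \<lambda>n\<in>{n \<in> M. dm n = cm m}.
                 THE k. \<exists>e1 \<alpha> g1 e2 \<beta> g2 h. lrep X e1 \<alpha> g1 m \<and> lrep X e2 \<beta> g2 n \<and>
                   h \<in> sandwich E (igr X \<alpha>) (igd X \<beta>) \<and> k = lmor X e1 (circ X \<alpha> \<beta> h) g2),
        Incl = {lmor X e (igone X e) f | e f. lle E e f} \<rparr>)"

subsection \<open>The category \<open>R\<^sub>G\<close>\<close>

definition rcl :: "('e, 'm) indgpd \<Rightarrow> 'e \<Rightarrow> 'e set" where
  "rcl X e = {f. Req (igb X) f e}"

definition simR :: "('e, 'm) indgpd \<Rightarrow> 'm \<Rightarrow> 'm \<Rightarrow> bool" where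
  "simR X \<alpha> \<beta> \<longleftrightarrow> \<alpha> \<in> Mor (igg X) \<and> \<beta> \<in> Mor (igg X) \<and>
     Req (igb X) (igd X \<alpha>) (igd X \<beta>) \<and> Req (igb X) (igr X \<alpha>) (igr X \<beta>) \<and>
     \<alpha> \<cdot>\<^bsub>igg X\<^esub> eps X (igr X \<alpha>) (igr X \<beta>) = eps X (igd X \<alpha>) (igd X \<beta>) \<cdot>\<^bsub>igg X\<^esub> \<beta>"

definition clsR :: "('e, 'm) indgpd \<Rightarrow> 'm \<Rightarrow> 'm set" where
  "clsR X \<alpha> = {\<beta>. simR X \<alpha> \<beta>}"

definition qR :: "('e, 'm) indgpd \<Rightarrow> 'e \<Rightarrow> 'e \<Rightarrow> ('e \<times> 'e) set" where
  "qR X e u = {(g, v). Req (igb X) g e \<and> v = u \<odot>\<^bsub>igb X\<^esub> g}"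

definition lepi :: "('e, 'm) indgpd \<Rightarrow> 'e \<Rightarrow> 'm \<Rightarrow> (('e \<times> 'e) set \<times> 'm set) set" where
  "lepi X e \<alpha> = {(qR X f v, clsR X \<theta>) | f v \<theta>.
     Req (igb X) f e \<and> nle (igb X) v f \<and> Leq (igb X) v (igr X \<alpha>) \<and> \<theta> \<in> Mor (igg X) \<and>
     clsR X \<theta> = clsR X (\<alpha> \<cdot>\<^bsub>igg X\<^esub> eps X (igr X \<alpha>) v)}"

text \<open>\<open>\<langle>e,\<alpha>,f]\<close>, a morphism from the class of e to the class of f although \<open>\<alpha>\<close> goes from \<open>d(\<alpha>)\<close>,
  which lies under f, to \<open>r(\<alpha>)\<close>, which lies under e.\<close>

definition rmor :: "('e, 'm) indgpd \<Rightarrow> 'e \<Rightarrow> 'm \<Rightarrow> 'e \<Rightarrow> ('e, 'm) tmor" where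
  "rmor X e \<alpha> f = (lepi X e \<alpha>, (rcl X (igd X \<alpha>), rcl X f))"

definition rrep :: "('e, 'm) indgpd \<Rightarrow> 'e \<Rightarrow> 'm \<Rightarrow> 'e \<Rightarrow> ('e, 'm) tmor \<Rightarrow> bool" where
  "rrep X e \<alpha> f m \<longleftrightarrow> e \<in> carr (igb X) \<and> f \<in> carr (igb X) \<and> \<alpha> \<in> Mor (igg X) \<and>
     nle (igb X) (igr X \<alpha>) e \<and> rle (igb X) (igd X \<alpha>) f \<and> m = rmor X e \<alpha> f"

definition RG :: "('e, 'm) indgpd \<Rightarrow> ('e set, ('e, 'm) tmor) scat" where
  "RG X =
     (let E = igb X;
          M = {m. \<exists>e \<alpha> f. rrep X e \<alpha> f m};
          dm = (\<lambda>m. THE A. \<exists>e \<alpha> f. rrep X e \<alpha> f m \<and> A = rcl X e);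
          cm = (\<lambda>m. THE A. \<exists>e \<alpha> f. rrep X e \<alpha> f m \<and> A = rcl X f) in
      \<lparr> Obj = rcl X ` carr E, Mor = M,
        Dom = restrict dm M, Cod = restrict cm M,
        Idn = (\<lambda>A\<in>rcl X ` carr E. THE m. \<exists>e\<in>A. m = rmor X e (igone X e) e),
        Cmp = (\<lambda>m\<in>M. \<lambda>n\<in>{n \<in> M. dm n = cm m}.
                 THE k. \<exists>e1 \<alpha> g1 e2 \<beta> g2 h. rrep X e1 \<alpha> g1 m \<and> rrep X e2 \<beta> g2 n \<and>
                   h \<in> sandwich E (igr X \<beta>) (igd X \<alpha>) \<and> k = rmor X e1 (circ X \<beta> \<alpha> h) g2),
        Incl = {rmor X e (igone X e) f | e f. rle E e f} \<rparr>)"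

subsection \<open>The functor \<open>\<Gamma>\<^sub>G\<close>\<close>

definition rcone :: "('e, 'm) indgpd \<Rightarrow> 'e \<Rightarrow> ('e set \<Rightarrow> ('e, 'm) tmor)" where
  "rcone X e = (\<lambda>A\<in>Obj (LG X). THE m. \<exists>g\<in>A. \<exists>h\<in>sandwich (igb X) g e.
     m = lmor X g (circ X (igone X g) (igone X e) h) e)"

definition GammaG ::
  "('e, 'm) indgpd \<Rightarrow>
   ('e set, ('e, 'm) tmor,
    ('e set, ('e, 'm) tmor, 'e set \<Rightarrow> ('e, 'm) tmor) setfunctor,
    ('e set, ('e, 'm) tmor, 'e set \<Rightarrow> ('e, 'm) tmor) setnatt) func" where
  "GammaG X =
     (let L = LG X; H = (\<lambda>e. H_functor L (rcone X e)) in
      \<lparr> FO = (\<lambda>A\<in>Obj (RG X). THE S. \<exists>e\<in>A. S = H e),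
        FM = (\<lambda>m\<in>Mor (RG X). THE t. \<exists>e \<alpha> f. rrep X e \<alpha> f m \<and>
               t = (H e, H f, \<lambda>A\<in>Obj L.
                     (FO (H e) A, FO (H f) A,
                      \<lambda>\<sigma>\<in>FO (H e) A.
                        inv_into (FO (H f) A) (eta L (rcone X f) A)
                          (lmor X f \<alpha> e \<cdot>\<^bsub>L\<^esub> eta L (rcone X e) A \<sigma>)))) \<rparr>)"

definition CG :: "('e, 'm) indgpd \<Rightarrow> ('e set, ('e, 'm) tmor, 'e set, ('e, 'm) tmor) xconn" where
  "CG X = \<lparr> xD = RG X, xC = LG X, xG = GammaG X \<rparr>"

definition F1 ::
  "('e, 'm) indgpd \<Rightarrow> ('f, 'n) indgpd \<Rightarrow> ('e, 'm, 'f, 'n) func \<Rightarrow>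
   ('e set, ('e, 'm) tmor, 'f set, ('f, 'n) tmor) func" where
  "F1 X Y F =
     \<lparr> FO = (\<lambda>A\<in>Obj (LG X). THE B. \<exists>e\<in>A. B = lcl Y (FO F e)),
       FM = (\<lambda>m\<in>Mor (LG X). THE n. \<exists>e \<alpha> f. lrep X e \<alpha> f m \<and>
              n = lmor Y (FO F e) (FM F \<alpha>) (FO F f)) \<rparr>"

definition F2 ::
  "('e, 'm) indgpd \<Rightarrow> ('f, 'n) indgpd \<Rightarrow> ('e, 'm, 'f, 'n) func \<Rightarrow>
   ('e set, ('e, 'm) tmor, 'f set, ('f, 'n) tmor) func" where
  "F2 X Y F =
     \<lparr> FO = (\<lambda>A\<in>Obj (RG X). THE B. \<exists>e\<in>A. B = rcl Y (FO F e)),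
       FM = (\<lambda>m\<in>Mor (RG X). THE n. \<exists>e \<alpha> f. rrep X e \<alpha> f m \<and>
              n = rmor Y (FO F e) (FM F \<alpha>) (FO F f)) \<rparr>"

end

theory Submission imports Defs begin

text \<open>
  The assignments are understood through a regular semigroup.  On the set \<open>S\<close> of \<open>p\<close>-classes of an
  inductive groupoid, the product of the classes of \<open>\<alpha>\<close> and \<open>\<beta>\<close> is the class of
  \<open>(\<alpha> \<circ> \<beta>)\<^sub>h\<close>; it depends neither on the representatives nor on the sandwich element \<open>h\<close>
  (\<open>circ_indep\<close>, \<open>circ_cong\<close>).  It is associative (\<open>pmul_assoc\<close>): both bracketings of a triple product
  can be evaluated with sandwich elements for which they become one and the same path.  The inverse of
  \<open>\<alpha>\<close> yields a semigroup inverse of its class, and the idempotents of \<open>S\<close> are the classes of the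
  identities (\<open>idempotent_ent\<close>), so they correspond to the elements of \<open>E\<close>.

  The category \<open>L\<^sub>G\<close> is the category of principal left ideals of \<open>S\<close>
  (\<open>LG_semigroup_category\<close>): its objects are the left ideals \<open>Se\<close>, and the morphism
  \<open>[e,\<alpha>,f\<rangle>\<close> is right translation \<open>Se \<rightarrow> Sf\<close> by the class \<open>s\<close> of \<open>\<alpha>\<close>, an element of \<open>eSf\<close>.
  Reversing the arrows of the groupoid and the product of the biordered set gives an inductive groupoid
  with the opposite semigroup, and \<open>R\<^sub>G\<close> is the category \<open>L\<close> of that opposite (\<open>RG_op\<close>).
  Whatever is proved for \<open>L\<^sub>G\<close> thereby holds for \<open>R\<^sub>G\<close>.

  For a regular semigroup the categories of principal left and right ideals are normal: an inverse \<open>t\<close>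
  of \<open>s\<close> splits a translation by \<open>s\<close> into a retraction, an isomorphism and an inclusion, and each
  idempotent \<open>e\<close> gives the principal cone \<open>Sg \<mapsto> (x \<mapsto> xe)\<close>.  A version of the Yoneda lemma for
  the \<open>H\<close>-functors (\<open>nt_bij\<close>) identifies the natural transformations between them with the morphisms
  between the apexes in the opposite direction.  For the \<open>H\<close>-functors of the principal cones at
  \<open>e\<close> and \<open>f\<close> these are the elements of \<open>fSe\<close>, which are also the morphisms \<open>eS \<rightarrow> fS\<close> between right ideals.
  Hence \<open>\<Gamma>\<close>, which sends \<open>eS\<close> to the \<open>H\<close>-functor of the principal cone at \<open>e\<close>, is fully faithful,
  and it is a local isomorphism because a subobject of \<open>\<Gamma>(eS)\<close> is again the \<open>H\<close>-functor of the principal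
  cone at an idempotent in \<open>eS\<close> (\<open>sub_H_functor\<close>).  This makes \<open>\<Gamma>\<close> a cross-connection.

  The pairs of a cross-connection of this kind are the pairs \<open>(Se, eS)\<close> (\<open>xE_iff\<close>), and its dual is the
  same construction for the opposite semigroup (\<open>is_dual_opposite\<close>).  It follows that \<open>g\<close> is the
  transpose of \<open>f\<close> exactly if both are translations by one element \<open>s\<close> of \<open>eSf\<close>: the map
  \<open>f : Se \<rightarrow> Sf\<close> on the right and \<open>g : fS \<rightarrow> eS\<close> on the left (\<open>is_transpose_iff\<close>).

  An inductive functor preserves sandwich elements, restrictions and evaluated chains, hence it induces a
  homomorphism \<open>\<phi>\<close> between the semigroups.  The functors \<open>F\<^sub>1\<close> and \<open>F\<^sub>2\<close> apply \<open>\<phi>\<close> to the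
  elements by which one translates.  Since idempotent cones and transposes are given by formulas in the
  semigroup, they are preserved (\<open>cross_semigroup_morphism\<close>).  Compatibility with identities and
  composition is visible on representatives.
\<close>

section \<open>Categories, functors and sets\<close>

lemma hom_MorD: "f \<in> hom C a b \<Longrightarrow> f \<in> Mor C"
  and hom_DomD: "f \<in> hom C a b \<Longrightarrow> Dom C f = a"
  and hom_CodD: "f \<in> hom C a b \<Longrightarrow> Cod C f = b"
  by (auto simp: hom_def)

lemma Mor_hom: "f \<in> Mor C \<Longrightarrow> f \<in> hom C (Dom C f) (Cod C f)"
  by (auto simp: hom_def)

text \<open>
  The extensionality premises come from the encoding of categories as records of functions that are undefined
  outside their domain.
\<close>

lemma categoryI:
  assumes "Dom C \<in> extensional (Mor C)" "Cod C \<in> extensional (Mor C)"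
    "Idn C \<in> extensional (Obj C)" "Cmp C \<in> extensional (Mor C)"
    "\<And>f. f \<in> Mor C \<Longrightarrow> Cmp C f \<in> extensional {g \<in> Mor C. Dom C g = Cod C f}"
    "\<And>f. f \<in> Mor C \<Longrightarrow> Dom C f \<in> Obj C" "\<And>f. f \<in> Mor C \<Longrightarrow> Cod C f \<in> Obj C"
    "\<And>a. a \<in> Obj C \<Longrightarrow> Idn C a \<in> hom C a a"
    "\<And>a b c f g. f \<in> hom C a b \<Longrightarrow> g \<in> hom C b c \<Longrightarrow> f \<cdot>\<^bsub>C\<^esub> g \<in> hom C a c"
    "\<And>a b f. f \<in> hom C a b \<Longrightarrow> Idn C a \<cdot>\<^bsub>C\<^esub> f = f"
    "\<And>a b f. f \<in> hom C a b \<Longrightarrow> f \<cdot>\<^bsub>C\<^esub> Idn C b = f"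
    "\<And>a b c d f g h. f \<in> hom C a b \<Longrightarrow> g \<in> hom C b c \<Longrightarrow> h \<in> hom C c d \<Longrightarrow>
       (f \<cdot>\<^bsub>C\<^esub> g) \<cdot>\<^bsub>C\<^esub> h = f \<cdot>\<^bsub>C\<^esub> (g \<cdot>\<^bsub>C\<^esub> h)"
  shows "category C"
proof -
  have "f \<cdot>\<^bsub>C\<^esub> g \<in> hom C (Dom C f) (Cod C g)" if "f \<in> Mor C" "g \<in> Mor C" "Dom C g = Cod C f" for f g
    using assms(9)[of f "Dom C f" "Cod C f" g "Cod C g"] that by (auto simp: hom_def)
  moreover have "(f \<cdot>\<^bsub>C\<^esub> g) \<cdot>\<^bsub>C\<^esub> h = f \<cdot>\<^bsub>C\<^esub> (g \<cdot>\<^bsub>C\<^esub> h)"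
    if "f \<in> Mor C" "g \<in> Mor C" "h \<in> Mor C" "Cod C f = Dom C g" "Cod C g = Dom C h" for f g h
    using assms(12)[of f "Dom C f" "Cod C f" g "Cod C g" h "Cod C h"] that by (auto simp: hom_def)
  moreover have "Idn C (Dom C f) \<cdot>\<^bsub>C\<^esub> f = f" "f \<cdot>\<^bsub>C\<^esub> Idn C (Cod C f) = f" if "f \<in> Mor C" for f
    using assms(10,11)[of f "Dom C f" "Cod C f"] that by (auto simp: hom_def)
  ultimately show ?thesis
    unfolding category_def using assms(1-8) by (auto simp: PiE_def Pi_def)
qed

context
  fixes C :: "('o, 'm, 'z) cat_scheme"
  assumes C: "category C"
begin

lemma cat_DomO: "f \<in> Mor C \<Longrightarrow> Dom C f \<in> Obj C" and cat_CodO: "f \<in> Mor C \<Longrightarrow> Cod C f \<in> Obj C"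
  and cat_Idn: "a \<in> Obj C \<Longrightarrow> Idn C a \<in> hom C a a"
  using C by (auto simp: category_def)

lemma cat_homO1: "f \<in> hom C a b \<Longrightarrow> a \<in> Obj C" and cat_homO2: "f \<in> hom C a b \<Longrightarrow> b \<in> Obj C"
  using cat_DomO cat_CodO by (auto simp: hom_def)

lemma cat_cmp: "f \<in> hom C a b \<Longrightarrow> g \<in> hom C b c \<Longrightarrow> f \<cdot>\<^bsub>C\<^esub> g \<in> hom C a c"
proof -
  assume a: "f \<in> hom C a b" "g \<in> hom C b c"
  have "Cmp C \<in> (\<Pi>\<^sub>E f\<in>Mor C. \<Pi>\<^sub>E g\<in>{g \<in> Mor C. Dom C g = Cod C f}. hom C (Dom C f) (Cod C g))"
    using C by (simp add: category_def)
  with a show ?thesis by (fastforce simp: hom_def PiE_def Pi_def)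
qed

lemma cat_idl: "f \<in> hom C a b \<Longrightarrow> Idn C a \<cdot>\<^bsub>C\<^esub> f = f"
  and cat_idr: "f \<in> hom C a b \<Longrightarrow> f \<cdot>\<^bsub>C\<^esub> Idn C b = f"
  using C by (auto simp: category_def hom_def)

lemma cat_assoc: "f \<in> hom C a b \<Longrightarrow> g \<in> hom C b c \<Longrightarrow> h \<in> hom C c d \<Longrightarrow>
    (f \<cdot>\<^bsub>C\<^esub> g) \<cdot>\<^bsub>C\<^esub> h = f \<cdot>\<^bsub>C\<^esub> (g \<cdot>\<^bsub>C\<^esub> h)"
  using C unfolding category_def hom_def by auto

lemma cat_ext: "Dom C \<in> extensional (Mor C)" "Cod C \<in> extensional (Mor C)" "Idn C \<in> extensional (Obj C)"
  "Cmp C \<in> extensional (Mor C)" "f \<in> Mor C \<Longrightarrow> Cmp C f \<in> extensional {g \<in> Mor C. Dom C g = Cod C f}"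
  using C by (auto simp: category_def PiE_def Pi_def)

lemma is_isoI: "f \<in> hom C a b \<Longrightarrow> g \<in> hom C b a \<Longrightarrow> f \<cdot>\<^bsub>C\<^esub> g = Idn C a \<Longrightarrow> g \<cdot>\<^bsub>C\<^esub> f = Idn C b \<Longrightarrow>
    is_iso C f"
  unfolding is_iso_def by (auto simp: hom_def)

lemma is_isoE:
  assumes "is_iso C f" "f \<in> hom C a b"
  obtains g where "g \<in> hom C b a" "f \<cdot>\<^bsub>C\<^esub> g = Idn C a" "g \<cdot>\<^bsub>C\<^esub> f = Idn C b"
  using assms unfolding is_iso_def by (auto simp: hom_def)

lemma is_iso_Idn: "a \<in> Obj C \<Longrightarrow> is_iso C (Idn C a)"
  by (rule is_isoI[of _ a a "Idn C a"]) (simp_all add: cat_Idn cat_idl[OF cat_Idn])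

end

lemma is_functorI:
  assumes "category C" "category D" "FO F \<in> extensional (Obj C)" "FM F \<in> extensional (Mor C)"
    "\<And>a. a \<in> Obj C \<Longrightarrow> FO F a \<in> Obj D"
    "\<And>a b f. f \<in> hom C a b \<Longrightarrow> FM F f \<in> hom D (FO F a) (FO F b)"
    "\<And>a. a \<in> Obj C \<Longrightarrow> FM F (Idn C a) = Idn D (FO F a)"
    "\<And>a b c f g. f \<in> hom C a b \<Longrightarrow> g \<in> hom C b c \<Longrightarrow> FM F (f \<cdot>\<^bsub>C\<^esub> g) = FM F f \<cdot>\<^bsub>D\<^esub> FM F g"
  shows "is_functor C D F"
proof -
  have "FM F (f \<cdot>\<^bsub>C\<^esub> g) = FM F f \<cdot>\<^bsub>D\<^esub> FM F g" if "f \<in> Mor C" "g \<in> Mor C" "Cod C f = Dom C g" for f g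
    using assms(8)[of f "Dom C f" "Cod C f" g "Cod C g"] that by (auto simp: hom_def)
  moreover have "FM F f \<in> hom D (FO F (Dom C f)) (FO F (Cod C f))" if "f \<in> Mor C" for f
    using assms(6)[of f "Dom C f" "Cod C f"] that by (auto simp: hom_def)
  ultimately show ?thesis
    unfolding is_functor_def using assms(1-5,7) by (auto simp: PiE_def Pi_def)
qed

context
  fixes C :: "('o, 'm, 'z) cat_scheme" and D :: "('p, 'q, 'y) cat_scheme" and F
  assumes F: "is_functor C D F"
begin

lemma func_cat1: "category C" and func_cat2: "category D"
  and func_ext: "FO F \<in> extensional (Obj C)" "FM F \<in> extensional (Mor C)"
  and func_O: "a \<in> Obj C \<Longrightarrow> FO F a \<in> Obj D"
  and func_id: "a \<in> Obj C \<Longrightarrow> FM F (Idn C a) = Idn D (FO F a)"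
  using F by (auto simp: is_functor_def PiE_def Pi_def)

lemma func_hom: "f \<in> hom C a b \<Longrightarrow> FM F f \<in> hom D (FO F a) (FO F b)"
  using F by (auto simp: is_functor_def PiE_def Pi_def hom_def)

lemma func_cmp: "f \<in> hom C a b \<Longrightarrow> g \<in> hom C b c \<Longrightarrow> FM F (f \<cdot>\<^bsub>C\<^esub> g) = FM F f \<cdot>\<^bsub>D\<^esub> FM F g"
  using F by (auto simp: is_functor_def hom_def)

lemma func_Mor: "f \<in> Mor C \<Longrightarrow> FM F f \<in> Mor D"
  using func_hom[OF Mor_hom] hom_MorD by fast

end

lemma func_eqI:
  fixes F G :: "('o, 'm, 'p, 'q) func"
  assumes "FO F \<in> extensional A" "FO G \<in> extensional A" "FM F \<in> extensional B" "FM G \<in> extensional B"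
    "\<And>a. a \<in> A \<Longrightarrow> FO F a = FO G a" "\<And>f. f \<in> B \<Longrightarrow> FM F f = FM G f"
  shows "F = G"
  using extensionalityI[OF assms(1,2)] extensionalityI[OF assms(3,4)] assms(5,6)
  by (metis func.surjective old.unit.exhaust)

lemma id_functor: "category C \<Longrightarrow> is_functor C C (id_func C)"
  by (rule is_functorI)
    (auto simp: id_func_def hom_MorD cat_Idn[THEN hom_MorD] cat_cmp[THEN hom_MorD] cat_homO1 cat_homO2)

lemma comp_functor:
  assumes F: "is_functor C D F" and G: "is_functor D E G"
  shows "is_functor C E (comp_func C F G)"
proof (rule is_functorI)
  note c = func_cat1[OF F]
  show "category C" "category E" using func_cat1[OF F] func_cat2[OF G] .
  show "FO (comp_func C F G) \<in> extensional (Obj C)" "FM (comp_func C F G) \<in> extensional (Mor C)"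
    by (auto simp: comp_func_def)
  show "FO (comp_func C F G) a \<in> Obj E" if "a \<in> Obj C" for a
    using that func_O[OF F] func_O[OF G] by (auto simp: comp_func_def)
  show "FM (comp_func C F G) f \<in> hom E (FO (comp_func C F G) a) (FO (comp_func C F G) b)"
    if "f \<in> hom C a b" for a b f
    using func_hom[OF G func_hom[OF F that]] that cat_homO1[OF c that] cat_homO2[OF c that]
    by (simp add: comp_func_def hom_MorD)
  show "FM (comp_func C F G) (Idn C a) = Idn E (FO (comp_func C F G) a)" if "a \<in> Obj C" for a
    using that func_O[OF F] func_id[OF F] func_id[OF G]
    by (simp add: comp_func_def cat_Idn[OF c, THEN hom_MorD])
  show "FM (comp_func C F G) (f \<cdot>\<^bsub>C\<^esub> g) = FM (comp_func C F G) f \<cdot>\<^bsub>E\<^esub> FM (comp_func C F G) g"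
    if "f \<in> hom C a b" "g \<in> hom C b d" for a b d f g
    using func_cmp[OF F that] func_cmp[OF G func_hom[OF F that(1)] func_hom[OF F that(2)]] that
      cat_cmp[OF c that]
    by (simp add: comp_func_def hom_MorD)
qed

lemma is_nattI:
  assumes "is_functor C D S" "is_functor C D T" "\<tau> \<in> extensional (Obj C)"
    "\<And>a. a \<in> Obj C \<Longrightarrow> \<tau> a \<in> hom D (FO S a) (FO T a)"
    "\<And>a b f. f \<in> hom C a b \<Longrightarrow> FM S f \<cdot>\<^bsub>D\<^esub> \<tau> b = \<tau> a \<cdot>\<^bsub>D\<^esub> FM T f"
  shows "is_natt C D (S, T, \<tau>)"
proof -
  have "FM S f \<cdot>\<^bsub>D\<^esub> \<tau> (Cod C f) = \<tau> (Dom C f) \<cdot>\<^bsub>D\<^esub> FM T f" if "f \<in> Mor C" for f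
    using assms(5)[OF Mor_hom[OF that]] .
  then show ?thesis using assms(1-4) by (auto simp: is_natt_def PiE_def Pi_def)
qed

lemma is_nattD:
  assumes "is_natt C D (S, T, \<tau>)"
  shows "is_functor C D S" "is_functor C D T" "\<tau> \<in> extensional (Obj C)"
    "\<And>a. a \<in> Obj C \<Longrightarrow> \<tau> a \<in> hom D (FO S a) (FO T a)"
    "\<And>a b f. f \<in> hom C a b \<Longrightarrow> FM S f \<cdot>\<^bsub>D\<^esub> \<tau> b = \<tau> a \<cdot>\<^bsub>D\<^esub> FM T f"
  using assms by (auto simp: is_natt_def PiE_def Pi_def hom_def)

lemma functor_cat_hom:
  "t \<in> hom (functor_cat C D) S T \<longleftrightarrow> is_natt C D t \<and> fst t = S \<and> fst (snd t) = T"
  by (auto simp: hom_def functor_cat_def Let_def)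

lemma functor_cat_category:
  assumes C: "category C" and D: "category D"
  shows "category (functor_cat C D)"
proof (rule categoryI)
  let ?N = "functor_cat C D"
  have MorN: "Mor ?N = {t. is_natt C D t}" and ObjN: "Obj ?N = {F. is_functor C D F}"
    by (auto simp: functor_cat_def Let_def)
  have cmpN: "s \<cdot>\<^bsub>?N\<^esub> t = (fst s, fst (snd t), \<lambda>a\<in>Obj C. snd (snd s) a \<cdot>\<^bsub>D\<^esub> snd (snd t) a)"
    if "is_natt C D s" "is_natt C D t" "fst (snd s) = fst t" for s t
    using that by (simp add: functor_cat_def Let_def)
  show "Dom ?N \<in> extensional (Mor ?N)" "Cod ?N \<in> extensional (Mor ?N)"
    "Idn ?N \<in> extensional (Obj ?N)" "Cmp ?N \<in> extensional (Mor ?N)"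
    "\<And>f. f \<in> Mor ?N \<Longrightarrow> Cmp ?N f \<in> extensional {g \<in> Mor ?N. Dom ?N g = Cod ?N f}"
    by (auto simp: functor_cat_def Let_def extensional_def)
  show "Dom ?N f \<in> Obj ?N" "Cod ?N f \<in> Obj ?N" if "f \<in> Mor ?N" for f
    using that is_nattD(1,2)[of C D "fst f" "fst (snd f)" "snd (snd f)"]
    by (simp_all add: functor_cat_def Let_def)
  show id: "Idn ?N F \<in> hom ?N F F" if "F \<in> Obj ?N" for F
  proof -
    from that have F: "is_functor C D F" by (simp add: ObjN)
    have "is_natt C D (F, F, \<lambda>a\<in>Obj C. Idn D (FO F a))"
    proof (rule is_nattI[OF F F])
      fix a b f assume f: "f \<in> hom C a b"
      then show "FM F f \<cdot>\<^bsub>D\<^esub> (\<lambda>a\<in>Obj C. Idn D (FO F a)) b = (\<lambda>a\<in>Obj C. Idn D (FO F a)) a \<cdot>\<^bsub>D\<^esub> FM F f"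
        using func_hom[OF F f] cat_idl[OF D] cat_idr[OF D] cat_homO1[OF C f] cat_homO2[OF C f]
        by fastforce
    qed (auto simp: cat_Idn[OF D] func_O[OF F])
    then show ?thesis using F unfolding functor_cat_hom by (simp add: functor_cat_def Let_def)
  qed
  show cmp: "s \<cdot>\<^bsub>?N\<^esub> t \<in> hom ?N F H" if s: "s \<in> hom ?N F G" and t: "t \<in> hom ?N G H" for s t F G H
  proof -
    obtain \<sigma> where s': "s = (F, G, \<sigma>)" "is_natt C D (F, G, \<sigma>)" using s by (cases s) (auto simp: functor_cat_hom)
    obtain \<tau> where t': "t = (G, H, \<tau>)" "is_natt C D (G, H, \<tau>)" using t by (cases t) (auto simp: functor_cat_hom)
    note S = is_nattD[OF s'(2)] and T = is_nattD[OF t'(2)]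
    have "is_natt C D (F, H, \<lambda>a\<in>Obj C. \<sigma> a \<cdot>\<^bsub>D\<^esub> \<tau> a)"
    proof (rule is_nattI[OF S(1) T(2)])
      fix a assume "a \<in> Obj C"
      then show "(\<lambda>a\<in>Obj C. \<sigma> a \<cdot>\<^bsub>D\<^esub> \<tau> a) a \<in> hom D (FO F a) (FO H a)"
        using cat_cmp[OF D S(4) T(4)] by simp
    next
      fix a b f assume f: "f \<in> hom C a b"
      note ab = cat_homO1[OF C f] cat_homO2[OF C f]
      have "FM F f \<cdot>\<^bsub>D\<^esub> (\<sigma> b \<cdot>\<^bsub>D\<^esub> \<tau> b) = (\<sigma> a \<cdot>\<^bsub>D\<^esub> FM G f) \<cdot>\<^bsub>D\<^esub> \<tau> b"
        using cat_assoc[OF D func_hom[OF S(1) f] S(4) T(4)] ab S(5)[OF f] by simp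
      also have "\<dots> = (\<sigma> a \<cdot>\<^bsub>D\<^esub> \<tau> a) \<cdot>\<^bsub>D\<^esub> FM H f"
        using cat_assoc[OF D S(4) func_hom[OF T(1) f] T(4)] cat_assoc[OF D S(4) T(4) func_hom[OF T(2) f]]
          ab T(5)[OF f] by simp
      finally show "FM F f \<cdot>\<^bsub>D\<^esub> (\<lambda>a\<in>Obj C. \<sigma> a \<cdot>\<^bsub>D\<^esub> \<tau> a) b = (\<lambda>a\<in>Obj C. \<sigma> a \<cdot>\<^bsub>D\<^esub> \<tau> a) a \<cdot>\<^bsub>D\<^esub> FM H f"
        using ab by simp
    qed auto
    then show ?thesis using cmpN[of s t] s' t' by (simp add: functor_cat_hom)
  qed
  show "Idn ?N F \<cdot>\<^bsub>?N\<^esub> t = t" "t \<cdot>\<^bsub>?N\<^esub> Idn ?N G = t" if t: "t \<in> hom ?N F G" for t F G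
  proof -
    obtain \<tau> where t': "t = (F, G, \<tau>)" "is_natt C D (F, G, \<tau>)" using t by (cases t) (auto simp: functor_cat_hom)
    note T = is_nattD[OF t'(2)]
    have iF: "is_natt C D (F, F, \<lambda>a\<in>Obj C. Idn D (FO F a))" "Idn ?N F = (F, F, \<lambda>a\<in>Obj C. Idn D (FO F a))"
      using id[of F] T(1) unfolding functor_cat_hom by (auto simp: functor_cat_def Let_def)
    have iG: "is_natt C D (G, G, \<lambda>a\<in>Obj C. Idn D (FO G a))" "Idn ?N G = (G, G, \<lambda>a\<in>Obj C. Idn D (FO G a))"
      using id[of G] T(2) unfolding functor_cat_hom by (auto simp: functor_cat_def Let_def)
    show "Idn ?N F \<cdot>\<^bsub>?N\<^esub> t = t"
      using cmpN[of "Idn ?N F" t] iF t' cat_idl[OF D T(4)] T(3) by (auto intro!: extensionalityI[of _ "Obj C"])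
    show "t \<cdot>\<^bsub>?N\<^esub> Idn ?N G = t"
      using cmpN[of t "Idn ?N G"] iG t' cat_idr[OF D T(4)] T(3) by (auto intro!: extensionalityI[of _ "Obj C"])
  qed
  show "(s \<cdot>\<^bsub>?N\<^esub> t) \<cdot>\<^bsub>?N\<^esub> u = s \<cdot>\<^bsub>?N\<^esub> (t \<cdot>\<^bsub>?N\<^esub> u)"
    if h: "s \<in> hom ?N F G" "t \<in> hom ?N G H" "u \<in> hom ?N H K" for s t u F G H K
  proof -
    obtain \<sigma> \<tau> \<upsilon> where s: "s = (F, G, \<sigma>)" "t = (G, H, \<tau>)" "u = (H, K, \<upsilon>)" 
      "is_natt C D (F, G, \<sigma>)" "is_natt C D (G, H, \<tau>)" "is_natt C D (H, K, \<upsilon>)"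
      using h by (cases s; cases t; cases u) (auto simp: functor_cat_hom)
    have st: "is_natt C D (s \<cdot>\<^bsub>?N\<^esub> t)" "is_natt C D (t \<cdot>\<^bsub>?N\<^esub> u)"
      using cmp h by (auto simp: functor_cat_hom)
    have "a \<in> Obj C \<Longrightarrow> (\<sigma> a \<cdot>\<^bsub>D\<^esub> \<tau> a) \<cdot>\<^bsub>D\<^esub> \<upsilon> a = \<sigma> a \<cdot>\<^bsub>D\<^esub> (\<tau> a \<cdot>\<^bsub>D\<^esub> \<upsilon> a)" for a
      by (rule cat_assoc[OF D is_nattD(4)[OF s(4)] is_nattD(4)[OF s(5)] is_nattD(4)[OF s(6)]])
    then show ?thesis
      using cmpN[of s t] cmpN[of t u] cmpN[OF st(1), of u] cmpN[OF _ st(2), of s] s by (auto intro!: restrict_ext)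
  qed
qed

lemma full_sub_simps:
  "Obj (full_sub C A) = A" "Mor (full_sub C A) = {f \<in> Mor C. Dom C f \<in> A \<and> Cod C f \<in> A}"
  "f \<in> Mor C \<Longrightarrow> Dom C f \<in> A \<Longrightarrow> Cod C f \<in> A \<Longrightarrow> Dom (full_sub C A) f = Dom C f"
  "f \<in> Mor C \<Longrightarrow> Dom C f \<in> A \<Longrightarrow> Cod C f \<in> A \<Longrightarrow> Cod (full_sub C A) f = Cod C f"
  "a \<in> A \<Longrightarrow> Idn (full_sub C A) a = Idn C a"
  by (auto simp: full_sub_def Let_def)

lemma full_sub_hom: "f \<in> hom (full_sub C A) a b \<longleftrightarrow> f \<in> hom C a b \<and> a \<in> A \<and> b \<in> A"
  by (auto simp: hom_def full_sub_def Let_def)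

lemma full_sub_cmp: "f \<in> hom (full_sub C A) a b \<Longrightarrow> g \<in> hom (full_sub C A) b c \<Longrightarrow>
    f \<cdot>\<^bsub>full_sub C A\<^esub> g = f \<cdot>\<^bsub>C\<^esub> g"
  by (auto simp: hom_def full_sub_def Let_def)

lemma full_sub_category:
  assumes C: "category C" and A: "A \<subseteq> Obj C"
  shows "category (full_sub C A)"
proof (rule categoryI)
  let ?N = "full_sub C A"
  show "Dom ?N \<in> extensional (Mor ?N)" "Cod ?N \<in> extensional (Mor ?N)"
    "Idn ?N \<in> extensional (Obj ?N)" "Cmp ?N \<in> extensional (Mor ?N)"
    "\<And>f. f \<in> Mor ?N \<Longrightarrow> Cmp ?N f \<in> extensional {g \<in> Mor ?N. Dom ?N g = Cod ?N f}"
    by (auto simp: full_sub_def Let_def extensional_def)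
  show "Dom ?N f \<in> Obj ?N" "Cod ?N f \<in> Obj ?N" if "f \<in> Mor ?N" for f
    using that by (auto simp: full_sub_def Let_def)
  show id: "Idn ?N a \<in> hom ?N a a" if "a \<in> Obj ?N" for a
    using cat_Idn[OF C] A that by (auto simp: full_sub_hom full_sub_simps)
  show cmp: "f \<cdot>\<^bsub>?N\<^esub> g \<in> hom ?N a c" if "f \<in> hom ?N a b" "g \<in> hom ?N b c" for f g a b c
    using that cat_cmp[OF C] by (auto simp: full_sub_cmp[OF that] full_sub_hom)
  show "Idn ?N a \<cdot>\<^bsub>?N\<^esub> f = f" "f \<cdot>\<^bsub>?N\<^esub> Idn ?N b = f" if f: "f \<in> hom ?N a b" for f a b
    using full_sub_cmp[OF id f] full_sub_cmp[OF f id] f cat_idl[OF C] cat_idr[OF C]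
    by (auto simp: full_sub_hom full_sub_simps)
  show "(f \<cdot>\<^bsub>?N\<^esub> g) \<cdot>\<^bsub>?N\<^esub> h = f \<cdot>\<^bsub>?N\<^esub> (g \<cdot>\<^bsub>?N\<^esub> h)"
    if f: "f \<in> hom ?N a b" "g \<in> hom ?N b c" "h \<in> hom ?N c d" for f g h a b c d
    using full_sub_cmp[OF cmp[OF f(1,2)] f(3)] full_sub_cmp[OF f(1) cmp[OF f(2,3)]]
      full_sub_cmp[OF f(1,2)] full_sub_cmp[OF f(2,3)] f cat_assoc[OF C, of f a b g c h d]
    by (auto simp: full_sub_hom)
qed

lemma Sets_hom: "f \<in> hom Sets A B \<longleftrightarrow> (\<exists>h. f = (A, B, h) \<and> h \<in> A \<rightarrow>\<^sub>E B)"
  by (auto simp: hom_def Sets_def Let_def)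

lemma Sets_Obj: "Obj Sets = UNIV" by (simp add: Sets_def Let_def)

lemma Sets_Idn: "Idn Sets A = (A, A, \<lambda>x\<in>A. x)" by (simp add: Sets_def Let_def)

lemma Sets_cmp: "f \<in> A \<rightarrow>\<^sub>E B \<Longrightarrow> g \<in> B \<rightarrow>\<^sub>E D \<Longrightarrow>
    (A, B, f) \<cdot>\<^bsub>Sets\<^esub> (B, D, g) = (A, D, \<lambda>x\<in>A. g (f x))"
  by (simp add: Sets_def Let_def)

lemma Sets_category: "category Sets"
proof (rule categoryI)
  show "Dom Sets \<in> extensional (Mor Sets)" "Cod Sets \<in> extensional (Mor Sets)"
    "Idn Sets \<in> extensional (Obj Sets)" "Cmp Sets \<in> extensional (Mor Sets)"
    "\<And>f. f \<in> Mor Sets \<Longrightarrow> Cmp Sets f \<in> extensional {g \<in> Mor Sets. Dom Sets g = Cod Sets f}"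
    by (auto simp: Sets_def Let_def extensional_def)
  show "Dom Sets f \<in> Obj Sets" "Cod Sets f \<in> Obj Sets" if "f \<in> Mor Sets" for f
    by (simp_all add: Sets_Obj)
  show "Idn Sets a \<in> hom Sets a a" for a by (auto simp: Sets_hom Sets_Idn)
  show "f \<cdot>\<^bsub>Sets\<^esub> g \<in> hom Sets a c" if "f \<in> hom Sets a b" "g \<in> hom Sets b c" for f g a b c
  proof -
    from that obtain h k where *: "f = (a, b, h)" "h \<in> a \<rightarrow>\<^sub>E b" "g = (b, c, k)" "k \<in> b \<rightarrow>\<^sub>E c"
      by (auto simp: Sets_hom)
    then have "(\<lambda>x\<in>a. k (h x)) \<in> a \<rightarrow>\<^sub>E c" by (auto simp: PiE_def Pi_def)
    then show ?thesis using * Sets_cmp[OF *(2,4)] by (simp add: Sets_hom)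
  qed
  show "Idn Sets a \<cdot>\<^bsub>Sets\<^esub> f = f" "f \<cdot>\<^bsub>Sets\<^esub> Idn Sets b = f" if "f \<in> hom Sets a b" for f a b
  proof -
    from that obtain h where *: "f = (a, b, h)" "h \<in> a \<rightarrow>\<^sub>E b" by (auto simp: Sets_hom)
    have "(\<lambda>x\<in>a. h x) = h" "(\<lambda>x\<in>a. (\<lambda>x\<in>b. x) (h x)) = h"
      using *(2) by (auto simp: PiE_def Pi_def intro!: extensionalityI[of _ a])
    moreover have "(\<lambda>x\<in>a. h ((\<lambda>x\<in>a. x) x)) = (\<lambda>x\<in>a. h x)" by (rule restrict_ext) auto
    ultimately show "Idn Sets a \<cdot>\<^bsub>Sets\<^esub> f = f" "f \<cdot>\<^bsub>Sets\<^esub> Idn Sets b = f"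
      using Sets_cmp[of "\<lambda>x\<in>a. x" a a h b] Sets_cmp[of h a b "\<lambda>x\<in>b. x" b] * by (simp_all add: Sets_Idn)
  qed
  show "(f \<cdot>\<^bsub>Sets\<^esub> g) \<cdot>\<^bsub>Sets\<^esub> h = f \<cdot>\<^bsub>Sets\<^esub> (g \<cdot>\<^bsub>Sets\<^esub> h)"
    if hh: "f \<in> hom Sets a b" "g \<in> hom Sets b c" "h \<in> hom Sets c d" for f g h a b c d
  proof -
    from hh obtain f' g' h' where *: "f = (a, b, f')" "f' \<in> a \<rightarrow>\<^sub>E b" "g = (b, c, g')" "g' \<in> b \<rightarrow>\<^sub>E c"
      "h = (c, d, h')" "h' \<in> c \<rightarrow>\<^sub>E d" by (auto simp: Sets_hom)
    have **: "(\<lambda>x\<in>a. g' (f' x)) \<in> a \<rightarrow>\<^sub>E c" "(\<lambda>x\<in>b. h' (g' x)) \<in> b \<rightarrow>\<^sub>E d" using * by (auto simp: PiE_def Pi_def)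
    show ?thesis using * Sets_cmp[OF *(2,4)] Sets_cmp[OF *(4,6)] Sets_cmp[OF **(1) *(6)] Sets_cmp[OF *(2) **(2)]
      by (auto intro!: restrict_ext)
  qed
qed

section \<open>Normal categories\<close>

definition split_epi :: "('o, 'm, 'z) cat_scheme \<Rightarrow> 'm \<Rightarrow> bool" where
  "split_epi C f \<longleftrightarrow> f \<in> Mor C \<and> (\<exists>s\<in>hom C (Cod C f) (Dom C f). s \<cdot>\<^bsub>C\<^esub> f = Idn C (Cod C f))"

text \<open>
  The cone \<open>\<gamma> * f\<^sup>\<circ>\<close>; for a cone \<open>\<gamma>\<close> with apex
  \<open>d\<close>, \<open>psi C \<gamma>\<close> restricted to the morphisms \<open>d \<rightarrow> c\<close>
  is the inverse of the natural bijection \<open>eta C \<gamma> c\<close>.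
\<close>

abbreviation psi :: "('o, 'm) scat \<Rightarrow> ('o \<Rightarrow> 'm) \<Rightarrow> 'm \<Rightarrow> ('o \<Rightarrow> 'm)" where
  "psi C \<gamma> f \<equiv> cone_comp C \<gamma> (epi_component C f)"

text \<open>
  The natural transformation \<open>H(\<gamma>;-) \<rightarrow> H(\<gamma>';-)\<close> that corresponds, under
  the isomorphisms of both functors with hom-functors, to precomposition with \<open>f\<close>.
\<close>

definition nt ::
  "('o, 'm) scat \<Rightarrow> ('o \<Rightarrow> 'm) \<Rightarrow> ('o \<Rightarrow> 'm) \<Rightarrow> 'm \<Rightarrow> ('o, 'm, 'o \<Rightarrow> 'm) setnatt" where
  "nt C \<gamma> \<gamma>' f = (H_functor C \<gamma>, H_functor C \<gamma>',
     \<lambda>a\<in>Obj C. (H_set C \<gamma> a, H_set C \<gamma>' a, \<lambda>\<sigma>\<in>H_set C \<gamma> a. psi C \<gamma>' (f \<cdot>\<^bsub>C\<^esub> eta C \<gamma> a \<sigma>)))"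

lemma split_epiI: "f \<in> hom C a b \<Longrightarrow> s \<in> hom C b a \<Longrightarrow> s \<cdot>\<^bsub>C\<^esub> f = Idn C b \<Longrightarrow> split_epi C f"
  by (auto simp: split_epi_def hom_def)

lemma split_epiE:
  assumes "split_epi C f" "f \<in> hom C a b"
  obtains s where "s \<in> hom C b a" "s \<cdot>\<^bsub>C\<^esub> f = Idn C b"
  using assms by (auto simp: split_epi_def hom_def)

lemma is_coneI:
  assumes "d \<in> Obj C" "\<gamma> \<in> extensional (Obj C)" "\<And>c. c \<in> Obj C \<Longrightarrow> \<gamma> c \<in> hom C c d"
    "\<And>a b j. j \<in> Incl C \<Longrightarrow> j \<in> hom C a b \<Longrightarrow> j \<cdot>\<^bsub>C\<^esub> \<gamma> b = \<gamma> a" "Incl C \<subseteq> Mor C"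
    "c \<in> Obj C" "is_iso C (\<gamma> c)"
  shows "is_cone C d \<gamma>"
proof -
  have "\<forall>j\<in>Incl C. j \<cdot>\<^bsub>C\<^esub> \<gamma> (Cod C j) = \<gamma> (Dom C j)"
    using assms(4)[OF _ Mor_hom] assms(5) by blast
  then show ?thesis using assms unfolding is_cone_def by (auto simp: PiE_def Pi_def)
qed

lemma apexI: "is_cone C d \<gamma> \<Longrightarrow> apex C \<gamma> = d"
  unfolding apex_def
proof (rule the_equality)
  fix d' assume "is_cone C d \<gamma>" "is_cone C d' \<gamma>"
  then have "\<gamma> d \<in> hom C d d" "\<gamma> d \<in> hom C d d'" unfolding is_cone_def by (auto simp: PiE_def Pi_def)
  then show "d' = d" by (auto simp: hom_def)
qed

lemma cone_apex: "cone C \<gamma> \<Longrightarrow> is_cone C (apex C \<gamma>) \<gamma>"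
  unfolding cone_def using apexI by metis

lemma is_coneD:
  assumes "is_cone C d \<gamma>"
  shows "d \<in> Obj C" "\<gamma> \<in> extensional (Obj C)" "c \<in> Obj C \<Longrightarrow> \<gamma> c \<in> hom C c d"
    "j \<in> Incl C \<Longrightarrow> j \<in> hom C a b \<Longrightarrow> j \<cdot>\<^bsub>C\<^esub> \<gamma> b = \<gamma> a"
    "\<exists>c\<in>Obj C. is_iso C (\<gamma> c)"
  using assms unfolding is_cone_def by (auto simp: PiE_def Pi_def hom_def)

locale normal_cat =
  fixes C :: "('o, 'm) scat" (structure)
  assumes normal: "normal_category C"
begin

lemma cat: "category C"
  using normal by (auto simp: normal_category_def category_with_subobjects_def)

lemmas DomO = cat_DomO[OF cat] and CodO = cat_CodO[OF cat] and Idn = cat_Idn[OF cat]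
  and homO1 = cat_homO1[OF cat] and homO2 = cat_homO2[OF cat] and cmp = cat_cmp[OF cat]
  and idl = cat_idl[OF cat] and idr = cat_idr[OF cat] and assoc = cat_assoc[OF cat]

lemma subobjects:
  "Incl C \<subseteq> Mor C" "\<forall>c\<in>Obj C. Idn C c \<in> Incl C"
  "\<forall>f\<in>Incl C. \<forall>g\<in>Incl C. Cod C f = Dom C g \<longrightarrow> f \<cdot> g \<in> Incl C"
  "\<forall>f\<in>Incl C. \<forall>g\<in>Incl C. Dom C f = Dom C g \<and> Cod C f = Cod C g \<longrightarrow> f = g"
  "\<forall>f\<in>Incl C. \<forall>g\<in>Incl C. Cod C f = Dom C g \<and> Cod C g = Dom C f \<and>
     f \<cdot> g = Idn C (Dom C f) \<and> g \<cdot> f = Idn C (Cod C f) \<longrightarrow> f = Idn C (Dom C f)"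
  "\<forall>f\<in>Incl C. \<forall>g\<in>Incl C. \<forall>h\<in>Mor C. Cod C h = Dom C g \<and> f = h \<cdot> g \<longrightarrow> h \<in> Incl C"
  using normal unfolding normal_category_def category_with_subobjects_def by - (elim conjE, assumption)+

lemmas Incl_Mor = subobjects(1)

lemma Incl_id: "c \<in> Obj C \<Longrightarrow> Idn C c \<in> Incl C"
  using subobjects(2) by blast

lemma Incl_unique: "f \<in> Incl C \<Longrightarrow> g \<in> Incl C \<Longrightarrow> f \<in> hom C a b \<Longrightarrow> g \<in> hom C a b \<Longrightarrow> f = g"
  using subobjects(4) by (simp add: hom_def)

lemma Incl_strict: "f \<in> Incl C \<Longrightarrow> g \<in> Incl C \<Longrightarrow> f \<in> hom C a b \<Longrightarrow> g \<in> hom C b a \<Longrightarrow>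
    f \<cdot> g = Idn C a \<Longrightarrow> g \<cdot> f = Idn C b \<Longrightarrow> f = Idn C a"
  using subobjects(5)[rule_format, of f g] by (simp add: hom_def)

lemma Incl_fact: "f \<in> Incl C \<Longrightarrow> g \<in> Incl C \<Longrightarrow> h \<in> hom C a b \<Longrightarrow> g \<in> hom C b c \<Longrightarrow>
    f = h \<cdot> g \<Longrightarrow> h \<in> Incl C"
  using subobjects(6)[rule_format, of f g h] by (simp add: hom_def)

lemma Incl_cancel:
  assumes "j \<in> Incl C" "j \<in> hom C b c" "f \<in> hom C a b" "g \<in> hom C a b" "f \<cdot> j = g \<cdot> j"
  shows "f = g"
proof -
  have "\<forall>f\<in>Incl C. monic C f"
    using normal unfolding normal_category_def category_with_subobjects_def by - (elim conjE)
  then have "monic C j" using assms(1) by blast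
  then show ?thesis using assms(2-) unfolding monic_def hom_def by auto
qed

text \<open>
  This uniqueness is what makes the epimorphic component of a morphism well defined. A section of either
  epimorphism expresses each inclusion as a factor of the other; the factors are mutually inverse inclusions,
  and a strict preorder has only trivial ones.
\<close>

lemma split_epi_incl_unique:
  assumes e: "e \<in> hom C a b" "split_epi C e" and j: "j \<in> Incl C" "j \<in> hom C b c"
    and e': "e' \<in> hom C a b'" "split_epi C e'" and j': "j' \<in> Incl C" "j' \<in> hom C b' c"
    and eq: "e \<cdot> j = e' \<cdot> j'"
  shows "b = b' \<and> e = e' \<and> j = j'"
proof -
  obtain s where s: "s \<in> hom C b a" "s \<cdot> e = Idn C b" using split_epiE[OF e(2,1)] .
  obtain s' where s': "s' \<in> hom C b' a" "s' \<cdot> e' = Idn C b'" using split_epiE[OF e'(2,1)] .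
  define h where "h = s \<cdot> e'"
  define h' where "h' = s' \<cdot> e"
  have h: "h \<in> hom C b b'" and h': "h' \<in> hom C b' b"
    unfolding h_def h'_def by (rule cmp[OF s(1) e'(1)], rule cmp[OF s'(1) e(1)])
  have hj: "j = h \<cdot> j'"
    unfolding h_def using assoc[OF s(1) e(1) j(2)] assoc[OF s(1) e'(1) j'(2)] s(2) idl[OF j(2)] eq by simp
  have hj': "j' = h' \<cdot> j"
    unfolding h'_def using assoc[OF s'(1) e(1) j(2)] assoc[OF s'(1) e'(1) j'(2)] s'(2) idl[OF j'(2)] eq by simp
  \<comment> \<open>A left factor of an inclusion through an inclusion is an inclusion.\<close>
  have hI: "h \<in> Incl C" "h' \<in> Incl C"
    using Incl_fact[OF j(1) j'(1) h j'(2) hj] Incl_fact[OF j'(1) j(1) h' j(2) hj'] .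
  have "(h \<cdot> h') \<cdot> j = Idn C b \<cdot> j"
    using assoc[OF h h' j(2)] idl[OF j(2)] by (simp add: hj[symmetric] hj'[symmetric])
  then have 1: "h \<cdot> h' = Idn C b"
    using Incl_cancel[OF j cmp[OF h h'] Idn] homO1[OF h] by blast
  have "(h' \<cdot> h) \<cdot> j' = Idn C b' \<cdot> j'"
    using assoc[OF h' h j'(2)] idl[OF j'(2)] by (simp add: hj[symmetric] hj'[symmetric])
  then have 2: "h' \<cdot> h = Idn C b'"
    using Incl_cancel[OF j' cmp[OF h' h] Idn] homO2[OF h] by blast
  have hid: "h = Idn C b" using Incl_strict[OF hI h h' 1 2] .
  then have bb: "b = b'" using h Idn[OF homO1[OF h]] by (auto simp: hom_def)
  have jj: "j = j'" using hj hid idl[OF j'(2)] bb by simp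
  have "e = e'" using Incl_cancel[OF j e(1)] e'(1) eq jj bb by simp
  then show ?thesis using bb jj by simp
qed

lemma normal_factorization_split:
  assumes "normal_factorization C f q u j" "f \<in> hom C a c"
  obtains b where "q \<cdot> u \<in> hom C a b" "split_epi C (q \<cdot> u)" "j \<in> Incl C" "j \<in> hom C b c"
    "f = (q \<cdot> u) \<cdot> j"
proof -
  obtain j0 where j0: "splits C j0 q" and u: "is_iso C u" and j: "j \<in> Incl C"
    and qu: "Cod C q = Dom C u" "Cod C u = Dom C j" and f: "f = (q \<cdot> u) \<cdot> j"
    using assms(1) unfolding normal_factorization_def retraction_def by blast
  have jM: "j \<in> hom C (Dom C j) (Cod C j)" using j Incl_Mor by (auto simp: hom_def)
  have uh: "u \<in> hom C (Cod C q) (Dom C j)" using u qu by (auto simp: is_iso_def hom_def)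
  have j0h: "j0 \<in> hom C (Dom C j0) (Cod C j0)" using j0 Incl_Mor by (auto simp: splits_def hom_def)
  have q: "q \<in> hom C (Cod C j0) (Dom C j0)" "j0 \<cdot> q = Idn C (Dom C j0)"
    using j0 by (auto simp: splits_def)
  have uh': "u \<in> hom C (Dom C j0) (Dom C j)" using uh q(1) by (auto simp: hom_def)
  obtain v where v: "v \<in> hom C (Dom C j) (Dom C j0)" "v \<cdot> u = Idn C (Dom C j)"
    using is_isoE[OF cat u uh'] by metis
  have "(v \<cdot> j0) \<cdot> (q \<cdot> u) = v \<cdot> ((j0 \<cdot> q) \<cdot> u)"
    using assoc[OF v(1) j0h cmp[OF q(1) uh']] assoc[OF j0h q(1) uh'] by simp
  also have "\<dots> = Idn C (Dom C j)" using q(2) idl[OF uh'] v(2) by simp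
  finally have se: "split_epi C (q \<cdot> u)"
    using split_epiI[OF cmp[OF q(1) uh'] cmp[OF v(1) j0h]] by blast
  have "f \<in> hom C (Cod C j0) (Cod C j)" using f cmp[OF cmp[OF q(1) uh'] jM] by simp
  then have "Cod C j0 = a" "Cod C j = c" using assms(2) by (auto simp: hom_def)
  then show ?thesis using that cmp[OF q(1) uh'] se j jM f by auto
qed

lemma epi_componentI:
  assumes e: "e \<in> hom C a b" "split_epi C e" and j: "j \<in> Incl C" "j \<in> hom C b c"
  shows "epi_component C (e \<cdot> j) = e"
  unfolding epi_component_def
proof (rule the_equality)
  have uniq: "q \<cdot> u = e" if nf: "normal_factorization C (e \<cdot> j) q u j'" for q u j'
    using normal_factorization_split[OF nf cmp[OF e(1) j(2)]] split_epi_incl_unique[OF e j] by metis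
  have "e \<cdot> j \<in> Mor C" using cmp[OF e(1) j(2)] by (rule hom_MorD)
  then obtain q u j' where "normal_factorization C (e \<cdot> j) q u j'"
    using normal unfolding normal_category_def by blast
  then show "\<exists>q u j'. normal_factorization C (e \<cdot> j) q u j' \<and> e = q \<cdot> u" using uniq by blast
  show "g = e" if "\<exists>q u j'. normal_factorization C (e \<cdot> j) q u j' \<and> g = q \<cdot> u" for g
    using that uniq by blast
qed

lemma epi_componentE:
  assumes "f \<in> hom C a c"
  obtains b j where "epi_component C f \<in> hom C a b" "split_epi C (epi_component C f)"
    "j \<in> Incl C" "j \<in> hom C b c" "epi_component C f \<cdot> j = f"
proof -
  obtain q u j where nf: "normal_factorization C f q u j"
    using normal assms unfolding normal_category_def by (auto simp: hom_def)
  obtain b where *: "q \<cdot> u \<in> hom C a b" "split_epi C (q \<cdot> u)" "j \<in> Incl C" "j \<in> hom C b c"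
    "f = (q \<cdot> u) \<cdot> j" using normal_factorization_split[OF nf assms] .
  then have "epi_component C f = q \<cdot> u" using epi_componentI[OF *(1-4)] by simp
  then show ?thesis using that * by simp
qed

lemma epi_component_split_epi: "e \<in> hom C a b \<Longrightarrow> split_epi C e \<Longrightarrow> epi_component C e = e"
  using epi_componentI[of e a b "Idn C b" b] Incl_id Idn homO2 idr by metis

lemma split_epi_cmp:
  assumes "e \<in> hom C a b" "split_epi C e" "f \<in> hom C b c" "split_epi C f"
  shows "split_epi C (e \<cdot> f)"
proof -
  obtain s where s: "s \<in> hom C b a" "s \<cdot> e = Idn C b" using split_epiE[OF assms(2,1)] .
  obtain t where t: "t \<in> hom C c b" "t \<cdot> f = Idn C c" using split_epiE[OF assms(4,3)] .
  have "(t \<cdot> s) \<cdot> (e \<cdot> f) = t \<cdot> ((s \<cdot> e) \<cdot> f)"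
    using assoc[OF t(1) s(1) cmp[OF assms(1,3)]] assoc[OF s(1) assms(1,3)] by simp
  also have "\<dots> = Idn C c" using s t idl[OF assms(3)] by simp
  finally show ?thesis using split_epiI[OF cmp[OF assms(1,3)] cmp[OF t(1) s(1)]] by blast
qed

text \<open>
  Composing with a split epimorphism on the left does not change the inclusion in a factorization.
\<close>

lemma epi_component_cmp:
  assumes e: "e \<in> hom C a b" "split_epi C e" and f: "f \<in> hom C b c"
  shows "epi_component C (e \<cdot> f) = e \<cdot> epi_component C f"
proof -
  obtain d j where *: "epi_component C f \<in> hom C b d" "split_epi C (epi_component C f)"
    "j \<in> Incl C" "j \<in> hom C d c" "epi_component C f \<cdot> j = f" using epi_componentE[OF f] .
  have "e \<cdot> f = (e \<cdot> epi_component C f) \<cdot> j"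
    using assoc[OF e(1) *(1,4)] *(5) by simp
  then show ?thesis
    using epi_componentI[OF cmp[OF e(1) *(1)] split_epi_cmp[OF e *(1,2)] *(3,4)] by simp
qed

lemma iso_split_epi: "is_iso C u \<Longrightarrow> split_epi C u"
  unfolding is_iso_def split_epi_def by auto

lemma cone_comp_ext: "cone_comp C \<gamma> f \<in> extensional (Obj C)"
  by (simp add: cone_comp_def)

lemma cone_comp_app: "a \<in> Obj C \<Longrightarrow> cone_comp C \<gamma> f a = \<gamma> a \<cdot> f"
  by (simp add: cone_comp_def)

lemma cone_comp_assoc:
  assumes "is_cone C d \<gamma>" "f \<in> hom C d b" "g \<in> hom C b c"
  shows "cone_comp C (cone_comp C \<gamma> f) g = cone_comp C \<gamma> (f \<cdot> g)"
  using assoc[OF is_coneD(3)[OF assms(1)] assms(2,3)]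
  by (intro extensionalityI[of _ "Obj C"]) (auto simp: cone_comp_def)

lemma cone_comp_id: "is_cone C d \<gamma> \<Longrightarrow> cone_comp C \<gamma> (Idn C d) = \<gamma>"
  using idr[OF is_coneD(3)] is_coneD(2)
  by (intro extensionalityI[of _ "Obj C"]) (auto simp: cone_comp_def)

lemma psi_id: "is_cone C d \<gamma> \<Longrightarrow> psi C \<gamma> (Idn C d) = \<gamma>"
  using epi_component_split_epi[OF Idn iso_split_epi] is_iso_Idn[OF cat] is_coneD(1) cone_comp_id by metis

text \<open>
  A component of the cone that is an isomorphism can be cancelled, which recovers the epimorphic component of
  the morphism, and the inclusion that follows it is determined by its two ends.
\<close>

lemma psi_inj:
  assumes "is_cone C d \<gamma>" "f \<in> hom C d c" "g \<in> hom C d c" "psi C \<gamma> f = psi C \<gamma> g"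
  shows "f = g"
proof -
  obtain k where k: "k \<in> Obj C" "is_iso C (\<gamma> k)" using is_coneD(5)[OF assms(1)] by blast
  note gk = is_coneD(3)[OF assms(1) k(1)]
  obtain u where u: "u \<in> hom C d k" "u \<cdot> \<gamma> k = Idn C d" using is_isoE[OF cat k(2) gk] by metis
  obtain b j where f: "epi_component C f \<in> hom C d b"
    "j \<in> Incl C" "j \<in> hom C b c" "epi_component C f \<cdot> j = f" using epi_componentE[OF assms(2)] .
  obtain b' j' where g: "epi_component C g \<in> hom C d b'"
    "j' \<in> Incl C" "j' \<in> hom C b' c" "epi_component C g \<cdot> j' = g" using epi_componentE[OF assms(3)] .
  have "\<gamma> k \<cdot> epi_component C f = \<gamma> k \<cdot> epi_component C g"
    using fun_cong[OF assms(4), of k] k(1) by (simp add: cone_comp_def)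
  then have ee: "epi_component C f = epi_component C g"
    using assoc[OF u(1) gk f(1)] assoc[OF u(1) gk g(1)] u(2) idl[OF f(1)] idl[OF g(1)] by simp
  have "b = b'" using f(1) g(1) unfolding ee by (simp add: hom_def)
  then have "j = j'" using Incl_unique[OF f(2) g(2) f(3)] g(3) by simp
  then show ?thesis by (metis f(4) g(4) ee)
qed

lemma eta_psi:
  assumes "is_cone C d \<gamma>" "f \<in> hom C d c"
  shows "eta C \<gamma> c (psi C \<gamma> f) = f"
  unfolding eta_def apexI[OF assms(1)]
  by (rule the_equality) (use assms psi_inj[OF assms(1)] in blast)+

lemma H_set_eq: "is_cone C d \<gamma> \<Longrightarrow> H_set C \<gamma> c = psi C \<gamma> ` hom C d c"
  unfolding H_set_def using apexI[of C d \<gamma>] by (simp add: Setcompr_eq_image)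

lemma eta_hom:
  assumes "is_cone C d \<gamma>" "\<sigma> \<in> H_set C \<gamma> c"
  shows "eta C \<gamma> c \<sigma> \<in> hom C d c" "psi C \<gamma> (eta C \<gamma> c \<sigma>) = \<sigma>"
  using assms(2) eta_psi[OF assms(1)] unfolding H_set_eq[OF assms(1)] by auto

lemma H_functor_functor:
  assumes c: "is_cone C d \<gamma>"
  shows "is_functor C Sets (H_functor C \<gamma>)"
proof (rule is_functorI)
  let ?H = "H_functor C \<gamma>"
  have app: "FM ?H f = (H_set C \<gamma> a, H_set C \<gamma> b, \<lambda>\<sigma>\<in>H_set C \<gamma> a. psi C \<gamma> (eta C \<gamma> a \<sigma> \<cdot> f))"
    if "f \<in> hom C a b" for f a b
    using that by (auto simp: H_functor_def hom_def)
  have mem: "(\<lambda>\<sigma>\<in>H_set C \<gamma> a. psi C \<gamma> (eta C \<gamma> a \<sigma> \<cdot> f)) \<in> H_set C \<gamma> a \<rightarrow>\<^sub>E H_set C \<gamma> b"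
    if f: "f \<in> hom C a b" for f a b
    using cmp[OF eta_hom(1)[OF c] f] by (auto simp: H_set_eq[OF c, of b])
  show "category C" "category (Sets :: ((('o \<Rightarrow> 'm) set, ('o \<Rightarrow> 'm) setmap) cat))" using cat Sets_category .
  show "FO ?H \<in> extensional (Obj C)" "FM ?H \<in> extensional (Mor C)" by (auto simp: H_functor_def)
  show "FO ?H a \<in> Obj Sets" for a by (simp add: Sets_Obj)
  show "FM ?H f \<in> hom Sets (FO ?H a) (FO ?H b)" if f: "f \<in> hom C a b" for f a b
    using mem[OF f] app[OF f] homO1[OF f] homO2[OF f] by (simp add: Sets_hom H_functor_def)
  show "FM ?H (Idn C a) = Idn Sets (FO ?H a)" if a: "a \<in> Obj C" for a
  proof -
    have "psi C \<gamma> (eta C \<gamma> a \<sigma> \<cdot> Idn C a) = \<sigma>" if "\<sigma> \<in> H_set C \<gamma> a" for \<sigma>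
      using eta_hom[OF c that] idr[OF eta_hom(1)[OF c that]] by simp
    then show ?thesis using app[OF Idn[OF a]] a by (auto simp: Sets_Idn H_functor_def)
  qed
  show "FM ?H (f \<cdot> g) = FM ?H f \<cdot>\<^bsub>Sets\<^esub> FM ?H g" if f: "f \<in> hom C a b" and g: "g \<in> hom C b k" for f g a b k
  proof -
    have "psi C \<gamma> (eta C \<gamma> b (psi C \<gamma> (eta C \<gamma> a \<sigma> \<cdot> f)) \<cdot> g) = psi C \<gamma> (eta C \<gamma> a \<sigma> \<cdot> (f \<cdot> g))"
      if s: "\<sigma> \<in> H_set C \<gamma> a" for \<sigma>
      using eta_psi[OF c cmp[OF eta_hom(1)[OF c s] f]] assoc[OF eta_hom(1)[OF c s] f g] by simp
    moreover have "psi C \<gamma> (eta C \<gamma> a \<sigma> \<cdot> f) \<in> H_set C \<gamma> b" if "\<sigma> \<in> H_set C \<gamma> a" for \<sigma>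
      using mem[OF f] that by (auto simp: PiE_def Pi_def)
    ultimately show ?thesis
      unfolding app[OF f] app[OF g] app[OF cmp[OF f g]] Sets_cmp[OF mem[OF f] mem[OF g]] by auto
  qed
qed

lemma H_functor_app: "a \<in> Obj C \<Longrightarrow> FO (H_functor C \<gamma>) a = H_set C \<gamma> a"
  "f \<in> hom C a b \<Longrightarrow> FM (H_functor C \<gamma>) f =
     (H_set C \<gamma> a, H_set C \<gamma> b, \<lambda>\<sigma>\<in>H_set C \<gamma> a. psi C \<gamma> (eta C \<gamma> a \<sigma> \<cdot> f))"
  by (auto simp: H_functor_def hom_def)

subsection \<open>The normal dual\<close>

lemma dual_sub: "{H_functor C \<gamma> | \<gamma>. cone C \<gamma>} \<subseteq> Obj (functor_cat C Sets)"
  using H_functor_functor cone_apex by (fastforce simp: functor_cat_def Let_def)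

abbreviation "ND \<equiv> full_sub (functor_cat C Sets) {H_functor C \<gamma> | \<gamma>. cone C \<gamma>}"

lemma normal_dual_fields: "Obj (normal_dual C) = Obj ND" "Mor (normal_dual C) = Mor ND"
  "Dom (normal_dual C) = Dom ND" "Cod (normal_dual C) = Cod ND" "Idn (normal_dual C) = Idn ND"
  "Cmp (normal_dual C) = Cmp ND"
  by (simp_all add: normal_dual_def Let_def cat.defs)

lemma normal_dual_category: "category (normal_dual C)"
  using full_sub_category[OF functor_cat_category[OF cat Sets_category] dual_sub]
  by (simp add: category_def normal_dual_fields hom_def)

lemma normal_dual_Obj: "Obj (normal_dual C) = {H_functor C \<gamma> | \<gamma>. cone C \<gamma>}"
  by (simp add: normal_dual_fields full_sub_simps)

lemma normal_dual_hom: "t \<in> hom (normal_dual C) S T \<longleftrightarrow>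
    is_natt C Sets t \<and> fst t = S \<and> fst (snd t) = T \<and> S \<in> Obj (normal_dual C) \<and> T \<in> Obj (normal_dual C)"
proof -
  have "hom (normal_dual C) S T = hom ND S T" by (simp add: hom_def normal_dual_fields)
  then show ?thesis by (simp add: full_sub_hom functor_cat_hom normal_dual_fields full_sub_simps)
qed

lemma normal_dual_cmp: "s \<in> hom (normal_dual C) S T \<Longrightarrow> t \<in> hom (normal_dual C) T U \<Longrightarrow>
    s \<cdot>\<^bsub>normal_dual C\<^esub> t = (S, U, \<lambda>a\<in>Obj C. snd (snd s) a \<cdot>\<^bsub>Sets\<^esub> snd (snd t) a)"
proof -
  assume h: "s \<in> hom (normal_dual C) S T" "t \<in> hom (normal_dual C) T U"
  have eq: "hom (normal_dual C) = hom ND" by (intro ext) (simp add: hom_def normal_dual_fields)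
  have "s \<cdot>\<^bsub>normal_dual C\<^esub> t = s \<cdot>\<^bsub>functor_cat C Sets\<^esub> t"
    using full_sub_cmp[OF h[unfolded eq]] by (simp only: normal_dual_fields(6))
  also have "\<dots> = (S, U, \<lambda>a\<in>Obj C. snd (snd s) a \<cdot>\<^bsub>Sets\<^esub> snd (snd t) a)"
    using h unfolding normal_dual_hom by (auto simp: functor_cat_def Let_def)
  finally show ?thesis .
qed

lemma normal_dual_Idn: "S \<in> Obj (normal_dual C) \<Longrightarrow>
    Idn (normal_dual C) S = (S, S, \<lambda>a\<in>Obj C. Idn Sets (FO S a))"
  using dual_sub unfolding normal_dual_fields by (auto simp: full_sub_simps functor_cat_def Let_def)

lemma normal_dual_Incl: "t \<in> Incl (normal_dual C) \<longleftrightarrow> t \<in> Mor (normal_dual C) \<and>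
    (\<forall>c\<in>Obj C. FO (fst t) c \<subseteq> FO (fst (snd t)) c \<and>
       snd (snd t) c = (FO (fst t) c, FO (fst (snd t)) c, \<lambda>\<sigma>\<in>FO (fst t) c. \<sigma>))"
  unfolding normal_dual_fields by (cases t) (simp add: normal_dual_def Let_def cat.defs)

lemma H_functor_Obj: "is_cone C d \<gamma> \<Longrightarrow> H_functor C \<gamma> \<in> Obj (normal_dual C)"
  by (auto simp: normal_dual_Obj cone_def)

lemma nt_natt:
  assumes c: "is_cone C d \<gamma>" and c': "is_cone C d' \<gamma>'" and f: "f \<in> hom C d' d"
  shows "nt C \<gamma> \<gamma>' f \<in> hom (normal_dual C) (H_functor C \<gamma>) (H_functor C \<gamma>')"
proof -
  let ?t = "\<lambda>a. \<lambda>\<sigma>\<in>H_set C \<gamma> a. psi C \<gamma>' (f \<cdot> eta C \<gamma> a \<sigma>)"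
  let ?h = "\<lambda>\<gamma> a g. \<lambda>\<sigma>\<in>H_set C \<gamma> a. psi C \<gamma> (eta C \<gamma> a \<sigma> \<cdot> g)"
  have mem: "?t a \<in> H_set C \<gamma> a \<rightarrow>\<^sub>E H_set C \<gamma>' a" for a
    using cmp[OF f eta_hom(1)[OF c]] by (auto simp: H_set_eq[OF c'])
  have hmem: "?h \<gamma> a g \<in> H_set C \<gamma> a \<rightarrow>\<^sub>E H_set C \<gamma> b" if "g \<in> hom C a b" "is_cone C d \<gamma>" for a b g \<gamma> d
    using cmp[OF eta_hom(1)[OF that(2)] that(1)] by (auto simp: H_set_eq[OF that(2), of b])
  have "is_natt C Sets (nt C \<gamma> \<gamma>' f)"
    unfolding nt_def
  proof (rule is_nattI[OF H_functor_functor[OF c] H_functor_functor[OF c']])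
    show "(\<lambda>a\<in>Obj C. (H_set C \<gamma> a, H_set C \<gamma>' a, ?t a)) a \<in> hom Sets (FO (H_functor C \<gamma>) a) (FO (H_functor C \<gamma>') a)"
      if "a \<in> Obj C" for a using that mem by (simp add: Sets_hom H_functor_app)
    fix a b g assume g: "g \<in> hom C a b"
    have "psi C \<gamma>' (f \<cdot> eta C \<gamma> b (psi C \<gamma> (eta C \<gamma> a \<sigma> \<cdot> g)))
        = psi C \<gamma>' (eta C \<gamma>' a (psi C \<gamma>' (f \<cdot> eta C \<gamma> a \<sigma>)) \<cdot> g)"
      if s: "\<sigma> \<in> H_set C \<gamma> a" for \<sigma>
      using eta_psi[OF c cmp[OF eta_hom(1)[OF c s] g]] eta_psi[OF c' cmp[OF f eta_hom(1)[OF c s]]]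
        assoc[OF f eta_hom(1)[OF c s] g] by simp
    moreover have "?h \<gamma> a g \<sigma> \<in> H_set C \<gamma> b" "?t a \<sigma> \<in> H_set C \<gamma>' a" if "\<sigma> \<in> H_set C \<gamma> a" for \<sigma>
      using hmem[OF g c] mem[of a] that unfolding PiE_def Pi_def by blast+
    ultimately show "FM (H_functor C \<gamma>) g \<cdot>\<^bsub>Sets\<^esub> (\<lambda>a\<in>Obj C. (H_set C \<gamma> a, H_set C \<gamma>' a, ?t a)) b
        = (\<lambda>a\<in>Obj C. (H_set C \<gamma> a, H_set C \<gamma>' a, ?t a)) a \<cdot>\<^bsub>Sets\<^esub> FM (H_functor C \<gamma>') g"
      using homO1[OF g] homO2[OF g] Sets_cmp[OF hmem[OF g c] mem] Sets_cmp[OF mem hmem[OF g c']]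
      by (auto simp: H_functor_app(2)[OF g])
  qed auto
  then show ?thesis
    unfolding normal_dual_hom using H_functor_Obj[OF c] H_functor_Obj[OF c'] by (simp add: nt_def)
qed

lemma nt_app: "a \<in> Obj C \<Longrightarrow> \<sigma> \<in> H_set C \<gamma> a \<Longrightarrow>
    natt_app (nt C \<gamma> \<gamma>' f) a \<sigma> = psi C \<gamma>' (f \<cdot> eta C \<gamma> a \<sigma>)"
  by (simp add: nt_def natt_app_def)

lemma normal_dual_hom_app:
  assumes "t \<in> hom (normal_dual C) (H_functor C \<gamma>) (H_functor C \<gamma>')"
  shows "t = (H_functor C \<gamma>, H_functor C \<gamma>', \<lambda>a\<in>Obj C. (H_set C \<gamma> a, H_set C \<gamma>' a, natt_app t a))"
    "a \<in> Obj C \<Longrightarrow> natt_app t a \<in> H_set C \<gamma> a \<rightarrow>\<^sub>E H_set C \<gamma>' a"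
proof -
  obtain \<tau> where t: "t = (H_functor C \<gamma>, H_functor C \<gamma>', \<tau>)" "is_natt C Sets (H_functor C \<gamma>, H_functor C \<gamma>', \<tau>)"
    using assms by (cases t) (auto simp: normal_dual_hom)
  note T = is_nattD[OF t(2)]
  have *: "\<tau> a = (H_set C \<gamma> a, H_set C \<gamma>' a, natt_app t a) \<and> natt_app t a \<in> H_set C \<gamma> a \<rightarrow>\<^sub>E H_set C \<gamma>' a"
    if "a \<in> Obj C" for a
    using T(4)[OF that] that by (auto simp: Sets_hom H_functor_app natt_app_def t)
  then show "t = (H_functor C \<gamma>, H_functor C \<gamma>', \<lambda>a\<in>Obj C. (H_set C \<gamma> a, H_set C \<gamma>' a, natt_app t a))"
    using T(3) by (auto simp: t intro!: extensionalityI[of _ "Obj C"])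
  show "natt_app t a \<in> H_set C \<gamma> a \<rightarrow>\<^sub>E H_set C \<gamma>' a" if "a \<in> Obj C" using * that by blast
qed

lemma normal_dual_hom_eqI:
  assumes "s \<in> hom (normal_dual C) (H_functor C \<gamma>) (H_functor C \<gamma>')"
    "t \<in> hom (normal_dual C) (H_functor C \<gamma>) (H_functor C \<gamma>')"
    "\<And>a \<sigma>. a \<in> Obj C \<Longrightarrow> \<sigma> \<in> H_set C \<gamma> a \<Longrightarrow> natt_app s a \<sigma> = natt_app t a \<sigma>"
  shows "s = t"
proof -
  have "natt_app s a = natt_app t a" if "a \<in> Obj C" for a
    using normal_dual_hom_app(2)[OF assms(1) that] normal_dual_hom_app(2)[OF assms(2) that] assms(3)[OF that]
    by (auto intro!: extensionalityI[of _ "H_set C \<gamma> a"] simp: PiE_def)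
  then show ?thesis
    by (subst normal_dual_hom_app(1)[OF assms(1)], subst normal_dual_hom_app(1)[OF assms(2)])
      (auto intro!: restrict_ext)
qed

text \<open>
  The Yoneda lemma for \<open>H\<close>-functors: the cone \<open>\<gamma>\<close> itself is the universal
  element of \<open>H(\<gamma>;-)\<close>, and a natural transformation is determined by its value there.
\<close>

lemma nt_bij:
  assumes c: "is_cone C d \<gamma>" and c': "is_cone C d' \<gamma>'"
  shows "bij_betw (nt C \<gamma> \<gamma>') (hom C d' d) (hom (normal_dual C) (H_functor C \<gamma>) (H_functor C \<gamma>'))"
proof (rule bij_betw_imageI)
  note dO = is_coneD(1)[OF c]
  have gm: "\<gamma> \<in> H_set C \<gamma> d" using psi_id[OF c] Idn[OF dO] by (force simp: H_set_eq[OF c])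
  have eg: "eta C \<gamma> d \<gamma> = Idn C d" using eta_psi[OF c Idn[OF dO]] psi_id[OF c] by simp
  have app: "natt_app (nt C \<gamma> \<gamma>' f) d \<gamma> = psi C \<gamma>' f" if "f \<in> hom C d' d" for f
    using nt_app[OF dO gm] idr[OF that] eg by simp
  show "inj_on (nt C \<gamma> \<gamma>') (hom C d' d)"
    by (rule inj_onI) (use app psi_inj[OF c'] in metis)
  show "nt C \<gamma> \<gamma>' ` hom C d' d = hom (normal_dual C) (H_functor C \<gamma>) (H_functor C \<gamma>')"
  proof (intro equalityI subsetI)
    fix t assume t: "t \<in> hom (normal_dual C) (H_functor C \<gamma>) (H_functor C \<gamma>')"
    \<comment> \<open>The morphism that corresponds to the value of \<open>t\<close> at the universal element.\<close>
    define f where "f = eta C \<gamma>' d (natt_app t d \<gamma>)"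
    have tg: "natt_app t d \<gamma> \<in> H_set C \<gamma>' d" using normal_dual_hom_app(2)[OF t dO] gm by (auto simp: PiE_def)
    have f: "f \<in> hom C d' d" unfolding f_def by (rule eta_hom(1)[OF c' tg])
    have "t = nt C \<gamma> \<gamma>' f"
    proof (rule normal_dual_hom_eqI[OF t nt_natt[OF c c' f]])
      fix a \<sigma> assume a: "a \<in> Obj C" and s: "\<sigma> \<in> H_set C \<gamma> a"
      define g where "g = eta C \<gamma> a \<sigma>"
      have g: "g \<in> hom C d a" "psi C \<gamma> g = \<sigma>" unfolding g_def using eta_hom[OF c s] by auto
      let ?H = "FM (H_functor C \<gamma>) g" and ?H' = "FM (H_functor C \<gamma>') g"
      have "is_natt C Sets t" using t by (simp add: normal_dual_hom)
      then have "?H \<cdot>\<^bsub>Sets\<^esub> snd (snd t) a = snd (snd t) d \<cdot>\<^bsub>Sets\<^esub> ?H'"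
        using is_nattD(5)[of C Sets "H_functor C \<gamma>" "H_functor C \<gamma>'" "snd (snd t)" g d a] g(1) t
        by (cases t) (auto simp: normal_dual_hom)
      moreover have "snd (snd t) a = (H_set C \<gamma> a, H_set C \<gamma>' a, natt_app t a)"
        "snd (snd t) d = (H_set C \<gamma> d, H_set C \<gamma>' d, natt_app t d)"
        using arg_cong[OF normal_dual_hom_app(1)[OF t], of "\<lambda>t. snd (snd t)"] a dO by auto
      moreover have Hm: "(\<lambda>\<sigma>\<in>H_set C \<gamma> d. psi C \<gamma> (eta C \<gamma> d \<sigma> \<cdot> g)) \<in> H_set C \<gamma> d \<rightarrow>\<^sub>E H_set C \<gamma> a"
        using func_hom[OF H_functor_functor[OF c] g(1)] dO a by (auto simp: Sets_hom H_functor_app H_functor_app(2)[OF g(1)])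
      moreover have Hm': "(\<lambda>\<sigma>\<in>H_set C \<gamma>' d. psi C \<gamma>' (eta C \<gamma>' d \<sigma> \<cdot> g)) \<in> H_set C \<gamma>' d \<rightarrow>\<^sub>E H_set C \<gamma>' a"
        using func_hom[OF H_functor_functor[OF c'] g(1)] dO a by (auto simp: Sets_hom H_functor_app H_functor_app(2)[OF g(1)])
      ultimately have eq: "(\<lambda>\<sigma>'\<in>H_set C \<gamma> d. natt_app t a ((\<lambda>\<sigma>\<in>H_set C \<gamma> d. psi C \<gamma> (eta C \<gamma> d \<sigma> \<cdot> g)) \<sigma>'))
          = (\<lambda>\<sigma>'\<in>H_set C \<gamma> d. (\<lambda>\<sigma>\<in>H_set C \<gamma>' d. psi C \<gamma>' (eta C \<gamma>' d \<sigma> \<cdot> g)) (natt_app t d \<sigma>'))"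
        using Sets_cmp[OF Hm normal_dual_hom_app(2)[OF t a]] Sets_cmp[OF normal_dual_hom_app(2)[OF t dO] Hm']
        by (simp add: H_functor_app(2)[OF g(1)])
      have "natt_app t a \<sigma> = psi C \<gamma>' (f \<cdot> g)"
        using fun_cong[OF eq, of \<gamma>] gm tg eg idl[OF g(1)] g(2) by (simp add: f_def)
      then show "natt_app t a \<sigma> = natt_app (nt C \<gamma> \<gamma>' f) a \<sigma>" using nt_app[OF a s] by (simp add: g_def)
    qed
    then show "t \<in> nt C \<gamma> \<gamma>' ` hom C d' d" using f by blast
  qed (use nt_natt[OF c c'] in blast)
qed

lemma nt_cmp:
  assumes c: "is_cone C d \<gamma>" and c': "is_cone C d' \<gamma>'" and c'': "is_cone C d'' \<gamma>''"
    and f: "f \<in> hom C d' d" and g: "g \<in> hom C d'' d'"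
  shows "nt C \<gamma> \<gamma>' f \<cdot>\<^bsub>normal_dual C\<^esub> nt C \<gamma>' \<gamma>'' g = nt C \<gamma> \<gamma>'' (g \<cdot> f)"
proof (rule normal_dual_hom_eqI[OF cat_cmp[OF normal_dual_category nt_natt[OF c c' f] nt_natt[OF c' c'' g]]
      nt_natt[OF c c'' cmp[OF g f]]])
  fix a \<sigma> assume a: "a \<in> Obj C" and s: "\<sigma> \<in> H_set C \<gamma> a"
  let ?s = "nt C \<gamma> \<gamma>' f" and ?t = "nt C \<gamma>' \<gamma>'' g"
  have mem: "natt_app ?s a \<in> H_set C \<gamma> a \<rightarrow>\<^sub>E H_set C \<gamma>' a" "natt_app ?t a \<in> H_set C \<gamma>' a \<rightarrow>\<^sub>E H_set C \<gamma>'' a"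
    using normal_dual_hom_app(2)[OF nt_natt[OF c c' f] a] normal_dual_hom_app(2)[OF nt_natt[OF c' c'' g] a] .
  have st: "snd (snd ?s) a = (H_set C \<gamma> a, H_set C \<gamma>' a, natt_app ?s a)"
    "snd (snd ?t) a = (H_set C \<gamma>' a, H_set C \<gamma>'' a, natt_app ?t a)"
    using a by (simp_all add: nt_def natt_app_def)
  have ns: "natt_app ?s a \<sigma> \<in> H_set C \<gamma>' a" using mem(1) s by (auto simp: PiE_def)
  have "natt_app (?s \<cdot>\<^bsub>normal_dual C\<^esub> ?t) a \<sigma> = natt_app ?t a (natt_app ?s a \<sigma>)"
    using a s normal_dual_cmp[OF nt_natt[OF c c' f] nt_natt[OF c' c'' g]] st Sets_cmp[OF mem]
    by (simp add: natt_app_def[of "(_, _)"])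
  also have "\<dots> = psi C \<gamma>'' (g \<cdot> (f \<cdot> eta C \<gamma> a \<sigma>))"
    using nt_app[OF a ns] nt_app[OF a s] eta_psi[OF c' cmp[OF f eta_hom(1)[OF c s]]] by simp
  also have "\<dots> = natt_app (nt C \<gamma> \<gamma>'' (g \<cdot> f)) a \<sigma>"
    using nt_app[OF a s] assoc[OF g f eta_hom(1)[OF c s]] by simp
  finally show "natt_app (?s \<cdot>\<^bsub>normal_dual C\<^esub> ?t) a \<sigma> = natt_app (nt C \<gamma> \<gamma>'' (g \<cdot> f)) a \<sigma>" .
qed

lemma nt_id:
  assumes c: "is_cone C d \<gamma>"
  shows "nt C \<gamma> \<gamma> (Idn C d) = Idn (normal_dual C) (H_functor C \<gamma>)"
proof (rule normal_dual_hom_eqI[OF nt_natt[OF c c Idn[OF is_coneD(1)[OF c]]]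
      cat_Idn[OF normal_dual_category H_functor_Obj[OF c]]])
  fix a \<sigma> assume a: "a \<in> Obj C" and s: "\<sigma> \<in> H_set C \<gamma> a"
  have "natt_app (Idn (normal_dual C) (H_functor C \<gamma>)) a \<sigma> = \<sigma>"
    using a s normal_dual_Idn[OF H_functor_Obj[OF c]] by (simp add: natt_app_def Sets_Idn H_functor_app)
  then show "natt_app (nt C \<gamma> \<gamma> (Idn C d)) a \<sigma> = natt_app (Idn (normal_dual C) (H_functor C \<gamma>)) a \<sigma>"
    using nt_app[OF a s] eta_hom[OF c s] idl[OF eta_hom(1)[OF c s]] by simp
qed

lemma cone_comp_iso:
  assumes c: "is_cone C d \<gamma>" and u: "is_iso C u" "u \<in> hom C d d'"
  shows "is_cone C d' (cone_comp C \<gamma> u)"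
proof -
  obtain v where v: "v \<in> hom C d' d" "u \<cdot> v = Idn C d" "v \<cdot> u = Idn C d'" using is_isoE[OF cat u] .
  let ?g = "cone_comp C \<gamma> u"
  obtain k where k: "k \<in> Obj C" "is_iso C (\<gamma> k)" using is_coneD(5)[OF c] by blast
  note gk = is_coneD(3)[OF c k(1)]
  obtain w where w: "w \<in> hom C d k" "\<gamma> k \<cdot> w = Idn C k" "w \<cdot> \<gamma> k = Idn C d" using is_isoE[OF cat k(2) gk] .
  have "(\<gamma> k \<cdot> u) \<cdot> (v \<cdot> w) = \<gamma> k \<cdot> ((u \<cdot> v) \<cdot> w)"
    using assoc[OF gk u(2) cmp[OF v(1) w(1)]] assoc[OF u(2) v(1) w(1)] by simp
  moreover have "(v \<cdot> w) \<cdot> (\<gamma> k \<cdot> u) = v \<cdot> ((w \<cdot> \<gamma> k) \<cdot> u)"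
    using assoc[OF v(1) w(1) cmp[OF gk u(2)]] assoc[OF w(1) gk u(2)] by simp
  ultimately have iso: "is_iso C (\<gamma> k \<cdot> u)"
    using is_isoI[OF cat cmp[OF gk u(2)] cmp[OF v(1) w(1)]] v w idl[OF w(1)] idl[OF u(2)] by simp
  show ?thesis
  proof (rule is_coneI[OF homO2[OF u(2)] cone_comp_ext _ _ Incl_Mor k(1)])
    show "?g a \<in> hom C a d'" if "a \<in> Obj C" for a
      using cmp[OF is_coneD(3)[OF c that] u(2)] that by (simp add: cone_comp_def)
    show "j \<cdot> ?g b = ?g a" if j: "j \<in> Incl C" "j \<in> hom C a b" for j a b
      using assoc[OF j(2) is_coneD(3)[OF c] u(2)] is_coneD(4)[OF c j] homO1[OF j(2)] homO2[OF j(2)]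
      by (simp add: cone_comp_def)
    show "is_iso C (?g k)" using iso k(1) by (simp add: cone_comp_def)
  qed
qed

lemma psi_iso:
  assumes c: "is_cone C d \<gamma>" and u: "is_iso C u" "u \<in> hom C d d'" and f: "f \<in> hom C d' a"
  shows "psi C (cone_comp C \<gamma> u) f = psi C \<gamma> (u \<cdot> f)"
  using epi_component_cmp[OF u(2) iso_split_epi[OF u(1)] f] epi_componentE[OF f] cone_comp_assoc[OF c u(2)] by metis

lemma eta_iso:
  assumes c: "is_cone C d \<gamma>" and u: "is_iso C u" "u \<in> hom C d d'" and s: "\<sigma> \<in> H_set C (cone_comp C \<gamma> u) a"
  shows "u \<cdot> eta C (cone_comp C \<gamma> u) a \<sigma> = eta C \<gamma> a \<sigma>"
proof -
  note c' = cone_comp_iso[OF c u]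
  note e = eta_hom[OF c' s]
  show ?thesis using eta_psi[OF c cmp[OF u(2) e(1)]] psi_iso[OF c u e(1)] e(2) by simp
qed

text \<open>
  Changing the apex of a cone along an isomorphism permutes the morphisms that parametrize the
  \<open>H\<close>-sets but not the cones in them.
\<close>

lemma H_functor_iso:
  assumes c: "is_cone C d \<gamma>" and u: "is_iso C u" "u \<in> hom C d d'"
  shows "H_functor C (cone_comp C \<gamma> u) = H_functor C \<gamma>"
proof -
  obtain v where v: "v \<in> hom C d' d" "u \<cdot> v = Idn C d" using is_isoE[OF cat u] .
  let ?g = "cone_comp C \<gamma> u"
  note c' = cone_comp_iso[OF c u] and p = psi_iso[OF c u] and E = eta_iso[OF c u]
  have vu: "u \<cdot> (v \<cdot> f) = f" if "f \<in> hom C d a" for f a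
    using assoc[OF u(2) v(1) that] v(2) idl[OF that] by simp
  have HS: "H_set C ?g a = H_set C \<gamma> a" for a
  proof -
    have "psi C ?g ` hom C d' a \<subseteq> psi C \<gamma> ` hom C d a" using p cmp[OF u(2)] by blast
    moreover have "psi C \<gamma> f \<in> psi C ?g ` hom C d' a" if f: "f \<in> hom C d a" for f
      using p[OF cmp[OF v(1) f]] vu[OF f] cmp[OF v(1) f] by force
    ultimately show ?thesis unfolding H_set_eq[OF c'] H_set_eq[OF c] by blast
  qed
  have M: "psi C ?g (eta C ?g a \<sigma> \<cdot> f) = psi C \<gamma> (eta C \<gamma> a \<sigma> \<cdot> f)"
    if s: "\<sigma> \<in> H_set C \<gamma> a" and f: "f \<in> hom C a b" for a b \<sigma> f
  proof -
    have s': "\<sigma> \<in> H_set C ?g a" using s HS by simp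
    show ?thesis using p[OF cmp[OF eta_hom(1)[OF c' s'] f]] assoc[OF u(2) eta_hom(1)[OF c' s'] f] E[OF s'] by simp
  qed
  show "H_functor C ?g = H_functor C \<gamma>"
    unfolding H_functor_def HS by (auto intro!: restrict_ext M Mor_hom)
qed

text \<open>
  Transport of \<open>nt\<close> along a change of both apexes: this shows that the value of
  \<open>\<Gamma>\<close> on a morphism of right ideals does not depend on the idempotents that represent the
  ideals.
\<close>

lemma nt_iso:
  assumes c: "is_cone C d \<gamma>" and u: "is_iso C u" "u \<in> hom C d d1"
    and c': "is_cone C d' \<gamma>'" and v: "is_iso C v" "v \<in> hom C d' d1'"
    and f: "f \<in> hom C d' d" "f1 \<in> hom C d1' d1" and eq: "f \<cdot> u = v \<cdot> f1"
  shows "nt C (cone_comp C \<gamma> u) (cone_comp C \<gamma>' v) f1 = nt C \<gamma> \<gamma>' f"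
proof -
  let ?g = "cone_comp C \<gamma> u" and ?g' = "cone_comp C \<gamma>' v"
  note d = cone_comp_iso[OF c u] H_functor_iso[OF c u] and d' = cone_comp_iso[OF c' v] H_functor_iso[OF c' v]
  have "nt C ?g ?g' f1 \<in> hom (normal_dual C) (H_functor C \<gamma>) (H_functor C \<gamma>')"
    using nt_natt[OF d(1) d'(1) f(2)] d(2) d'(2) by simp
  then show ?thesis
  proof (rule normal_dual_hom_eqI[OF _ nt_natt[OF c c' f(1)]])
    fix a \<sigma> assume a: "a \<in> Obj C" and s: "\<sigma> \<in> H_set C \<gamma> a"
    have s': "\<sigma> \<in> H_set C ?g a" using s d(2) H_functor_app(1)[OF a] by metis
    note e = eta_hom(1)[OF d(1) s']
    have "natt_app (nt C ?g ?g' f1) a \<sigma> = psi C \<gamma>' (v \<cdot> (f1 \<cdot> eta C ?g a \<sigma>))"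
      using nt_app[OF a s'] psi_iso[OF c' v cmp[OF f(2) e]] by simp
    also have "v \<cdot> (f1 \<cdot> eta C ?g a \<sigma>) = f \<cdot> (u \<cdot> eta C ?g a \<sigma>)"
      using assoc[OF v(2) f(2) e] assoc[OF f(1) u(2) e] eq by simp
    also have "psi C \<gamma>' \<dots> = natt_app (nt C \<gamma> \<gamma>' f) a \<sigma>"
      using nt_app[OF a s] eta_iso[OF c u s'] by simp
    finally show "natt_app (nt C ?g ?g' f1) a \<sigma> = natt_app (nt C \<gamma> \<gamma>' f) a \<sigma>" .
  qed
qed

text \<open>
  On the left is the composite of \<open>\<eta>\<^sub>\<gamma>\<close>, precomposition with \<open>f\<close>
  and the inverse of \<open>\<eta>\<^sub>\<gamma>\<^sub>'\<close>, the form in which \<open>\<Gamma>\<close>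
  is given on morphisms.
\<close>

lemma nt_alt:
  assumes c: "is_cone C d \<gamma>" and c': "is_cone C d' \<gamma>'" and f: "f \<in> hom C d' d"
  shows "(H_functor C \<gamma>, H_functor C \<gamma>', \<lambda>A\<in>Obj C. (FO (H_functor C \<gamma>) A, FO (H_functor C \<gamma>') A,
      \<lambda>\<sigma>\<in>FO (H_functor C \<gamma>) A. inv_into (FO (H_functor C \<gamma>') A) (eta C \<gamma>' A) (f \<cdot> eta C \<gamma> A \<sigma>)))
    = nt C \<gamma> \<gamma>' f"
proof -
  have "inv_into (H_set C \<gamma>' A) (eta C \<gamma>' A) (f \<cdot> eta C \<gamma> A \<sigma>) = psi C \<gamma>' (f \<cdot> eta C \<gamma> A \<sigma>)"
    if s: "\<sigma> \<in> H_set C \<gamma> A" for A \<sigma>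
  proof (rule inv_into_f_eq)
    note g = cmp[OF f eta_hom(1)[OF c s]]
    show "inj_on (eta C \<gamma>' A) (H_set C \<gamma>' A)"
      by (rule inj_on_inverseI[of _ "psi C \<gamma>'"]) (rule eta_hom(2)[OF c'])
    show "psi C \<gamma>' (f \<cdot> eta C \<gamma> A \<sigma>) \<in> H_set C \<gamma>' A" using H_set_eq[OF c'] g by blast
    show "eta C \<gamma>' A (psi C \<gamma>' (f \<cdot> eta C \<gamma> A \<sigma>)) = f \<cdot> eta C \<gamma> A \<sigma>" by (rule eta_psi[OF c' g])
  qed
  then show ?thesis unfolding nt_def by (simp add: H_functor_app(1) cong: restrict_cong)
qed

text \<open>
  By universality \<open>\<gamma> = \<gamma>' * f\<^sup>\<circ>\<close> for an endomorphism \<open>f\<close>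
  of the apex; idempotence of both cones, evaluated at the apex, gives \<open>f\<^sup>\<circ> = 1\<close>.
\<close>

lemma idempotent_cone_unique:
  assumes "idempotent_cone C \<gamma>" "idempotent_cone C \<gamma>'" "apex C \<gamma> = c" "apex C \<gamma>' = c"
    "H_functor C \<gamma> = H_functor C \<gamma>'"
  shows "\<gamma> = \<gamma>'"
proof -
  have c: "is_cone C c \<gamma>" "is_cone C c \<gamma>'" and i: "\<gamma> c = Idn C c" "\<gamma>' c = Idn C c"
    using assms cone_apex[of C \<gamma>] cone_apex[of C \<gamma>'] unfolding idempotent_cone_def by simp_all
  note cO = is_coneD(1)[OF c(1)]
  have "\<gamma> \<in> H_set C \<gamma> c" using psi_id[OF c(1)] Idn[OF cO] by (force simp: H_set_eq[OF c(1)])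
  then have "\<gamma> \<in> H_set C \<gamma>' c" using assms(5) H_functor_app(1)[OF cO] by metis
  then obtain f where f: "f \<in> hom C c c" "\<gamma> = psi C \<gamma>' f" by (auto simp: H_set_eq[OF c(2)])
  obtain b where e: "epi_component C f \<in> hom C c b" using epi_componentE[OF f(1)] by metis
  have "\<gamma> c = epi_component C f" using f(2) cO i(2) idl[OF e] by (simp add: cone_comp_def)
  then show ?thesis using f(2) i(1) cone_comp_id[OF c(2)] by simp
qed

end

section \<open>Cross-connections and their duals\<close>

locale xcon =
  fixes X :: "('p, 'q, 'o, 'm) xconn"
  assumes cc: "cross_connection X"
begin

sublocale C: normal_cat "xC X" by unfold_locales (use cc in \<open>simp add: cross_connection_def\<close>)
sublocale D: normal_cat "xD X" by unfold_locales (use cc in \<open>simp add: cross_connection_def\<close>)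

lemma Gamma_functor: "is_functor (xD X) (normal_dual (xC X)) (xG X)"
  using cc by (simp add: cross_connection_def local_isomorphism_def)

lemma Gamma_ff: "a \<in> Obj (xD X) \<Longrightarrow> b \<in> Obj (xD X) \<Longrightarrow>
    bij_betw (FM (xG X)) (hom (xD X) a b) (hom (normal_dual (xC X)) (FO (xG X) a) (FO (xG X) b))"
  using cc by (simp add: cross_connection_def local_isomorphism_def fully_faithful_def)

lemma xE_ex1: "c \<in> Obj (xC X) \<Longrightarrow> \<exists>d. (c, d) \<in> xE X"
  using cc by (auto simp: cross_connection_def xE_def)

lemma xE_ex2: assumes "d \<in> Obj (xD X)" shows "\<exists>c. (c, d) \<in> xE X"
proof -
  obtain \<gamma> where g: "cone (xC X) \<gamma>" "H_functor (xC X) \<gamma> = FO (xG X) d"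
    using func_O[OF Gamma_functor assms] by (auto simp: C.normal_dual_Obj)
  obtain c where "c \<in> Obj (xC X)" "is_iso (xC X) (\<gamma> c)" using is_coneD(5)[OF cone_apex[OF g(1)]] by blast
  then show ?thesis using g assms unfolding xE_def M_set_def by blast
qed

lemma xE_Obj: "(c, d) \<in> xE X \<Longrightarrow> c \<in> Obj (xC X) \<and> d \<in> Obj (xD X)"
  by (simp add: xE_def)

text \<open>
  A cone that represents \<open>\<Gamma>(d)\<close> has an isomorphism as its component at \<open>c\<close>;
  composing with the inverse of that component makes \<open>c\<close> the apex and the cone idempotent.
\<close>

lemma xcone_exists:
  assumes "(c, d) \<in> xE X"
  shows "\<exists>\<gamma>. idempotent_cone (xC X) \<gamma> \<and> apex (xC X) \<gamma> = c \<and> H_functor (xC X) \<gamma> = FO (xG X) d"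
proof -
  obtain \<gamma> where g: "cone (xC X) \<gamma>" "H_functor (xC X) \<gamma> = FO (xG X) d" "is_iso (xC X) (\<gamma> c)"
    and c: "c \<in> Obj (xC X)" using assms unfolding xE_def M_set_def by blast
  define a where "a = apex (xC X) \<gamma>"
  have cg: "is_cone (xC X) a \<gamma>" unfolding a_def by (rule cone_apex[OF g(1)])
  note gc = is_coneD(3)[OF cg c]
  obtain v where v: "v \<in> hom (xC X) a c" "\<gamma> c \<cdot>\<^bsub>xC X\<^esub> v = Idn (xC X) c" "v \<cdot>\<^bsub>xC X\<^esub> \<gamma> c = Idn (xC X) a"
    using is_isoE[OF C.cat g(3) gc] .
  have iv: "is_iso (xC X) v" using is_isoI[OF C.cat v(1) gc v(3,2)] .
  have "is_cone (xC X) c (cone_comp (xC X) \<gamma> v)" using C.cone_comp_iso[OF cg iv v(1)] .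
  then show ?thesis
    using C.H_functor_iso[OF cg iv v(1)] g(2) v(2) c apexI
    unfolding idempotent_cone_def cone_def by (metis C.cone_comp_app)
qed

lemma xcone_spec:
  assumes "(c, d) \<in> xE X"
  shows "idempotent_cone (xC X) (xcone X c d)" "apex (xC X) (xcone X c d) = c"
    "H_functor (xC X) (xcone X c d) = FO (xG X) d" "is_cone (xC X) c (xcone X c d)"
proof -
  have "\<exists>!\<gamma>. idempotent_cone (xC X) \<gamma> \<and> apex (xC X) \<gamma> = c \<and> H_functor (xC X) \<gamma> = FO (xG X) d"
    using xcone_exists[OF assms] C.idempotent_cone_unique by metis
  from theI'[OF this] show 1: "idempotent_cone (xC X) (xcone X c d)" "apex (xC X) (xcone X c d) = c"
    "H_functor (xC X) (xcone X c d) = FO (xG X) d"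
    unfolding xcone_def by blast+
  then show "is_cone (xC X) c (xcone X c d)" using cone_apex unfolding idempotent_cone_def by metis
qed

lemma xcone_eqI:
  assumes "c \<in> Obj (xC X)" "d \<in> Obj (xD X)" "is_cone (xC X) c \<gamma>" "\<gamma> c = Idn (xC X) c"
    "H_functor (xC X) \<gamma> = FO (xG X) d"
  shows "(c, d) \<in> xE X" "xcone X c d = \<gamma>"
proof -
  have "cone (xC X) \<gamma>" "is_iso (xC X) (\<gamma> c)"
    using assms(1,3,4) is_iso_Idn[OF C.cat] by (auto simp: cone_def)
  then show E: "(c, d) \<in> xE X" using assms(1,2,5) unfolding xE_def M_set_def by blast
  have "idempotent_cone (xC X) \<gamma>" "apex (xC X) \<gamma> = c"
    using assms(3,4) apexI[OF assms(3)] by (auto simp: idempotent_cone_def cone_def)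
  then show "xcone X c d = \<gamma>"
    using C.idempotent_cone_unique[OF xcone_spec(1)[OF E] _ xcone_spec(2)[OF E]] xcone_spec(3)[OF E] assms(5)
    by metis
qed

lemma Gamma_hom:
  assumes "(c, d) \<in> xE X" "(c', d') \<in> xE X" "g \<in> hom (xD X) d' d"
  shows "FM (xG X) g \<in> hom (normal_dual (xC X)) (H_functor (xC X) (xcone X c' d')) (H_functor (xC X) (xcone X c d))"
  using func_hom[OF Gamma_functor assms(3)] xcone_spec(3)[OF assms(1)] xcone_spec(3)[OF assms(2)] by simp

text \<open>
  With the Yoneda correspondence, linking becomes an equation between two natural transformations. Since
  \<open>\<Gamma>\<close> is fully faithful, every morphism is then linked to exactly one morphism of the
  other category.
\<close>

lemma linked_iff:
  assumes E: "(c, d) \<in> xE X" and E': "(c', d') \<in> xE X"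
    and f: "f \<in> hom (xC X) c c'" and g: "g \<in> hom (xD X) d' d"
  shows "linked X c d c' d' f g \<longleftrightarrow> FM (xG X) g = nt (xC X) (xcone X c' d') (xcone X c d) f"
    (is "_ \<longleftrightarrow> ?G = ?n")
proof -
  note c = xcone_spec(4)[OF E] and c' = xcone_spec(4)[OF E']
  note G = Gamma_hom[OF E E' g]
  have FO: "FO (FO (xG X) d') a = H_set (xC X) (xcone X c' d') a" if "a \<in> Obj (xC X)" for a
    using C.H_functor_app(1)[OF that] xcone_spec(3)[OF E'] by metis
  have mem: "natt_app ?G a \<sigma> \<in> H_set (xC X) (xcone X c d) a"
    if "a \<in> Obj (xC X)" "\<sigma> \<in> H_set (xC X) (xcone X c' d') a" for a \<sigma>
    using C.normal_dual_hom_app(2)[OF G that(1)] that(2) by (auto simp: PiE_def)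
  show ?thesis
  proof
    assume l: "linked X c d c' d' f g"
    show "?G = ?n"
    proof (rule C.normal_dual_hom_eqI[OF G C.nt_natt[OF c' c f]])
      fix a \<sigma> assume a: "a \<in> Obj (xC X)" and s: "\<sigma> \<in> H_set (xC X) (xcone X c' d') a"
      have "f \<cdot>\<^bsub>xC X\<^esub> eta (xC X) (xcone X c' d') a \<sigma> = eta (xC X) (xcone X c d) a (natt_app ?G a \<sigma>)"
        using l a s FO unfolding linked_def by blast
      then show "natt_app ?G a \<sigma> = natt_app ?n a \<sigma>"
        using C.eta_hom(2)[OF c mem[OF a s]] C.nt_app[OF a s] by simp
    qed
  next
    assume eq: "?G = ?n"
    have "f \<cdot>\<^bsub>xC X\<^esub> eta (xC X) (xcone X c' d') a \<sigma> = eta (xC X) (xcone X c d) a (natt_app ?G a \<sigma>)"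
      if "a \<in> Obj (xC X)" "\<sigma> \<in> H_set (xC X) (xcone X c' d') a" for a \<sigma>
      unfolding eq C.nt_app[OF that]
      using C.eta_psi[OF c C.cmp[OF f C.eta_hom(1)[OF c' that(2)]]] by simp
    then show "linked X c d c' d' f g" unfolding linked_def using FO by blast
  qed
qed

lemma linked_unique:
  assumes E: "(c, d) \<in> xE X" and E': "(c', d') \<in> xE X"
    and f: "f \<in> hom (xC X) c c'" and g: "g \<in> hom (xD X) d' d" "g' \<in> hom (xD X) d' d"
    and "linked X c d c' d' f g" "linked X c d c' d' f g'"
  shows "g = g'"
proof -
  have "FM (xG X) g = FM (xG X) g'" using assms linked_iff[OF E E' f g(1)] linked_iff[OF E E' f g(2)] by simp
  then show ?thesis using Gamma_ff[of d' d] xE_Obj[OF E] xE_Obj[OF E'] g unfolding bij_betw_def inj_on_def by blast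
qed

lemma linked_exists:
  assumes E: "(c, d) \<in> xE X" and E': "(c', d') \<in> xE X" and f: "f \<in> hom (xC X) c c'"
  obtains g where "g \<in> hom (xD X) d' d" "linked X c d c' d' f g"
proof -
  have "nt (xC X) (xcone X c' d') (xcone X c d) f \<in> hom (normal_dual (xC X)) (FO (xG X) d') (FO (xG X) d)"
    using C.nt_natt[OF xcone_spec(4)[OF E'] xcone_spec(4)[OF E] f] xcone_spec(3)[OF E] xcone_spec(3)[OF E'] by simp
  then obtain g where g: "g \<in> hom (xD X) d' d" "nt (xC X) (xcone X c' d') (xcone X c d) f = FM (xG X) g"
    using Gamma_ff[of d' d] xE_Obj[OF E] xE_Obj[OF E'] unfolding bij_betw_def by blast
  then show ?thesis using that linked_iff[OF E E' f g(1)] by metis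
qed

end

lemma is_dualD:
  assumes "is_dual X Y"
  shows "cross_connection Y" "xD Y = xC X" "xC Y = xD X"
    "c \<in> Obj (xC X) \<Longrightarrow> d \<in> Obj (xD X) \<Longrightarrow> (c, d) \<in> xE X \<longleftrightarrow> (d, c) \<in> xE Y"
    "(c, d) \<in> xE X \<Longrightarrow> (c', d') \<in> xE X \<Longrightarrow> f \<in> hom (xC X) c c' \<Longrightarrow> g \<in> hom (xD X) d' d \<Longrightarrow>
       linked Y d' c' d c g f \<longleftrightarrow> linked X c d c' d' f g"
    "(c, d) \<in> xE X \<Longrightarrow> (c', d') \<in> xE X \<Longrightarrow> linked X c d c' d' (xcone X c' d' c) (xcone Y d c d')"
  using assms unfolding is_dual_def by fast+

text \<open>
  The components of the cones \<open>\<delta>(c,d)\<close> of a dual are linked to components of cones of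
  \<open>X\<close>, hence determined by \<open>X\<close>. The cones determine the dual functor on objects, and
  linking determines it on morphisms.
\<close>

lemma dual_unique:
  assumes X: "cross_connection X" and Y: "is_dual X Y" and Y': "is_dual X Y'"
  shows "Y = Y'"
proof -
  interpret X: xcon X by unfold_locales (rule X)
  interpret Y: xcon Y by unfold_locales (rule is_dualD(1)[OF Y])
  interpret Y': xcon Y' by unfold_locales (rule is_dualD(1)[OF Y'])
  note y = is_dualD[OF Y] and y' = is_dualD[OF Y']
  have Edual: "(d, c) \<in> xE Y \<and> (d, c) \<in> xE Y'" if "(c, d) \<in> xE X" for c d
    using y(4)[of c d] y'(4)[of c d] X.xE_Obj[OF that] that by blast
  have xc: "xcone Y d c = xcone Y' d c" if E: "(c, d) \<in> xE X" for c d
  proof (rule extensionalityI[of _ "Obj (xD X)"])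
    have cy: "is_cone (xD X) d (xcone Y d c)" "is_cone (xD X) d (xcone Y' d c)"
      using Y.xcone_spec(4)[of d c] Y'.xcone_spec(4)[of d c] Edual[OF E] y(3) y'(3) by simp_all
    show "xcone Y d c \<in> extensional (Obj (xD X))" "xcone Y' d c \<in> extensional (Obj (xD X))"
      using is_coneD(2)[OF cy(1)] is_coneD(2)[OF cy(2)] .
    fix d' assume d': "d' \<in> Obj (xD X)"
    obtain c' where E': "(c', d') \<in> xE X" using X.xE_ex2[OF d'] by blast
    have "xcone X c' d' c \<in> hom (xC X) c c'"
      using is_coneD(3)[OF X.xcone_spec(4)[OF E']] X.xE_Obj[OF E] by blast
    from X.linked_unique[OF E E' this is_coneD(3)[OF cy(1) d'] is_coneD(3)[OF cy(2) d'] y(6)[OF E E'] y'(6)[OF E E']]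
    show "xcone Y d c d' = xcone Y' d c d'" .
  qed
  have "xG Y = xG Y'"
  proof (rule func_eqI[of _ "Obj (xC X)" _ "Mor (xC X)"])
    show "FO (xG Y) \<in> extensional (Obj (xC X))" "FO (xG Y') \<in> extensional (Obj (xC X))"
      "FM (xG Y) \<in> extensional (Mor (xC X))" "FM (xG Y') \<in> extensional (Mor (xC X))"
      using func_ext[OF Y.Gamma_functor] func_ext[OF Y'.Gamma_functor] y(2) y'(2) by simp_all
    show "FO (xG Y) c = FO (xG Y') c" if c: "c \<in> Obj (xC X)" for c
    proof -
      obtain d where E: "(c, d) \<in> xE X" using X.xE_ex1[OF c] by blast
      then show ?thesis using xc[OF E] Y.xcone_spec(3)[of d c] Y'.xcone_spec(3)[of d c] Edual[OF E] y(3) y'(3) by simp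
    qed
    show "FM (xG Y) f = FM (xG Y') f" if "f \<in> Mor (xC X)" for f
    proof -
      define c where "c = Dom (xC X) f"
      define c' where "c' = Cod (xC X) f"
      have f: "f \<in> hom (xC X) c c'" unfolding c_def c'_def using Mor_hom[OF that] .
      obtain d where E: "(c, d) \<in> xE X" using X.xE_ex1[OF X.C.homO1[OF f]] by blast
      obtain d' where E': "(c', d') \<in> xE X" using X.xE_ex1[OF X.C.homO2[OF f]] by blast
      obtain g where g: "g \<in> hom (xD X) d' d" "linked X c d c' d' f g" using X.linked_exists[OF E E' f] .
      have gY: "g \<in> hom (xC Y) d' d" "f \<in> hom (xD Y) c c'" and gY': "g \<in> hom (xC Y') d' d" "f \<in> hom (xD Y') c c'"
        using g(1) f y(2,3) y'(2,3) by simp_all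
      have "FM (xG Y) f = nt (xD X) (xcone Y d c) (xcone Y d' c') g"
        using Y.linked_iff[OF _ _ gY] Edual[OF E] Edual[OF E'] y(5)[OF E E' f g(1)] g(2) y(3) by simp
      moreover have "FM (xG Y') f = nt (xD X) (xcone Y' d c) (xcone Y' d' c') g"
        using Y'.linked_iff[OF _ _ gY'] Edual[OF E] Edual[OF E'] y'(5)[OF E E' f g(1)] g(2) y'(3) by simp
      ultimately show ?thesis using xc[OF E] xc[OF E'] by simp
    qed
  qed
  then show ?thesis using y(2,3) y'(2,3) by (cases Y, cases Y') simp
qed

lemma dual_eqI: "cross_connection X \<Longrightarrow> is_dual X Y \<Longrightarrow> dual X = Y"
  unfolding dual_def using dual_unique by blast

section \<open>The categories of cross-connections and of inductive groupoids\<close>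

lemma comp_func_simps: "a \<in> Obj C \<Longrightarrow> FO (comp_func C F G) a = FO G (FO F a)"
  "f \<in> Mor C \<Longrightarrow> FM (comp_func C F G) f = FM G (FM F f)"
  by (simp_all add: comp_func_def)

lemma id_func_simps: "a \<in> Obj C \<Longrightarrow> FO (id_func C) a = a" "f \<in> Mor C \<Longrightarrow> FM (id_func C) f = f"
  by (simp_all add: id_func_def)

lemma comp_func_ext: "FO (comp_func C F G) \<in> extensional (Obj C)" "FM (comp_func C F G) \<in> extensional (Mor C)"
  by (simp_all add: comp_func_def)

lemma comp_func_id1: assumes F: "is_functor C D F" shows "comp_func C (id_func C) F = F"
  by (rule func_eqI[OF comp_func_ext(1) func_ext(1)[OF F] comp_func_ext(2) func_ext(2)[OF F]])
    (simp_all add: comp_func_simps id_func_simps)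

lemma comp_func_id2: assumes F: "is_functor C D F" shows "comp_func C F (id_func D) = F"
  by (rule func_eqI[OF comp_func_ext(1) func_ext(1)[OF F] comp_func_ext(2) func_ext(2)[OF F]])
    (simp_all add: comp_func_simps id_func_simps func_O[OF F] func_Mor[OF F])

lemma comp_func_assoc: assumes F: "is_functor C D F"
  shows "comp_func C (comp_func C F G) H = comp_func C F (comp_func D G H)"
  by (rule func_eqI[OF comp_func_ext(1) comp_func_ext(1) comp_func_ext(2) comp_func_ext(2)])
    (simp_all add: comp_func_simps func_O[OF F] func_Mor[OF F])

lemma xconn_morphismD:
  assumes "xconn_morphism X Y F G"
  shows "is_functor (xC X) (xC Y) F" "inclusion_preserving (xC X) (xC Y) F"
    "is_functor (xD X) (xD Y) G" "inclusion_preserving (xD X) (xD Y) G"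
    "(c, d) \<in> xE X \<Longrightarrow> (FO F c, FO G d) \<in> xE Y"
    "(c, d) \<in> xE X \<Longrightarrow> c' \<in> Obj (xC X) \<Longrightarrow> FM F (xcone X c d c') = xcone Y (FO F c) (FO G d) (FO F c')"
    "is_transpose X c d c' d' f g \<Longrightarrow> is_transpose Y (FO F c) (FO G d) (FO F c') (FO G d') (FM F f) (FM G g)"
proof -
  assume t: "is_transpose X c d c' d' f g"
  have "\<forall>(c, d)\<in>xE X. \<forall>(c', d')\<in>xE X. \<forall>f\<in>hom (xC X) c c'. \<forall>g\<in>hom (xD X) d' d.
        is_transpose X c d c' d' f g \<longrightarrow>
        is_transpose Y (FO F c) (FO G d) (FO F c') (FO G d') (FM F f) (FM G g)"
    using assms unfolding xconn_morphism_def by (elim conjE)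
  moreover have "(c, d) \<in> xE X" "(c', d') \<in> xE X" "f \<in> hom (xC X) c c'" "g \<in> hom (xD X) d' d"
    using t by (simp_all add: is_transpose_def)
  ultimately show "is_transpose Y (FO F c) (FO G d) (FO F c') (FO G d') (FM F f) (FM G g)" using t by fast
qed (use assms[unfolded xconn_morphism_def] in \<open>fast+\<close>)

lemma xconn_morphismI:
  assumes "is_functor (xC X) (xC Y) F" "inclusion_preserving (xC X) (xC Y) F"
    "is_functor (xD X) (xD Y) G" "inclusion_preserving (xD X) (xD Y) G"
    "\<And>c d. (c, d) \<in> xE X \<Longrightarrow> (FO F c, FO G d) \<in> xE Y"
    "\<And>c d c'. (c, d) \<in> xE X \<Longrightarrow> c' \<in> Obj (xC X) \<Longrightarrow> FM F (xcone X c d c') = xcone Y (FO F c) (FO G d) (FO F c')"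
    "\<And>c d c' d' f g. is_transpose X c d c' d' f g \<Longrightarrow>
       is_transpose Y (FO F c) (FO G d) (FO F c') (FO G d') (FM F f) (FM G g)"
  shows "xconn_morphism X Y F G"
  unfolding xconn_morphism_def using assms by auto

lemma xconn_morphism_id:
  assumes X: "cross_connection X"
  shows "xconn_morphism X X (id_func (xC X)) (id_func (xD X))"
proof -
  interpret xcon X by unfold_locales (rule X)
  show ?thesis
  proof (rule xconn_morphismI[OF id_functor[OF C.cat] _ id_functor[OF D.cat]])
    show "inclusion_preserving (xC X) (xC X) (id_func (xC X))" "inclusion_preserving (xD X) (xD X) (id_func (xD X))"
      using C.Incl_Mor D.Incl_Mor by (auto simp: inclusion_preserving_def id_func_def)
    fix c d assume E: "(c, d) \<in> xE X"
    then show "(FO (id_func (xC X)) c, FO (id_func (xD X)) d) \<in> xE X" by (simp add: id_func_def xE_def)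
    show "FM (id_func (xC X)) (xcone X c d c') = xcone X (FO (id_func (xC X)) c) (FO (id_func (xD X)) d) (FO (id_func (xC X)) c')"
      if c': "c' \<in> Obj (xC X)" for c'
      using hom_MorD[OF is_coneD(3)[OF xcone_spec(4)[OF E] c']] c' xE_Obj[OF E] by (simp add: id_func_simps)
  next
    fix c d c' d' f g assume t: "is_transpose X c d c' d' f g"
    then have "c \<in> Obj (xC X)" "d \<in> Obj (xD X)" "c' \<in> Obj (xC X)" "d' \<in> Obj (xD X)" "f \<in> Mor (xC X)" "g \<in> Mor (xD X)"
      by (auto simp: is_transpose_def xE_def hom_def)
    then show "is_transpose X (FO (id_func (xC X)) c) (FO (id_func (xD X)) d) (FO (id_func (xC X)) c')
      (FO (id_func (xD X)) d') (FM (id_func (xC X)) f) (FM (id_func (xD X)) g)"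
      using t by (simp add: id_func_simps)
  qed
qed

text \<open>
  Both defining conditions pass to composites, because the pairs \<open>(c,d)\<close> on which they are
  imposed are preserved.
\<close>

lemma xconn_morphism_comp:
  assumes X: "cross_connection X" and m: "xconn_morphism X Y F G" and n: "xconn_morphism Y Z F' G'"
  shows "xconn_morphism X Z (comp_func (xC X) F F') (comp_func (xD X) G G')"
proof -
  interpret xcon X by unfold_locales (rule X)
  note M = xconn_morphismD[OF m] and N = xconn_morphismD[OF n]
  show ?thesis
  proof (rule xconn_morphismI[OF comp_functor[OF M(1) N(1)] _ comp_functor[OF M(3) N(3)]])
    show "inclusion_preserving (xC X) (xC Z) (comp_func (xC X) F F')" "inclusion_preserving (xD X) (xD Z) (comp_func (xD X) G G')"
      using C.Incl_Mor D.Incl_Mor M(2,4) N(2,4) by (auto simp: inclusion_preserving_def comp_func_def)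
    fix c d assume E: "(c, d) \<in> xE X"
    then show "(FO (comp_func (xC X) F F') c, FO (comp_func (xD X) G G') d) \<in> xE Z"
      using N(5)[OF M(5)[OF E]] xE_Obj[OF E] by (simp add: comp_func_simps)
    show "FM (comp_func (xC X) F F') (xcone X c d c')
        = xcone Z (FO (comp_func (xC X) F F') c) (FO (comp_func (xD X) G G') d) (FO (comp_func (xC X) F F') c')"
      if c': "c' \<in> Obj (xC X)" for c'
      using hom_MorD[OF is_coneD(3)[OF xcone_spec(4)[OF E] c']] c' xE_Obj[OF E] M(6)[OF E c']
        N(6)[OF M(5)[OF E] func_O[OF M(1) c']] by (simp add: comp_func_simps)
  next
    fix c d c' d' f g assume t: "is_transpose X c d c' d' f g"
    then have "c \<in> Obj (xC X)" "d \<in> Obj (xD X)" "c' \<in> Obj (xC X)" "d' \<in> Obj (xD X)" "f \<in> Mor (xC X)" "g \<in> Mor (xD X)"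
      by (auto simp: is_transpose_def xE_def hom_def)
    then show "is_transpose Z (FO (comp_func (xC X) F F') c) (FO (comp_func (xD X) G G') d) (FO (comp_func (xC X) F F') c')
      (FO (comp_func (xD X) G G') d') (FM (comp_func (xC X) F F') f) (FM (comp_func (xD X) G G') g)"
      using N(7)[OF M(7)[OF t]] by (simp add: comp_func_simps)
  qed
qed

lemma CC_simps: "Obj CC = {X. cross_connection X}"
  "Mor CC = {(X, Y, F, G). cross_connection X \<and> cross_connection Y \<and> xconn_morphism X Y F G}"
  "cross_connection X \<Longrightarrow> Idn CC X = (X, X, id_func (xC X), id_func (xD X))"
  by (simp_all add: CC_def Let_def)

lemma CC_hom: "m \<in> hom CC X Y \<longleftrightarrow>
    (\<exists>F G. m = (X, Y, F, G) \<and> cross_connection X \<and> cross_connection Y \<and> xconn_morphism X Y F G)"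
  by (auto simp: hom_def CC_def Let_def)

lemma CC_cmp: "(X, Y, F, G) \<in> Mor CC \<Longrightarrow> (Y, Z, F', G') \<in> Mor CC \<Longrightarrow>
    (X, Y, F, G) \<cdot>\<^bsub>CC\<^esub> (Y, Z, F', G') = (X, Z, comp_func (xC X) F F', comp_func (xD X) G G')"
  by (simp add: CC_def Let_def)

lemma CC_category: "category CC"
proof (rule categoryI)
  show "Dom CC \<in> extensional (Mor CC)" "Cod CC \<in> extensional (Mor CC)"
    "Idn CC \<in> extensional (Obj CC)" "Cmp CC \<in> extensional (Mor CC)"
    "\<And>f. f \<in> Mor CC \<Longrightarrow> Cmp CC f \<in> extensional {g \<in> Mor CC. Dom CC g = Cod CC f}"
    by (auto simp: CC_def Let_def extensional_def)
  show "Dom CC f \<in> Obj CC" "Cod CC f \<in> Obj CC" if "f \<in> Mor CC" for f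
    using that by (auto simp: CC_def Let_def)
  show "Idn CC X \<in> hom CC X X" if "X \<in> Obj CC" for X
    using that xconn_morphism_id by (simp add: CC_hom CC_simps)
  show "m \<cdot>\<^bsub>CC\<^esub> n \<in> hom CC X Z" if "m \<in> hom CC X Y" "n \<in> hom CC Y Z" for m n X Y Z
    using that xconn_morphism_comp[of X Y _ _ Z] by (auto simp: CC_hom CC_cmp CC_simps)
  show "Idn CC X \<cdot>\<^bsub>CC\<^esub> m = m" if m: "m \<in> hom CC X Y" for m X Y
  proof -
    obtain F G where *: "m = (X, Y, F, G)" "cross_connection X" "cross_connection Y" "xconn_morphism X Y F G"
      using m by (auto simp: CC_hom)
    then show ?thesis
      using CC_cmp[of X X "id_func (xC X)" "id_func (xD X)" Y F G] xconn_morphism_id[of X]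
        comp_func_id1[OF xconn_morphismD(1)[OF *(4)]] comp_func_id1[OF xconn_morphismD(3)[OF *(4)]]
      by (simp add: CC_simps)
  qed
  show "m \<cdot>\<^bsub>CC\<^esub> Idn CC Y = m" if m: "m \<in> hom CC X Y" for m X Y
  proof -
    obtain F G where *: "m = (X, Y, F, G)" "cross_connection X" "cross_connection Y" "xconn_morphism X Y F G"
      using m by (auto simp: CC_hom)
    then show ?thesis
      using CC_cmp[of X Y F G Y "id_func (xC Y)" "id_func (xD Y)"] xconn_morphism_id[of Y]
        comp_func_id2[OF xconn_morphismD(1)[OF *(4)]] comp_func_id2[OF xconn_morphismD(3)[OF *(4)]]
      by (simp add: CC_simps)
  qed
  show "(m \<cdot>\<^bsub>CC\<^esub> n) \<cdot>\<^bsub>CC\<^esub> k = m \<cdot>\<^bsub>CC\<^esub> (n \<cdot>\<^bsub>CC\<^esub> k)"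
    if h: "m \<in> hom CC X Y" "n \<in> hom CC Y Z" "k \<in> hom CC Z W" for m n k X Y Z W
  proof -
    obtain F G F' G' F'' G'' where *: "m = (X, Y, F, G)" "n = (Y, Z, F', G')" "k = (Z, W, F'', G'')"
      "cross_connection X" "cross_connection Y" "cross_connection Z" "cross_connection W"
      "xconn_morphism X Y F G" "xconn_morphism Y Z F' G'" "xconn_morphism Z W F'' G''"
      using h by (auto simp: CC_hom)
    show ?thesis
      using * xconn_morphism_comp[OF *(4,8,9)] xconn_morphism_comp[OF *(5,9,10)]
      by (simp add: CC_cmp CC_simps comp_func_assoc[OF xconn_morphismD(1)[OF *(8)]]
          comp_func_assoc[OF xconn_morphismD(3)[OF *(8)]])
  qed
qed

lemma bimorphismD:
  assumes "bimorphism E E' \<theta>"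
  shows "e \<in> carr E \<Longrightarrow> \<theta> e \<in> carr E'" "(e, f) \<in> bdom E \<Longrightarrow> (\<theta> e, \<theta> f) \<in> bdom E'"
    "(e, f) \<in> bdom E \<Longrightarrow> \<theta> (e \<odot>\<^bsub>E\<^esub> f) = \<theta> e \<odot>\<^bsub>E'\<^esub> \<theta> f"
  using assms by (auto simp: bimorphism_def)

lemma bimorphism_rel:
  assumes "bimorphism E E' \<theta>"
  shows "lle E e f \<Longrightarrow> lle E' (\<theta> e) (\<theta> f)" "rle E e f \<Longrightarrow> rle E' (\<theta> e) (\<theta> f)"
    "Leq E e f \<Longrightarrow> Leq E' (\<theta> e) (\<theta> f)" "Req E e f \<Longrightarrow> Req E' (\<theta> e) (\<theta> f)" "nle E e f \<Longrightarrow> nle E' (\<theta> e) (\<theta> f)"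
proof -
  show 1: "lle E' (\<theta> e) (\<theta> f)" if "lle E e f" for e f
    using that bimorphismD(2,3)[OF assms, of e f] by (simp add: lle_def)
  show 2: "rle E' (\<theta> e) (\<theta> f)" if "rle E e f" for e f
    using that bimorphismD(2,3)[OF assms, of f e] by (simp add: rle_def)
  show "Leq E e f \<Longrightarrow> Leq E' (\<theta> e) (\<theta> f)" "Req E e f \<Longrightarrow> Req E' (\<theta> e) (\<theta> f)" "nle E e f \<Longrightarrow> nle E' (\<theta> e) (\<theta> f)"
    using 1 2 by (auto simp: Leq_def Req_def nle_def)
qed

lemma bimorphism_path:
  assumes b: "bimorphism E E' \<theta>" and p: "is_path E p"
  shows "is_path E' (map \<theta> p)"
  unfolding is_path_def
proof (intro conjI)
  show "map \<theta> p \<noteq> []" "set (map \<theta> p) \<subseteq> carr E'" using p bimorphismD(1)[OF b] by (auto simp: is_path_def)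
  have "successively (\<lambda>e f. Req E e f \<or> Leq E e f) p" using p by (simp add: is_path_def)
  then have "successively (\<lambda>e f. Req E' (\<theta> e) (\<theta> f) \<or> Leq E' (\<theta> e) (\<theta> f)) p"
    by (rule successively_mono) (use bimorphism_rel[OF b] in blast)
  then show "successively (\<lambda>e f. Req E' e f \<or> Leq E' e f) (map \<theta> p)" by (simp add: successively_map)
qed

lemma inductive_functorD:
  assumes "inductive_functor X Y F"
  shows "is_functor (igg X) (igg Y) F" "order_preserving (igg X) (igg Y) F"
    "regular_bimorphism (igb X) (igb Y) (FO F)" "bimorphism (igb X) (igb Y) (FO F)"
    "is_path (igb X) p \<Longrightarrow> FM F (ige X (echain (igb X) p)) = ige Y (echain (igb Y) (map (FO F) p))"
  using assms unfolding inductive_functor_def regular_bimorphism_def by blast+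

lemma inductive_groupoidD:
  assumes "inductive_groupoid X"
  shows "regular_biordered_set (igb X)" "biordered_set (igb X)" "ordered_groupoid (igg X)" "Obj (igg X) = carr (igb X)"
    "v_isomorphism (chain_groupoid (igb X)) (igg X) \<lparr> FO = (\<lambda>e\<in>carr (igb X). e), FM = ige X \<rparr>"
    "category (igg X)"
proof -
  show 1: "regular_biordered_set (igb X)" and 2: "ordered_groupoid (igg X)" and "Obj (igg X) = carr (igb X)" and
    "v_isomorphism (chain_groupoid (igb X)) (igg X) \<lparr> FO = (\<lambda>e\<in>carr (igb X). e), FM = ige X \<rparr>"
    using assms unfolding inductive_groupoid_def Let_def by - (elim conjE, assumption)+
  show "biordered_set (igb X)" using 1 by (simp add: regular_biordered_set_def)
  show "category (igg X)" using 2 by (simp add: ordered_groupoid_def groupoid_def)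
qed

lemma biordered_set_carr:
  assumes "biordered_set E" "(e, f) \<in> bdom E"
  shows "e \<in> carr E" "f \<in> carr E" "e \<odot>\<^bsub>E\<^esub> f \<in> carr E"
proof -
  have "bdom E \<subseteq> carr E \<times> carr E" "\<forall>(e, f)\<in>bdom E. e \<odot>\<^bsub>E\<^esub> f \<in> carr E"
    using assms(1) unfolding biordered_set_def by - (elim conjE, assumption)+
  then show "e \<in> carr E" "f \<in> carr E" "e \<odot>\<^bsub>E\<^esub> f \<in> carr E" using assms(2) by auto
qed

lemma ige_Mor:
  assumes "inductive_groupoid X" "is_path (igb X) p"
  shows "ige X (echain (igb X) p) \<in> Mor (igg X)"
proof -
  have "echain (igb X) p \<in> Mor (chain_groupoid (igb X))" using assms(2) by (auto simp: chain_groupoid_def Let_def)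
  then show ?thesis
    using func_Mor[of "chain_groupoid (igb X)" "igg X"] inductive_groupoidD(5)[OF assms(1)] unfolding v_isomorphism_def
    by fastforce
qed

lemma ordered_groupoid_ole: "ordered_groupoid G \<Longrightarrow> ole G \<subseteq> Mor G \<times> Mor G"
  unfolding ordered_groupoid_def by (elim conjE)

lemma inductive_functor_id:
  assumes X: "inductive_groupoid X"
  shows "inductive_functor X X (id_func (igg X))"
  unfolding inductive_functor_def
proof (intro conjI allI impI)
  note x = inductive_groupoidD[OF X]
  have O: "FO (id_func (igg X)) e = e" if "e \<in> carr (igb X)" for e using that x(4) by (simp add: id_func_simps)
  show "is_functor (igg X) (igg X) (id_func (igg X))" by (rule id_functor[OF x(6)])
  show "order_preserving (igg X) (igg X) (id_func (igg X))"
    using ordered_groupoid_ole[OF x(3)] by (auto simp: order_preserving_def id_func_simps dest!: subsetD)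
  show "regular_bimorphism (igb X) (igb X) (FO (id_func (igg X)))"
    unfolding regular_bimorphism_def bimorphism_def
  proof (intro conjI ballI)
    show "FO (id_func (igg X)) \<in> carr (igb X) \<rightarrow> carr (igb X)" using O by simp
    show "case p of (e, f) \<Rightarrow> (FO (id_func (igg X)) e, FO (id_func (igg X)) f) \<in> bdom (igb X) \<and>
        FO (id_func (igg X)) (e \<odot>\<^bsub>igb X\<^esub> f) = FO (id_func (igg X)) e \<odot>\<^bsub>igb X\<^esub> FO (id_func (igg X)) f"
      if "p \<in> bdom (igb X)" for p
      using that biordered_set_carr[OF x(2)] O by (cases p) simp
    show "FO (id_func (igg X)) ` sandwich (igb X) e f \<subseteq> sandwich (igb X) (FO (id_func (igg X)) e) (FO (id_func (igg X)) f)"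
      if "e \<in> carr (igb X)" "f \<in> carr (igb X)" for e f
      using O that by (auto simp: sandwich_def)
  qed
  fix p assume p: "is_path (igb X) p"
  have "map (FO (id_func (igg X))) p = p" using p O by (intro map_idI) (auto simp: is_path_def)
  then show "FM (id_func (igg X)) (ige X (echain (igb X) p)) = ige X (echain (igb X) (map (FO (id_func (igg X))) p))"
    using ige_Mor[OF X p] by (simp add: id_func_simps)
qed

lemma inductive_functor_comp:
  assumes X: "inductive_groupoid X" and F: "inductive_functor X Y F" and G: "inductive_functor Y Z G"
  shows "inductive_functor X Z (comp_func (igg X) F G)"
  unfolding inductive_functor_def
proof (intro conjI allI impI)
  note x = inductive_groupoidD[OF X]
  note f = inductive_functorD[OF F] and g = inductive_functorD[OF G]
  have O: "FO (comp_func (igg X) F G) e = FO G (FO F e)" if "e \<in> carr (igb X)" for e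
    using that x(4) by (simp add: comp_func_simps)
  show "is_functor (igg X) (igg Z) (comp_func (igg X) F G)" by (rule comp_functor[OF f(1) g(1)])
  show "order_preserving (igg X) (igg Z) (comp_func (igg X) F G)"
    unfolding order_preserving_def
  proof clarify
    fix u v assume uv: "(u, v) \<in> ole (igg X)"
    then have "u \<in> Mor (igg X)" "v \<in> Mor (igg X)" using ordered_groupoid_ole[OF x(3)] by auto
    then show "(FM (comp_func (igg X) F G) u, FM (comp_func (igg X) F G) v) \<in> ole (igg Z)"
      using uv f(2) g(2) unfolding order_preserving_def by (auto simp: comp_func_simps)
  qed
  show "regular_bimorphism (igb X) (igb Z) (FO (comp_func (igg X) F G))"
    unfolding regular_bimorphism_def bimorphism_def
  proof (intro conjI ballI)
    show "FO (comp_func (igg X) F G) \<in> carr (igb X) \<rightarrow> carr (igb Z)"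
      using O bimorphismD(1)[OF f(4)] bimorphismD(1)[OF g(4)] by simp
    show "case p of (e, e') \<Rightarrow> (FO (comp_func (igg X) F G) e, FO (comp_func (igg X) F G) e') \<in> bdom (igb Z) \<and>
        FO (comp_func (igg X) F G) (e \<odot>\<^bsub>igb X\<^esub> e') = FO (comp_func (igg X) F G) e \<odot>\<^bsub>igb Z\<^esub> FO (comp_func (igg X) F G) e'"
      if "p \<in> bdom (igb X)" for p
      using that biordered_set_carr[OF x(2)] O bimorphismD(2,3)[OF f(4)] bimorphismD(2,3)[OF g(4)] by (cases p) simp
    show "FO (comp_func (igg X) F G) ` sandwich (igb X) e f \<subseteq> sandwich (igb Z) (FO (comp_func (igg X) F G) e) (FO (comp_func (igg X) F G) f)"
      if e: "e \<in> carr (igb X)" "f \<in> carr (igb X)" for e f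
    proof -
      have "FO F ` sandwich (igb X) e f \<subseteq> sandwich (igb Y) (FO F e) (FO F f)"
        using f(3) e unfolding regular_bimorphism_def by blast
      moreover have "FO G ` sandwich (igb Y) (FO F e) (FO F f) \<subseteq> sandwich (igb Z) (FO G (FO F e)) (FO G (FO F f))"
        using g(3) bimorphismD(1)[OF f(4)] e unfolding regular_bimorphism_def by blast
      moreover have "FO (comp_func (igg X) F G) h = FO G (FO F h)" if "h \<in> sandwich (igb X) e f" for h
        using that O by (simp add: sandwich_def)
      ultimately show ?thesis using O e by fastforce
    qed
  qed
  fix p assume p: "is_path (igb X) p"
  have "map (FO (comp_func (igg X) F G)) p = map (FO G) (map (FO F) p)"
    using p O by (auto simp: is_path_def subset_iff)
  then show "FM (comp_func (igg X) F G) (ige X (echain (igb X) p)) = ige Z (echain (igb Z) (map (FO (comp_func (igg X) F G)) p))"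
    using ige_Mor[OF X p] f(5)[OF p] g(5)[OF bimorphism_path[OF f(4) p]]
    by (simp only: comp_func_simps)
qed

lemma IG_simps: "Obj IG = {X. inductive_groupoid X}"
  "Mor IG = {(X, Y, F). inductive_groupoid X \<and> inductive_groupoid Y \<and> inductive_functor X Y F}"
  "inductive_groupoid X \<Longrightarrow> Idn IG X = (X, X, id_func (igg X))"
  by (simp_all add: IG_def Let_def)

lemma IG_hom: "m \<in> hom IG X Y \<longleftrightarrow>
    (\<exists>F. m = (X, Y, F) \<and> inductive_groupoid X \<and> inductive_groupoid Y \<and> inductive_functor X Y F)"
  by (auto simp: hom_def IG_def Let_def)

lemma IG_cmp: "(X, Y, F) \<in> Mor IG \<Longrightarrow> (Y, Z, F') \<in> Mor IG \<Longrightarrow>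
    (X, Y, F) \<cdot>\<^bsub>IG\<^esub> (Y, Z, F') = (X, Z, comp_func (igg X) F F')"
  by (simp add: IG_def Let_def)

lemma IG_category: "category IG"
proof (rule categoryI)
  show "Dom IG \<in> extensional (Mor IG)" "Cod IG \<in> extensional (Mor IG)"
    "Idn IG \<in> extensional (Obj IG)" "Cmp IG \<in> extensional (Mor IG)"
    "\<And>f. f \<in> Mor IG \<Longrightarrow> Cmp IG f \<in> extensional {g \<in> Mor IG. Dom IG g = Cod IG f}"
    by (auto simp: IG_def Let_def extensional_def)
  show "Dom IG f \<in> Obj IG" "Cod IG f \<in> Obj IG" if "f \<in> Mor IG" for f
    using that by (auto simp: IG_def Let_def)
  show "Idn IG X \<in> hom IG X X" if "X \<in> Obj IG" for X
    using that inductive_functor_id by (simp add: IG_hom IG_simps)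
  show "m \<cdot>\<^bsub>IG\<^esub> n \<in> hom IG X Z" if "m \<in> hom IG X Y" "n \<in> hom IG Y Z" for m n X Y Z
    using that inductive_functor_comp[of X Y _ Z] by (auto simp: IG_hom IG_cmp IG_simps)
  show "Idn IG X \<cdot>\<^bsub>IG\<^esub> m = m" if m: "m \<in> hom IG X Y" for m X Y
    using m inductive_functor_id[of X] comp_func_id1 inductive_functorD(1)
    by (fastforce simp: IG_hom IG_simps IG_cmp)
  show "m \<cdot>\<^bsub>IG\<^esub> Idn IG Y = m" if m: "m \<in> hom IG X Y" for m X Y
    using m inductive_functor_id[of Y] comp_func_id2 inductive_functorD(1)
    by (fastforce simp: IG_hom IG_simps IG_cmp)
  show "(m \<cdot>\<^bsub>IG\<^esub> n) \<cdot>\<^bsub>IG\<^esub> k = m \<cdot>\<^bsub>IG\<^esub> (n \<cdot>\<^bsub>IG\<^esub> k)"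
    if h: "m \<in> hom IG X Y" "n \<in> hom IG Y Z" "k \<in> hom IG Z W" for m n k X Y Z W
  proof -
    obtain F F' F'' where *: "m = (X, Y, F)" "n = (Y, Z, F')" "k = (Z, W, F'')"
      "inductive_groupoid X" "inductive_groupoid Y" "inductive_groupoid Z" "inductive_groupoid W"
      "inductive_functor X Y F" "inductive_functor Y Z F'" "inductive_functor Z W F''"
      using h by (auto simp: IG_hom)
    show ?thesis
      using * inductive_functor_comp[OF *(4,8,9)] inductive_functor_comp[OF *(5,9,10)]
      by (simp add: IG_cmp IG_simps comp_func_assoc[OF inductive_functorD(1)[OF *(8)]])
  qed
qed

section \<open>Biordered sets\<close>

definition opb :: "'e biord \<Rightarrow> 'e biord" where
  "opb E = \<lparr> carr = carr E, bdom = (bdom E)\<inverse>, bmul = (\<lambda>e f. f \<odot>\<^bsub>E\<^esub> e) \<rparr>"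

lemma opb_opb: "opb (opb E) = E" by (simp add: opb_def)

lemma opb_simps [simp]: "carr (opb E) = carr E" "bmul (opb E) e f = f \<odot>\<^bsub>E\<^esub> e" "bdom (opb E) = (bdom E)\<inverse>"
  by (simp_all add: opb_def)

lemma opb_rel [simp]: "lle (opb E) = rle E" "rle (opb E) = lle E" "Leq (opb E) = Req E" "Req (opb E) = Leq E"
  "nle (opb E) = nle E"
  by (auto simp: fun_eq_iff lle_def rle_def Leq_def Req_def nle_def)

lemma sandwich_opb [simp]: "sandwich (opb E) e f = sandwich E f e"
  by (auto simp: sandwich_def)

locale biordered =
  fixes E :: "'e biord" (structure)
  assumes biordered: "biordered_set E"
begin

lemma lle_carr: "lle E e f \<Longrightarrow> e \<in> carr E \<and> f \<in> carr E"
  and rle_carr: "rle E e f \<Longrightarrow> e \<in> carr E \<and> f \<in> carr E"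
  using biordered_set_carr[OF biordered] by (auto simp: lle_def rle_def)

lemma mul_l: "lle E e f \<Longrightarrow> e \<odot> f = e" and mul_r: "rle E e f \<Longrightarrow> f \<odot> e = e"
  by (simp_all add: lle_def rle_def)

lemma biord_axioms:
  "\<forall>e\<in>carr E. lle E e e \<and> rle E e e"
  "\<forall>e f g. lle E e f \<and> lle E f g \<longrightarrow> lle E e g"
  "\<forall>e f g. rle E e f \<and> rle E f g \<longrightarrow> rle E e g"
  "\<forall>e f. lle E e f \<longrightarrow> Leq E e (f \<odot> e) \<and> nle E (f \<odot> e) f"
  "\<forall>e f. rle E e f \<longrightarrow> Req E e (e \<odot> f) \<and> nle E (e \<odot> f) f"
  "\<forall>e f g. rle E f e \<and> rle E g e \<and> lle E f g \<longrightarrow>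
     lle E (f \<odot> e) (g \<odot> e) \<and> (g \<odot> f) \<odot> e = (g \<odot> e) \<odot> (f \<odot> e)"
  "\<forall>e f g. lle E f e \<and> lle E g e \<and> rle E f g \<longrightarrow>
     rle E (e \<odot> f) (e \<odot> g) \<and> e \<odot> (f \<odot> g) = (e \<odot> f) \<odot> (e \<odot> g)"
  "\<forall>e f g. lle E e f \<and> lle E f g \<longrightarrow> f \<odot> (g \<odot> e) = f \<odot> e"
  "\<forall>e f g. rle E e f \<and> rle E f g \<longrightarrow> (e \<odot> g) \<odot> f = e \<odot> f"
  "\<forall>e f g. lle E f e \<and> lle E g e \<and> rle E (e \<odot> f) (e \<odot> g) \<longrightarrow>
     (\<exists>f'\<in>carr E. rle E f' g \<and> lle E f' e \<and> e \<odot> f' = e \<odot> f)"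
  "\<forall>e f g. rle E f e \<and> rle E g e \<and> lle E (f \<odot> e) (g \<odot> e) \<longrightarrow>
     (\<exists>f'\<in>carr E. lle E f' g \<and> rle E f' e \<and> f' \<odot> e = f \<odot> e)"
  using biordered unfolding biordered_set_def by - (elim conjE, assumption)+

lemma lle_refl: "e \<in> carr E \<Longrightarrow> lle E e e" and rle_refl: "e \<in> carr E \<Longrightarrow> rle E e e"
  using biord_axioms(1) by blast+

lemma lle_trans: "lle E e f \<Longrightarrow> lle E f g \<Longrightarrow> lle E e g"
  using biord_axioms(2) by blast

lemma rle_trans: "rle E e f \<Longrightarrow> rle E f g \<Longrightarrow> rle E e g"
  using biord_axioms(3) by blast

lemma B2l: "lle E e f \<Longrightarrow> Leq E e (f \<odot> e)" "lle E e f \<Longrightarrow> nle E (f \<odot> e) f"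
  using biord_axioms(4) by blast+

lemma B2r: "rle E e f \<Longrightarrow> Req E e (e \<odot> f)" "rle E e f \<Longrightarrow> nle E (e \<odot> f) f"
  using biord_axioms(5) by blast+

lemma B3r: "rle E f e \<Longrightarrow> rle E g e \<Longrightarrow> lle E f g \<Longrightarrow> lle E (f \<odot> e) (g \<odot> e)"
  "rle E f e \<Longrightarrow> rle E g e \<Longrightarrow> lle E f g \<Longrightarrow> (g \<odot> f) \<odot> e = (g \<odot> e) \<odot> (f \<odot> e)"
  using biord_axioms(6) by blast+

lemma B3l: "lle E f e \<Longrightarrow> lle E g e \<Longrightarrow> rle E f g \<Longrightarrow> rle E (e \<odot> f) (e \<odot> g)"
  "lle E f e \<Longrightarrow> lle E g e \<Longrightarrow> rle E f g \<Longrightarrow> e \<odot> (f \<odot> g) = (e \<odot> f) \<odot> (e \<odot> g)"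
  using biord_axioms(7) by blast+

lemma B4l: "lle E e f \<Longrightarrow> lle E f g \<Longrightarrow> f \<odot> (g \<odot> e) = f \<odot> e"
  using biord_axioms(8) by blast

lemma B4r: "rle E e f \<Longrightarrow> rle E f g \<Longrightarrow> (e \<odot> g) \<odot> f = e \<odot> f"
  using biord_axioms(9) by blast

lemma B5l:
  assumes "lle E f e" "lle E g e" "rle E (e \<odot> f) (e \<odot> g)"
  obtains f' where "rle E f' g" "lle E f' e" "e \<odot> f' = e \<odot> f"
  using biord_axioms(10) assms by blast

lemma LeqD: "Leq E e f \<Longrightarrow> lle E e f" "Leq E e f \<Longrightarrow> lle E f e"
  and ReqD: "Req E e f \<Longrightarrow> rle E e f" "Req E e f \<Longrightarrow> rle E f e"
  and nleD: "nle E e f \<Longrightarrow> lle E e f" "nle E e f \<Longrightarrow> rle E e f"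
  by (auto simp: Leq_def Req_def nle_def)

lemma Leq_carr: "Leq E e f \<Longrightarrow> e \<in> carr E \<and> f \<in> carr E"
  and Req_carr: "Req E e f \<Longrightarrow> e \<in> carr E \<and> f \<in> carr E"
  and nle_carr: "nle E e f \<Longrightarrow> e \<in> carr E \<and> f \<in> carr E"
  using lle_carr rle_carr by (auto simp: Leq_def Req_def nle_def)

lemma Leq_refl: "e \<in> carr E \<Longrightarrow> Leq E e e" and Req_refl: "e \<in> carr E \<Longrightarrow> Req E e e"
  and nle_refl: "e \<in> carr E \<Longrightarrow> nle E e e"
  using lle_refl rle_refl by (auto simp: Leq_def Req_def nle_def)

lemma Leq_sym: "Leq E e f \<Longrightarrow> Leq E f e" and Req_sym: "Req E e f \<Longrightarrow> Req E f e"
  by (auto simp: Leq_def Req_def)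

lemma Leq_trans: "Leq E e f \<Longrightarrow> Leq E f g \<Longrightarrow> Leq E e g"
  and Req_trans: "Req E e f \<Longrightarrow> Req E f g \<Longrightarrow> Req E e g"
  and nle_trans: "nle E e f \<Longrightarrow> nle E f g \<Longrightarrow> nle E e g"
  using lle_trans rle_trans unfolding Leq_def Req_def nle_def by blast+

lemma lr_eq: "lle E e f \<Longrightarrow> rle E f e \<Longrightarrow> e = f"
  by (simp add: lle_def rle_def)

lemma H_eq: "Leq E e f \<Longrightarrow> Req E e f \<Longrightarrow> e = f"
  using lr_eq LeqD ReqD by blast

lemma nle_Leq_eq: "nle E e f \<Longrightarrow> Leq E e f \<Longrightarrow> e = f" and nle_Req_eq: "nle E e f \<Longrightarrow> Req E e f \<Longrightarrow> e = f"
  using lr_eq LeqD ReqD nleD by metis+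

lemma nle_mul: "nle E e f \<Longrightarrow> e \<odot> f = e" "nle E e f \<Longrightarrow> f \<odot> e = e"
  using mul_l mul_r nleD by blast+

subsection \<open>Sandwich sets\<close>

lemma sandwichD:
  assumes "h \<in> sandwich E e f"
  shows "lle E h e" "rle E h f" "lle E g e \<Longrightarrow> rle E g f \<Longrightarrow> lle E (g \<odot> f) (h \<odot> f)"
    "lle E g e \<Longrightarrow> rle E g f \<Longrightarrow> rle E (e \<odot> g) (e \<odot> h)"
  using assms by (auto simp: sandwich_def)

lemma sandwichI:
  assumes "lle E h e" "rle E h f" "\<And>g. lle E g e \<Longrightarrow> rle E g f \<Longrightarrow> lle E (g \<odot> f) (h \<odot> f)"
    "\<And>g. lle E g e \<Longrightarrow> rle E g f \<Longrightarrow> rle E (e \<odot> g) (e \<odot> h)"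
  shows "h \<in> sandwich E e f"
  using assms lle_carr by (auto simp: sandwich_def)

lemma sandwich_Leq_sub:
  assumes L: "Leq E e e'" and h: "h \<in> sandwich E e f"
  shows "h \<in> sandwich E e' f"
proof (rule sandwichI)
  note hs = sandwichD[OF h]
  show "lle E h e'" "rle E h f" using lle_trans[OF hs(1) LeqD(1)[OF L]] hs(2) .
  fix g assume g: "lle E g e'" "rle E g f"
  have ge: "lle E g e" using lle_trans[OF g(1) LeqD(2)[OF L]] .
  show "lle E (g \<odot> f) (h \<odot> f)" using hs(3)[OF ge g(2)] .
  have "rle E (e' \<odot> (e \<odot> g)) (e' \<odot> (e \<odot> h))"
    using B3l(1)[of "e \<odot> g" e' "e \<odot> h"] hs(4)[OF ge g(2)] B2l(2)[OF ge] B2l(2)[OF hs(1)] LeqD(1)[OF L]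
      lle_trans nleD(1) by blast
  then show "rle E (e' \<odot> g) (e' \<odot> h)"
    using B4l[OF g(1) LeqD(2)[OF L]] B4l[OF lle_trans[OF hs(1) LeqD(1)[OF L]] LeqD(2)[OF L]] by simp
qed

lemma sandwich_Leq: "Leq E e e' \<Longrightarrow> sandwich E e f = sandwich E e' f"
  using sandwich_Leq_sub Leq_sym by blast

lemma sandwich_of_lle: assumes "lle E e f" shows "f \<odot> e \<in> sandwich E e f"
proof (rule sandwichI)
  note fe = B2l[OF assms]
  note ef = lle_carr[OF assms]
  show "lle E (f \<odot> e) e" "rle E (f \<odot> e) f" using LeqD(2)[OF fe(1)] nleD(2)[OF fe(2)] .
  fix g assume g: "lle E g e" "rle E g f"
  have gf: "lle E g f" using lle_trans[OF g(1) assms] .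
  show "lle E (g \<odot> f) (f \<odot> e \<odot> f)"
    using lle_trans[OF g(1) LeqD(1)[OF fe(1)]] mul_l[OF gf] mul_l[OF nleD(1)[OF fe(2)]] by simp
  have "e \<odot> (f \<odot> e) = e" using B4l[OF lle_refl assms] ef mul_l[OF lle_refl] by simp
  then show "rle E (e \<odot> g) (e \<odot> (f \<odot> e))" using nleD(2)[OF B2l(2)[OF g(1)]] by simp
qed

lemma sandwich_of_lle': assumes "lle E d e" shows "d \<in> sandwich E e d"
proof (rule sandwichI)
  note dd = lle_carr[OF assms]
  show "lle E d e" "rle E d d" using assms rle_refl dd by auto
  fix g assume g: "lle E g e" "rle E g d"
  show "lle E (g \<odot> d) (d \<odot> d)" using nleD(1)[OF B2r(2)[OF g(2)]] mul_l[OF lle_refl] dd by simp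
  show "rle E (e \<odot> g) (e \<odot> d)" using B3l(1)[OF g(1) assms g(2)] .
qed

text \<open>
  Two elements \<open>h\<close> and \<open>h'\<close> of a sandwich set are opposite corners of an
  \<open>E\<close>-square. Its corner \<open>k\<close> forms a row-singular square with \<open>h'\<close> and
  their multiples by \<open>e\<close>, and a column-singular square with \<open>h\<close> and their multiples
  by \<open>f\<close>.
\<close>

lemma sandwich_corner:
  assumes h: "h \<in> sandwich E e f" and h': "h' \<in> sandwich E e f"
  obtains k where "Leq E k h" "Req E k h'" "e \<odot> k = e \<odot> h" "k \<odot> f = h' \<odot> f"
    "Req E (e \<odot> h) (e \<odot> h')" "Leq E (h \<odot> f) (h' \<odot> f)"
proof -
  note s = sandwichD[OF h] and s' = sandwichD[OF h']
  have R: "Req E (e \<odot> h) (e \<odot> h')" using s(4)[OF s'(1,2)] s'(4)[OF s(1,2)] by (simp add: Req_def)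
  have L: "Leq E (h \<odot> f) (h' \<odot> f)" using s(3)[OF s'(1,2)] s'(3)[OF s(1,2)] by (simp add: Leq_def)
  \<comment> \<open>(B5) lifts the relation between the images of \<open>h\<close> and \<open>h'\<close> under
    multiplication by \<open>e\<close>.\<close>
  obtain k where k: "rle E k h'" "lle E k e" "e \<odot> k = e \<odot> h" using B5l[OF s(1) s'(1) ReqD(1)[OF R]] .
  have kL: "Leq E k h" using Leq_trans[OF B2l(1)[OF k(2)]] Leq_sym[OF B2l(1)[OF s(1)]] k(3) by simp
  note kh' = B2r[OF k(1)]
  have "e \<odot> (k \<odot> h') = e \<odot> h'" using B3l(2)[OF k(2) s'(1) k(1)] k(3) mul_r[OF ReqD(2)[OF R]] by simp
  moreover have "lle E (k \<odot> h') e" using lle_trans[OF nleD(1)[OF kh'(2)] s'(1)] .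
  ultimately have "Leq E (k \<odot> h') h'" using Leq_trans[OF B2l(1)] Leq_sym[OF B2l(1)[OF s'(1)]] by metis
  then have kR: "Req E k h'" using nle_Leq_eq[OF kh'(2)] kh'(1) by simp
  have kf: "rle E k f" using rle_trans[OF ReqD(1)[OF kR] s'(2)] .
  have "Req E (k \<odot> f) (h' \<odot> f)" using Req_trans[OF Req_sym[OF B2r(1)[OF kf]] Req_trans[OF kR B2r(1)[OF s'(2)]]] .
  moreover have "Leq E (k \<odot> f) (h \<odot> f)"
    using B3r(1)[OF kf s(2) LeqD(1)[OF kL]] B3r(1)[OF s(2) kf LeqD(2)[OF kL]] by (simp add: Leq_def)
  ultimately have "k \<odot> f = h' \<odot> f" using H_eq Leq_trans[OF _ L] by blast
  then show ?thesis using that kL kR k(3) R L by blast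
qed

text \<open>
  In a semigroup, \<open>ag \<in> Shg\<close> gives \<open>ag = (ag)(hg)\<close>; since \<open>gh = h\<close>,
  this says \<open>ag = ahg\<close>. Here (B3) and (B4) take the place of the associative law.
\<close>

lemma sandwich_absorb:
  assumes a: "rle E a h" and h: "rle E h g" and l: "lle E (a \<odot> g) (h \<odot> g)"
  shows "(a \<odot> h) \<odot> g = a \<odot> g"
proof -
  define w where "w = h \<odot> g"
  define b where "b = a \<odot> g"
  define c where "c = b \<odot> h"
  have ag: "rle E a g" using rle_trans[OF a h] .
  have bR: "Req E a b" "nle E b g" unfolding b_def using B2r[OF ag] .
  have wR: "Req E h w" "nle E w g" unfolding w_def using B2r[OF h] .
  have bh: "rle E b h" using rle_trans[OF ReqD(2)[OF bR(1)] a] .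
  have bw: "rle E b w" using rle_trans[OF bh ReqD(1)[OF wR(1)]] .
  have blw: "lle E b w" using l by (simp add: b_def w_def)
  have ca: "c = a \<odot> h" unfolding c_def b_def using B4r[OF a h] .
  have cR: "Req E b c" "nle E c h" unfolding c_def using B2r[OF bh] .
  have cw: "c \<odot> w = b" unfolding c_def using B4r[OF bw ReqD(2)[OF wR(1)]] mul_l[OF blw] by simp
  have rcw: "rle E c w" using rle_trans[OF ReqD(2)[OF cR(1)] bw] .
  have "(c \<odot> g) \<odot> w = b" using B4r[OF rcw nleD(2)[OF wR(2)]] cw by simp
  moreover have "lle E (c \<odot> g) w"
    unfolding w_def using B3r(1)[OF rle_trans[OF nleD(2)[OF cR(2)] h] h nleD(1)[OF cR(2)]] .
  ultimately have "c \<odot> g = b" using mul_l by simp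
  then show ?thesis by (simp add: ca b_def)
qed

text \<open>
  Sandwich elements can be chosen in two stages: a sandwich element \<open>k\<close> of \<open>f'\<close> with
  the trace \<open>fh\<close> of a sandwich element \<open>h\<close> of \<open>(f, g)\<close> lifts, below
  \<open>h\<close>, to a sandwich element of \<open>(f', g)\<close>. This lets the sandwich elements of the
  two bracketings of a triple product be chosen compatibly.
\<close>

lemma sandwich_restrict:
  assumes h: "h \<in> sandwich E f g" and f': "nle E f' f" and k: "k \<in> sandwich E f' (f \<odot> h)"
    and m: "rle E m h" "lle E m f" "f \<odot> m = k"
  shows "m \<in> sandwich E f' g"
proof -
  note hs = sandwichD[OF h] and ks = sandwichD[OF k]
  have mk: "Leq E m k" using B2l(1)[OF m(2)] m(3) by simp
  have mf': "lle E m f'" using lle_trans[OF LeqD(1)[OF mk] ks(1)] .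
  have mg: "rle E m g" using rle_trans[OF m(1) hs(2)] .
  note mgh = sandwich_absorb[OF m(1) hs(2) hs(3)[OF m(2) mg]]
  show ?thesis
  proof (rule sandwichI[OF mf' mg])
    fix n assume n: "lle E n f'" "rle E n g"
    have nf: "lle E n f" using lle_trans[OF n(1) nleD(1)[OF f']] .
    have fn: "lle E (f \<odot> n) f'" using lle_trans[OF LeqD(2)[OF B2l(1)[OF nf]] n(1)] .
    note fnh = hs(4)[OF nf n(2)]
    have "rle E (f' \<odot> (f \<odot> n)) (f' \<odot> k)" using ks(4)[OF fn fnh] .
    then show "rle E (f' \<odot> n) (f' \<odot> m)"
      using B4l[OF n(1) nleD(1)[OF f']] B4l[OF mf' nleD(1)[OF f']] m(3) by simp
    \<comment> \<open>A competitor \<open>n\<close> of \<open>m\<close> is replaced by one below \<open>h\<close>, where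
      \<open>k\<close> being a sandwich element applies.\<close>
    obtain n' where n': "rle E n' h" "lle E n' f" "f \<odot> n' = f \<odot> n" using B5l[OF nf hs(1) fnh] .
    have n'h: "lle E (n' \<odot> h) f" "lle E (m \<odot> h) f"
      using lle_trans[OF nleD(1)[OF B2r(2)[OF n'(1)]] hs(1)] lle_trans[OF nleD(1)[OF B2r(2)[OF m(1)]] hs(1)] .
    have "lle E ((f \<odot> n) \<odot> (f \<odot> h)) (k \<odot> (f \<odot> h))" using ks(3)[OF fn fnh] .
    then have "lle E (f \<odot> (n' \<odot> h)) (f \<odot> (m \<odot> h))"
      using B3l(2)[OF n'(2) hs(1) n'(1)] B3l(2)[OF m(2) hs(1) m(1)] n'(3) m(3) by simp
    then have 1: "lle E (n' \<odot> h) (m \<odot> h)"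
      using lle_trans LeqD(1)[OF B2l(1)[OF n'h(1)]] LeqD(2)[OF B2l(1)[OF n'h(2)]] by blast
    have nn': "Leq E n n'" using Leq_trans[OF B2l(1)[OF nf]] Leq_sym[OF B2l(1)[OF n'(2)]] n'(3) by simp
    have n'g: "rle E n' g" using rle_trans[OF n'(1) hs(2)] .
    have 2: "lle E (n \<odot> g) (n' \<odot> g)" using B3r(1)[OF n(2) n'g LeqD(1)[OF nn']] .
    have "n' \<odot> h \<odot> g = n' \<odot> g" using sandwich_absorb[OF n'(1) hs(2) hs(3)[OF n'(2) n'g]] .
    then have "lle E (n' \<odot> g) (m \<odot> g)"
      using B3r(1)[OF _ _ 1, of g] rle_trans[OF nleD(2)[OF B2r(2)[OF n'(1)]] hs(2)]
        rle_trans[OF nleD(2)[OF B2r(2)[OF m(1)]] hs(2)] mgh by simp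
    then show "lle E (n \<odot> g) (m \<odot> g)" using lle_trans[OF 2] by blast
  qed
qed

end

lemma biordered_set_opb:
  assumes "biordered_set E"
  shows "biordered_set (opb E)"
proof -
  interpret biordered E by unfold_locales (rule assms)
  have *: "bdom E \<subseteq> carr E \<times> carr E" "\<forall>(e, f)\<in>bdom E. e \<odot>\<^bsub>E\<^esub> f \<in> carr E"
    "\<forall>e f. (e, f) \<notin> bdom E \<longrightarrow> e \<odot>\<^bsub>E\<^esub> f = undefined"
    "bdom E = {(e, f). lle E e f \<or> rle E e f \<or> lle E f e \<or> rle E f e}"
    using assms unfolding biordered_set_def by - (elim conjE, assumption)+
  show ?thesis
    unfolding biordered_set_def opb_rel opb_simps
  proof (intro conjI biord_axioms)
    show "(bdom E)\<inverse> \<subseteq> carr E \<times> carr E" using *(1) by blast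
    show "\<forall>(e, f)\<in>(bdom E)\<inverse>. f \<odot>\<^bsub>E\<^esub> e \<in> carr E" using *(2) by blast
    show "\<forall>e f. (e, f) \<notin> (bdom E)\<inverse> \<longrightarrow> f \<odot>\<^bsub>E\<^esub> e = undefined" using *(3) by simp
    show "\<forall>e\<in>carr E. rle E e e \<and> lle E e e" using biord_axioms(1) by blast
    show "(bdom E)\<inverse> = {(e, f). rle E e f \<or> lle E e f \<or> rle E f e \<or> lle E f e}"
      by (subst *(4)) blast
  qed
qed

lemma regular_biordered_set_opb: "regular_biordered_set E \<Longrightarrow> regular_biordered_set (opb E)"
  by (simp add: regular_biordered_set_def biordered_set_opb)

section \<open>Ordered groupoids\<close>

locale ordered_gpd =
  fixes G :: "('o, 'm) ogpd" (structure)
  assumes og: "ordered_groupoid G"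
begin

abbreviation le :: "'m \<Rightarrow> 'm \<Rightarrow> bool" (infix "\<preceq>" 50) where "u \<preceq> x \<equiv> (u, x) \<in> ole G"

lemma og_axioms: "groupoid G" "ole G \<subseteq> Mor G \<times> Mor G" "\<forall>x\<in>Mor G. x \<preceq> x" "trans (ole G)" "antisym (ole G)"
  "\<forall>u v x y. u \<preceq> x \<and> v \<preceq> y \<and> Cod G u = Dom G v \<and> Cod G x = Dom G y \<longrightarrow> u \<cdot> v \<preceq> x \<cdot> y"
  "\<forall>x y. x \<preceq> y \<longrightarrow> minv G x \<preceq> minv G y"
  "\<forall>x\<in>Mor G. \<forall>e\<in>Obj G. vle G e (Dom G x) \<longrightarrow> (\<exists>!y. y \<preceq> x \<and> Dom G y = e)"
  "\<forall>x\<in>Mor G. \<forall>f\<in>Obj G. vle G f (Cod G x) \<longrightarrow> (\<exists>!y. y \<preceq> x \<and> Cod G y = f)"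
  using og unfolding ordered_groupoid_def by - (elim conjE, assumption)+

lemma cat: "category G" using og_axioms(1) by (simp add: groupoid_def)

lemma DomO [simp]: "x \<in> Mor G \<Longrightarrow> Dom G x \<in> Obj G" and CodO [simp]: "x \<in> Mor G \<Longrightarrow> Cod G x \<in> Obj G"
  using cat_DomO[OF cat] cat_CodO[OF cat] by auto

lemma cmp_simps [simp]:
  assumes "x \<in> Mor G" "y \<in> Mor G" "Cod G x = Dom G y"
  shows "x \<cdot> y \<in> Mor G" "Dom G (x \<cdot> y) = Dom G x" "Cod G (x \<cdot> y) = Cod G y"
  using cat_cmp[OF cat, of x "Dom G x" "Cod G x" y "Cod G y"] assms by (auto simp: hom_def)

lemma assoc [simp]:
  assumes "x \<in> Mor G" "y \<in> Mor G" "z \<in> Mor G" "Cod G x = Dom G y" "Cod G y = Dom G z"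
  shows "(x \<cdot> y) \<cdot> z = x \<cdot> (y \<cdot> z)"
  using cat_assoc[OF cat, of x "Dom G x" "Cod G x" y "Cod G y" z "Cod G z"] assms by (auto simp: hom_def)

lemma Idn_simps [simp]: "e \<in> Obj G \<Longrightarrow> Idn G e \<in> Mor G" "e \<in> Obj G \<Longrightarrow> Dom G (Idn G e) = e"
  "e \<in> Obj G \<Longrightarrow> Cod G (Idn G e) = e"
  using cat_Idn[OF cat, of e] by (auto simp: hom_def)

lemma id_left [simp]: "x \<in> Mor G \<Longrightarrow> Dom G x = e \<Longrightarrow> Idn G e \<cdot> x = x"
  and id_right [simp]: "x \<in> Mor G \<Longrightarrow> Cod G x = e \<Longrightarrow> x \<cdot> Idn G e = x"
  using cat_idl[OF cat, of x e "Cod G x"] cat_idr[OF cat, of x "Dom G x" e] by (auto simp: hom_def)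

lemma minv_props:
  assumes "x \<in> Mor G"
  shows "minv G x \<in> Mor G" "Dom G (minv G x) = Cod G x" "Cod G (minv G x) = Dom G x"
    "x \<cdot> minv G x = Idn G (Dom G x)" "minv G x \<cdot> x = Idn G (Cod G x)"
proof -
  have "is_iso G x" using og_axioms(1) assms by (simp add: groupoid_def)
  then obtain y where y: "y \<in> hom G (Cod G x) (Dom G x)" "x \<cdot> y = Idn G (Dom G x)" "y \<cdot> x = Idn G (Cod G x)"
    unfolding is_iso_def by blast
  have "z = y" if z: "z \<in> hom G (Cod G x) (Dom G x)" "x \<cdot> z = Idn G (Dom G x)" "z \<cdot> x = Idn G (Cod G x)" for z
  proof -
    have "z \<cdot> (x \<cdot> y) = (z \<cdot> x) \<cdot> y" using assms y(1) z(1) by (simp add: hom_def)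
    then show ?thesis using y z by (simp add: hom_def)
  qed
  with y have "minv G x = y" unfolding minv_def by blast
  with y show "minv G x \<in> Mor G" "Dom G (minv G x) = Cod G x" "Cod G (minv G x) = Dom G x"
    "x \<cdot> minv G x = Idn G (Dom G x)" "minv G x \<cdot> x = Idn G (Cod G x)" by (auto simp: hom_def)
qed

lemmas minv_simps [simp] = minv_props(1,2,3)

lemma minv_unique:
  assumes "x \<in> Mor G" "y \<in> Mor G" "Dom G y = Cod G x" "Cod G y = Dom G x" "x \<cdot> y = Idn G (Dom G x)"
  shows "minv G x = y"
proof -
  have "minv G x \<cdot> (x \<cdot> y) = (minv G x \<cdot> x) \<cdot> y" using assms(1-4) by simp
  then show ?thesis using assms minv_props(5)[OF assms(1)] by simp
qed

lemma minv_minv [simp]: "x \<in> Mor G \<Longrightarrow> minv G (minv G x) = x"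
  by (rule minv_unique) (simp_all add: minv_props)

lemma cancel_left:
  assumes "x \<in> Mor G" "y \<in> Mor G" "Cod G x = Dom G y"
  shows "minv G x \<cdot> (x \<cdot> y) = y"
proof -
  have "minv G x \<cdot> (x \<cdot> y) = (minv G x \<cdot> x) \<cdot> y" using assms by simp
  then show ?thesis using assms minv_props(5) by simp
qed

lemma cancel_left':
  assumes "x \<in> Mor G" "y \<in> Mor G" "Dom G x = Dom G y"
  shows "x \<cdot> (minv G x \<cdot> y) = y"
  using cancel_left[of "minv G x" y] assms by simp

lemma minv_cmp:
  assumes "x \<in> Mor G" "y \<in> Mor G" "Cod G x = Dom G y"
  shows "minv G (x \<cdot> y) = minv G y \<cdot> minv G x"
  by (rule minv_unique) (use assms cancel_left'[of y "minv G x"] minv_props(4)[of x] in simp_all)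

lemma inv_swap:
  assumes m: "x \<in> Mor G" "u \<in> Mor G" "v \<in> Mor G" "y \<in> Mor G"
    and c: "Cod G x = Dom G u" "Cod G v = Dom G y" "Dom G x = Dom G v" "Cod G u = Cod G y"
  shows "x \<cdot> u = v \<cdot> y \<longleftrightarrow> minv G v \<cdot> x = y \<cdot> minv G u"
proof
  assume eq: "x \<cdot> u = v \<cdot> y"
  have "minv G v \<cdot> x = minv G v \<cdot> ((x \<cdot> u) \<cdot> minv G u)" using m c minv_props(4)[of u] by simp
  also have "\<dots> = minv G v \<cdot> (v \<cdot> (y \<cdot> minv G u))" unfolding eq using m c by simp
  also have "\<dots> = y \<cdot> minv G u" using cancel_left[of v "y \<cdot> minv G u"] m c by simp
  finally show "minv G v \<cdot> x = y \<cdot> minv G u" .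
next
  assume eq: "minv G v \<cdot> x = y \<cdot> minv G u"
  have "x \<cdot> u = v \<cdot> ((minv G v \<cdot> x) \<cdot> u)" using cancel_left'[of v "x \<cdot> u"] m c by simp
  also have "\<dots> = v \<cdot> y" unfolding eq using m c minv_props(5)[of u] by simp
  finally show "x \<cdot> u = v \<cdot> y" .
qed

lemma le_Mor: "u \<preceq> x \<Longrightarrow> u \<in> Mor G \<and> x \<in> Mor G"
  using og_axioms(2) by blast

lemma le_refl [simp]: "x \<in> Mor G \<Longrightarrow> x \<preceq> x"
  using og_axioms(3) by blast

lemma le_trans: "u \<preceq> x \<Longrightarrow> x \<preceq> y \<Longrightarrow> u \<preceq> y"
  using og_axioms(4) by (rule transD)

lemma le_cmp: "u \<preceq> x \<Longrightarrow> v \<preceq> y \<Longrightarrow> Cod G u = Dom G v \<Longrightarrow> Cod G x = Dom G y \<Longrightarrow> u \<cdot> v \<preceq> x \<cdot> y"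
  using og_axioms(6) by blast

lemma le_minv: "u \<preceq> x \<Longrightarrow> minv G u \<preceq> minv G x"
  using og_axioms(7) by blast

lemma le_dom: "u \<preceq> x \<Longrightarrow> vle G (Dom G u) (Dom G x)"
  and le_cod: "u \<preceq> x \<Longrightarrow> vle G (Cod G u) (Cod G x)"
proof -
  assume ux: "u \<preceq> x"
  have m: "u \<in> Mor G" "x \<in> Mor G" using le_Mor[OF ux] by auto
  show "vle G (Dom G u) (Dom G x)"
    using le_cmp[OF ux le_minv[OF ux]] m unfolding vle_def by (simp add: minv_props)
  show "vle G (Cod G u) (Cod G x)"
    using le_cmp[OF le_minv[OF ux] ux] m unfolding vle_def by (simp add: minv_props)
qed

text \<open>
  Uniqueness of restrictions: a morphism below \<open>x\<close> is determined by its domain. Restrictions are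
  therefore named by any morphism below \<open>x\<close> with the right domain.
\<close>

lemma dom_unique: assumes "u \<preceq> x" "v \<preceq> x" "Dom G u = Dom G v" shows "u = v"
proof -
  have "\<exists>!y. y \<preceq> x \<and> Dom G y = Dom G u"
    using og_axioms(8)[rule_format, of x "Dom G u"] le_Mor[OF assms(1)] le_dom[OF assms(1)] DomO by simp
  then show ?thesis by (rule ex1E) (use assms in metis)
qed

lemma cod_unique: assumes "u \<preceq> x" "v \<preceq> x" "Cod G u = Cod G v" shows "u = v"
proof -
  have "\<exists>!y. y \<preceq> x \<and> Cod G y = Cod G u"
    using og_axioms(9)[rule_format, of x "Cod G u"] le_Mor[OF assms(1)] le_cod[OF assms(1)] CodO by simp
  then show ?thesis by (rule ex1E) (use assms in metis)
qed

lemma restr_dom: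
  assumes "x \<in> Mor G" "e \<in> Obj G" "vle G e (Dom G x)"
  shows "restr_dom G e x \<preceq> x" "Dom G (restr_dom G e x) = e"
proof -
  have "\<exists>!y. y \<preceq> x \<and> Dom G y = e" using og_axioms(8)[rule_format, OF assms] .
  from theI'[OF this] show "restr_dom G e x \<preceq> x" "Dom G (restr_dom G e x) = e" by (simp_all add: restr_dom_def)
qed

lemma restr_cod:
  assumes "x \<in> Mor G" "e \<in> Obj G" "vle G e (Cod G x)"
  shows "restr_cod G x e \<preceq> x" "Cod G (restr_cod G x e) = e"
proof -
  have "\<exists>!y. y \<preceq> x \<and> Cod G y = e" using og_axioms(9)[rule_format, OF assms] .
  from theI'[OF this] show "restr_cod G x e \<preceq> x" "Cod G (restr_cod G x e) = e" by (simp_all add: restr_cod_def)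
qed

lemma restr_dom_eq: "u \<preceq> x \<Longrightarrow> Dom G u = e \<Longrightarrow> restr_dom G e x = u"
  unfolding restr_dom_def by (rule the_equality) (auto intro: dom_unique)

lemma restr_cod_eq: "u \<preceq> x \<Longrightarrow> Cod G u = e \<Longrightarrow> restr_cod G x e = u"
  unfolding restr_cod_def by (rule the_equality) (auto intro: cod_unique)

end

definition opg :: "('o, 'm) ogpd \<Rightarrow> ('o, 'm) ogpd" where
  "opg G = \<lparr> Obj = Obj G, Mor = Mor G, Dom = Cod G, Cod = Dom G, Idn = Idn G,
     Cmp = (\<lambda>f\<in>Mor G. \<lambda>g\<in>{g \<in> Mor G. Cod G g = Dom G f}. g \<cdot>\<^bsub>G\<^esub> f), ole = ole G \<rparr>"

lemma opg_simps [simp]: "Obj (opg G) = Obj G" "Mor (opg G) = Mor G" "Dom (opg G) = Cod G" "Cod (opg G) = Dom G"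
  "Idn (opg G) = Idn G" "ole (opg G) = ole G"
  "f \<in> Mor G \<Longrightarrow> g \<in> Mor G \<Longrightarrow> Cod G g = Dom G f \<Longrightarrow> f \<cdot>\<^bsub>opg G\<^esub> g = g \<cdot>\<^bsub>G\<^esub> f"
  by (simp_all add: opg_def)

lemma opg_restr [simp]: "restr_dom (opg G) e x = restr_cod G x e" "restr_cod (opg G) x e = restr_dom G e x"
  by (simp_all add: restr_dom_def restr_cod_def)

lemma opg_hom: "hom (opg G) a b = hom G b a"
  by (auto simp: hom_def)

context ordered_gpd
begin

lemma opg_opg: "opg (opg G) = G"
proof -
  have "(\<lambda>f\<in>Mor G. \<lambda>g\<in>{g \<in> Mor G. Dom G g = Cod G f}. g \<cdot>\<^bsub>opg G\<^esub> f) = Cmp G"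
  proof (rule extensionalityI[OF restrict_extensional cat_ext(4)[OF cat]])
    fix f assume f: "f \<in> Mor G"
    have "(\<lambda>g\<in>{g \<in> Mor G. Dom G g = Cod G f}. g \<cdot>\<^bsub>opg G\<^esub> f) = Cmp G f"
      by (rule extensionalityI[OF restrict_extensional cat_ext(5)[OF cat f]]) (use f in simp)
    then show "(\<lambda>f\<in>Mor G. \<lambda>g\<in>{g \<in> Mor G. Dom G g = Cod G f}. g \<cdot>\<^bsub>opg G\<^esub> f) f = Cmp G f" using f by simp
  qed
  then show ?thesis unfolding opg_def[of "opg G"] by (cases G) simp
qed

lemma opg_category: "category (opg G)"
proof (rule categoryI)
  show "Dom (opg G) \<in> extensional (Mor (opg G))" "Cod (opg G) \<in> extensional (Mor (opg G))"
    "Idn (opg G) \<in> extensional (Obj (opg G))" using cat_ext[OF cat] by simp_all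
  show "Cmp (opg G) \<in> extensional (Mor (opg G))"
    "\<And>f. f \<in> Mor (opg G) \<Longrightarrow> Cmp (opg G) f \<in> extensional {g \<in> Mor (opg G). Dom (opg G) g = Cod (opg G) f}"
    by (auto simp: opg_def)
qed (auto simp: hom_def)

lemma opg_minv: assumes "x \<in> Mor G" shows "minv (opg G) x = minv G x"
  unfolding minv_def[of "opg G"]
proof (rule the_equality)
  show "minv G x \<in> hom (opg G) (Cod (opg G) x) (Dom (opg G) x) \<and>
      x \<cdot>\<^bsub>opg G\<^esub> minv G x = Idn (opg G) (Dom (opg G) x) \<and> minv G x \<cdot>\<^bsub>opg G\<^esub> x = Idn (opg G) (Cod (opg G) x)"
    using assms minv_props[OF assms] by (simp add: hom_def)
  fix y assume "y \<in> hom (opg G) (Cod (opg G) x) (Dom (opg G) x) \<and>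
      x \<cdot>\<^bsub>opg G\<^esub> y = Idn (opg G) (Dom (opg G) x) \<and> y \<cdot>\<^bsub>opg G\<^esub> x = Idn (opg G) (Cod (opg G) x)"
  then show "y = minv G x" using minv_unique[OF assms, of y] assms by (auto simp: hom_def)
qed

lemma opg_ordered_groupoid: "ordered_groupoid (opg G)"
  unfolding ordered_groupoid_def opg_simps(1-6)
proof (intro conjI og_axioms)
  show "groupoid (opg G)"
    unfolding groupoid_def
  proof (intro conjI ballI opg_category)
    fix x assume "x \<in> Mor (opg G)"
    then have x: "x \<in> Mor G" by simp
    show "is_iso (opg G) x"
      by (rule is_isoI[OF opg_category, of x "Cod G x" "Dom G x" "minv G x"])
        (use x minv_props[OF x] in \<open>simp_all add: hom_def\<close>)
  qed
  show "\<forall>u v x y. u \<preceq> x \<and> v \<preceq> y \<and> Dom G u = Cod G v \<and> Dom G x = Cod G y \<longrightarrow> u \<cdot>\<^bsub>opg G\<^esub> v \<preceq> x \<cdot>\<^bsub>opg G\<^esub> y"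
  proof clarify
    fix u v x y assume a: "u \<preceq> x" "v \<preceq> y" "Dom G u = Cod G v" "Dom G x = Cod G y"
    have "u \<in> Mor G" "v \<in> Mor G" "x \<in> Mor G" "y \<in> Mor G" using le_Mor a(1,2) by blast+
    then show "u \<cdot>\<^bsub>opg G\<^esub> v \<preceq> x \<cdot>\<^bsub>opg G\<^esub> y" using a le_cmp[OF a(2,1)] by simp
  qed
  show "\<forall>x y. x \<preceq> y \<longrightarrow> minv (opg G) x \<preceq> minv (opg G) y"
    using le_Mor le_minv opg_minv by metis
  show "\<forall>x\<in>Mor G. \<forall>e\<in>Obj G. vle (opg G) e (Cod G x) \<longrightarrow> (\<exists>!y. y \<preceq> x \<and> Cod G y = e)"
    "\<forall>x\<in>Mor G. \<forall>f\<in>Obj G. vle (opg G) f (Dom G x) \<longrightarrow> (\<exists>!y. y \<preceq> x \<and> Dom G y = f)"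
    using og_axioms(8,9) by (simp_all add: vle_def)
qed

end

section \<open>Inductive groupoids through their evaluation on two-element chains\<close>

text \<open>
  An inductive groupoid enters the construction of the semigroup and of the two categories only through the
  evaluations \<open>\<epsilon>(e,f)\<close> of two-element chains. The locale collects the properties of
  these evaluations, in a form that also holds for the opposite groupoid. The axioms (IG1) are stated for
  morphisms \<open>u, v\<close> below \<open>x\<close>, which stand for its restrictions to their domains.
\<close>

locale ind_gpd =
  fixes X :: "('e, 'm) indgpd"
  assumes reg: "regular_biordered_set (igb X)"
    and ordg: "ordered_groupoid (igg X)"
    and ObjG: "Obj (igg X) = carr (igb X)"
    and vle_iff: "e \<in> carr (igb X) \<Longrightarrow> f \<in> carr (igb X) \<Longrightarrow> vle (igg X) e f \<longleftrightarrow> nle (igb X) e f"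
    and eps_hom: "Req (igb X) e f \<or> Leq (igb X) e f \<Longrightarrow> eps X e f \<in> hom (igg X) e f"
    and eps_id: "e \<in> carr (igb X) \<Longrightarrow> eps X e e = Idn (igg X) e"
    and eps_R: "Req (igb X) e f \<Longrightarrow> Req (igb X) f g \<Longrightarrow> eps X e f \<cdot>\<^bsub>igg X\<^esub> eps X f g = eps X e g"
    and eps_L: "Leq (igb X) e f \<Longrightarrow> Leq (igb X) f g \<Longrightarrow> eps X e f \<cdot>\<^bsub>igg X\<^esub> eps X f g = eps X e g"
    and eps_le_L: "Leq (igb X) e f \<Longrightarrow> nle (igb X) g e \<Longrightarrow> (eps X g (f \<odot>\<^bsub>igb X\<^esub> g), eps X e f) \<in> ole (igg X)"
    and eps_le_R: "Req (igb X) e f \<Longrightarrow> nle (igb X) g e \<Longrightarrow> (eps X g (g \<odot>\<^bsub>igb X\<^esub> f), eps X e f) \<in> ole (igg X)"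
    and IG1_r: "u \<in> Mor (igg X) \<Longrightarrow> v \<in> Mor (igg X) \<Longrightarrow> (u, x) \<in> ole (igg X) \<Longrightarrow> (v, x) \<in> ole (igg X) \<Longrightarrow>
       rle (igb X) (Dom (igg X) u) (Dom (igg X) v) \<Longrightarrow> rle (igb X) (Cod (igg X) u) (Cod (igg X) v) \<and>
       eps X (Dom (igg X) u) (Dom (igg X) u \<odot>\<^bsub>igb X\<^esub> Dom (igg X) v) \<cdot>\<^bsub>igg X\<^esub>
           restr_dom (igg X) (Dom (igg X) u \<odot>\<^bsub>igb X\<^esub> Dom (igg X) v) x
         = u \<cdot>\<^bsub>igg X\<^esub> eps X (Cod (igg X) u) (Cod (igg X) u \<odot>\<^bsub>igb X\<^esub> Cod (igg X) v)"
    and IG1_l: "u \<in> Mor (igg X) \<Longrightarrow> v \<in> Mor (igg X) \<Longrightarrow> (u, x) \<in> ole (igg X) \<Longrightarrow> (v, x) \<in> ole (igg X) \<Longrightarrow>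
       lle (igb X) (Dom (igg X) u) (Dom (igg X) v) \<Longrightarrow> lle (igb X) (Cod (igg X) u) (Cod (igg X) v) \<and>
       eps X (Dom (igg X) u) (Dom (igg X) v \<odot>\<^bsub>igb X\<^esub> Dom (igg X) u) \<cdot>\<^bsub>igg X\<^esub>
           restr_dom (igg X) (Dom (igg X) v \<odot>\<^bsub>igb X\<^esub> Dom (igg X) u) x
         = u \<cdot>\<^bsub>igg X\<^esub> eps X (Cod (igg X) u) (Cod (igg X) v \<odot>\<^bsub>igb X\<^esub> Cod (igg X) u)"
    and IG2_row: "lle (igb X) g e \<Longrightarrow> lle (igb X) h e \<Longrightarrow> Req (igb X) g h \<Longrightarrow>
       eps X g h \<cdot>\<^bsub>igg X\<^esub> eps X h (e \<odot>\<^bsub>igb X\<^esub> h)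
         = eps X g (e \<odot>\<^bsub>igb X\<^esub> g) \<cdot>\<^bsub>igg X\<^esub> eps X (e \<odot>\<^bsub>igb X\<^esub> g) (e \<odot>\<^bsub>igb X\<^esub> h)"
    and IG2_col: "rle (igb X) g e \<Longrightarrow> rle (igb X) h e \<Longrightarrow> Leq (igb X) g h \<Longrightarrow>
       eps X g h \<cdot>\<^bsub>igg X\<^esub> eps X h (h \<odot>\<^bsub>igb X\<^esub> e)
         = eps X g (g \<odot>\<^bsub>igb X\<^esub> e) \<cdot>\<^bsub>igg X\<^esub> eps X (g \<odot>\<^bsub>igb X\<^esub> e) (h \<odot>\<^bsub>igb X\<^esub> e)"

sublocale ind_gpd \<subseteq> biordered "igb X"
  by unfold_locales (use reg in \<open>simp add: regular_biordered_set_def\<close>)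

sublocale ind_gpd \<subseteq> ordered_gpd "igg X"
  by unfold_locales (rule ordg)

context ind_gpd
begin

abbreviation "E \<equiv> igb X"
abbreviation "G \<equiv> igg X"
abbreviation "\<epsilon> \<equiv> eps X"
abbreviation "dm \<equiv> Dom (igg X)"
abbreviation "rg \<equiv> Cod (igg X)"
abbreviation leG (infix "\<preceq>" 50) where "u \<preceq> x \<equiv> (u, x) \<in> ole (igg X)"
abbreviation bm (infixl "\<star>" 75) where "e \<star> f \<equiv> e \<odot>\<^bsub>igb X\<^esub> f"
abbreviation gm (infixl "\<bullet>" 70) where "x \<bullet> y \<equiv> x \<cdot>\<^bsub>igg X\<^esub> y"

lemma ObjG_iff [simp]: "e \<in> Obj G \<longleftrightarrow> e \<in> carr E" by (simp add: ObjG)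

lemma eps_simps_R [simp]: "Req E e f \<Longrightarrow> \<epsilon> e f \<in> Mor G" "Req E e f \<Longrightarrow> dm (\<epsilon> e f) = e" "Req E e f \<Longrightarrow> rg (\<epsilon> e f) = f"
  using eps_hom[of e f] by (auto simp: hom_def)

lemma eps_simps_L [simp]: "Leq E e f \<Longrightarrow> \<epsilon> e f \<in> Mor G" "Leq E e f \<Longrightarrow> dm (\<epsilon> e f) = e" "Leq E e f \<Longrightarrow> rg (\<epsilon> e f) = f"
  using eps_hom[of e f] by (auto simp: hom_def)

lemma dm_carr [simp]: "x \<in> Mor G \<Longrightarrow> dm x \<in> carr E" and rg_carr [simp]: "x \<in> Mor G \<Longrightarrow> rg x \<in> carr E"
  using DomO CodO by auto

lemma le_dm: "u \<preceq> x \<Longrightarrow> nle E (dm u) (dm x)" and le_rg: "u \<preceq> x \<Longrightarrow> nle E (rg u) (rg x)"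
  using le_dom le_cod vle_iff le_Mor dm_carr rg_carr by blast+

lemma restr_dm:
  assumes "x \<in> Mor G" "nle E e (dm x)"
  shows "restr_dom G e x \<preceq> x" "dm (restr_dom G e x) = e" "restr_dom G e x \<in> Mor G"
proof -
  have "vle G e (dm x)" "e \<in> Obj G" using assms vle_iff nle_carr[OF assms(2)] by auto
  then show "restr_dom G e x \<preceq> x" "dm (restr_dom G e x) = e" using restr_dom[OF assms(1)] by auto
  then show "restr_dom G e x \<in> Mor G" using le_Mor by blast
qed

lemma restr_rg:
  assumes "x \<in> Mor G" "nle E e (rg x)"
  shows "restr_cod G x e \<preceq> x" "rg (restr_cod G x e) = e" "restr_cod G x e \<in> Mor G"
proof -
  have "vle G e (rg x)" "e \<in> Obj G" using assms vle_iff nle_carr[OF assms(2)] by auto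
  then show "restr_cod G x e \<preceq> x" "rg (restr_cod G x e) = e" using restr_cod[OF assms(1)] by auto
  then show "restr_cod G x e \<in> Mor G" using le_Mor by blast
qed

lemma eps_minv_R: "Req E e f \<Longrightarrow> minv G (\<epsilon> e f) = \<epsilon> f e"
  by (rule minv_unique) (use eps_R[of e f e] eps_id[of e] Req_carr[of e f] in \<open>auto simp: Req_sym\<close>)

lemma eps_minv_L: "Leq E e f \<Longrightarrow> minv G (\<epsilon> e f) = \<epsilon> f e"
  by (rule minv_unique) (use eps_L[of e f e] eps_id[of e] Leq_carr[of e f] in \<open>auto simp: Leq_sym\<close>)

end

subsection \<open>The opposite inductive groupoid\<close>

text \<open>
  The opposite biordered set and groupoid, with the same objects. A chain is evaluated in the opposite
  groupoid as the inverse of its old value, which then again runs from its first to its last element.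
\<close>

definition opi :: "('e, 'm) indgpd \<Rightarrow> ('e, 'm) indgpd" where
  "opi X = \<lparr> igb = opb (igb X), igg = opg (igg X), ige = (\<lambda>c. minv (igg X) (ige X c)) \<rparr>"

lemma opi_simps [simp]: "igb (opi X) = opb (igb X)" "igg (opi X) = opg (igg X)"
  by (simp_all add: opi_def)

lemma is_path_opb: "is_path (opb E) = is_path E"
  by (auto simp: is_path_def fun_eq_iff disj_commute)

lemma path_step_opb1: "path_step E p q \<Longrightarrow> path_step (opb E) p q"
proof (induction rule: path_step.induct)
  case (inessential_R p a x b q)
  then show ?case by (intro path_step.inessential_L) (simp_all only: is_path_opb opb_rel)
next
  case (inessential_L p a x b q)
  then show ?case by (intro path_step.inessential_R) (simp_all only: is_path_opb opb_rel)
next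
  case (diagonal e)
  then show ?case by (intro path_step.diagonal) (simp only: is_path_opb)
qed

lemma path_step_opb: "path_step (opb E) p q \<longleftrightarrow> path_step E p q"
proof -
  have "opb (opb E) = E" by (simp add: opb_def)
  then show ?thesis using path_step_opb1[of E p q] path_step_opb1[of "opb E" p q] by auto
qed

lemma eps_opi: "eps (opi X) e f = minv (igg X) (eps X e f)"
proof -
  have "path_step (opb (igb X)) = path_step (igb X)" by (intro ext) (rule path_step_opb)
  then have "echain (opb (igb X)) = echain (igb X)" by (intro ext) (simp only: echain_def)
  then show ?thesis by (simp add: eps_def) (simp add: opi_def)
qed

lemma (in ind_gpd) eps_opi_R: "Req E e f \<Longrightarrow> eps (opi X) e f = \<epsilon> f e"
  and eps_opi_L: "Leq E e f \<Longrightarrow> eps (opi X) e f = \<epsilon> f e"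
  by (simp_all add: eps_opi eps_minv_R eps_minv_L)

text \<open>
  (IG1) for restrictions compared at their codomains. It is (IG1) for the inverse of \<open>x\<close>,
  inverted.
\<close>

lemma (in ind_gpd) IG1_cod:
  assumes "u \<preceq> x" "v \<preceq> x"
  shows "rle E (rg u) (rg v) \<Longrightarrow> rle E (dm u) (dm v) \<and>
      restr_cod G x (rg u \<star> rg v) \<bullet> \<epsilon> (rg u \<star> rg v) (rg u) = \<epsilon> (dm u \<star> dm v) (dm u) \<bullet> u"
    and "lle E (rg u) (rg v) \<Longrightarrow> lle E (dm u) (dm v) \<and>
      restr_cod G x (rg v \<star> rg u) \<bullet> \<epsilon> (rg v \<star> rg u) (rg u) = \<epsilon> (dm v \<star> dm u) (dm u) \<bullet> u"
proof -
  have m: "u \<in> Mor G" "v \<in> Mor G" "x \<in> Mor G" using le_Mor assms by auto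
  have i: "minv G u \<preceq> minv G x" "minv G v \<preceq> minv G x" using le_minv assms by auto
  have rd: "restr_dom G e (minv G x) = minv G (restr_cod G x e)" if "nle E e (rg x)" for e
    by (rule restr_dom_eq) (use restr_rg[OF m(3) that] le_minv in auto)
  show "rle E (dm u) (dm v) \<and>
      restr_cod G x (rg u \<star> rg v) \<bullet> \<epsilon> (rg u \<star> rg v) (rg u) = \<epsilon> (dm u \<star> dm v) (dm u) \<bullet> u"
    if r: "rle E (rg u) (rg v)"
  proof -
    note * = IG1_r[OF _ _ i, simplified minv_simps[OF m(1)] minv_simps[OF m(2)], OF TrueI TrueI r]
    have R: "Req E (rg u) (rg u \<star> rg v)" "Req E (dm u) (dm u \<star> dm v)" using B2r(1)[OF r] B2r(1)[of "dm u" "dm v"] * by auto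
    have n: "nle E (rg u \<star> rg v) (rg x)" using nle_trans[OF B2r(2)[OF r] le_rg[OF assms(2)]] .
    note w = restr_rg[OF m(3) n]
    have "minv G (\<epsilon> (rg u) (rg u \<star> rg v) \<bullet> minv G (restr_cod G x (rg u \<star> rg v)))
        = minv G (minv G u \<bullet> \<epsilon> (dm u) (dm u \<star> dm v))"
      using * rd[OF n] by simp
    then have "restr_cod G x (rg u \<star> rg v) \<bullet> \<epsilon> (rg u \<star> rg v) (rg u) = \<epsilon> (dm u \<star> dm v) (dm u) \<bullet> u"
      using R w m by (simp add: minv_cmp eps_minv_R)
    then show ?thesis using * by simp
  qed
  show "lle E (dm u) (dm v) \<and>
      restr_cod G x (rg v \<star> rg u) \<bullet> \<epsilon> (rg v \<star> rg u) (rg u) = \<epsilon> (dm v \<star> dm u) (dm u) \<bullet> u"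
    if r: "lle E (rg u) (rg v)"
  proof -
    note * = IG1_l[OF _ _ i, simplified minv_simps[OF m(1)] minv_simps[OF m(2)], OF TrueI TrueI r]
    have R: "Leq E (rg u) (rg v \<star> rg u)" "Leq E (dm u) (dm v \<star> dm u)" using B2l(1)[OF r] B2l(1)[of "dm u" "dm v"] * by auto
    have n: "nle E (rg v \<star> rg u) (rg x)" using nle_trans[OF B2l(2)[OF r] le_rg[OF assms(2)]] .
    note w = restr_rg[OF m(3) n]
    have "minv G (\<epsilon> (rg u) (rg v \<star> rg u) \<bullet> minv G (restr_cod G x (rg v \<star> rg u)))
        = minv G (minv G u \<bullet> \<epsilon> (dm u) (dm v \<star> dm u))"
      using * rd[OF n] by simp
    then have "restr_cod G x (rg v \<star> rg u) \<bullet> \<epsilon> (rg v \<star> rg u) (rg u) = \<epsilon> (dm v \<star> dm u) (dm u) \<bullet> u"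
      using R w m by (simp add: minv_cmp eps_minv_L)
    then show ?thesis using * by simp
  qed
qed

lemma (in ind_gpd) ind_gpd_opi: "ind_gpd (opi X)"
proof (unfold_locales, unfold opi_simps opb_rel opb_simps)
  show "regular_biordered_set (opb E)" by (rule regular_biordered_set_opb[OF reg])
  show "ordered_groupoid (opg G)" by (rule opg_ordered_groupoid)
  show "Obj (opg G) = carr E" by (simp add: ObjG)
  show "vle (opg G) e f \<longleftrightarrow> nle E e f" if "e \<in> carr E" "f \<in> carr E" for e f
    using vle_iff[OF that] by (simp add: vle_def)
  show "eps (opi X) e f \<in> hom (opg G) e f" if "Leq E e f \<or> Req E e f" for e f
    using that eps_opi_R[of e f] eps_opi_L[of e f] eps_hom[of f e] by (auto simp: opg_hom Leq_sym Req_sym)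
  show "eps (opi X) e e = Idn (opg G) e" if "e \<in> carr E" for e
    using that eps_opi_R[of e e] eps_id[OF that] by (simp add: Req_refl)
  show "eps (opi X) e f \<cdot>\<^bsub>opg G\<^esub> eps (opi X) f g = eps (opi X) e g" if "Leq E e f" "Leq E f g" for e f g
    using that eps_L[of g f e] Leq_trans[OF that] by (simp add: eps_opi_L Leq_sym)
  show "eps (opi X) e f \<cdot>\<^bsub>opg G\<^esub> eps (opi X) f g = eps (opi X) e g" if "Req E e f" "Req E f g" for e f g
    using that eps_R[of g f e] Req_trans[OF that] by (simp add: eps_opi_R Req_sym)
  show "(eps (opi X) g (g \<star> f), eps (opi X) e f) \<in> ole (opg G)" if "Req E e f" "nle E g e" for e f g
    using le_minv[OF eps_le_R[OF that]] by (simp add: eps_opi)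
  show "(eps (opi X) g (f \<star> g), eps (opi X) e f) \<in> ole (opg G)" if "Leq E e f" "nle E g e" for e f g
    using le_minv[OF eps_le_L[OF that]] by (simp add: eps_opi)
  show "lle E (Cod (opg G) u) (Cod (opg G) v) \<and>
       eps (opi X) (Dom (opg G) u) (Dom (opg G) v \<star> Dom (opg G) u) \<cdot>\<^bsub>opg G\<^esub>
         restr_dom (opg G) (Dom (opg G) v \<star> Dom (opg G) u) x
       = u \<cdot>\<^bsub>opg G\<^esub> eps (opi X) (Cod (opg G) u) (Cod (opg G) v \<star> Cod (opg G) u)"
    if a: "u \<in> Mor (opg G)" "v \<in> Mor (opg G)" "(u, x) \<in> ole (opg G)" "(v, x) \<in> ole (opg G)"
      "lle E (Dom (opg G) u) (Dom (opg G) v)" for u v x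
  proof -
    have b: "u \<preceq> x" "v \<preceq> x" "lle E (rg u) (rg v)" "u \<in> Mor G" "x \<in> Mor G" using a le_Mor by auto
    note c = IG1_cod(2)[OF b(1,2,3)]
    have L: "Leq E (rg u) (rg v \<star> rg u)" "Leq E (dm u) (dm v \<star> dm u)" using B2l(1) b(3) c by auto
    note w = restr_rg[OF b(5) nle_trans[OF B2l(2)[OF b(3)] le_rg[OF b(2)]]]
    show ?thesis using c L w b(4) by (simp add: eps_opi_L Leq_sym)
  qed
  show "rle E (Cod (opg G) u) (Cod (opg G) v) \<and>
       eps (opi X) (Dom (opg G) u) (Dom (opg G) u \<star> Dom (opg G) v) \<cdot>\<^bsub>opg G\<^esub>
         restr_dom (opg G) (Dom (opg G) u \<star> Dom (opg G) v) x
       = u \<cdot>\<^bsub>opg G\<^esub> eps (opi X) (Cod (opg G) u) (Cod (opg G) u \<star> Cod (opg G) v)"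
    if a: "u \<in> Mor (opg G)" "v \<in> Mor (opg G)" "(u, x) \<in> ole (opg G)" "(v, x) \<in> ole (opg G)"
      "rle E (Dom (opg G) u) (Dom (opg G) v)" for u v x
  proof -
    have b: "u \<preceq> x" "v \<preceq> x" "rle E (rg u) (rg v)" "u \<in> Mor G" "x \<in> Mor G" using a le_Mor by auto
    note c = IG1_cod(1)[OF b(1,2,3)]
    have L: "Req E (rg u) (rg u \<star> rg v)" "Req E (dm u) (dm u \<star> dm v)" using B2r(1) b(3) c by auto
    note w = restr_rg[OF b(5) nle_trans[OF B2r(2)[OF b(3)] le_rg[OF b(2)]]]
    show ?thesis using c L w b(4) by (simp add: eps_opi_R Req_sym)
  qed
  show "eps (opi X) g h \<cdot>\<^bsub>opg G\<^esub> eps (opi X) h (h \<star> e)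
         = eps (opi X) g (g \<star> e) \<cdot>\<^bsub>opg G\<^esub> eps (opi X) (g \<star> e) (h \<star> e)"
    if a: "rle E g e" "rle E h e" "Leq E g h" for g e h
  proof -
    note R = B2r(1)[OF a(1)] B2r(1)[OF a(2)]
    have L: "Leq E (g \<star> e) (h \<star> e)" using B3r(1)[OF a(1,2)] B3r(1)[OF a(2,1)] a(3) by (simp add: Leq_def)
    show ?thesis using arg_cong[OF IG2_col[OF a], of "minv G"] R L a(3)
      by (simp add: eps_opi minv_cmp)
  qed
  show "eps (opi X) g h \<cdot>\<^bsub>opg G\<^esub> eps (opi X) h (e \<star> h)
         = eps (opi X) g (e \<star> g) \<cdot>\<^bsub>opg G\<^esub> eps (opi X) (e \<star> g) (e \<star> h)"
    if a: "lle E g e" "lle E h e" "Req E g h" for g e h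
  proof -
    note L = B2l(1)[OF a(1)] B2l(1)[OF a(2)]
    have R: "Req E (e \<star> g) (e \<star> h)" using B3l(1)[OF a(1,2)] B3l(1)[OF a(2,1)] a(3) by (simp add: Req_def)
    show ?thesis using arg_cong[OF IG2_row[OF a], of "minv G"] R L a(3)
      by (simp add: eps_opi minv_cmp)
  qed
qed

section \<open>Evaluation of chains\<close>

context biordered
begin

lemma path_stepD:
  assumes "path_step E p q"
  shows "is_path E p" "is_path E q" "hd p = hd q" "last p = last q"
proof -
  have "is_path E p \<and> is_path E q \<and> hd p = hd q \<and> last p = last q"
    using assms
  proof (induction rule: path_step.induct)
    case (inessential_R p a x b q)
    then have "Req E a b" using Req_trans by blast
    with inessential_R have "is_path E (p @ [a, b] @ q)"
      by (cases q) (auto simp: is_path_def successively_append_iff)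
    moreover have "hd (p @ [a, x, b] @ q) = hd (p @ [a, b] @ q)" by (cases p) simp_all
    ultimately show ?case using inessential_R by simp
  next
    case (inessential_L p a x b q)
    then have "Leq E a b" using Leq_trans by blast
    with inessential_L have "is_path E (p @ [a, b] @ q)"
      by (cases q) (auto simp: is_path_def successively_append_iff)
    moreover have "hd (p @ [a, x, b] @ q) = hd (p @ [a, b] @ q)" by (cases p) simp_all
    ultimately show ?case using inessential_L by simp
  next
    case (diagonal e)
    then show ?case by (auto simp: is_path_def)
  qed
  then show "is_path E p" "is_path E q" "hd p = hd q" "last p = last q" by auto
qed

lemma path_equivD:
  assumes "equivclp (path_step E) p q" "is_path E p"
  shows "is_path E q \<and> hd p = hd q \<and> last p = last q"
  using assms(1)
proof (induction rule: equivclp_induct)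
  case base
  then show ?case using assms(2) by simp
next
  case (step y z)
  then show ?case using path_stepD[of y z] path_stepD[of z y] by metis
qed

lemma echain_eq_iff: "echain E p = echain E q \<longleftrightarrow> equivclp (path_step E) p q"
proof
  assume "echain E p = echain E q"
  moreover have "q \<in> echain E q" by (simp add: echain_def)
  ultimately have "q \<in> echain E p" by simp
  then show "equivclp (path_step E) p q" by (simp add: echain_def)
next
  assume "equivclp (path_step E) p q"
  then show "echain E p = echain E q"
    unfolding echain_def by (intro Collect_cong) (metis equivclp_trans equivclp_sym)
qed

text \<open>
  Contracting \<open>(e,e)\<close> to \<open>(e)\<close> is a step only for this path; inside a longer path
  the repetition of \<open>e\<close> is an inessential element.
\<close>

lemma path_step_append:
  assumes "path_step E p p'" "is_path E (p @ r)"
  shows "equivclp (path_step E) (p @ r) (p' @ r)"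
  using assms
proof (induction rule: path_step.induct)
  case (inessential_R p a x b q)
  then have "path_step E (p @ [a, x, b] @ (q @ r)) (p @ [a, b] @ (q @ r))"
    by (intro path_step.inessential_R) simp_all
  from r_into_equivclp[where r="path_step E", OF this] show ?case by simp
next
  case (inessential_L p a x b q)
  then have "path_step E (p @ [a, x, b] @ (q @ r)) (p @ [a, b] @ (q @ r))"
    by (intro path_step.inessential_L) simp_all
  from r_into_equivclp[where r="path_step E", OF this] show ?case by simp
next
  case (diagonal e)
  show ?case
  proof (cases r)
    case Nil
    then show ?thesis using r_into_equivclp[where r="path_step E", OF path_step.diagonal[OF diagonal(1)]] by simp
  next
    case (Cons b q)
    have e: "e \<in> carr E" using diagonal(1) by (simp add: is_path_def)
    have p: "is_path E ([] @ [e, e, b] @ q)" using diagonal(2) Cons by simp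
    then have "Req E e b \<or> Leq E e b" by (simp add: is_path_def)
    then have "path_step E ([] @ [e, e, b] @ q) ([] @ [e, b] @ q)"
      using path_step.inessential_R[OF p] path_step.inessential_L[OF p] Req_refl[OF e] Leq_refl[OF e] by blast
    from r_into_equivclp[where r="path_step E", OF this] show ?thesis using Cons by simp
  qed
qed

lemma path_step_prepend:
  assumes "path_step E p p'" "is_path E (r @ tl p)" "r \<noteq> []" "last r = hd p"
  shows "equivclp (path_step E) (r @ tl p) (r @ tl p')"
  using assms
proof (induction rule: path_step.induct)
  case (inessential_R p a x b q)
  show ?case
  proof (cases p)
    case Nil
    define r0 where "r0 = butlast r"
    have r: "r = r0 @ [a]" using inessential_R(5,6) Nil by (auto simp: r0_def)
    have "path_step E (r0 @ [a, x, b] @ q) (r0 @ [a, b] @ q)"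
      by (intro path_step.inessential_R) (use inessential_R Nil r in simp_all)
    from r_into_equivclp[where r="path_step E", OF this] show ?thesis using Nil r by simp
  next
    case (Cons c p0)
    have "path_step E ((r @ p0) @ [a, x, b] @ q) ((r @ p0) @ [a, b] @ q)"
      by (intro path_step.inessential_R) (use inessential_R Cons in simp_all)
    from r_into_equivclp[where r="path_step E", OF this] show ?thesis using Cons by simp
  qed
next
  case (inessential_L p a x b q)
  show ?case
  proof (cases p)
    case Nil
    define r0 where "r0 = butlast r"
    have r: "r = r0 @ [a]" using inessential_L(5,6) Nil by (auto simp: r0_def)
    have "path_step E (r0 @ [a, x, b] @ q) (r0 @ [a, b] @ q)"
      by (intro path_step.inessential_L) (use inessential_L Nil r in simp_all)
    from r_into_equivclp[where r="path_step E", OF this] show ?thesis using Nil r by simp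
  next
    case (Cons c p0)
    have "path_step E ((r @ p0) @ [a, x, b] @ q) ((r @ p0) @ [a, b] @ q)"
      by (intro path_step.inessential_L) (use inessential_L Cons in simp_all)
    from r_into_equivclp[where r="path_step E", OF this] show ?thesis using Cons by simp
  qed
next
  case (diagonal e)
  define r0 where "r0 = butlast r"
  have r: "r = r0 @ [e]" using diagonal(3,4) by (auto simp: r0_def)
  have e: "e \<in> carr E" using diagonal(1) by (simp add: is_path_def)
  show ?case
  proof (cases r0 rule: rev_cases)
    case Nil
    then show ?thesis using r_into_equivclp[where r="path_step E", OF path_step.diagonal[OF diagonal(1)]] r by simp
  next
    case (snoc r1 y)
    have p: "is_path E (r1 @ [y, e, e] @ [])" using diagonal(2) r snoc by simp
    then have "Req E y e \<or> Leq E y e" by (simp add: is_path_def successively_append_iff)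
    then have "path_step E (r1 @ [y, e, e] @ []) (r1 @ [y, e] @ [])"
      using path_step.inessential_R[OF p] path_step.inessential_L[OF p] Req_refl[OF e] Leq_refl[OF e] by blast
    from r_into_equivclp[where r="path_step E", OF this] show ?thesis using r snoc by simp
  qed
qed

lemma is_path_join: "is_path E p \<Longrightarrow> is_path E q \<Longrightarrow> last p = hd q \<Longrightarrow> is_path E (p @ tl q)"
  by (cases q; cases "tl q") (auto simp: is_path_def successively_append_iff)

lemma path_equiv_join:
  assumes "equivclp (path_step E) p p'" "equivclp (path_step E) q q'"
    "is_path E p" "is_path E q" "last p = hd q"
  shows "equivclp (path_step E) (p @ tl q) (p' @ tl q')"
proof -
  have 1: "equivclp (path_step E) (p @ tl q) (p' @ tl q) \<and> is_path E p' \<and> last p = last p'"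
    using assms(1)
  proof (induction rule: equivclp_induct)
    case base
    then show ?case using assms(3) by simp
  next
    case (step y z)
    note h = step(3)
    have z: "is_path E z \<and> last y = last z" using step(2) path_stepD[of y z] path_stepD[of z y] by metis
    have "is_path E (y @ tl q)" "is_path E (z @ tl q)"
      using is_path_join[of y q] is_path_join[of z q] z h assms(4,5) by auto
    then have "equivclp (path_step E) (y @ tl q) (z @ tl q)"
      using step(2) path_step_append[of y z] path_step_append[of z y] equivclp_sym by metis
    then show ?case using h z equivclp_trans by metis
  qed
  have "equivclp (path_step E) (p' @ tl q) (p' @ tl q') \<and> is_path E q' \<and> hd q = hd q'"
    using assms(2)
  proof (induction rule: equivclp_induct)
    case base
    then show ?case using assms(4) by simp
  next
    case (step y z)
    note h = step(3)
    have z: "is_path E z \<and> hd y = hd z" using step(2) path_stepD[of y z] path_stepD[of z y] by metis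
    have p': "p' \<noteq> []" using 1 by (auto simp: is_path_def)
    have l: "last p' = hd y" "last p' = hd z" using 1 z h assms(5) by auto
    have "is_path E (p' @ tl y)" "is_path E (p' @ tl z)"
      using is_path_join[of p' y] is_path_join[of p' z] z h 1 assms(5) l by auto
    then have "equivclp (path_step E) (p' @ tl y) (p' @ tl z)"
      using step(2) path_step_prepend[of y z p', OF _ _ p' l(1)] path_step_prepend[of z y p', OF _ _ p' l(2)] equivclp_sym
      by metis
    then show ?case using h z equivclp_trans by metis
  qed
  then show ?thesis using 1 equivclp_trans by metis
qed

lemma chain_rep:
  assumes "is_path E p"
  defines "r \<equiv> SOME q. q \<in> echain E p"
  shows "equivclp (path_step E) p r" "is_path E r" "hd r = hd p" "last r = last p"
proof -
  have "p \<in> echain E p" by (simp add: echain_def)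
  then have "r \<in> echain E p" unfolding r_def by (rule someI)
  then show "equivclp (path_step E) p r" by (simp add: echain_def)
  from path_equivD[OF this assms(1)] show "is_path E r" "hd r = hd p" "last r = last p" by auto
qed

text \<open>
  Composition in the chain groupoid is computed on arbitrary representatives, the common endpoint being
  written once.
\<close>

lemma chain_groupoid_facts:
  assumes "is_path E p"
  shows "echain E p \<in> hom (chain_groupoid E) (hd p) (last p)"
    and "is_path E q \<Longrightarrow> last p = hd q \<Longrightarrow>
      echain E p \<cdot>\<^bsub>chain_groupoid E\<^esub> echain E q = echain E (p @ tl q)"
proof -
  show "echain E p \<in> hom (chain_groupoid E) (hd p) (last p)"
    using assms chain_rep[OF assms] by (auto simp: hom_def chain_groupoid_def Let_def)
  assume q: "is_path E q" "last p = hd q"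
  let ?r = "\<lambda>p. SOME q. q \<in> echain E p"
  have "echain E p \<cdot>\<^bsub>chain_groupoid E\<^esub> echain E q = echain E (?r p @ tl (?r q))"
    using assms q chain_rep[OF assms] chain_rep[OF q(1)] by (auto simp: chain_groupoid_def Let_def)
  also have "\<dots> = echain E (p @ tl q)"
    using path_equiv_join[OF chain_rep(1)[OF assms] chain_rep(1)[OF q(1)] assms q] by (metis echain_eq_iff)
  finally show "echain E p \<cdot>\<^bsub>chain_groupoid E\<^esub> echain E q = echain E (p @ tl q)" .
qed

lemma chain_le:
  assumes "is_path E p" "is_path E q" "nle E (hd p) (hd q)" "descend E (hd p) (tl q) = p"
  shows "(echain E p, echain E q) \<in> ole (chain_groupoid E)"
proof -
  have "\<exists>p' q'. (echain E p, echain E q) = (echain E p', echain E q') \<and> is_path E p' \<and> is_path E q' \<and>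
      nle E (hd p') (hd q') \<and> echain E p' = echain E (descend E (hd p') (tl q'))"
    using assms by (intro exI[of _ p] exI[of _ q]) simp
  then show ?thesis by (simp only: chain_groupoid_def Let_def ogpd.select_convs mem_Collect_eq)
qed

lemma is_path_pair: "Req E e f \<or> Leq E e f \<Longrightarrow> is_path E [e, f]"
  using Req_carr Leq_carr by (auto simp: is_path_def)

end

text \<open>
  The evaluation functor turns identities between chains of length two and three, and the order on chains,
  into the properties of \<open>\<epsilon>(e,f)\<close>.
\<close>

lemma ind_gpd_of_inductive:
  assumes X: "inductive_groupoid X"
  shows "ind_gpd X"
proof -
  note x = inductive_groupoidD[OF X]
  let ?E = "igb X" and ?G = "igg X" and ?C = "chain_groupoid (igb X)"
  let ?F = "\<lparr> FO = (\<lambda>e\<in>carr ?E. e), FM = ige X \<rparr>"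
  interpret biordered ?E by unfold_locales (rule x(2))
  interpret ordered_gpd ?G by unfold_locales (rule x(3))
  have vi: "is_functor ?C ?G ?F" "order_preserving ?C ?G ?F"
    "\<And>e f. e \<in> Obj ?C \<Longrightarrow> f \<in> Obj ?C \<Longrightarrow> vle ?C e f \<longleftrightarrow> vle ?G (FO ?F e) (FO ?F f)"
    using x(5) unfolding v_isomorphism_def by blast+
  have ObjC: "Obj ?C = carr ?E" by (simp add: chain_groupoid_def Let_def)
  have eh: "eps X e f \<in> hom ?G e f" if "Req ?E e f \<or> Leq ?E e f" for e f
  proof -
    have "ige X (echain ?E [e, f]) \<in> hom ?G (FO ?F e) (FO ?F f)"
      using func_hom[OF vi(1) chain_groupoid_facts(1)[OF is_path_pair[OF that]]] by simp
    moreover have "e \<in> carr ?E" "f \<in> carr ?E" using that Req_carr Leq_carr by blast+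
    ultimately show ?thesis by (simp add: eps_def)
  qed
  have eid: "eps X e e = Idn ?G e" if e: "e \<in> carr ?E" for e
  proof -
    have "path_step ?E [e, e] [e]" using is_path_pair[of e e] Req_refl[OF e] by (intro path_step.diagonal) blast
    from r_into_equivclp[where r="path_step ?E", OF this] have "echain ?E [e, e] = echain ?E [e]" unfolding echain_eq_iff by simp
    moreover have "ige X (Idn ?C e) = Idn ?G e" using func_id[OF vi(1)] e ObjC by auto
    ultimately show ?thesis using e by (simp add: eps_def chain_groupoid_def Let_def)
  qed
  have etr: "eps X e f \<cdot>\<^bsub>?G\<^esub> eps X f g = eps X e g"
    if r: "Req ?E e f \<and> Req ?E f g \<or> Leq ?E e f \<and> Leq ?E f g" for e f g
  proof -
    have ef: "is_path ?E [e, f]" "is_path ?E [f, g]" using r by (auto intro: is_path_pair)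
    have efg: "is_path ?E ([] @ [e, f, g] @ [])" using is_path_join[OF ef] by simp
    have "path_step ?E ([] @ [e, f, g] @ []) ([] @ [e, g] @ [])"
      using r path_step.inessential_R[OF efg] path_step.inessential_L[OF efg] by blast
    from r_into_equivclp[where r="path_step ?E", OF this] have "echain ?E [e, f, g] = echain ?E [e, g]" unfolding echain_eq_iff by simp
    then show ?thesis
      using func_cmp[OF vi(1) chain_groupoid_facts(1)[OF ef(1)], of "echain ?E [f, g]" g]
        chain_groupoid_facts(1)[OF ef(2)] chain_groupoid_facts(2)[OF ef] by (simp add: eps_def)
  qed
  have ele: "(eps X g h, eps X e f) \<in> ole ?G"
    if r: "Req ?E e f \<or> Leq ?E e f" and gh: "Req ?E g h \<or> Leq ?E g h" and n: "nle ?E g e"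
      and h: "h = (f \<odot>\<^bsub>?E\<^esub> g) \<odot>\<^bsub>?E\<^esub> f" for e f g h
  proof -
    have "(echain ?E [g, h], echain ?E [e, f]) \<in> ole ?C"
      using is_path_pair[OF r] is_path_pair[OF gh] n h
      by (intro chain_le) simp_all
    then show ?thesis using vi(2) unfolding order_preserving_def eps_def by fastforce
  qed
  have IG1: "\<forall>x\<in>Mor ?G. \<forall>e1 e2 f1 f2. nle ?E e1 (Dom ?G x) \<and> nle ?E e2 (Dom ?G x) \<and>
        f1 = Cod ?G (restr_dom ?G e1 x) \<and> f2 = Cod ?G (restr_dom ?G e2 x) \<longrightarrow>
        (rle ?E e1 e2 \<longrightarrow> rle ?E f1 f2 \<and>
           eps X e1 (e1 \<odot>\<^bsub>?E\<^esub> e2) \<cdot>\<^bsub>?G\<^esub> restr_dom ?G (e1 \<odot>\<^bsub>?E\<^esub> e2) x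
           = restr_dom ?G e1 x \<cdot>\<^bsub>?G\<^esub> eps X f1 (f1 \<odot>\<^bsub>?E\<^esub> f2)) \<and>
        (lle ?E e1 e2 \<longrightarrow> lle ?E f1 f2 \<and>
           eps X e1 (e2 \<odot>\<^bsub>?E\<^esub> e1) \<cdot>\<^bsub>?G\<^esub> restr_dom ?G (e2 \<odot>\<^bsub>?E\<^esub> e1) x
           = restr_dom ?G e1 x \<cdot>\<^bsub>?G\<^esub> eps X f1 (f2 \<odot>\<^bsub>?E\<^esub> f1))"
    and IG2: "\<forall>e f g h. singular_square ?E e f g h \<longrightarrow>
        eps X e f \<cdot>\<^bsub>?G\<^esub> eps X f h = eps X e g \<cdot>\<^bsub>?G\<^esub> eps X g h"
    using X unfolding inductive_groupoid_def Let_def by - (elim conjE, assumption)+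
  have vle: "vle ?G e f \<longleftrightarrow> nle ?E e f" if ef: "e \<in> carr ?E" "f \<in> carr ?E" for e f
  proof -
    have p1: "is_path ?E [e]" if "e \<in> carr ?E" for e using that by (simp add: is_path_def)
    have "vle ?C e f \<longleftrightarrow> (echain ?E [e], echain ?E [f]) \<in> ole ?C"
      using ef by (simp add: vle_def) (simp add: chain_groupoid_def Let_def)
    also have "\<dots> \<longleftrightarrow> nle ?E e f"
    proof
      assume "(echain ?E [e], echain ?E [f]) \<in> ole ?C"
      then obtain p q where pq: "echain ?E [e] = echain ?E p" "echain ?E [f] = echain ?E q" "nle ?E (hd p) (hd q)"
        by (auto simp: chain_groupoid_def Let_def)
      then show "nle ?E e f"
        using path_equivD[OF _ p1[OF ef(1)], of p] path_equivD[OF _ p1[OF ef(2)], of q] by (simp add: echain_eq_iff)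
    next
      assume "nle ?E e f"
      then show "(echain ?E [e], echain ?E [f]) \<in> ole ?C"
        using p1 ef by (intro chain_le) simp_all
    qed
    finally show ?thesis using vi(3)[of e f] ef ObjC by simp
  qed
  have ledm: "nle ?E (Dom ?G u) (Dom ?G v)" if "(u, v) \<in> ole ?G" for u v
    using le_dom[OF that] vle le_Mor[OF that] DomO x(4) by metis
  show ?thesis
  proof unfold_locales
    show "regular_biordered_set ?E" "ordered_groupoid ?G" "Obj ?G = carr ?E" by (fact x)+
    show "\<And>e f. e \<in> carr ?E \<Longrightarrow> f \<in> carr ?E \<Longrightarrow> vle ?G e f = nle ?E e f" by (fact vle)
    show "\<And>e f. Req ?E e f \<or> Leq ?E e f \<Longrightarrow> eps X e f \<in> hom ?G e f" by (fact eh)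
    show "\<And>e. e \<in> carr ?E \<Longrightarrow> eps X e e = Idn ?G e" by (fact eid)
    show "eps X e f \<cdot>\<^bsub>?G\<^esub> eps X f g = eps X e g" if "Req ?E e f" "Req ?E f g" for e f g using etr that by blast
    show "eps X e f \<cdot>\<^bsub>?G\<^esub> eps X f g = eps X e g" if "Leq ?E e f" "Leq ?E f g" for e f g using etr that by blast
    show "(eps X g (f \<odot>\<^bsub>?E\<^esub> g), eps X e f) \<in> ole ?G" if "Leq ?E e f" "nle ?E g e" for e f g
    proof -
      have l: "lle ?E g f" using lle_trans[OF nleD(1)[OF that(2)] LeqD(1)[OF that(1)]] .
      show ?thesis
        by (rule ele[OF disjI2[OF that(1)] disjI2[OF B2l(1)[OF l]] that(2) nle_mul(1)[OF B2l(2)[OF l], symmetric]])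
    qed
    show "(eps X g (g \<odot>\<^bsub>?E\<^esub> f), eps X e f) \<in> ole ?G" if "Req ?E e f" "nle ?E g e" for e f g
    proof -
      have l: "rle ?E g f" using rle_trans[OF nleD(2)[OF that(2)] ReqD(1)[OF that(1)]] .
      have "g \<odot>\<^bsub>?E\<^esub> f = (f \<odot>\<^bsub>?E\<^esub> g) \<odot>\<^bsub>?E\<^esub> f" by (simp only: mul_r[OF l])
      then show ?thesis by (rule ele[OF disjI1[OF that(1)] disjI1[OF B2r(1)[OF l]] that(2)])
    qed
    show "rle ?E (Cod ?G u) (Cod ?G v) \<and>
       eps X (Dom ?G u) (Dom ?G u \<odot>\<^bsub>?E\<^esub> Dom ?G v) \<cdot>\<^bsub>?G\<^esub> restr_dom ?G (Dom ?G u \<odot>\<^bsub>?E\<^esub> Dom ?G v) y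
         = u \<cdot>\<^bsub>?G\<^esub> eps X (Cod ?G u) (Cod ?G u \<odot>\<^bsub>?E\<^esub> Cod ?G v)"
      if "u \<in> Mor ?G" "v \<in> Mor ?G" "(u, y) \<in> ole ?G" "(v, y) \<in> ole ?G" "rle ?E (Dom ?G u) (Dom ?G v)" for u v y
      using IG1[rule_format, of y "Dom ?G u" "Dom ?G v" "Cod ?G u" "Cod ?G v"] ledm[OF that(3)] ledm[OF that(4)]
        restr_dom_eq[OF that(3)] restr_dom_eq[OF that(4)] le_Mor[OF that(3)] that(5) by simp
    show "lle ?E (Cod ?G u) (Cod ?G v) \<and>
       eps X (Dom ?G u) (Dom ?G v \<odot>\<^bsub>?E\<^esub> Dom ?G u) \<cdot>\<^bsub>?G\<^esub> restr_dom ?G (Dom ?G v \<odot>\<^bsub>?E\<^esub> Dom ?G u) y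
         = u \<cdot>\<^bsub>?G\<^esub> eps X (Cod ?G u) (Cod ?G v \<odot>\<^bsub>?E\<^esub> Cod ?G u)"
      if "u \<in> Mor ?G" "v \<in> Mor ?G" "(u, y) \<in> ole ?G" "(v, y) \<in> ole ?G" "lle ?E (Dom ?G u) (Dom ?G v)" for u v y
      using IG1[rule_format, of y "Dom ?G u" "Dom ?G v" "Cod ?G u" "Cod ?G v"] ledm[OF that(3)] ledm[OF that(4)]
        restr_dom_eq[OF that(3)] restr_dom_eq[OF that(4)] le_Mor[OF that(3)] that(5) by simp
    show "eps X g h \<cdot>\<^bsub>?G\<^esub> eps X h (e \<odot>\<^bsub>?E\<^esub> h) = eps X g (e \<odot>\<^bsub>?E\<^esub> g) \<cdot>\<^bsub>?G\<^esub> eps X (e \<odot>\<^bsub>?E\<^esub> g) (e \<odot>\<^bsub>?E\<^esub> h)"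
      if "lle ?E g e" "lle ?E h e" "Req ?E g h" for g e h
    proof -
      have "singular_square ?E g h (e \<odot>\<^bsub>?E\<^esub> g) (e \<odot>\<^bsub>?E\<^esub> h)" unfolding singular_square_def using that by blast
      then show ?thesis using IG2 by blast
    qed
    show "eps X g h \<cdot>\<^bsub>?G\<^esub> eps X h (h \<odot>\<^bsub>?E\<^esub> e) = eps X g (g \<odot>\<^bsub>?E\<^esub> e) \<cdot>\<^bsub>?G\<^esub> eps X (g \<odot>\<^bsub>?E\<^esub> e) (h \<odot>\<^bsub>?E\<^esub> e)"
      if "rle ?E g e" "rle ?E h e" "Leq ?E g h" for g e h
    proof -
      have "singular_square ?E g (g \<odot>\<^bsub>?E\<^esub> e) h (h \<odot>\<^bsub>?E\<^esub> e)" unfolding singular_square_def using that by blast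
      then show ?thesis using IG2 by metis
    qed
  qed
qed

section \<open>The regular semigroup of an inductive groupoid\<close>

definition simP :: "('e, 'm) indgpd \<Rightarrow> 'm \<Rightarrow> 'm \<Rightarrow> bool" where
  "simP X \<alpha> \<beta> \<longleftrightarrow> \<alpha> \<in> Mor (igg X) \<and> \<beta> \<in> Mor (igg X) \<and>
     Req (igb X) (igd X \<alpha>) (igd X \<beta>) \<and> Leq (igb X) (igr X \<alpha>) (igr X \<beta>) \<and>
     \<alpha> \<cdot>\<^bsub>igg X\<^esub> eps X (igr X \<alpha>) (igr X \<beta>) = eps X (igd X \<alpha>) (igd X \<beta>) \<cdot>\<^bsub>igg X\<^esub> \<beta>"

definition pcl :: "('e, 'm) indgpd \<Rightarrow> 'm \<Rightarrow> 'm set" where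
  "pcl X \<alpha> = {\<beta>. simP X \<alpha> \<beta>}"

definition pS :: "('e, 'm) indgpd \<Rightarrow> 'm set set" where
  "pS X = pcl X ` Mor (igg X)"

text \<open>
  Outside the semigroup the value does not depend on \<open>X\<close>; therefore the product of the opposite
  groupoid is the reversed product for all arguments.
\<close>

definition pmul :: "('e, 'm) indgpd \<Rightarrow> 'm set \<Rightarrow> 'm set \<Rightarrow> 'm set" where
  "pmul X A B = (if A \<in> pS X \<and> B \<in> pS X
     then THE C. \<exists>\<alpha>\<in>A. \<exists>\<beta>\<in>B. \<exists>h\<in>sandwich (igb X) (igr X \<alpha>) (igd X \<beta>). C = pcl X (circ X \<alpha> \<beta> h)
     else undefined)"

text \<open>The idempotent of the semigroup that corresponds to \<open>e\<close>.\<close>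

definition ent :: "('e, 'm) indgpd \<Rightarrow> 'e \<Rightarrow> 'm set" where
  "ent X e = pcl X (igone X e)"

context ind_gpd
begin

lemma eps_L': "Leq E e f \<Longrightarrow> Leq E f g \<Longrightarrow> z \<in> Mor G \<Longrightarrow> dm z = g \<Longrightarrow> \<epsilon> e f \<bullet> (\<epsilon> f g \<bullet> z) = \<epsilon> e g \<bullet> z"
  using assoc[of "\<epsilon> e f" "\<epsilon> f g" z] eps_L[of e f g] by simp

lemma eps_R': "Req E e f \<Longrightarrow> Req E f g \<Longrightarrow> z \<in> Mor G \<Longrightarrow> dm z = g \<Longrightarrow> \<epsilon> e f \<bullet> (\<epsilon> f g \<bullet> z) = \<epsilon> e g \<bullet> z"
  using assoc[of "\<epsilon> e f" "\<epsilon> f g" z] eps_R[of e f g] by simp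

lemma eps_R_inv: "Req E e f \<Longrightarrow> z \<in> Mor G \<Longrightarrow> dm z = e \<Longrightarrow> \<epsilon> e f \<bullet> (\<epsilon> f e \<bullet> z) = z"
  using eps_R'[of e f e z] eps_id[of e] Req_carr[of e f] by (simp add: Req_sym)

lemma eps_L_inv: "Leq E e f \<Longrightarrow> z \<in> Mor G \<Longrightarrow> dm z = e \<Longrightarrow> \<epsilon> e f \<bullet> (\<epsilon> f e \<bullet> z) = z"
  using eps_L'[of e f e z] eps_id[of e] Leq_carr[of e f] by (simp add: Leq_sym)

text \<open>
  Replaces one side of a commuting square inside a composite that is bracketed to the right.
\<close>

lemma swap_ext:
  assumes "a \<bullet> b = c \<bullet> d" "a \<in> Mor G" "b \<in> Mor G" "c \<in> Mor G" "d \<in> Mor G" "rg a = dm b" "rg c = dm d"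
    "z \<in> Mor G" "rg b = dm z" "rg d = dm z"
  shows "a \<bullet> (b \<bullet> z) = c \<bullet> (d \<bullet> z)"
proof -
  have "(a \<bullet> b) \<bullet> z = (c \<bullet> d) \<bullet> z" using assms(1) by simp
  then show ?thesis using assms(2-) by simp
qed

lemma simPI: "\<alpha> \<in> Mor G \<Longrightarrow> \<beta> \<in> Mor G \<Longrightarrow> Req E (dm \<alpha>) (dm \<beta>) \<Longrightarrow> Leq E (rg \<alpha>) (rg \<beta>) \<Longrightarrow>
    \<alpha> \<bullet> \<epsilon> (rg \<alpha>) (rg \<beta>) = \<epsilon> (dm \<alpha>) (dm \<beta>) \<bullet> \<beta> \<Longrightarrow> simP X \<alpha> \<beta>"
  by (simp add: simP_def)

lemma simPD:
  assumes "simP X \<alpha> \<beta>"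
  shows "\<alpha> \<in> Mor G" "\<beta> \<in> Mor G" "Req E (dm \<alpha>) (dm \<beta>)" "Leq E (rg \<alpha>) (rg \<beta>)"
    "\<alpha> \<bullet> \<epsilon> (rg \<alpha>) (rg \<beta>) = \<epsilon> (dm \<alpha>) (dm \<beta>) \<bullet> \<beta>" "\<beta> = \<epsilon> (dm \<beta>) (dm \<alpha>) \<bullet> (\<alpha> \<bullet> \<epsilon> (rg \<alpha>) (rg \<beta>))"
proof -
  show *: "\<alpha> \<in> Mor G" "\<beta> \<in> Mor G" "Req E (dm \<alpha>) (dm \<beta>)" "Leq E (rg \<alpha>) (rg \<beta>)"
    "\<alpha> \<bullet> \<epsilon> (rg \<alpha>) (rg \<beta>) = \<epsilon> (dm \<alpha>) (dm \<beta>) \<bullet> \<beta>" using assms unfolding simP_def by auto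
  show "\<beta> = \<epsilon> (dm \<beta>) (dm \<alpha>) \<bullet> (\<alpha> \<bullet> \<epsilon> (rg \<alpha>) (rg \<beta>))"
    unfolding *(5) using eps_R_inv[OF Req_sym[OF *(3)] *(2)] by simp
qed

lemma simP_refl: "\<alpha> \<in> Mor G \<Longrightarrow> simP X \<alpha> \<alpha>"
  by (rule simPI) (simp_all add: Req_refl Leq_refl eps_id)

lemma simP_sym: assumes "simP X \<alpha> \<beta>" shows "simP X \<beta> \<alpha>"
proof (rule simPI)
  note s = simPD[OF assms]
  show "\<beta> \<in> Mor G" "\<alpha> \<in> Mor G" "Req E (dm \<beta>) (dm \<alpha>)" "Leq E (rg \<beta>) (rg \<alpha>)" using s Req_sym Leq_sym by auto
  have "\<beta> \<bullet> \<epsilon> (rg \<beta>) (rg \<alpha>) = \<epsilon> (dm \<beta>) (dm \<alpha>) \<bullet> (\<alpha> \<bullet> (\<epsilon> (rg \<alpha>) (rg \<beta>) \<bullet> \<epsilon> (rg \<beta>) (rg \<alpha>)))"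
    using arg_cong[OF s(6), of "\<lambda>z. z \<bullet> \<epsilon> (rg \<beta>) (rg \<alpha>)"] s(1-4) by (simp add: Req_sym Leq_sym)
  then show "\<beta> \<bullet> \<epsilon> (rg \<beta>) (rg \<alpha>) = \<epsilon> (dm \<beta>) (dm \<alpha>) \<bullet> \<alpha>"
    using eps_L[OF s(4) Leq_sym[OF s(4)]] s(1) by (simp add: eps_id)
qed

lemma simP_trans: assumes "simP X \<alpha> \<beta>" "simP X \<beta> \<gamma>" shows "simP X \<alpha> \<gamma>"
proof (rule simPI)
  note s = simPD[OF assms(1)] and t = simPD[OF assms(2)]
  show "\<alpha> \<in> Mor G" "\<gamma> \<in> Mor G" using s t by auto
  show "Req E (dm \<alpha>) (dm \<gamma>)" "Leq E (rg \<alpha>) (rg \<gamma>)" using Req_trans[OF s(3) t(3)] Leq_trans[OF s(4) t(4)] .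
  have "\<alpha> \<bullet> \<epsilon> (rg \<alpha>) (rg \<gamma>) = \<alpha> \<bullet> (\<epsilon> (rg \<alpha>) (rg \<beta>) \<bullet> \<epsilon> (rg \<beta>) (rg \<gamma>))"
    using eps_L[OF s(4) t(4)] by simp
  also have "\<dots> = \<epsilon> (dm \<alpha>) (dm \<beta>) \<bullet> (\<beta> \<bullet> \<epsilon> (rg \<beta>) (rg \<gamma>))"
    by (rule swap_ext[OF s(5)]) (use s t in simp_all)
  also have "\<dots> = \<epsilon> (dm \<alpha>) (dm \<gamma>) \<bullet> \<gamma>"
    unfolding t(5) by (rule eps_R'[OF s(3) t(3)]) (use t in simp_all)
  finally show "\<alpha> \<bullet> \<epsilon> (rg \<alpha>) (rg \<gamma>) = \<epsilon> (dm \<alpha>) (dm \<gamma>) \<bullet> \<gamma>" .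
qed

lemma pcl_eq: assumes "\<beta> \<in> Mor G" shows "pcl X \<alpha> = pcl X \<beta> \<longleftrightarrow> simP X \<alpha> \<beta>"
proof
  assume "pcl X \<alpha> = pcl X \<beta>"
  moreover have "\<beta> \<in> pcl X \<beta>" using simP_refl[OF assms] by (simp add: pcl_def)
  ultimately have "\<beta> \<in> pcl X \<alpha>" by simp
  then show "simP X \<alpha> \<beta>" by (simp add: pcl_def)
next
  assume "simP X \<alpha> \<beta>"
  then show "pcl X \<alpha> = pcl X \<beta>"
    unfolding pcl_def by (intro Collect_cong) (metis simP_trans simP_sym)
qed

lemma pclI: "simP X \<alpha> \<beta> \<Longrightarrow> pcl X \<alpha> = pcl X \<beta>"
  using pcl_eq simPD(2) by blast

subsection \<open>Restrictions along the two relations\<close>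

text \<open>
  For \<open>\<R>\<close>-related codomains (IG1) takes its symmetric form: restrictions of one morphism
  commute with the evaluations between their ends.
\<close>

lemma restr_Req_rg:
  assumes "a \<preceq> x" "a' \<preceq> x" "Req E (rg a) (rg a')"
  shows "Req E (dm a) (dm a')" "a \<bullet> \<epsilon> (rg a) (rg a') = \<epsilon> (dm a) (dm a') \<bullet> a'"
proof -
  note 1 = IG1_cod(1)[OF assms(1,2) ReqD(1)[OF assms(3)]] and 2 = IG1_cod(1)[OF assms(2,1) ReqD(2)[OF assms(3)]]
  show R: "Req E (dm a) (dm a')" using 1 2 by (simp add: Req_def)
  have "rg a' \<star> rg a = rg a" "dm a' \<star> dm a = dm a"
    using mul_r[OF ReqD(1)[OF assms(3)]] mul_r[OF ReqD(1)[OF R]] .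
  then show "a \<bullet> \<epsilon> (rg a) (rg a') = \<epsilon> (dm a) (dm a') \<bullet> a'" using 2 restr_cod_eq[OF assms(1)] by simp
qed

lemma restr_Leq_rg:
  assumes "a \<preceq> x" "a' \<preceq> x" "Leq E (rg a) (rg a')"
  shows "Leq E (dm a) (dm a')" "a \<bullet> \<epsilon> (rg a) (rg a') = \<epsilon> (dm a) (dm a') \<bullet> a'"
proof -
  note 1 = IG1_cod(2)[OF assms(1,2) LeqD(1)[OF assms(3)]] and 2 = IG1_cod(2)[OF assms(2,1) LeqD(2)[OF assms(3)]]
  show R: "Leq E (dm a) (dm a')" using 1 2 by (simp add: Leq_def)
  have "rg a \<star> rg a' = rg a" "dm a \<star> dm a' = dm a"
    using mul_l[OF LeqD(1)[OF assms(3)]] mul_l[OF LeqD(1)[OF R]] .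
  then show "a \<bullet> \<epsilon> (rg a) (rg a') = \<epsilon> (dm a) (dm a') \<bullet> a'" using 2 restr_cod_eq[OF assms(1)] by simp
qed

lemma restr_Leq_dm:
  assumes "a \<preceq> x" "a' \<preceq> x" "Leq E (dm a) (dm a')"
  shows "Leq E (rg a) (rg a')" "a \<bullet> \<epsilon> (rg a) (rg a') = \<epsilon> (dm a) (dm a') \<bullet> a'"
proof -
  have m: "a \<in> Mor G" "a' \<in> Mor G" using le_Mor assms by auto
  note 1 = IG1_l[OF m assms(1,2) LeqD(1)[OF assms(3)]] and 2 = IG1_l[OF m(2,1) assms(2,1) LeqD(2)[OF assms(3)]]
  show R: "Leq E (rg a) (rg a')" using 1 2 by (simp add: Leq_def)
  show "a \<bullet> \<epsilon> (rg a) (rg a') = \<epsilon> (dm a) (dm a') \<bullet> a'"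
    using restr_Leq_rg(2)[OF assms(1,2) R] .
qed

lemma circ_parts:
  assumes "\<alpha> \<in> Mor G" "\<beta> \<in> Mor G" "h \<in> sandwich E (rg \<alpha>) (dm \<beta>)"
  obtains a b where "a \<preceq> \<alpha>" "b \<preceq> \<beta>" "rg a = rg \<alpha> \<star> h" "dm b = h \<star> dm \<beta>" "a \<in> Mor G" "b \<in> Mor G"
    "Leq E (rg \<alpha> \<star> h) h" "Req E h (h \<star> dm \<beta>)"
    "circ X \<alpha> \<beta> h = a \<bullet> (\<epsilon> (rg \<alpha> \<star> h) h \<bullet> (\<epsilon> h (h \<star> dm \<beta>) \<bullet> b))"
proof -
  note s = sandwichD[OF assms(3)]
  note L = B2l[OF s(1)] and R = B2r[OF s(2)]
  note a = restr_rg[OF assms(1) L(2)] and b = restr_dm[OF assms(2) R(2)]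
  show ?thesis
    using that[OF a(1) b(1) a(2) b(2) a(3) b(3) Leq_sym[OF L(1)] R(1)] a b L(1) R(1)
    by (simp add: circ_def Let_def Leq_sym)
qed

text \<open>
  The restrictions in the product may be given by any morphisms below \<open>\<alpha>\<close> and
  \<open>\<beta>\<close> with the right ends.
\<close>

lemma circ_eqI:
  assumes "\<alpha> \<in> Mor G" "\<beta> \<in> Mor G" "h \<in> sandwich E (rg \<alpha>) (dm \<beta>)"
    "a \<preceq> \<alpha>" "b \<preceq> \<beta>" "rg a = rg \<alpha> \<star> h" "dm b = h \<star> dm \<beta>"
  shows "circ X \<alpha> \<beta> h = a \<bullet> (\<epsilon> (rg \<alpha> \<star> h) h \<bullet> (\<epsilon> h (h \<star> dm \<beta>) \<bullet> b))"
    "a \<in> Mor G" "b \<in> Mor G" "Leq E (rg \<alpha> \<star> h) h" "Req E h (h \<star> dm \<beta>)"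
proof -
  obtain a' b' where *: "a' \<preceq> \<alpha>" "b' \<preceq> \<beta>" "rg a' = rg \<alpha> \<star> h" "dm b' = h \<star> dm \<beta>" "a' \<in> Mor G" "b' \<in> Mor G"
    "Leq E (rg \<alpha> \<star> h) h" "Req E h (h \<star> dm \<beta>)"
    "circ X \<alpha> \<beta> h = a' \<bullet> (\<epsilon> (rg \<alpha> \<star> h) h \<bullet> (\<epsilon> h (h \<star> dm \<beta>) \<bullet> b'))" using circ_parts[OF assms(1-3)] .
  have "a = a'" "b = b'" using cod_unique[OF assms(4) *(1)] dom_unique[OF assms(5) *(2)] assms(6,7) *(3,4) by auto
  then show "circ X \<alpha> \<beta> h = a \<bullet> (\<epsilon> (rg \<alpha> \<star> h) h \<bullet> (\<epsilon> h (h \<star> dm \<beta>) \<bullet> b))"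
    "a \<in> Mor G" "b \<in> Mor G" "Leq E (rg \<alpha> \<star> h) h" "Req E h (h \<star> dm \<beta>)" using * by auto
qed

lemma circ_Mor:
  assumes "\<alpha> \<in> Mor G" "\<beta> \<in> Mor G" "h \<in> sandwich E (rg \<alpha>) (dm \<beta>)"
  shows "circ X \<alpha> \<beta> h \<in> Mor G" "nle E (dm (circ X \<alpha> \<beta> h)) (dm \<alpha>)" "nle E (rg (circ X \<alpha> \<beta> h)) (rg \<beta>)"
proof -
  obtain a b where *: "a \<preceq> \<alpha>" "b \<preceq> \<beta>" "rg a = rg \<alpha> \<star> h" "dm b = h \<star> dm \<beta>" "a \<in> Mor G" "b \<in> Mor G"
    "Leq E (rg \<alpha> \<star> h) h" "Req E h (h \<star> dm \<beta>)"
    "circ X \<alpha> \<beta> h = a \<bullet> (\<epsilon> (rg \<alpha> \<star> h) h \<bullet> (\<epsilon> h (h \<star> dm \<beta>) \<bullet> b))" using circ_parts[OF assms] .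
  show "circ X \<alpha> \<beta> h \<in> Mor G" "nle E (dm (circ X \<alpha> \<beta> h)) (dm \<alpha>)" "nle E (rg (circ X \<alpha> \<beta> h)) (rg \<beta>)"
    using * le_dm[OF *(1)] le_rg[OF *(2)] by simp_all
qed

text \<open>
  The corner \<open>k\<close> of the square spanned by \<open>h\<close> and \<open>h'\<close> lies in two
  singular squares, over \<open>\<r>(\<alpha>)\<close> and over \<open>\<d>(\<beta>)\<close>. By (IG2) the two
  products agree up to evaluations at the inner ends of the restrictions, and (IG1) moves these to the outer
  ends.
\<close>

lemma circ_indep:
  assumes "\<alpha> \<in> Mor G" "\<beta> \<in> Mor G" "h \<in> sandwich E (rg \<alpha>) (dm \<beta>)" "h' \<in> sandwich E (rg \<alpha>) (dm \<beta>)"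
  shows "simP X (circ X \<alpha> \<beta> h) (circ X \<alpha> \<beta> h')"
proof -
  let ?e = "rg \<alpha>" and ?f = "dm \<beta>"
  obtain a b where *: "a \<preceq> \<alpha>" "b \<preceq> \<beta>" "rg a = ?e \<star> h" "dm b = h \<star> ?f" "a \<in> Mor G" "b \<in> Mor G"
    "Leq E (?e \<star> h) h" "Req E h (h \<star> ?f)"
    "circ X \<alpha> \<beta> h = a \<bullet> (\<epsilon> (?e \<star> h) h \<bullet> (\<epsilon> h (h \<star> ?f) \<bullet> b))" using circ_parts[OF assms(1-3)] .
  obtain a' b' where #: "a' \<preceq> \<alpha>" "b' \<preceq> \<beta>" "rg a' = ?e \<star> h'" "dm b' = h' \<star> ?f" "a' \<in> Mor G" "b' \<in> Mor G"
    "Leq E (?e \<star> h') h'" "Req E h' (h' \<star> ?f)"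
    "circ X \<alpha> \<beta> h' = a' \<bullet> (\<epsilon> (?e \<star> h') h' \<bullet> (\<epsilon> h' (h' \<star> ?f) \<bullet> b'))" using circ_parts[OF assms(1,2,4)] .
  obtain k where k: "Leq E k h" "Req E k h'" "?e \<star> k = ?e \<star> h" "k \<star> ?f = h' \<star> ?f"
    "Req E (?e \<star> h) (?e \<star> h')" "Leq E (h \<star> ?f) (h' \<star> ?f)" using sandwich_corner[OF assms(3,4)] .
  note s = sandwichD[OF assms(3)] and s' = sandwichD[OF assms(4)]
  have ke: "lle E k ?e" and kf: "rle E k ?f" using lle_trans[OF LeqD(1)[OF k(1)] s(1)] rle_trans[OF ReqD(1)[OF k(2)] s'(2)] .
  have A: "Req E (dm a) (dm a')" "a \<bullet> \<epsilon> (?e \<star> h) (?e \<star> h') = \<epsilon> (dm a) (dm a') \<bullet> a'"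
    using restr_Req_rg[OF *(1) #(1)] k(5) *(3) #(3) by auto
  have B: "Leq E (rg b) (rg b')" "b \<bullet> \<epsilon> (rg b) (rg b') = \<epsilon> (h \<star> ?f) (h' \<star> ?f) \<bullet> b'"
    using restr_Leq_dm[OF *(2) #(2)] k(6) *(4) #(4) by auto
  have ekh: "Leq E (?e \<star> h) k" using Leq_trans[OF *(7) Leq_sym[OF k(1)]] .
  have col: "\<epsilon> h k \<bullet> \<epsilon> k (h' \<star> ?f) = \<epsilon> h (h \<star> ?f) \<bullet> \<epsilon> (h \<star> ?f) (h' \<star> ?f)"
    using IG2_col[OF s(2) kf Leq_sym[OF k(1)]] k(4) by simp
  have row: "\<epsilon> k h' \<bullet> \<epsilon> h' (?e \<star> h') = \<epsilon> k (?e \<star> h) \<bullet> \<epsilon> (?e \<star> h) (?e \<star> h')"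
    using IG2_row[OF ke s'(1) k(2)] k(3) by simp
  have khf: "Req E k (h' \<star> ?f)" using Req_trans[OF k(2) #(8)] .
  have mid: "\<epsilon> (?e \<star> h) h \<bullet> (\<epsilon> h (h \<star> ?f) \<bullet> (\<epsilon> (h \<star> ?f) (h' \<star> ?f) \<bullet> b'))
      = \<epsilon> (?e \<star> h) (?e \<star> h') \<bullet> (\<epsilon> (?e \<star> h') h' \<bullet> (\<epsilon> h' (h' \<star> ?f) \<bullet> b'))"
  proof -
    have "\<epsilon> h (h \<star> ?f) \<bullet> (\<epsilon> (h \<star> ?f) (h' \<star> ?f) \<bullet> b') = \<epsilon> h k \<bullet> (\<epsilon> k (h' \<star> ?f) \<bullet> b')"
      by (rule swap_ext[OF col[symmetric]]) (use * # k khf in \<open>simp_all add: Leq_sym\<close>)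
    also have "\<dots> = \<epsilon> h k \<bullet> (\<epsilon> k h' \<bullet> (\<epsilon> h' (h' \<star> ?f) \<bullet> b'))"
      using eps_R'[OF k(2) #(8) #(6)] #(4) by simp
    finally have 1: "\<epsilon> (?e \<star> h) h \<bullet> (\<epsilon> h (h \<star> ?f) \<bullet> (\<epsilon> (h \<star> ?f) (h' \<star> ?f) \<bullet> b'))
        = \<epsilon> (?e \<star> h) k \<bullet> (\<epsilon> k h' \<bullet> (\<epsilon> h' (h' \<star> ?f) \<bullet> b'))"
      using eps_L'[OF *(7) Leq_sym[OF k(1)], of "\<epsilon> k h' \<bullet> (\<epsilon> h' (h' \<star> ?f) \<bullet> b')"] # k by simp
    let ?z = "\<epsilon> h' (h' \<star> ?f) \<bullet> b'"
    have z: "?z \<in> Mor G" "dm ?z = h'" using # by simp_all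
    have "\<epsilon> k h' \<bullet> ?z = \<epsilon> k h' \<bullet> (\<epsilon> h' (?e \<star> h') \<bullet> (\<epsilon> (?e \<star> h') h' \<bullet> ?z))"
      using eps_L_inv[OF Leq_sym[OF #(7)] z] by simp
    also have "\<dots> = \<epsilon> k (?e \<star> h) \<bullet> (\<epsilon> (?e \<star> h) (?e \<star> h') \<bullet> (\<epsilon> (?e \<star> h') h' \<bullet> ?z))"
      by (rule swap_ext[OF row]) (use # k ekh z in \<open>simp_all add: Leq_sym\<close>)
    finally show ?thesis
      unfolding 1 using eps_L_inv[OF ekh, of "\<epsilon> (?e \<star> h) (?e \<star> h') \<bullet> (\<epsilon> (?e \<star> h') h' \<bullet> ?z)"] # k z by simp
  qed
  show ?thesis
  proof (rule simPI)
    show "circ X \<alpha> \<beta> h \<in> Mor G" "circ X \<alpha> \<beta> h' \<in> Mor G" using circ_Mor(1) assms by auto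
    have d: "dm (circ X \<alpha> \<beta> h) = dm a" "dm (circ X \<alpha> \<beta> h') = dm a'"
      "rg (circ X \<alpha> \<beta> h) = rg b" "rg (circ X \<alpha> \<beta> h') = rg b'" using * # by simp_all
    show "Req E (dm (circ X \<alpha> \<beta> h)) (dm (circ X \<alpha> \<beta> h'))" "Leq E (rg (circ X \<alpha> \<beta> h)) (rg (circ X \<alpha> \<beta> h'))"
      unfolding d using A B by auto
    have "circ X \<alpha> \<beta> h \<bullet> \<epsilon> (rg b) (rg b') = a \<bullet> (\<epsilon> (?e \<star> h) h \<bullet> (\<epsilon> h (h \<star> ?f) \<bullet> (b \<bullet> \<epsilon> (rg b) (rg b'))))"
      unfolding *(9) using * B(1) by simp
    also have "\<dots> = a \<bullet> (\<epsilon> (?e \<star> h) (?e \<star> h') \<bullet> (\<epsilon> (?e \<star> h') h' \<bullet> (\<epsilon> h' (h' \<star> ?f) \<bullet> b')))"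
      unfolding B(2) mid ..
    also have "\<dots> = \<epsilon> (dm a) (dm a') \<bullet> circ X \<alpha> \<beta> h'"
      unfolding #(9) by (rule swap_ext[OF A(2)]) (use * # k A in simp_all)
    finally show "circ X \<alpha> \<beta> h \<bullet> \<epsilon> (rg (circ X \<alpha> \<beta> h)) (rg (circ X \<alpha> \<beta> h'))
        = \<epsilon> (dm (circ X \<alpha> \<beta> h)) (dm (circ X \<alpha> \<beta> h')) \<bullet> circ X \<alpha> \<beta> h'" unfolding d .
  qed
qed

text \<open>
  The restriction of \<open>\<alpha>'\<close> to the codomain \<open>\<r>(\<alpha>')h\<close> is the
  restriction of \<open>\<alpha>\<close>, preceded and followed by evaluations.
\<close>

lemma circ_left:
  assumes p: "simP X \<alpha> \<alpha>'" and b: "\<beta> \<in> Mor G" and h: "h \<in> sandwich E (rg \<alpha>) (dm \<beta>)"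
  shows "simP X (circ X \<alpha> \<beta> h) (circ X \<alpha>' \<beta> h)"
proof -
  note s = simPD[OF p]
  let ?e = "rg \<alpha>" and ?e' = "rg \<alpha>'" and ?f = "dm \<beta>"
  have h': "h \<in> sandwich E ?e' ?f" using h sandwich_Leq[OF s(4)] by simp
  note hs = sandwichD[OF h]
  obtain a b where *: "a \<preceq> \<alpha>" "b \<preceq> \<beta>" "rg a = ?e \<star> h" "dm b = h \<star> ?f" "a \<in> Mor G" "b \<in> Mor G"
    "Leq E (?e \<star> h) h" "Req E h (h \<star> ?f)"
    "circ X \<alpha> \<beta> h = a \<bullet> (\<epsilon> (?e \<star> h) h \<bullet> (\<epsilon> h (h \<star> ?f) \<bullet> b))" using circ_parts[OF s(1) b h] .
  define d where "d = dm a \<star> dm \<alpha>'"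
  have ad: "nle E (dm a) (dm \<alpha>)" using le_dm[OF *(1)] .
  have r: "rle E (dm a) (dm \<alpha>')" using rle_trans[OF nleD(2)[OF ad] ReqD(1)[OF s(3)]] .
  have dR: "Req E (dm a) d" unfolding d_def using B2r(1)[OF r] .
  have e1: "\<epsilon> d (dm a) \<preceq> \<epsilon> (dm \<alpha>') (dm \<alpha>)"
    using le_minv[OF eps_le_R[OF s(3) ad]] s(3) dR unfolding d_def[symmetric] by (simp add: eps_minv_R)
  have "?e' \<star> (?e \<star> h) = ?e' \<star> h" using B4l[OF sandwichD(1)[OF h'] LeqD(2)[OF s(4)]] .
  then have e2: "\<epsilon> (?e \<star> h) (?e' \<star> h) \<preceq> \<epsilon> ?e ?e'"
    using eps_le_L[OF s(4) B2l(2)[OF hs(1)]] by simp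
  have eL: "Leq E (?e \<star> h) (?e' \<star> h)" using Leq_trans[OF *(7) B2l(1)[OF sandwichD(1)[OF h']]] .
  \<comment> \<open>Each of the three factors is below the corresponding factor of
    \<open>\<alpha>' = \<epsilon>(\<d>(\<alpha>'),\<d>(\<alpha>)) \<alpha> \<epsilon>(\<r>(\<alpha>),\<r>(\<alpha>'))\<close>.\<close>
  let ?a = "\<epsilon> d (dm a) \<bullet> (a \<bullet> \<epsilon> (?e \<star> h) (?e' \<star> h))"
  have "?a \<preceq> \<epsilon> (dm \<alpha>') (dm \<alpha>) \<bullet> (\<alpha> \<bullet> \<epsilon> ?e ?e')"
    by (intro le_cmp e1 e2 *(1)) (use * s eL dR in \<open>simp_all add: Req_sym\<close>)
  then have a': "?a \<preceq> \<alpha>'" using s(6) by simp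
  have ra: "rg ?a = ?e' \<star> h" "dm ?a = d" "?a \<in> Mor G" using * eL dR by (simp_all add: Req_sym)
  note c' = circ_eqI[OF s(2) b h' a' *(2) ra(1) *(4)]
  let ?z = "\<epsilon> h (h \<star> ?f) \<bullet> b"
  have z: "?z \<in> Mor G" "dm ?z = h" "rg ?z = rg b" using * by simp_all
  show ?thesis
  proof (rule simPI)
    show "circ X \<alpha> \<beta> h \<in> Mor G" "circ X \<alpha>' \<beta> h \<in> Mor G" using circ_Mor(1) s(1,2) b h h' by auto
    have d: "dm (circ X \<alpha> \<beta> h) = dm a" "dm (circ X \<alpha>' \<beta> h) = d" "rg (circ X \<alpha> \<beta> h) = rg b" "rg (circ X \<alpha>' \<beta> h) = rg b"
      unfolding *(9) c'(1) using * ra c'(4) z by simp_all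
    show "Req E (dm (circ X \<alpha> \<beta> h)) (dm (circ X \<alpha>' \<beta> h))" "Leq E (rg (circ X \<alpha> \<beta> h)) (rg (circ X \<alpha>' \<beta> h))"
      unfolding d using dR *(6) by (auto simp: Leq_refl)
    have "\<epsilon> (dm a) d \<bullet> circ X \<alpha>' \<beta> h
        = \<epsilon> (dm a) d \<bullet> (\<epsilon> d (dm a) \<bullet> (a \<bullet> (\<epsilon> (?e \<star> h) (?e' \<star> h) \<bullet> (\<epsilon> (?e' \<star> h) h \<bullet> ?z))))"
      unfolding c'(1) using * dR eL c'(4) z by (simp add: Req_sym)
    also have "\<dots> = a \<bullet> (\<epsilon> (?e \<star> h) (?e' \<star> h) \<bullet> (\<epsilon> (?e' \<star> h) h \<bullet> ?z))"
      by (rule eps_R_inv[OF dR]) (use * eL c'(4) z in simp_all)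
    also have "\<dots> = circ X \<alpha> \<beta> h" unfolding *(9) using eps_L'[OF eL c'(4) z(1,2)] by simp
    finally show "circ X \<alpha> \<beta> h \<bullet> \<epsilon> (rg (circ X \<alpha> \<beta> h)) (rg (circ X \<alpha>' \<beta> h))
        = \<epsilon> (dm (circ X \<alpha> \<beta> h)) (dm (circ X \<alpha>' \<beta> h)) \<bullet> circ X \<alpha>' \<beta> h"
      unfolding d using *(6) circ_Mor(1)[OF s(1) b h] d by (simp add: eps_id)
  qed
qed

text \<open>
  The product is a path read from left to right; the opposite groupoid reads the same path backwards.
\<close>

lemma circ_opi:
  assumes "\<alpha> \<in> Mor G" "\<beta> \<in> Mor G" "h \<in> sandwich E (rg \<alpha>) (dm \<beta>)"
  shows "circ (opi X) \<beta> \<alpha> h = circ X \<alpha> \<beta> h"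
proof -
  obtain a b where *: "a \<preceq> \<alpha>" "b \<preceq> \<beta>" "rg a = rg \<alpha> \<star> h" "dm b = h \<star> dm \<beta>" "a \<in> Mor G" "b \<in> Mor G"
    "Leq E (rg \<alpha> \<star> h) h" "Req E h (h \<star> dm \<beta>)"
    "circ X \<alpha> \<beta> h = a \<bullet> (\<epsilon> (rg \<alpha> \<star> h) h \<bullet> (\<epsilon> h (h \<star> dm \<beta>) \<bullet> b))" using circ_parts[OF assms] .
  have "restr_cod G \<alpha> (rg \<alpha> \<star> h) = a" "restr_dom G (h \<star> dm \<beta>) \<beta> = b"
    using restr_cod_eq[OF *(1,3)] restr_dom_eq[OF *(2,4)] .
  then show ?thesis using * by (simp add: circ_def[of "opi X"] Let_def eps_opi_L eps_opi_R Leq_sym Req_sym)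
qed

lemma simP_opi1: "simP X \<alpha> \<beta> \<Longrightarrow> simP (opi X) \<alpha> \<beta>"
proof -
  assume p: "simP X \<alpha> \<beta>"
  note s = simPD[OF p] and t = simPD[OF simP_sym[OF p]]
  show ?thesis unfolding simP_def using s(1-4) t(5) by (simp add: eps_opi_L eps_opi_R Leq_sym Req_sym)
qed

lemma simP_opi: "simP (opi X) \<alpha> \<beta> \<longleftrightarrow> simP X \<alpha> \<beta>"
proof
  assume p: "simP (opi X) \<alpha> \<beta>"
  then have s: "\<alpha> \<in> Mor G" "\<beta> \<in> Mor G" "Leq E (rg \<alpha>) (rg \<beta>)" "Req E (dm \<alpha>) (dm \<beta>)"
    "\<epsilon> (dm \<beta>) (dm \<alpha>) \<bullet> \<alpha> = \<beta> \<bullet> \<epsilon> (rg \<beta>) (rg \<alpha>)"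
    unfolding simP_def by (auto simp: eps_opi_L eps_opi_R Leq_sym Req_sym)
  then have "simP X \<beta> \<alpha>" by (intro simPI) (simp_all add: Leq_sym Req_sym)
  then show "simP X \<alpha> \<beta>" by (rule simP_sym)
qed (rule simP_opi1)

lemma pcl_opi: "pcl (opi X) = pcl X"
  by (auto simp: pcl_def simP_opi fun_eq_iff)

text \<open>This is \<open>circ_left\<close> for the opposite groupoid.\<close>

lemma circ_right:
  assumes a: "\<alpha> \<in> Mor G" and p: "simP X \<beta> \<beta>'" and h: "h \<in> sandwich E (rg \<alpha>) (dm \<beta>)"
  shows "simP X (circ X \<alpha> \<beta> h) (circ X \<alpha> \<beta>' h)" "h \<in> sandwich E (rg \<alpha>) (dm \<beta>')"
proof -
  interpret op: ind_gpd "opi X" by (rule ind_gpd_opi)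
  note s = simPD[OF p]
  show h': "h \<in> sandwich E (rg \<alpha>) (dm \<beta>')" using op.sandwich_Leq[of "dm \<beta>" "dm \<beta>'" "rg \<alpha>"] s(3) h by simp
  show "simP X (circ X \<alpha> \<beta> h) (circ X \<alpha> \<beta>' h)"
    using op.circ_left[of \<beta> \<beta>' \<alpha> h] a p h circ_opi[OF a s(1) h] circ_opi[OF a s(2) h'] by (simp add: simP_opi)
qed

lemma circ_cong:
  assumes p: "simP X \<alpha> \<alpha>'" and q: "simP X \<beta> \<beta>'"
    and h: "h \<in> sandwich E (rg \<alpha>) (dm \<beta>)" and h': "h' \<in> sandwich E (rg \<alpha>') (dm \<beta>')"
  shows "simP X (circ X \<alpha> \<beta> h) (circ X \<alpha>' \<beta>' h')"
proof -
  note s = simPD[OF p] and t = simPD[OF q]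
  note 1 = circ_left[OF p t(1) h]
  have "h \<in> sandwich E (rg \<alpha>') (dm \<beta>)" using h sandwich_Leq[OF s(4)] by simp
  note 2 = circ_right[OF s(2) q this]
  show ?thesis using simP_trans[OF 1 simP_trans[OF 2(1) circ_indep[OF s(2) t(2) 2(2) h']]] .
qed

lemma sandwich_ex: "e \<in> carr E \<Longrightarrow> f \<in> carr E \<Longrightarrow> \<exists>h. h \<in> sandwich E e f"
  using reg by (auto simp: regular_biordered_set_def)

lemma pmul_pcl:
  assumes "\<alpha> \<in> Mor G" "\<beta> \<in> Mor G" "h \<in> sandwich E (rg \<alpha>) (dm \<beta>)"
  shows "pmul X (pcl X \<alpha>) (pcl X \<beta>) = pcl X (circ X \<alpha> \<beta> h)"
proof -
  have "pcl X \<alpha> \<in> pS X" "pcl X \<beta> \<in> pS X" using assms by (auto simp: pS_def)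
  then have "pmul X (pcl X \<alpha>) (pcl X \<beta>) = (THE C. \<exists>\<alpha>'\<in>pcl X \<alpha>. \<exists>\<beta>'\<in>pcl X \<beta>.
      \<exists>h'\<in>sandwich E (rg \<alpha>') (dm \<beta>'). C = pcl X (circ X \<alpha>' \<beta>' h'))"
    by (simp add: pmul_def)
  also have "\<dots> = pcl X (circ X \<alpha> \<beta> h)"
proof (rule the_equality)
  have "\<alpha> \<in> pcl X \<alpha>" "\<beta> \<in> pcl X \<beta>" using simP_refl assms by (auto simp: pcl_def)
  then show "\<exists>\<alpha>'\<in>pcl X \<alpha>. \<exists>\<beta>'\<in>pcl X \<beta>. \<exists>h'\<in>sandwich E (rg \<alpha>') (dm \<beta>'). pcl X (circ X \<alpha> \<beta> h) = pcl X (circ X \<alpha>' \<beta>' h')"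
    using assms(3) by blast
  fix C assume "\<exists>\<alpha>'\<in>pcl X \<alpha>. \<exists>\<beta>'\<in>pcl X \<beta>. \<exists>h'\<in>sandwich E (rg \<alpha>') (dm \<beta>'). C = pcl X (circ X \<alpha>' \<beta>' h')"
  then obtain \<alpha>' \<beta>' h' where *: "simP X \<alpha> \<alpha>'" "simP X \<beta> \<beta>'" "h' \<in> sandwich E (rg \<alpha>') (dm \<beta>')" "C = pcl X (circ X \<alpha>' \<beta>' h')"
    by (auto simp: pcl_def)
  then show "C = pcl X (circ X \<alpha> \<beta> h)" using pclI[OF circ_cong[OF *(1,2) assms(3) *(3)]] by simp
qed
  finally show ?thesis .
qed

lemma pmul_closed: "A \<in> pS X \<Longrightarrow> B \<in> pS X \<Longrightarrow> pmul X A B \<in> pS X"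
proof -
  assume "A \<in> pS X" "B \<in> pS X"
  then obtain \<alpha> \<beta> where *: "\<alpha> \<in> Mor G" "\<beta> \<in> Mor G" "A = pcl X \<alpha>" "B = pcl X \<beta>" by (auto simp: pS_def)
  obtain h where h: "h \<in> sandwich E (rg \<alpha>) (dm \<beta>)" using sandwich_ex[of "rg \<alpha>" "dm \<beta>"] * by auto
  show ?thesis using pmul_pcl[OF *(1,2) h] circ_Mor(1)[OF *(1,2) h] * by (simp add: pS_def)
qed

lemma pS_opi: "pS (opi X) = pS X" by (simp add: pS_def pcl_opi)

lemma pmul_opi: "pmul (opi X) A B = pmul X B A"
proof (cases "A \<in> pS X \<and> B \<in> pS X")
  case False
  then show ?thesis by (auto simp: pmul_def pS_opi)
next
  case True
  then obtain \<alpha> \<beta> where *: "\<alpha> \<in> Mor G" "\<beta> \<in> Mor G" "A = pcl X \<alpha>" "B = pcl X \<beta>" by (auto simp: pS_def)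
  obtain h where h: "h \<in> sandwich E (rg \<beta>) (dm \<alpha>)" using sandwich_ex[of "rg \<beta>" "dm \<alpha>"] * by auto
  interpret op: ind_gpd "opi X" by (rule ind_gpd_opi)
  have "pmul (opi X) (pcl X \<alpha>) (pcl X \<beta>) = pcl X (circ (opi X) \<alpha> \<beta> h)"
    using op.pmul_pcl[of \<alpha> \<beta> h] * h by (simp add: pcl_opi)
  then show ?thesis using circ_opi[OF *(2,1) h] pmul_pcl[OF *(2,1) h] * by simp
qed

lemma ent_opi: "ent (opi X) = ent X" by (simp add: ent_def pcl_opi fun_eq_iff)

end

subsection \<open>Associativity\<close>

text \<open>
  A triple product in which \<open>y\<close> is not restricted: the path through a restriction of
  \<open>x\<close>, the elements \<open>m'\<close> and \<open>\<d>(y)\<close>, the morphism \<open>y\<close>,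
  the elements \<open>\<r>(y)\<close> and \<open>m\<close>, and a restriction of \<open>z\<close>. This shape
  is symmetric under reversal.
\<close>

definition mid :: "('e, 'm) indgpd \<Rightarrow> 'm \<Rightarrow> 'e \<Rightarrow> 'm \<Rightarrow> 'e \<Rightarrow> 'm \<Rightarrow> 'm" where
  "mid X x m' y m z = (let G = igg X; xm = igr X x \<odot>\<^bsub>igb X\<^esub> m'; mz = m \<odot>\<^bsub>igb X\<^esub> igd X z in
     restr_cod G x xm \<cdot>\<^bsub>G\<^esub> (eps X xm m' \<cdot>\<^bsub>G\<^esub> (eps X m' (igd X y) \<cdot>\<^bsub>G\<^esub>
       (y \<cdot>\<^bsub>G\<^esub> (eps X (igr X y) m \<cdot>\<^bsub>G\<^esub> (eps X m mz \<cdot>\<^bsub>G\<^esub> restr_dom G mz z))))))"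

context ind_gpd
begin

lemma sandwich_absorb':
  assumes "lle E a h" "lle E h g" "rle E (g \<star> a) (g \<star> h)"
  shows "g \<star> (h \<star> a) = g \<star> a"
proof -
  interpret op: ind_gpd "opi X" by (rule ind_gpd_opi)
  show ?thesis using op.sandwich_absorb[of a h g] assms by simp
qed

lemma image_rle:
  assumes "u \<preceq> x" "v \<preceq> x" "rle E (dm u) (dm v)"
  obtains p where "p \<preceq> x" "dm p = dm u \<star> dm v" "rg p = rg u \<star> rg v" "rle E (rg u) (rg v)"
proof -
  have m: "u \<in> Mor G" "v \<in> Mor G" "x \<in> Mor G" using le_Mor assms by auto
  note 1 = IG1_r[OF m(1,2) assms]
  note p = restr_dm[OF m(3) nle_trans[OF B2r(2)[OF assms(3)] le_dm[OF assms(2)]]]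
  have R: "Req E (dm u) (dm u \<star> dm v)" "Req E (rg u) (rg u \<star> rg v)" using B2r(1) assms(3) 1 by auto
  have "rg (restr_dom G (dm u \<star> dm v) x) = rg u \<star> rg v"
    using arg_cong[OF conjunct2[OF 1], of rg] R p m by simp
  then show ?thesis using that p 1 by blast
qed

lemma image_lle:
  assumes "u \<preceq> x" "v \<preceq> x" "lle E (dm u) (dm v)"
  obtains p where "p \<preceq> x" "dm p = dm v \<star> dm u" "rg p = rg v \<star> rg u" "lle E (rg u) (rg v)"
proof -
  have m: "u \<in> Mor G" "v \<in> Mor G" "x \<in> Mor G" using le_Mor assms by auto
  note 1 = IG1_l[OF m(1,2) assms]
  note p = restr_dm[OF m(3) nle_trans[OF B2l(2)[OF assms(3)] le_dm[OF assms(2)]]]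
  have R: "Leq E (dm u) (dm v \<star> dm u)" "Leq E (rg u) (rg v \<star> rg u)" using B2l(1) assms(3) 1 by auto
  have "rg (restr_dom G (dm v \<star> dm u) x) = rg v \<star> rg u"
    using arg_cong[OF conjunct2[OF 1], of rg] R p m by simp
  then show ?thesis using that p 1 by blast
qed

text \<open>
  By (IG1) a morphism of the groupoid induces a bijection between the elements below its domain and those
  below its codomain that preserves the products in the definition of sandwich sets.
\<close>

lemma sandwich_image:
  assumes "y1 \<preceq> y" "y2 \<preceq> y" "y3 \<preceq> y" "dm y3 \<in> sandwich E (dm y1) (dm y2)"
  shows "rg y3 \<in> sandwich E (rg y1) (rg y2)"
proof (rule sandwichI)
  note s = sandwichD[OF assms(4)]
  have ym: "y \<in> Mor G" using le_Mor[OF assms(1)] by simp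
  obtain q where q: "q \<preceq> y" "dm q = dm y3 \<star> dm y2" "rg q = rg y3 \<star> rg y2" "rle E (rg y3) (rg y2)"
    using image_rle[OF assms(3,2) s(2)] .
  obtain q' where q': "q' \<preceq> y" "dm q' = dm y1 \<star> dm y3" "rg q' = rg y1 \<star> rg y3" "lle E (rg y3) (rg y1)"
    using image_lle[OF assms(3,1) s(1)] .
  show "lle E (rg y3) (rg y1)" "rle E (rg y3) (rg y2)" by fact+
  fix n assume n: "lle E n (rg y1)" "rle E n (rg y2)"
  have "nle E n (rg y)"
    using lle_trans[OF n(1) nleD(1)[OF le_rg[OF assms(1)]]] rle_trans[OF n(2) nleD(2)[OF le_rg[OF assms(2)]]]
    by (simp add: nle_def)
  note w = restr_rg[OF ym this]
  define w where "w = restr_cod G y n"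
  have wy: "w \<preceq> y" "rg w = n" using w by (simp_all add: w_def)
  have d: "lle E (dm w) (dm y1)" "rle E (dm w) (dm y2)"
    using IG1_cod(2)[OF wy(1) assms(1)] IG1_cod(1)[OF wy(1) assms(2)] n wy(2) by auto
  obtain p where p: "p \<preceq> y" "dm p = dm w \<star> dm y2" "rg p = rg w \<star> rg y2" using image_rle[OF wy(1) assms(2) d(2)] .
  obtain p' where p': "p' \<preceq> y" "dm p' = dm y1 \<star> dm w" "rg p' = rg y1 \<star> rg w" using image_lle[OF wy(1) assms(1) d(1)] .
  show "lle E (n \<star> rg y2) (rg y3 \<star> rg y2)"
    using image_lle[OF p(1) q(1)] s(3)[OF d] p q wy by metis
  show "rle E (rg y1 \<star> n) (rg y1 \<star> rg y3)"
    using image_rle[OF p'(1) q'(1)] s(4)[OF d] p' q' wy by metis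
qed

text \<open>
  The product \<open>(x \<circ> y) \<circ> z\<close>, for a suitable sandwich element \<open>m\<close>, as a
  triple product through the part \<open>y3\<close> of \<open>y\<close>. The restriction of
  \<open>x \<circ> y\<close> that the product requires is found below \<open>x \<circ> y\<close> factor by
  factor. It uses the part \<open>y4\<close> of \<open>y\<close> whose domain is \<open>\<L>\<close>-related
  to that of \<open>y3\<close>; (IG1) exchanges \<open>y4\<close> for \<open>y3\<close>, and the
  column-singular square on \<open>c\<close> and \<open>m'\<close> over \<open>\<d>(y)\<close> exchanges
  \<open>c\<close> for \<open>m'\<close>.
\<close>

lemma circ_half:
  assumes x: "x \<in> Mor G" and y: "y \<in> Mor G" and z: "z \<in> Mor G" and h: "h \<in> sandwich E (rg x) (dm y)"
    and y3: "y3 \<preceq> y" and l: "lle E (dm y3) (h \<star> dm y)"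
    and m': "lle E m' h" "rle E m' (dm y)" "m' \<star> dm y = dm y3"
    and m: "m \<in> sandwich E (rg (circ X x y h)) (dm z)" "Leq E m (rg y3)"
      "rg (circ X x y h) \<star> m = rg (circ X x y h) \<star> rg y3"
  shows "circ X (circ X x y h) z m = mid X x m' y3 m z"
proof -
  let ?rx = "rg x" and ?e = "dm y" and ?l = "dm y3" and ?k = "rg y3"
  obtain a y1 where *: "a \<preceq> x" "y1 \<preceq> y" "rg a = ?rx \<star> h" "dm y1 = h \<star> ?e" "a \<in> Mor G" "y1 \<in> Mor G"
    "Leq E (?rx \<star> h) h" "Req E h (h \<star> ?e)"
    "circ X x y h = a \<bullet> (\<epsilon> (?rx \<star> h) h \<bullet> (\<epsilon> h (h \<star> ?e) \<bullet> y1))" using circ_parts[OF x y h] .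
  define u where "u = h \<star> ?e"
  note s = sandwichD[OF h]
  have f': "rg (circ X x y h) = rg y1" using * by simp
  have u: "nle E u ?e" unfolding u_def using B2r(2)[OF s(2)] .
  have lu: "lle E ?l u" using l by (simp add: u_def)
  have y3m: "y3 \<in> Mor G" using le_Mor[OF y3] by simp
  obtain y4 where y4: "y4 \<preceq> y" "dm y4 = u \<star> ?l" "rg y4 = rg y1 \<star> ?k" "lle E ?k (rg y1)"
    using image_lle[OF y3 *(2)] lu *(4) by (metis u_def)
  have y4m: "y4 \<in> Mor G" using le_Mor[OF y4(1)] by simp
  have ul: "nle E (u \<star> ?l) u" "Leq E (u \<star> ?l) ?l" using B2l[OF lu] Leq_sym by auto
  have y41: "y4 \<preceq> y1"
  proof -
    have "nle E (u \<star> ?l) (dm y1)" using ul(1) *(4) by (simp add: u_def)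
    note r = restr_dm[OF *(6) this]
    have "y4 = restr_dom G (u \<star> ?l) y1" using dom_unique[OF y4(1) le_trans[OF r(1) *(2)]] r(2) y4(2) by simp
    then show ?thesis using r(1) by simp
  qed
  \<comment> \<open>The trace of \<open>m'\<close> below \<open>h\<close>: the middle of the restriction of
    \<open>x \<circ> y\<close> passes through \<open>c\<close> instead of \<open>h\<close>.\<close>
  define c where "c = h \<star> m'"
  have c: "Leq E c m'" "nle E c h" unfolding c_def using B2l[OF m'(1)] Leq_sym by auto
  have ce: "c \<star> ?e = u \<star> ?l" unfolding c_def u_def using B3r(2)[OF m'(2) s(2) m'(1)] m'(3) by simp
  have cre: "rle E c ?e" using rle_trans[OF nleD(2)[OF c(2)] s(2)] .
  have cR: "Req E c (u \<star> ?l)" using B2r(1)[OF cre] ce by simp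
  have hu: "Req E h u" unfolding u_def using *(8) .
  have cu: "rle E c u" using rle_trans[OF nleD(2)[OF c(2)] ReqD(1)[OF hu]] .
  have "c \<star> u = u \<star> ?l" using B4r[OF cu nleD(2)[OF u]] ce nle_mul(1)[OF ul(1)] by simp
  then have e1: "\<epsilon> c (u \<star> ?l) \<preceq> \<epsilon> h u" using eps_le_R[OF hu c(2)] by simp
  have ch: "lle E c ?rx" using lle_trans[OF nleD(1)[OF c(2)] s(1)] .
  have e0c: "Leq E (?rx \<star> c) c" using B2l(1)[OF ch] Leq_sym by blast
  have n0: "nle E (?rx \<star> c) (?rx \<star> h)"
  proof -
    have "lle E (?rx \<star> c) (?rx \<star> h)"
      using lle_trans[OF LeqD(1)[OF e0c] lle_trans[OF nleD(1)[OF c(2)] LeqD(2)[OF *(7)]]] .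
    then show ?thesis using B3l(1)[OF ch s(1) nleD(2)[OF c(2)]] by (simp add: nle_def)
  qed
  have "h \<star> (?rx \<star> c) = c" using B4l[OF nleD(1)[OF c(2)] s(1)] mul_r[OF nleD(2)[OF c(2)]] by simp
  then have e2: "\<epsilon> (?rx \<star> c) c \<preceq> \<epsilon> (?rx \<star> h) h" using eps_le_L[OF *(7) n0] by simp
  have m'0: "lle E m' ?rx" using lle_trans[OF m'(1) s(1)] .
  have e0: "?rx \<star> c = ?rx \<star> m'" unfolding c_def using sandwich_absorb'[OF m'(1) s(1) s(4)[OF m'0 m'(2)]] .
  have n0a: "nle E (?rx \<star> c) (rg a)" using n0 *(3) by simp
  define a2 where "a2 = restr_cod G a (?rx \<star> c)"
  have a2: "a2 \<preceq> a" "rg a2 = ?rx \<star> c" "a2 \<in> Mor G" unfolding a2_def using restr_rg[OF *(5) n0a] by auto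
  have a2x: "restr_cod G x (?rx \<star> m') = a2" using restr_cod_eq[OF le_trans[OF a2(1) *(1)]] a2(2) e0 by simp
  \<comment> \<open>The restriction of \<open>x \<circ> y\<close> with codomain
    \<open>\<r>(x \<circ> y)m\<close>.\<close>
  let ?P = "a2 \<bullet> (\<epsilon> (?rx \<star> c) c \<bullet> (\<epsilon> c (u \<star> ?l) \<bullet> y4))"
  have P: "?P \<preceq> circ X x y h"
    unfolding *(9) u_def[symmetric]
    by (intro le_cmp a2 e2 e1 y41) (use * a2 y4 y4m e0c cR hu in \<open>simp_all add: u_def\<close>)
  have rk: "rg y1 \<star> m = rg y1 \<star> ?k" using m(3) f' by simp
  have rP: "rg ?P = rg (circ X x y h) \<star> m" unfolding f' rk using a2 y4 y4m e0c cR by simp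
  note cM = circ_Mor(1)[OF x y h]
  note ms = sandwichD[OF m(1)]
  define z1 where "z1 = restr_dom G (m \<star> dm z) z"
  have z1: "z1 \<preceq> z" "dm z1 = m \<star> dm z" "z1 \<in> Mor G" unfolding z1_def using restr_dm[OF z B2r(2)[OF ms(2)]] by auto
  note C = circ_eqI[OF cM z m(1) P z1(1) rP z1(2)]
  let ?T = "\<epsilon> m (m \<star> dm z) \<bullet> z1"
  have T: "?T \<in> Mor G" "dm ?T = m" using C(5) z1 by simp_all
  have fk: "Leq E (rg y1 \<star> ?k) ?k" using B2l(1)[OF y4(4)] Leq_sym by blast
  have km: "Leq E ?k m" using Leq_sym[OF m(2)] .
  note IG = restr_Leq_dm(2)[OF y4(1) y3, unfolded y4(2,3), OF ul(2)]
  have 1: "y4 \<bullet> (\<epsilon> (rg y1 \<star> ?k) m \<bullet> ?T) = \<epsilon> (u \<star> ?l) ?l \<bullet> (y3 \<bullet> (\<epsilon> ?k m \<bullet> ?T))"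
  proof -
    have "y4 \<bullet> (\<epsilon> (rg y1 \<star> ?k) m \<bullet> ?T) = y4 \<bullet> (\<epsilon> (rg y1 \<star> ?k) ?k \<bullet> (\<epsilon> ?k m \<bullet> ?T))"
      using eps_L'[OF fk km T] by simp
    also have "\<dots> = \<epsilon> (u \<star> ?l) ?l \<bullet> (y3 \<bullet> (\<epsilon> ?k m \<bullet> ?T))"
      by (rule swap_ext[OF IG]) (use y4 y4m y3m ul fk km T in simp_all)
    finally show ?thesis .
  qed
  let ?Y = "y3 \<bullet> (\<epsilon> ?k m \<bullet> ?T)"
  have Y: "?Y \<in> Mor G" "dm ?Y = ?l" using y3m km T by simp_all
  have m'l: "Req E m' ?l" using B2r(1)[OF m'(2)] m'(3) by simp
  have col: "\<epsilon> c m' \<bullet> \<epsilon> m' ?l = \<epsilon> c (u \<star> ?l) \<bullet> \<epsilon> (u \<star> ?l) ?l"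
    using IG2_col[OF cre m'(2) c(1)] ce m'(3) by simp
  have 2: "\<epsilon> c (u \<star> ?l) \<bullet> (\<epsilon> (u \<star> ?l) ?l \<bullet> ?Y) = \<epsilon> c m' \<bullet> (\<epsilon> m' ?l \<bullet> ?Y)"
    by (rule swap_ext[OF col[symmetric]]) (use c cR ul m'l Y in simp_all)
  have 3: "\<epsilon> (?rx \<star> c) c \<bullet> (\<epsilon> c m' \<bullet> (\<epsilon> m' ?l \<bullet> ?Y)) = \<epsilon> (?rx \<star> m') m' \<bullet> (\<epsilon> m' ?l \<bullet> ?Y)"
    using eps_L'[OF e0c c(1), of "\<epsilon> m' ?l \<bullet> ?Y"] m'l Y e0 by simp
  have "circ X (circ X x y h) z m = a2 \<bullet> (\<epsilon> (?rx \<star> c) c \<bullet> (\<epsilon> c (u \<star> ?l) \<bullet> (y4 \<bullet> (\<epsilon> (rg y1 \<star> ?k) m \<bullet> ?T))))"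
    unfolding C(1) f' rk
    using a2 e0c cR y4 y4m T Leq_trans[OF fk km] by simp
  also have "\<dots> = a2 \<bullet> (\<epsilon> (?rx \<star> m') m' \<bullet> (\<epsilon> m' ?l \<bullet> ?Y))" unfolding 1 2 3 ..
  also have "\<dots> = mid X x m' y3 m z" by (simp add: mid_def Let_def a2x z1_def)
  finally show ?thesis .
qed

lemma mid_opi:
  assumes x: "x \<in> Mor G" and y: "y \<in> Mor G" and z: "z \<in> Mor G"
    and m: "lle E m' (rg x)" "Req E m' (dm y)" "Leq E (rg y) m" "rle E m (dm z)"
  shows "mid (opi X) z m y m' x = mid X x m' y m z"
proof -
  note a = restr_rg[OF x B2l(2)[OF m(1)]] and b = restr_dm[OF z B2r(2)[OF m(4)]]
  show ?thesis
    using a b y m B2l(1)[OF m(1)] B2r(1)[OF m(4)]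
    by (simp add: mid_def Let_def eps_opi_L eps_opi_R Leq_sym Req_sym)
qed

text \<open>
  The first products use a part \<open>y1\<close> of \<open>y\<close> cut out at its domain and a part
  \<open>y2\<close> cut out at its codomain. A sandwich element \<open>l\<close> of their domains cuts out a
  part \<open>y3\<close>, and its image \<open>k\<close> under \<open>y\<close> is a sandwich element of their
  codomains. Lifting \<open>l\<close> and \<open>k\<close> to sandwich elements \<open>m'\<close> and
  \<open>m\<close> for the second products turns both bracketings into the same triple product: one by
  \<open>circ_half\<close>, the other by \<open>circ_half\<close> for the opposite groupoid.
\<close>

theorem pmul_assoc:
  assumes "A \<in> pS X" "B \<in> pS X" "C \<in> pS X"
  shows "pmul X (pmul X A B) C = pmul X A (pmul X B C)"
proof -
  interpret op: ind_gpd "opi X" by (rule ind_gpd_opi)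
  obtain x y z where *: "x \<in> Mor G" "y \<in> Mor G" "z \<in> Mor G" "A = pcl X x" "B = pcl X y" "C = pcl X z"
    using assms by (auto simp: pS_def)
  obtain h1 where h1: "h1 \<in> sandwich E (rg x) (dm y)" using sandwich_ex[of "rg x" "dm y"] * by auto
  obtain h2 where h2: "h2 \<in> sandwich E (rg y) (dm z)" using sandwich_ex[of "rg y" "dm z"] * by auto
  note s1 = sandwichD[OF h1] and s2 = sandwichD[OF h2]
  let ?e = "dm y" and ?f = "rg y"
  obtain x1 y1 where p1: "y1 \<preceq> y" "dm y1 = h1 \<star> ?e" "rg (circ X x y h1) = rg y1"
    using circ_parts[OF *(1,2) h1] by (metis cmp_simps eps_simps_L eps_simps_R)
  obtain y2 z2 where p2: "y2 \<preceq> y" "rg y2 = ?f \<star> h2" "dm (circ X y z h2) = dm y2"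
    using circ_parts[OF *(2,3) h2] by (metis cmp_simps eps_simps_L eps_simps_R)
  have m12: "y1 \<in> Mor G" "y2 \<in> Mor G" using le_Mor p1(1) p2(1) by auto
  obtain l where l: "l \<in> sandwich E (dm y1) (dm y2)" using sandwich_ex[of "dm y1" "dm y2"] m12 by auto
  note ls = sandwichD[OF l]
  have ln: "nle E l ?e"
    using lle_trans[OF ls(1) nleD(1)[OF le_dm[OF p1(1)]]] rle_trans[OF ls(2) nleD(2)[OF le_dm[OF p2(1)]]]
    by (simp add: nle_def)
  define y3 where "y3 = restr_dom G l y"
  have y3: "y3 \<preceq> y" "dm y3 = l" "y3 \<in> Mor G" unfolding y3_def using restr_dm[OF *(2) ln] by auto
  define k where "k = rg y3"
  have k: "k \<in> sandwich E (rg y1) (?f \<star> h2)"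
    using sandwich_image[OF p1(1) p2(1) y3(1)] l y3(2) p2(2) by (simp add: k_def)
  note ks = sandwichD[OF k]
  have n1: "nle E (rg y1) ?f" and n2: "nle E (dm y2) ?e" using le_rg[OF p1(1)] le_dm[OF p2(1)] .
  have kn: "nle E k ?f" unfolding k_def using le_rg[OF y3(1)] .
  obtain m where m: "rle E m h2" "lle E m ?f" "?f \<star> m = k"
    using B5l[OF nleD(1)[OF kn] s2(1)] ks(2) mul_r[OF nleD(2)[OF kn]] by metis
  obtain m' where m': "lle E m' h1" "rle E m' ?e" "m' \<star> ?e = l"
    using op.B5l[of l ?e h1] nleD(2)[OF ln] s1(2) ls(1) p1(2) mul_l[OF nleD(1)[OF ln]] by auto
  have mS: "m \<in> sandwich E (rg y1) (dm z)" using sandwich_restrict[OF h2 n1 k m] .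
  have m'S: "m' \<in> sandwich E (rg x) (dm y2)"
    using op.sandwich_restrict[of h1 ?e "rg x" "dm y2" l m'] h1 n2 l m' p1(2) by simp
  have mk: "Leq E m k" using B2l(1)[OF m(2)] m(3) by simp
  have m'l: "Req E m' l" using B2r(1)[OF m'(2)] m'(3) by simp
  have fm: "rg y1 \<star> m = rg y1 \<star> k" using B4l[OF sandwichD(1)[OF mS] nleD(1)[OF n1]] m(3) by simp
  have em: "m' \<star> dm y2 = l \<star> dm y2" using B4r[OF sandwichD(2)[OF m'S] nleD(2)[OF n2]] m'(3) by simp
  have 1: "circ X (circ X x y h1) z m = mid X x m' y3 m z"
    by (rule circ_half[OF *(1-3) h1 y3(1)]) (use ls p1 y3 m' mS mk fm in \<open>simp_all add: k_def\<close>)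
  have cop: "circ (opi X) z y h2 = circ X y z h2" by (rule circ_opi[OF *(2,3) h2])
  have c2: "circ X y z h2 \<in> Mor G" by (rule circ_Mor(1)[OF *(2,3) h2])
  have m'S2: "m' \<in> sandwich E (rg x) (dm (circ X y z h2))" using m'S p2(3) by simp
  have "circ (opi X) (circ (opi X) z y h2) x m' = mid (opi X) z m y3 m' x"
    by (rule op.circ_half) (use * h2 y3 ks m m'S2 m'l em p2 in \<open>simp_all add: cop k_def\<close>)
  then have 2: "circ X x (circ X y z h2) m' = mid X x m' y3 m z"
    using circ_opi[OF *(1) c2 m'S2] mid_opi[OF *(1) y3(3) *(3), of m' m] sandwichD[OF mS] sandwichD[OF m'S] m'l mk y3
    by (simp add: cop k_def Leq_sym)
  have mS1: "m \<in> sandwich E (rg (circ X x y h1)) (dm z)" using mS p1(3) by simp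
  show ?thesis
    using pmul_pcl[OF *(1,2) h1] pmul_pcl[OF *(2,3) h2] pmul_pcl[OF circ_Mor(1)[OF *(1,2) h1] *(3) mS1]
      pmul_pcl[OF *(1) c2 m'S2] 1 2 * by simp
qed

subsection \<open>Idempotents and inverses\<close>

lemma ent_in: "e \<in> carr E \<Longrightarrow> ent X e \<in> pS X"
  by (simp add: ent_def pS_def)

lemma pcl_in: "\<alpha> \<in> Mor G \<Longrightarrow> pcl X \<alpha> \<in> pS X"
  by (simp add: pS_def)

lemma restr_Idn: "nle E f e \<Longrightarrow> Idn G f \<preceq> Idn G e"
  using vle_iff nle_carr unfolding vle_def by blast

text \<open>
  The domain of a product is below the domain of its first factor, which gives one direction; conversely
  \<open>\<d>(\<alpha>)e\<close> is a sandwich element for which the product with \<open>1\<^sub>e\<close>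
  only adds an evaluation.
\<close>

lemma ent_left_iff:
  assumes a: "\<alpha> \<in> Mor G" and e: "e \<in> carr E"
  shows "pmul X (ent X e) (pcl X \<alpha>) = pcl X \<alpha> \<longleftrightarrow> rle E (dm \<alpha>) e"
proof
  assume eq: "pmul X (ent X e) (pcl X \<alpha>) = pcl X \<alpha>"
  obtain h where h: "h \<in> sandwich E (rg (Idn G e)) (dm \<alpha>)" using sandwich_ex[of e "dm \<alpha>"] a e by auto
  have i: "Idn G e \<in> Mor G" using e by simp
  have "pcl X (circ X (Idn G e) \<alpha> h) = pcl X \<alpha>" using eq pmul_pcl[OF i a h] by (simp add: ent_def)
  then have "simP X (circ X (Idn G e) \<alpha> h) \<alpha>" using pcl_eq[OF a] by blast
  then have "Req E (dm (circ X (Idn G e) \<alpha> h)) (dm \<alpha>)" by (rule simPD(3))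
  moreover have "nle E (dm (circ X (Idn G e) \<alpha> h)) e" using circ_Mor(2)[OF i a h] e by simp
  ultimately show "rle E (dm \<alpha>) e" using rle_trans ReqD(2) nleD(2) by blast
next
  assume r: "rle E (dm \<alpha>) e"
  interpret op: ind_gpd "opi X" by (rule ind_gpd_opi)
  define h where "h = dm \<alpha> \<star> e"
  have h: "h \<in> sandwich E e (dm \<alpha>)" unfolding h_def using op.sandwich_of_lle[of "dm \<alpha>" e] r by simp
  have hR: "Req E (dm \<alpha>) h" "nle E h e" unfolding h_def using B2r[OF r] .
  have hd: "h \<star> dm \<alpha> = dm \<alpha>" using mul_r[OF ReqD(1)[OF hR(1)]] .
  have eh: "e \<star> h = h" using nle_mul(2)[OF hR(2)] .
  have hc: "h \<in> carr E" using nle_carr[OF hR(2)] by simp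
  have i: "Idn G e \<in> Mor G" "rg (Idn G e) = e" using e by simp_all
  have h': "h \<in> sandwich E (rg (Idn G e)) (dm \<alpha>)" using h i by simp
  have "circ X (Idn G e) \<alpha> h = Idn G h \<bullet> (\<epsilon> (rg (Idn G e) \<star> h) h \<bullet> (\<epsilon> h (h \<star> dm \<alpha>) \<bullet> \<alpha>))"
    by (rule circ_eqI(1)[OF i(1) a h' restr_Idn[OF hR(2)] le_refl[OF a]]) (simp_all add: hc eh i hd)
  also have "\<dots> = \<epsilon> h (dm \<alpha>) \<bullet> \<alpha>" using a hc hR by (simp add: eh i hd eps_id Req_sym)
  finally have c: "circ X (Idn G e) \<alpha> h = \<epsilon> h (dm \<alpha>) \<bullet> \<alpha>" .
  have "simP X \<alpha> (\<epsilon> h (dm \<alpha>) \<bullet> \<alpha>)"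
  proof (rule simPI)
    show "\<alpha> \<in> Mor G" "\<epsilon> h (dm \<alpha>) \<bullet> \<alpha> \<in> Mor G" using a hR by (simp_all add: Req_sym)
    show "Req E (dm \<alpha>) (dm (\<epsilon> h (dm \<alpha>) \<bullet> \<alpha>))" "Leq E (rg \<alpha>) (rg (\<epsilon> h (dm \<alpha>) \<bullet> \<alpha>))"
      using a hR by (simp_all add: Req_sym Leq_refl)
    show "\<alpha> \<bullet> \<epsilon> (rg \<alpha>) (rg (\<epsilon> h (dm \<alpha>) \<bullet> \<alpha>)) = \<epsilon> (dm \<alpha>) (dm (\<epsilon> h (dm \<alpha>) \<bullet> \<alpha>)) \<bullet> (\<epsilon> h (dm \<alpha>) \<bullet> \<alpha>)"
      using a hR eps_R_inv[OF hR(1) a] by (simp add: Req_sym eps_id)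
  qed
  then show "pmul X (ent X e) (pcl X \<alpha>) = pcl X \<alpha>"
    using pmul_pcl[OF i(1) a h'] c pclI by (simp add: ent_def)
qed

lemma ent_right_iff:
  assumes a: "\<alpha> \<in> Mor G" and e: "e \<in> carr E"
  shows "pmul X (pcl X \<alpha>) (ent X e) = pcl X \<alpha> \<longleftrightarrow> lle E (rg \<alpha>) e"
proof -
  interpret op: ind_gpd "opi X" by (rule ind_gpd_opi)
  show ?thesis using op.ent_left_iff[of \<alpha> e] a e pmul_opi by (simp add: pcl_opi ent_opi)
qed

lemma ent_mult_lle:
  assumes b: "\<beta> \<in> Mor G" and l: "lle E (dm \<beta>) e"
  shows "pmul X (ent X e) (pcl X \<beta>) = pcl X (\<epsilon> (e \<star> dm \<beta>) (dm \<beta>) \<bullet> \<beta>)"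
proof -
  let ?d = "dm \<beta>"
  have e: "e \<in> carr E" "?d \<in> carr E" using lle_carr[OF l] by auto
  have i: "Idn G e \<in> Mor G" "rg (Idn G e) = e" using e by simp_all
  have h: "?d \<in> sandwich E (rg (Idn G e)) ?d" using sandwich_of_lle'[OF l] i by simp
  note B = B2l[OF l]
  have c: "e \<star> ?d \<in> carr E" using nle_carr[OF B(2)] by simp
  have dd: "?d \<star> ?d = ?d" using mul_l[OF lle_refl[OF e(2)]] .
  have "circ X (Idn G e) \<beta> ?d = Idn G (e \<star> ?d) \<bullet> (\<epsilon> (rg (Idn G e) \<star> ?d) ?d \<bullet> (\<epsilon> ?d (?d \<star> ?d) \<bullet> \<beta>))"
    by (rule circ_eqI(1)[OF i(1) b h restr_Idn[OF B(2)] le_refl[OF b]]) (simp_all add: c i dd)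
  also have "\<dots> = \<epsilon> (e \<star> ?d) ?d \<bullet> \<beta>" using b c B e by (simp add: i dd eps_id Leq_sym)
  finally show ?thesis using pmul_pcl[OF i(1) b h] by (simp add: ent_def)
qed

lemma pmul_minv: assumes a: "\<alpha> \<in> Mor G" shows "pmul X (pcl X \<alpha>) (pcl X (minv G \<alpha>)) = ent X (dm \<alpha>)"
proof -
  let ?r = "rg \<alpha>"
  have r: "?r \<in> carr E" "?r \<star> ?r = ?r" using a mul_l[OF lle_refl] by auto
  have h: "?r \<in> sandwich E (rg \<alpha>) (dm (minv G \<alpha>))" using sandwich_of_lle'[OF lle_refl[OF r(1)]] a by simp
  have m: "minv G \<alpha> \<in> Mor G" using a by simp
  have "circ X \<alpha> (minv G \<alpha>) ?r = \<alpha> \<bullet> (\<epsilon> (rg \<alpha> \<star> ?r) ?r \<bullet> (\<epsilon> ?r (?r \<star> dm (minv G \<alpha>)) \<bullet> minv G \<alpha>))"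
    by (rule circ_eqI(1)[OF a m h le_refl[OF a] le_refl[OF m]]) (use a r in simp_all)
  also have "\<dots> = Idn G (dm \<alpha>)" using a r by (simp add: eps_id minv_props)
  finally show ?thesis using pmul_pcl[OF a m h] by (simp add: ent_def)
qed

lemma ent_le_l: "e \<in> carr E \<Longrightarrow> f \<in> carr E \<Longrightarrow> pmul X (ent X e) (ent X f) = ent X e \<longleftrightarrow> lle E e f"
  using ent_right_iff[of "Idn G e" f] by (simp add: ent_def)

lemma ent_le_r: "e \<in> carr E \<Longrightarrow> f \<in> carr E \<Longrightarrow> pmul X (ent X f) (ent X e) = ent X e \<longleftrightarrow> rle E e f"
  using ent_left_iff[of "Idn G e" f] by (simp add: ent_def)

lemma ent_inj: assumes "e \<in> carr E" "f \<in> carr E" "ent X e = ent X f" shows "e = f"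
proof -
  have "lle E e f" "rle E f e" using ent_le_l[OF assms(1,2)] ent_le_r[OF assms(2,1)] ent_le_l[of e e] assms lle_refl by auto
  then show ?thesis by (rule lr_eq)
qed

text \<open>
  If \<open>\<alpha> \<circ> \<alpha>\<close> is \<open>p\<close>-related to \<open>\<alpha>\<close>, its ends
  are below and related to those of \<open>\<alpha>\<close>, so no proper restriction takes place. Cancelling
  \<open>\<alpha>\<close> leaves \<open>\<alpha>\<close> as an evaluation through the sandwich element
  \<open>h\<close>, that is, as a representative of the class of \<open>1\<^sub>h\<close>.
\<close>

lemma idempotent_ent:
  assumes A: "A \<in> pS X" "pmul X A A = A"
  obtains e where "e \<in> carr E" "A = ent X e"
proof -
  obtain \<alpha> where a: "\<alpha> \<in> Mor G" "A = pcl X \<alpha>" using A(1) by (auto simp: pS_def)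
  obtain h where h: "h \<in> sandwich E (rg \<alpha>) (dm \<alpha>)" using sandwich_ex[of "rg \<alpha>" "dm \<alpha>"] a by auto
  obtain b c where *: "b \<preceq> \<alpha>" "c \<preceq> \<alpha>" "rg b = rg \<alpha> \<star> h" "dm c = h \<star> dm \<alpha>" "b \<in> Mor G" "c \<in> Mor G"
    "Leq E (rg \<alpha> \<star> h) h" "Req E h (h \<star> dm \<alpha>)"
    "circ X \<alpha> \<alpha> h = b \<bullet> (\<epsilon> (rg \<alpha> \<star> h) h \<bullet> (\<epsilon> h (h \<star> dm \<alpha>) \<bullet> c))" using circ_parts[OF a(1) a(1) h] .
  have "pcl X (circ X \<alpha> \<alpha> h) = pcl X \<alpha>" using pmul_pcl[OF a(1) a(1) h] A(2) a(2) by simp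
  then have p: "simP X (circ X \<alpha> \<alpha> h) \<alpha>" using pcl_eq[OF a(1)] by blast
  note s = simPD[OF p]
  have d: "dm (circ X \<alpha> \<alpha> h) = dm b" "rg (circ X \<alpha> \<alpha> h) = rg c" unfolding *(9) using * by simp_all
  have db: "dm b = dm \<alpha>" using nle_Req_eq[OF le_dm[OF *(1)]] s(3) d by simp
  have rc: "rg c = rg \<alpha>" using nle_Leq_eq[OF le_rg[OF *(2)]] s(4) d by simp
  have bc: "b = \<alpha>" "c = \<alpha>" using dom_unique[OF *(1) le_refl[OF a(1)] db] cod_unique[OF *(2) le_refl[OF a(1)] rc] .
  have hL: "Leq E (rg \<alpha>) h" "Req E h (dm \<alpha>)" using * bc by auto
  have eh: "rg \<alpha> \<star> h = rg \<alpha>" "h \<star> dm \<alpha> = dm \<alpha>" using * bc by auto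
  have "\<alpha> \<bullet> (\<epsilon> (rg \<alpha>) h \<bullet> (\<epsilon> h (dm \<alpha>) \<bullet> \<alpha>)) = \<alpha>"
    using s(5) unfolding d db rc using *(9) a(1) hL unfolding bc eh by (simp add: eps_id)
  then have "minv G \<alpha> \<bullet> (\<alpha> \<bullet> (\<epsilon> (rg \<alpha>) h \<bullet> (\<epsilon> h (dm \<alpha>) \<bullet> \<alpha>))) = minv G \<alpha> \<bullet> \<alpha>" by simp
  then have id: "\<epsilon> (rg \<alpha>) h \<bullet> (\<epsilon> h (dm \<alpha>) \<bullet> \<alpha>) = Idn G (rg \<alpha>)"
    using cancel_left[of \<alpha> "\<epsilon> (rg \<alpha>) h \<bullet> (\<epsilon> h (dm \<alpha>) \<bullet> \<alpha>)"] a(1) hL minv_props(5)[OF a(1)] by simp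
  have hc: "h \<in> carr E" using Leq_carr[OF hL(1)] by simp
  have "\<epsilon> h (dm \<alpha>) \<bullet> \<alpha> = \<epsilon> h (rg \<alpha>) \<bullet> (\<epsilon> (rg \<alpha>) h \<bullet> (\<epsilon> h (dm \<alpha>) \<bullet> \<alpha>))"
    using eps_L_inv[OF Leq_sym[OF hL(1)], of "\<epsilon> h (dm \<alpha>) \<bullet> \<alpha>"] a(1) hL by simp
  then have e: "\<epsilon> h (dm \<alpha>) \<bullet> \<alpha> = \<epsilon> h (rg \<alpha>)" unfolding id using hL by (simp add: Leq_sym)
  have "simP X (Idn G h) \<alpha>"
    by (rule simPI) (use a(1) hc hL e in \<open>simp_all add: Leq_sym\<close>)
  then have "A = ent X h" using pclI a(2) by (simp add: ent_def)
  then show ?thesis using that hc by blast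
qed

end

locale regular_semigroup =
  fixes S :: "'s set" and mul :: "'s \<Rightarrow> 's \<Rightarrow> 's" (infixl "\<otimes>" 70)
  assumes closed: "a \<in> S \<Longrightarrow> b \<in> S \<Longrightarrow> a \<otimes> b \<in> S"
    and mul_assoc: "a \<in> S \<Longrightarrow> b \<in> S \<Longrightarrow> c \<in> S \<Longrightarrow> (a \<otimes> b) \<otimes> c = a \<otimes> (b \<otimes> c)"
    and inverse_ex: "a \<in> S \<Longrightarrow> \<exists>b\<in>S. a \<otimes> b \<otimes> a = a \<and> b \<otimes> a \<otimes> b = b"

lemma (in ind_gpd) semigroup: "regular_semigroup (pS X) (pmul X)"
proof
  show "pmul X A B \<in> pS X" if "A \<in> pS X" "B \<in> pS X" for A B using pmul_closed[OF that] .
  show "pmul X (pmul X A B) C = pmul X A (pmul X B C)" if "A \<in> pS X" "B \<in> pS X" "C \<in> pS X" for A B C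
    using pmul_assoc[OF that] .
  show "\<exists>B\<in>pS X. pmul X (pmul X A B) A = A \<and> pmul X (pmul X B A) B = B" if A: "A \<in> pS X" for A
  proof -
    obtain \<alpha> where a: "\<alpha> \<in> Mor G" "A = pcl X \<alpha>" using A by (auto simp: pS_def)
    have m: "minv G \<alpha> \<in> Mor G" using a by simp
    have "pmul X (pmul X A (pcl X (minv G \<alpha>))) A = A"
      unfolding a(2) pmul_minv[OF a(1)] using ent_left_iff[OF a(1)] a(1) by (simp add: rle_refl)
    moreover have "pmul X (pmul X (pcl X (minv G \<alpha>)) A) (pcl X (minv G \<alpha>)) = pcl X (minv G \<alpha>)"
      using pmul_minv[OF m] ent_left_iff[OF m] a by (simp add: rle_refl)
    ultimately show ?thesis using pcl_in[OF m] by blast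
  qed
qed

section \<open>The category of principal left ideals of a regular semigroup\<close>

text \<open>
  The category of principal left ideals of a regular semigroup, up to the way its objects and morphisms are
  encoded: \<open>lc e\<close> stands for \<open>Se\<close>, and \<open>LM e s f\<close> for the map
  \<open>x \<mapsto> xs\<close> from \<open>Se\<close> to \<open>Sf\<close>, where \<open>s \<in> eSf\<close>.
  With another idempotent generator \<open>e\<close> of the same left ideal \<open>Se'\<close>, translation by
  \<open>s'\<close> is translation by \<open>es'\<close>.
\<close>

locale semigroup_category = regular_semigroup S mul
  for S :: "'s set" and mul :: "'s \<Rightarrow> 's \<Rightarrow> 's" (infixl "\<otimes>" 70) +
  fixes C :: "('o, 'm) scat" and lc :: "'s \<Rightarrow> 'o" and LM :: "'s \<Rightarrow> 's \<Rightarrow> 's \<Rightarrow> 'm"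
  assumes Obj_C: "Obj C = lc ` {e \<in> S. e \<otimes> e = e}"
    and lc_eq: "e \<in> S \<Longrightarrow> f \<in> S \<Longrightarrow> e \<otimes> e = e \<Longrightarrow> f \<otimes> f = f \<Longrightarrow> lc e = lc f \<longleftrightarrow> e \<otimes> f = e \<and> f \<otimes> e = f"
    and Mor_C: "Mor C = {LM e s f | e s f. e \<in> S \<and> s \<in> S \<and> f \<in> S \<and> e \<otimes> e = e \<and> f \<otimes> f = f \<and> e \<otimes> s = s \<and> s \<otimes> f = s}"
    and LM_eq: "e \<in> S \<Longrightarrow> s \<in> S \<Longrightarrow> f \<in> S \<Longrightarrow> e \<otimes> e = e \<Longrightarrow> f \<otimes> f = f \<Longrightarrow> e \<otimes> s = s \<Longrightarrow> s \<otimes> f = s \<Longrightarrow>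
      e' \<in> S \<Longrightarrow> s' \<in> S \<Longrightarrow> f' \<in> S \<Longrightarrow> e' \<otimes> e' = e' \<Longrightarrow> f' \<otimes> f' = f' \<Longrightarrow> e' \<otimes> s' = s' \<Longrightarrow> s' \<otimes> f' = s' \<Longrightarrow>
      LM e s f = LM e' s' f' \<longleftrightarrow> lc e = lc e' \<and> lc f = lc f' \<and> s = e \<otimes> s'"
    and ext_C: "Dom C \<in> extensional (Mor C)" "Cod C \<in> extensional (Mor C)" "Idn C \<in> extensional (Obj C)"
      "Cmp C \<in> extensional (Mor C)" "\<And>f. f \<in> Mor C \<Longrightarrow> Cmp C f \<in> extensional {g \<in> Mor C. Dom C g = Cod C f}"
    and Dom_Cod_LM: "e \<in> S \<Longrightarrow> s \<in> S \<Longrightarrow> f \<in> S \<Longrightarrow> e \<otimes> e = e \<Longrightarrow> f \<otimes> f = f \<Longrightarrow> e \<otimes> s = s \<Longrightarrow> s \<otimes> f = s \<Longrightarrow>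
      Dom C (LM e s f) = lc e \<and> Cod C (LM e s f) = lc f"
    and Idn_LM: "e \<in> S \<Longrightarrow> e \<otimes> e = e \<Longrightarrow> Idn C (lc e) = LM e e e"
    and Cmp_LM: "e \<in> S \<Longrightarrow> s \<in> S \<Longrightarrow> f \<in> S \<Longrightarrow> t \<in> S \<Longrightarrow> g \<in> S \<Longrightarrow> e \<otimes> e = e \<Longrightarrow> f \<otimes> f = f \<Longrightarrow> g \<otimes> g = g \<Longrightarrow>
      e \<otimes> s = s \<Longrightarrow> s \<otimes> f = s \<Longrightarrow> f \<otimes> t = t \<Longrightarrow> t \<otimes> g = t \<Longrightarrow> LM e s f \<cdot>\<^bsub>C\<^esub> LM f t g = LM e (s \<otimes> t) g"
    and Incl_C: "Incl C = {LM e e f | e f. e \<in> S \<and> f \<in> S \<and> e \<otimes> e = e \<and> f \<otimes> f = f \<and> e \<otimes> f = e}"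

definition ei :: "('e, 'm) indgpd \<Rightarrow> 'm set \<Rightarrow> 'e" where
  "ei X A = (THE e. e \<in> carr (igb X) \<and> ent X e = A)"

definition plc :: "('e, 'm) indgpd \<Rightarrow> 'm set \<Rightarrow> 'e set" where
  "plc X A = lcl X (ei X A)"

text \<open>
  The morphism \<open>[e,\<alpha>,f\<rangle>\<close>, named by the \<open>p\<close>-classes of
  \<open>1\<^sub>e\<close>, \<open>\<alpha>\<close> and \<open>1\<^sub>f\<close>.
\<close>

definition pLM :: "('e, 'm) indgpd \<Rightarrow> 'm set \<Rightarrow> 'm set \<Rightarrow> 'm set \<Rightarrow> ('e, 'm) tmor" where
  "pLM X A s B = lmor X (ei X A) (SOME \<alpha>. \<alpha> \<in> s) (ei X B)"

context ind_gpd
begin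

lemma lcl_eq: "f \<in> carr E \<Longrightarrow> lcl X e = lcl X f \<longleftrightarrow> Leq E e f"
proof
  assume "f \<in> carr E" "lcl X e = lcl X f"
  then have "f \<in> lcl X e" using Leq_refl by (simp add: lcl_def)
  then show "Leq E e f" using Leq_sym by (simp add: lcl_def)
next
  assume "Leq E e f"
  then show "lcl X e = lcl X f" unfolding lcl_def by (intro Collect_cong) (metis Leq_trans Leq_sym)
qed

lemma simLI: "\<alpha> \<in> Mor G \<Longrightarrow> \<beta> \<in> Mor G \<Longrightarrow> Leq E (dm \<alpha>) (dm \<beta>) \<Longrightarrow> Leq E (rg \<alpha>) (rg \<beta>) \<Longrightarrow>
    \<alpha> \<bullet> \<epsilon> (rg \<alpha>) (rg \<beta>) = \<epsilon> (dm \<alpha>) (dm \<beta>) \<bullet> \<beta> \<Longrightarrow> simL X \<alpha> \<beta>"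
  by (simp add: simL_def)

lemma simLD:
  assumes "simL X \<alpha> \<beta>"
  shows "\<alpha> \<in> Mor G" "\<beta> \<in> Mor G" "Leq E (dm \<alpha>) (dm \<beta>)" "Leq E (rg \<alpha>) (rg \<beta>)"
    "\<alpha> \<bullet> \<epsilon> (rg \<alpha>) (rg \<beta>) = \<epsilon> (dm \<alpha>) (dm \<beta>) \<bullet> \<beta>"
  using assms unfolding simL_def by auto

lemma simL_refl: "\<alpha> \<in> Mor G \<Longrightarrow> simL X \<alpha> \<alpha>"
  by (rule simLI) (simp_all add: Leq_refl eps_id)

lemma simL_sym: assumes "simL X \<alpha> \<beta>" shows "simL X \<beta> \<alpha>"
proof (rule simLI)
  note s = simLD[OF assms]
  show "\<beta> \<in> Mor G" "\<alpha> \<in> Mor G" "Leq E (dm \<beta>) (dm \<alpha>)" "Leq E (rg \<beta>) (rg \<alpha>)" using s Leq_sym by auto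
  have b: "\<beta> = \<epsilon> (dm \<beta>) (dm \<alpha>) \<bullet> (\<alpha> \<bullet> \<epsilon> (rg \<alpha>) (rg \<beta>))"
    unfolding s(5) using eps_L_inv[OF Leq_sym[OF s(3)] s(2)] by simp
  have "\<beta> \<bullet> \<epsilon> (rg \<beta>) (rg \<alpha>) = \<epsilon> (dm \<beta>) (dm \<alpha>) \<bullet> (\<alpha> \<bullet> (\<epsilon> (rg \<alpha>) (rg \<beta>) \<bullet> \<epsilon> (rg \<beta>) (rg \<alpha>)))"
    using arg_cong[OF b, of "\<lambda>z. z \<bullet> \<epsilon> (rg \<beta>) (rg \<alpha>)"] s(1-4) by (simp add: Leq_sym)
  then show "\<beta> \<bullet> \<epsilon> (rg \<beta>) (rg \<alpha>) = \<epsilon> (dm \<beta>) (dm \<alpha>) \<bullet> \<alpha>"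
    using eps_L[OF s(4) Leq_sym[OF s(4)]] s(1) by (simp add: eps_id)
qed

lemma simL_trans: assumes "simL X \<alpha> \<beta>" "simL X \<beta> \<gamma>" shows "simL X \<alpha> \<gamma>"
proof (rule simLI)
  note s = simLD[OF assms(1)] and t = simLD[OF assms(2)]
  show "\<alpha> \<in> Mor G" "\<gamma> \<in> Mor G" using s t by auto
  show "Leq E (dm \<alpha>) (dm \<gamma>)" "Leq E (rg \<alpha>) (rg \<gamma>)" using Leq_trans[OF s(3) t(3)] Leq_trans[OF s(4) t(4)] .
  have "\<alpha> \<bullet> \<epsilon> (rg \<alpha>) (rg \<gamma>) = \<alpha> \<bullet> (\<epsilon> (rg \<alpha>) (rg \<beta>) \<bullet> \<epsilon> (rg \<beta>) (rg \<gamma>))"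
    using eps_L[OF s(4) t(4)] by simp
  also have "\<dots> = \<epsilon> (dm \<alpha>) (dm \<beta>) \<bullet> (\<beta> \<bullet> \<epsilon> (rg \<beta>) (rg \<gamma>))"
    by (rule swap_ext[OF s(5)]) (use s t in simp_all)
  also have "\<dots> = \<epsilon> (dm \<alpha>) (dm \<gamma>) \<bullet> \<gamma>"
    unfolding t(5) by (rule eps_L'[OF s(3) t(3)]) (use t in simp_all)
  finally show "\<alpha> \<bullet> \<epsilon> (rg \<alpha>) (rg \<gamma>) = \<epsilon> (dm \<alpha>) (dm \<gamma>) \<bullet> \<gamma>" .
qed

lemma clsL_eq: assumes "\<beta> \<in> Mor G" shows "clsL X \<alpha> = clsL X \<beta> \<longleftrightarrow> simL X \<alpha> \<beta>"
proof
  assume "clsL X \<alpha> = clsL X \<beta>"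
  moreover have "\<beta> \<in> clsL X \<beta>" using simL_refl[OF assms] by (simp add: clsL_def)
  ultimately have "\<beta> \<in> clsL X \<alpha>" by simp
  then show "simL X \<alpha> \<beta>" by (simp add: clsL_def)
next
  assume "simL X \<alpha> \<beta>"
  then show "clsL X \<alpha> = clsL X \<beta>"
    unfolding clsL_def by (intro Collect_cong) (metis simL_trans simL_sym)
qed

lemma qL_Leq: "Leq E f e \<Longrightarrow> qL X f v = qL X e v"
  unfolding qL_def by (auto intro: Leq_trans Leq_sym)

text \<open>
  A member \<open>(g, gw)\<close> of \<open>qL X e w\<close> is determined by its first component.
\<close>

lemma qL_eqD:
  assumes "qL X e w = qL X e' w'" "e \<in> carr E"
  shows "Leq E e e'" "e \<star> w = e \<star> w'"
proof -
  have "(e, e \<star> w) \<in> qL X e w" using Leq_refl[OF assms(2)] by (simp add: qL_def)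
  then have "(e, e \<star> w) \<in> qL X e' w'" using assms(1) by simp
  then show "Leq E e e'" "e \<star> w = e \<star> w'" by (auto simp: qL_def)
qed

text \<open>
  The first component \<open>e\<close> may be kept fixed among the representatives of a right epi.
\<close>

lemma repi_eq:
  assumes "\<alpha> \<in> Mor G" "rle E (dm \<alpha>) e"
  shows "repi X e \<alpha> = {(qL X e w, clsL X (\<epsilon> w (dm \<alpha>) \<bullet> \<alpha>)) | w. Req E w (dm \<alpha>) \<and> nle E w e}"
proof (intro equalityI subsetI)
  fix p assume "p \<in> repi X e \<alpha>"
  then obtain f v \<theta> where *: "p = (qL X f v, clsL X \<theta>)" "Leq E f e" "nle E v f" "Req E v (dm \<alpha>)"
    "clsL X \<theta> = clsL X (\<epsilon> v (dm \<alpha>) \<bullet> \<alpha>)" unfolding repi_def by blast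
  have "nle E v e"
    using lle_trans[OF nleD(1)[OF *(3)] LeqD(1)[OF *(2)]] rle_trans[OF ReqD(1)[OF *(4)] assms(2)] by (simp add: nle_def)
  then show "p \<in> {(qL X e w, clsL X (\<epsilon> w (dm \<alpha>) \<bullet> \<alpha>)) | w. Req E w (dm \<alpha>) \<and> nle E w e}"
    using * qL_Leq[OF *(2)] by auto
next
  fix p assume "p \<in> {(qL X e w, clsL X (\<epsilon> w (dm \<alpha>) \<bullet> \<alpha>)) | w. Req E w (dm \<alpha>) \<and> nle E w e}"
  then obtain w where *: "p = (qL X e w, clsL X (\<epsilon> w (dm \<alpha>) \<bullet> \<alpha>))" "Req E w (dm \<alpha>)" "nle E w e" by blast
  have "\<epsilon> w (dm \<alpha>) \<bullet> \<alpha> \<in> Mor G" "Leq E e e" using * assms(1) nle_carr[OF *(3)] Leq_refl by simp_all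
  then show "p \<in> repi X e \<alpha>" unfolding repi_def using * by blast
qed

text \<open>
  For a fixed \<open>e\<close>, the retractions in the two right epis are compared at the common element
  \<open>w = \<d>(\<alpha>)e\<close>, where equality of \<open>\<sim>\<^sub>L\<close>-classes means equality
  up to an evaluation at the codomain.
\<close>

lemma repi_same:
  assumes a: "\<alpha> \<in> Mor G" "rle E (dm \<alpha>) e" and b: "\<beta> \<in> Mor G" "rle E (dm \<beta>) e"
  shows "repi X e \<alpha> = repi X e \<beta> \<longleftrightarrow> simP X \<alpha> \<beta>"
proof
  assume eq: "repi X e \<alpha> = repi X e \<beta>"
  define w where "w = dm \<alpha> \<star> e"
  have w: "Req E (dm \<alpha>) w" "nle E w e" unfolding w_def using B2r[OF a(2)] .
  have "(qL X e w, clsL X (\<epsilon> w (dm \<alpha>) \<bullet> \<alpha>)) \<in> repi X e \<alpha>" unfolding repi_eq[OF a] using w Req_sym by blast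
  then obtain w' where w': "qL X e w = qL X e w'" "clsL X (\<epsilon> w (dm \<alpha>) \<bullet> \<alpha>) = clsL X (\<epsilon> w' (dm \<beta>) \<bullet> \<beta>)"
    "Req E w' (dm \<beta>)" "nle E w' e" unfolding eq repi_eq[OF b] by blast
  have ww: "w' = w"
    using qL_eqD(2)[OF w'(1)] nle_mul(2)[OF w(2)] nle_mul(2)[OF w'(4)] nle_carr[OF w(2)] by simp
  note R = w'(3)[unfolded ww]
  have m: "\<epsilon> w (dm \<beta>) \<bullet> \<beta> \<in> Mor G" "\<epsilon> w (dm \<alpha>) \<bullet> \<alpha> \<in> Mor G" using a b w R by (simp_all add: Req_sym)
  have s: "simL X (\<epsilon> w (dm \<alpha>) \<bullet> \<alpha>) (\<epsilon> w (dm \<beta>) \<bullet> \<beta>)" using w'(2) clsL_eq[OF m(1)] ww by simp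
  note sl = simLD[OF s]
  have wa: "Req E w (dm \<alpha>)" using w Req_sym by blast
  have L: "Leq E (rg \<alpha>) (rg \<beta>)" using sl(4) a b wa R by simp
  have wc: "w \<in> carr E" using nle_carr[OF w(2)] by simp
  have eq2: "\<epsilon> w (dm \<alpha>) \<bullet> (\<alpha> \<bullet> \<epsilon> (rg \<alpha>) (rg \<beta>)) = \<epsilon> w (dm \<beta>) \<bullet> \<beta>"
    using sl(5) a b wa R L wc m by (simp add: eps_id)
  have "\<alpha> \<bullet> \<epsilon> (rg \<alpha>) (rg \<beta>) = \<epsilon> (dm \<alpha>) w \<bullet> (\<epsilon> w (dm \<alpha>) \<bullet> (\<alpha> \<bullet> \<epsilon> (rg \<alpha>) (rg \<beta>)))"
    using eps_R_inv[OF w(1), of "\<alpha> \<bullet> \<epsilon> (rg \<alpha>) (rg \<beta>)"] a L by simp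
  also have "\<dots> = \<epsilon> (dm \<alpha>) (dm \<beta>) \<bullet> \<beta>" unfolding eq2 by (rule eps_R'[OF w(1) R b(1)]) simp
  finally show "simP X \<alpha> \<beta>" using simPI[OF a(1) b(1) Req_trans[OF w(1) R] L] by blast
next
  assume p: "simP X \<alpha> \<beta>"
  note s = simPD[OF p]
  have R: "Req E w (dm \<alpha>) \<longleftrightarrow> Req E w (dm \<beta>)" for w using s(3) Req_trans Req_sym by blast
  have "clsL X (\<epsilon> w (dm \<alpha>) \<bullet> \<alpha>) = clsL X (\<epsilon> w (dm \<beta>) \<bullet> \<beta>)" if w: "Req E w (dm \<alpha>)" for w
  proof -
    note w' = w[unfolded R]
    have m: "\<epsilon> w (dm \<beta>) \<bullet> \<beta> \<in> Mor G" "\<epsilon> w (dm \<alpha>) \<bullet> \<alpha> \<in> Mor G" using a b w w' by simp_all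
    have wc: "w \<in> carr E" using Req_carr[OF w] by simp
    have "\<epsilon> w (dm \<alpha>) \<bullet> (\<alpha> \<bullet> \<epsilon> (rg \<alpha>) (rg \<beta>)) = \<epsilon> w (dm \<beta>) \<bullet> \<beta>"
      unfolding s(5) by (rule eps_R'[OF w s(3) b(1)]) simp
    then have "simL X (\<epsilon> w (dm \<alpha>) \<bullet> \<alpha>) (\<epsilon> w (dm \<beta>) \<bullet> \<beta>)"
      using a b w w' s(4) wc m by (intro simLI) (simp_all add: Leq_refl eps_id)
    then show ?thesis using clsL_eq[OF m(1)] by blast
  qed
  then show "repi X e \<alpha> = repi X e \<beta>" unfolding repi_eq[OF a] repi_eq[OF b] using R by (intro Collect_cong) metis
qed

lemma repi_shift_aux:
  assumes b: "\<beta> \<in> Mor G" and d: "nle E (dm \<beta>) e'" and e: "Leq E e e'"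
    and w': "Req E w' (dm \<beta>)" "nle E w' e'"
  defines "d \<equiv> dm \<beta>" and "w \<equiv> e \<star> w'"
  shows "Req E w (e \<star> d)" "nle E w e" "qL X e w = qL X e' w'"
    "clsL X (\<epsilon> w (e \<star> d) \<bullet> (\<epsilon> (e \<star> d) d \<bullet> \<beta>)) = clsL X (\<epsilon> w' d \<bullet> \<beta>)"
proof -
  have de: "lle E d e" "lle E w' e" using lle_trans[OF nleD(1) LeqD(2)[OF e]] d w'(2) by (auto simp: d_def)
  note D = B2l[OF de(1)] and W = B2l[OF de(2)]
  have wd: "Req E w' d" using w'(1) by (simp add: d_def)
  show R: "Req E w (e \<star> d)"
    unfolding w_def using B3l(1)[OF de(2,1) ReqD(1)[OF wd]] B3l(1)[OF de(1,2) ReqD(2)[OF wd]] by (simp add: Req_def)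
  show "nle E w e" unfolding w_def using W by simp
  have "g \<star> w = g \<star> w'" if "Leq E g e" for g
  proof -
    have "lle E w' g" using lle_trans[OF de(2) LeqD(2)[OF that]] .
    then show ?thesis unfolding w_def by (rule B4l[OF _ LeqD(1)[OF that]])
  qed
  then have "qL X e w = qL X e w'" unfolding qL_def by auto
  then show "qL X e w = qL X e' w'" using qL_Leq[OF e, of w'] by simp
  have wL: "Leq E w w'" unfolding w_def using W(1) Leq_sym by blast
  have dL: "Leq E (e \<star> d) d" using D(1) Leq_sym by blast
  have row: "\<epsilon> w' d \<bullet> \<epsilon> d (e \<star> d) = \<epsilon> w' w \<bullet> \<epsilon> w (e \<star> d)" unfolding w_def by (rule IG2_row[OF de(2,1) wd])
  have bd: "dm \<beta> = d" by (simp add: d_def)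
  have "\<epsilon> w w' \<bullet> (\<epsilon> w' d \<bullet> \<beta>) = \<epsilon> w w' \<bullet> (\<epsilon> w' d \<bullet> (\<epsilon> d (e \<star> d) \<bullet> (\<epsilon> (e \<star> d) d \<bullet> \<beta>)))"
    using eps_L_inv[OF D(1) b bd] by simp
  also have "\<dots> = \<epsilon> w w' \<bullet> (\<epsilon> w' w \<bullet> (\<epsilon> w (e \<star> d) \<bullet> (\<epsilon> (e \<star> d) d \<bullet> \<beta>)))"
    by (rule arg_cong[of _ _ "\<lambda>z. \<epsilon> w w' \<bullet> z"], rule swap_ext[OF row]) (use b bd D dL wL wd R in \<open>simp_all add: Leq_sym\<close>)
  also have "\<dots> = \<epsilon> w (e \<star> d) \<bullet> (\<epsilon> (e \<star> d) d \<bullet> \<beta>)"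
    by (rule eps_L_inv[OF wL]) (use b bd dL R in simp_all)
  finally have eq: "\<epsilon> w (e \<star> d) \<bullet> (\<epsilon> (e \<star> d) d \<bullet> \<beta>) = \<epsilon> w w' \<bullet> (\<epsilon> w' d \<bullet> \<beta>)" by simp
  have m: "\<epsilon> w (e \<star> d) \<bullet> (\<epsilon> (e \<star> d) d \<bullet> \<beta>) \<in> Mor G" "\<epsilon> w' d \<bullet> \<beta> \<in> Mor G" using b bd R dL wd by simp_all
  have "simL X (\<epsilon> w (e \<star> d) \<bullet> (\<epsilon> (e \<star> d) d \<bullet> \<beta>)) (\<epsilon> w' d \<bullet> \<beta>)"
    by (rule simLI[OF m]) (use b bd R dL wd wL eq m in \<open>simp_all add: Leq_refl eps_id\<close>)
  then show "clsL X (\<epsilon> w (e \<star> d) \<bullet> (\<epsilon> (e \<star> d) d \<bullet> \<beta>)) = clsL X (\<epsilon> w' d \<bullet> \<beta>)" using clsL_eq[OF m(2)] by blast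
qed

text \<open>
  Passing from \<open>e'\<close> to an \<open>\<L>\<close>-related \<open>e\<close> multiplies the domains by
  \<open>e\<close> on the left; the row-singular square over \<open>e\<close> on \<open>w'\<close> and
  \<open>\<d>(\<beta>)\<close> compares the two right epis.
\<close>

lemma repi_shift:
  assumes b: "\<beta> \<in> Mor G" and d: "nle E (dm \<beta>) e'" and e: "Leq E e e'"
  shows "repi X e (\<epsilon> (e \<star> dm \<beta>) (dm \<beta>) \<bullet> \<beta>) = repi X e' \<beta>"
proof -
  let ?d = "dm \<beta>"
  let ?b = "\<epsilon> (e \<star> ?d) ?d \<bullet> \<beta>"
  have de: "lle E ?d e" using lle_trans[OF nleD(1)[OF d] LeqD(2)[OF e]] .
  note D = B2l[OF de]
  have bm: "?b \<in> Mor G" "dm ?b = e \<star> ?d" using b D by (simp_all add: Leq_sym)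
  have rb: "rle E (dm ?b) e" using nleD(2)[OF D(2)] bm(2) by simp
  note aux = repi_shift_aux[OF b d e]
  have "\<exists>w'. w = e \<star> w' \<and> Req E w' ?d \<and> nle E w' e'" if w: "Req E w (e \<star> ?d)" "nle E w e" for w
  proof (intro exI[of _ "e' \<star> w"] conjI)
    have we': "lle E w e'" using lle_trans[OF nleD(1)[OF w(2)] LeqD(1)[OF e]] .
    show "w = e \<star> (e' \<star> w)" using B4l[OF nleD(1)[OF w(2)] LeqD(1)[OF e]] nle_mul(2)[OF w(2)] by simp
    show "nle E (e' \<star> w) e'" using B2l(2)[OF we'] .
    have ed: "lle E (e \<star> ?d) e'" using lle_trans[OF nleD(1)[OF D(2)] LeqD(1)[OF e]] .
    have "e' \<star> (e \<star> ?d) = ?d" using B4l[OF nleD(1)[OF d] LeqD(2)[OF e]] nle_mul(2)[OF d] by simp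
    then show "Req E (e' \<star> w) ?d"
      using B3l(1)[OF we' ed ReqD(1)[OF w(1)]] B3l(1)[OF ed we' ReqD(2)[OF w(1)]] by (simp add: Req_def)
  qed
  then show ?thesis
    unfolding repi_eq[OF bm(1) rb] repi_eq[OF b nleD(2)[OF d]] bm(2) using aux by blast
qed

text \<open>
  The condition on \<open>\<d>(\<alpha>)\<close> is \<open>\<le>\<^sub>r\<close> rather than
  \<open>\<le>\<close>, as this is invariant under \<open>p\<close>; it amounts to the class of
  \<open>\<alpha>\<close> being in \<open>eSf\<close>.
\<close>

definition vrep :: "'e \<Rightarrow> 'm \<Rightarrow> 'e \<Rightarrow> bool" where
  "vrep e \<alpha> f \<longleftrightarrow> e \<in> carr E \<and> f \<in> carr E \<and> \<alpha> \<in> Mor G \<and> rle E (dm \<alpha>) e \<and> lle E (rg \<alpha>) f"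

lemma vrepD: assumes "vrep e \<alpha> f" shows "e \<in> carr E" "f \<in> carr E" "\<alpha> \<in> Mor G" "rle E (dm \<alpha>) e" "lle E (rg \<alpha>) f"
  using assms unfolding vrep_def by auto

lemma vrep_simP: "vrep e \<alpha> f \<Longrightarrow> simP X \<alpha> \<beta> \<Longrightarrow> vrep e \<beta> f"
  unfolding vrep_def using simPD[of \<alpha> \<beta>] rle_trans lle_trans LeqD ReqD by blast

lemma vrep_normal:
  assumes "vrep e \<alpha> f"
  obtains \<alpha>' where "simP X \<alpha> \<alpha>'" "nle E (dm \<alpha>') e" "vrep e \<alpha>' f" "lmor X e \<alpha> f = lmor X e \<alpha>' f" "rg \<alpha>' = rg \<alpha>"
proof -
  note v = vrepD[OF assms]
  note R = B2r[OF v(4)]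
  let ?a = "\<epsilon> (dm \<alpha> \<star> e) (dm \<alpha>) \<bullet> \<alpha>"
  have m: "?a \<in> Mor G" "dm ?a = dm \<alpha> \<star> e" "rg ?a = rg \<alpha>" using v(3) R by (simp_all add: Req_sym)
  have p: "simP X \<alpha> ?a"
    by (rule simPI[OF v(3) m(1)]) (use v(3) m R eps_R_inv[OF R(1) v(3)] in \<open>simp_all add: Leq_refl eps_id\<close>)
  have v': "vrep e ?a f" by (rule vrep_simP[OF assms p])
  have "repi X e \<alpha> = repi X e ?a" using repi_same[OF v(3,4) m(1)] vrepD(4)[OF v'] p by blast
  then have "lmor X e \<alpha> f = lmor X e ?a f" using m by (simp add: lmor_def)
  then show ?thesis using that p v' m R by simp
qed

text \<open>
  Equality of morphisms of \<open>L\<^sub>G\<close> in terms of the semigroup: translations agree on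
  \<open>Se = Se'\<close> if they agree at its generator \<open>e\<close>.
\<close>

lemma lmor_eq:
  assumes a: "vrep e \<alpha> f" and b: "vrep e' \<beta> f'"
  shows "lmor X e \<alpha> f = lmor X e' \<beta> f' \<longleftrightarrow> Leq E e e' \<and> Leq E f f' \<and> pcl X \<alpha> = pmul X (ent X e) (pcl X \<beta>)"
proof -
  note va = vrepD[OF a]
  obtain \<beta>1 where b1: "simP X \<beta> \<beta>1" "nle E (dm \<beta>1) e'" "vrep e' \<beta>1 f'" "lmor X e' \<beta> f' = lmor X e' \<beta>1 f'" "rg \<beta>1 = rg \<beta>"
    using vrep_normal[OF b] .
  note vb = vrepD[OF b1(3)]
  let ?b = "\<epsilon> (e \<star> dm \<beta>1) (dm \<beta>1) \<bullet> \<beta>1"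
  have *: "pmul X (ent X e) (pcl X \<beta>) = pcl X ?b" "repi X e ?b = repi X e' \<beta>1" "?b \<in> Mor G" "rle E (dm ?b) e" "rg ?b = rg \<beta>1"
    if e: "Leq E e e'"
  proof -
    have de: "lle E (dm \<beta>1) e" using lle_trans[OF nleD(1)[OF b1(2)] LeqD(2)[OF e]] .
    show "pmul X (ent X e) (pcl X \<beta>) = pcl X ?b" using ent_mult_lle[OF vb(3) de] pclI[OF b1(1)] by simp
    show "repi X e ?b = repi X e' \<beta>1" by (rule repi_shift[OF vb(3) b1(2) e])
    show "?b \<in> Mor G" "rle E (dm ?b) e" "rg ?b = rg \<beta>1" using vb(3) B2l[OF de] nleD(2) by (simp_all add: Leq_sym)
  qed
  show ?thesis
  proof
    assume eq: "lmor X e \<alpha> f = lmor X e' \<beta> f'"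
    then have r: "repi X e \<alpha> = repi X e' \<beta>1" and l: "lcl X f = lcl X f'" unfolding b1(4) by (simp_all add: lmor_def)
    have f: "Leq E f f'" using l lcl_eq[OF vb(2)] by blast
    have "Req E (dm \<alpha> \<star> e) (dm \<alpha>)" "nle E (dm \<alpha> \<star> e) e" using B2r[OF va(4)] Req_sym by auto
    then have "(qL X e (dm \<alpha> \<star> e), clsL X (\<epsilon> (dm \<alpha> \<star> e) (dm \<alpha>) \<bullet> \<alpha>)) \<in> repi X e \<alpha>"
      unfolding repi_eq[OF va(3,4)] by blast
    then obtain w' where "qL X e (dm \<alpha> \<star> e) = qL X e' w'" unfolding r repi_eq[OF vb(3,4)] by blast
    then have e: "Leq E e e'" using qL_eqD(1) va(1) by blast
    have "simP X \<alpha> ?b" using repi_same[OF va(3,4) *(3,4)[OF e]] r *(2)[OF e] by simp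
    then show "Leq E e e' \<and> Leq E f f' \<and> pcl X \<alpha> = pmul X (ent X e) (pcl X \<beta>)" using e f *(1)[OF e] pclI by simp
  next
    assume h: "Leq E e e' \<and> Leq E f f' \<and> pcl X \<alpha> = pmul X (ent X e) (pcl X \<beta>)"
    then have e: "Leq E e e'" and f: "Leq E f f'" by auto
    have p: "simP X \<alpha> ?b" using h *(1)[OF e] pcl_eq[OF *(3)[OF e]] by simp
    have "repi X e \<alpha> = repi X e' \<beta>1" using repi_same[OF va(3,4) *(3,4)[OF e]] p *(2)[OF e] by simp
    moreover have "lcl X (rg \<alpha>) = lcl X (rg \<beta>1)" using simPD(4)[OF p] *(5)[OF e] lcl_eq[of "rg \<beta>1"] vb(3) by simp
    moreover have "lcl X f = lcl X f'" using f lcl_eq[OF vb(2)] by blast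
    ultimately show "lmor X e \<alpha> f = lmor X e' \<beta> f'" unfolding b1(4) by (simp add: lmor_def)
  qed
qed

lemma lrep_vrep: "lrep X e \<alpha> f m \<Longrightarrow> vrep e \<alpha> f \<and> m = lmor X e \<alpha> f"
  unfolding lrep_def vrep_def using nleD by blast

lemma vrep_lrep: assumes "vrep e \<alpha> f" obtains \<alpha>' where "simP X \<alpha> \<alpha>'" "lrep X e \<alpha>' f (lmor X e \<alpha> f)"
proof -
  obtain \<alpha>' where *: "simP X \<alpha> \<alpha>'" "nle E (dm \<alpha>') e" "vrep e \<alpha>' f" "lmor X e \<alpha> f = lmor X e \<alpha>' f"
    using vrep_normal[OF assms] .
  then show ?thesis using that vrepD[OF *(3)] unfolding lrep_def by metis
qed

lemma LG_Obj: "Obj (LG X) = lcl X ` carr E" by (simp add: LG_def Let_def)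

lemma LG_Mor: "Mor (LG X) = {lmor X e \<alpha> f | e \<alpha> f. vrep e \<alpha> f}"
proof -
  have "Mor (LG X) = {m. \<exists>e \<alpha> f. lrep X e \<alpha> f m}" by (simp add: LG_def Let_def)
  also have "\<dots> = {lmor X e \<alpha> f | e \<alpha> f. vrep e \<alpha> f}" using lrep_vrep vrep_lrep by blast
  finally show ?thesis .
qed

lemma LG_dm:
  assumes "vrep e \<alpha> f"
  shows "(THE A. \<exists>e' \<alpha>' f'. lrep X e' \<alpha>' f' (lmor X e \<alpha> f) \<and> A = lcl X e') = lcl X e"
    "(THE A. \<exists>e' \<alpha>' f'. lrep X e' \<alpha>' f' (lmor X e \<alpha> f) \<and> A = lcl X f') = lcl X f"
proof -
  obtain \<alpha>1 where a1: "lrep X e \<alpha>1 f (lmor X e \<alpha> f)" using vrep_lrep[OF assms] by blast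
  have u: "lcl X e' = lcl X e \<and> lcl X f' = lcl X f" if "lrep X e' \<alpha>' f' (lmor X e \<alpha> f)" for e' \<alpha>' f'
    using lrep_vrep[OF that] lmor_eq[OF assms, of e' \<alpha>' f'] lcl_eq[of e' e] lcl_eq[of f' f] vrepD(1,2)[of e' \<alpha>' f'] by auto
  show "(THE A. \<exists>e' \<alpha>' f'. lrep X e' \<alpha>' f' (lmor X e \<alpha> f) \<and> A = lcl X e') = lcl X e"
    by (rule the_equality) (use a1 u in blast)+
  show "(THE A. \<exists>e' \<alpha>' f'. lrep X e' \<alpha>' f' (lmor X e \<alpha> f) \<and> A = lcl X f') = lcl X f"
    by (rule the_equality) (use a1 u in blast)+
qed

lemma LG_Dom: assumes "vrep e \<alpha> f" shows "Dom (LG X) (lmor X e \<alpha> f) = lcl X e" "Cod (LG X) (lmor X e \<alpha> f) = lcl X f"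
proof -
  obtain \<alpha>1 where "lrep X e \<alpha>1 f (lmor X e \<alpha> f)" using vrep_lrep[OF assms] by blast
  then have "\<exists>e' \<alpha>' f'. lrep X e' \<alpha>' f' (lmor X e \<alpha> f)" by blast
  then show "Dom (LG X) (lmor X e \<alpha> f) = lcl X e" "Cod (LG X) (lmor X e \<alpha> f) = lcl X f"
    using LG_dm[OF assms] by (simp_all add: LG_def Let_def)
qed

lemma vrep_Idn: "e \<in> carr E \<Longrightarrow> lle E e f \<Longrightarrow> vrep e (Idn G e) f"
  unfolding vrep_def using lle_carr rle_refl by simp

lemma LG_Idn: assumes "e \<in> carr E" shows "Idn (LG X) (lcl X e) = lmor X e (Idn G e) e"
proof -
  have "Idn (LG X) (lcl X e) = (THE m. \<exists>e'\<in>lcl X e. m = lmor X e' (Idn G e') e')"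
    using assms by (simp add: LG_def Let_def)
  also have "\<dots> = lmor X e (Idn G e) e"
  proof (rule the_equality)
    show "\<exists>e'\<in>lcl X e. lmor X e (Idn G e) e = lmor X e' (Idn G e') e'" using Leq_refl[OF assms] by (auto simp: lcl_def)
    fix m assume "\<exists>e'\<in>lcl X e. m = lmor X e' (Idn G e') e'"
    then obtain e' where e': "Leq E e' e" "m = lmor X e' (Idn G e') e'" by (auto simp: lcl_def)
    have c: "e' \<in> carr E" using Leq_carr[OF e'(1)] by simp
    have "pmul X (ent X e') (ent X e) = ent X e'" using ent_le_l[OF c assms] LeqD(1)[OF e'(1)] by simp
    then show "m = lmor X e (Idn G e) e"
      using lmor_eq[OF vrep_Idn[OF c lle_refl[OF c]] vrep_Idn[OF assms lle_refl[OF assms]]] e' by (simp add: ent_def)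
  qed
  finally show ?thesis .
qed

lemma vrep_circ:
  assumes "vrep e \<alpha> f" "vrep e' \<beta> g" "h \<in> sandwich E (rg \<alpha>) (dm \<beta>)"
  shows "vrep e (circ X \<alpha> \<beta> h) g"
proof -
  note a = vrepD[OF assms(1)] and b = vrepD[OF assms(2)]
  note c = circ_Mor[OF a(3) b(3) assms(3)]
  show ?thesis unfolding vrep_def
    using a b c(1) rle_trans[OF nleD(2)[OF c(2)] a(4)] lle_trans[OF nleD(1)[OF c(3)] b(5)] by simp
qed

lemma LG_Cmp:
  assumes a: "vrep e \<alpha> f" and b: "vrep f \<beta> g" and h: "h \<in> sandwich E (rg \<alpha>) (dm \<beta>)"
  shows "lmor X e \<alpha> f \<cdot>\<^bsub>LG X\<^esub> lmor X f \<beta> g = lmor X e (circ X \<alpha> \<beta> h) g"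
proof -
  let ?m = "lmor X e \<alpha> f" and ?n = "lmor X f \<beta> g"
  interpret S: regular_semigroup "pS X" "pmul X" by (rule semigroup)
  let ?P = "\<lambda>k. \<exists>e1 \<alpha> g1 e2 \<beta> g2 h. lrep X e1 \<alpha> g1 ?m \<and> lrep X e2 \<beta> g2 ?n \<and>
                   h \<in> sandwich E (igr X \<alpha>) (igd X \<beta>) \<and> k = lmor X e1 (circ X \<alpha> \<beta> h) g2"
  obtain \<alpha>1 where a1: "simP X \<alpha> \<alpha>1" "lrep X e \<alpha>1 f ?m" using vrep_lrep[OF a] .
  obtain \<beta>1 where b1: "simP X \<beta> \<beta>1" "lrep X f \<beta>1 g ?n" using vrep_lrep[OF b] .
  have mn: "\<exists>e \<alpha> f. lrep X e \<alpha> f ?m" "\<exists>e \<alpha> f. lrep X e \<alpha> f ?n" using a1 b1 by blast+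
  have "?m \<cdot>\<^bsub>LG X\<^esub> ?n = (THE k. ?P k)"
    using mn LG_dm[OF a] LG_dm[OF b] by (simp add: LG_def Let_def)
  also have "\<dots> = lmor X e (circ X \<alpha> \<beta> h) g"
  proof (rule the_equality)
    have u: "k = lmor X e (circ X \<alpha> \<beta> h) g" if k: "?P k" for k
    proof -
      obtain e1 \<alpha>' g1 e2 \<beta>' g2 h' where r: "lrep X e1 \<alpha>' g1 ?m" "lrep X e2 \<beta>' g2 ?n"
        "h' \<in> sandwich E (rg \<alpha>') (dm \<beta>')" "k = lmor X e1 (circ X \<alpha>' \<beta>' h') g2" using k by blast
      have va: "vrep e1 \<alpha>' g1" and ea: "lmor X e1 \<alpha>' g1 = ?m" using lrep_vrep[OF r(1)] by auto
      have vb: "vrep e2 \<beta>' g2" and eb: "lmor X e2 \<beta>' g2 = ?n" using lrep_vrep[OF r(2)] by auto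
      note A = lmor_eq[OF va a, THEN iffD1, OF ea] and B = lmor_eq[OF vb b, THEN iffD1, OF eb]
      note va' = vrepD[OF va] and vb' = vrepD[OF vb] and a' = vrepD[OF a] and b' = vrepD[OF b]
      have "pcl X (circ X \<alpha>' \<beta>' h') = pmul X (pmul X (ent X e1) (pcl X \<alpha>)) (pmul X (ent X e2) (pcl X \<beta>))"
        using pmul_pcl[OF va'(3) vb'(3) r(3)] A B by simp
      also have "\<dots> = pmul X (ent X e1) (pmul X (pmul X (pcl X \<alpha>) (ent X e2)) (pcl X \<beta>))"
        using S.mul_assoc S.closed ent_in pcl_in va' vb' a' b' by simp
      also have "pmul X (pcl X \<alpha>) (ent X e2) = pcl X \<alpha>"
        using ent_right_iff[OF a'(3) vb'(1)] lle_trans[OF a'(5) LeqD(2)] B by blast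
      also have "pmul X (pcl X \<alpha>) (pcl X \<beta>) = pcl X (circ X \<alpha> \<beta> h)" using pmul_pcl[OF a'(3) b'(3) h] .
      finally show ?thesis
        using lmor_eq[OF vrep_circ[OF va vb r(3)] vrep_circ[OF a b h]] A B r(4) by blast
    qed
    show "k = lmor X e (circ X \<alpha> \<beta> h) g" if "?P k" for k using u[OF that] .
    obtain h1 where "h1 \<in> sandwich E (rg \<alpha>1) (dm \<beta>1)"
      using sandwich_ex[of "rg \<alpha>1" "dm \<beta>1"] simPD(2)[OF a1(1)] simPD(2)[OF b1(1)] by auto
    then have "?P (lmor X e (circ X \<alpha>1 \<beta>1 h1) g)" using a1(2) b1(2) by blast
    with u[OF this] show "?P (lmor X e (circ X \<alpha> \<beta> h) g)" by simp
  qed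
  finally show ?thesis .
qed

lemma LG_Incl: "Incl (LG X) = {lmor X e (Idn G e) f | e f. lle E e f}"
  by (simp add: LG_def Let_def)

lemma ei_ent: "e \<in> carr E \<Longrightarrow> ei X (ent X e) = e"
  unfolding ei_def by (rule the_equality) (auto intro: ent_inj)

lemma plc_ent: "e \<in> carr E \<Longrightarrow> plc X (ent X e) = lcl X e"
  by (simp add: plc_def ei_ent)

lemma idempotents: "{A \<in> pS X. pmul X A A = A} = ent X ` carr E"
proof (intro equalityI subsetI)
  fix A assume "A \<in> {A \<in> pS X. pmul X A A = A}"
  then show "A \<in> ent X ` carr E" by (auto elim: idempotent_ent)
next
  fix A assume "A \<in> ent X ` carr E"
  then show "A \<in> {A \<in> pS X. pmul X A A = A}" using ent_in ent_le_l lle_refl by auto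
qed

lemma pLM_lmor:
  assumes "vrep e \<alpha> f"
  shows "pLM X (ent X e) (pcl X \<alpha>) (ent X f) = lmor X e \<alpha> f"
proof -
  note v = vrepD[OF assms]
  have "\<alpha> \<in> pcl X \<alpha>" using simP_refl[OF v(3)] by (simp add: pcl_def)
  then have "(SOME \<beta>. \<beta> \<in> pcl X \<alpha>) \<in> pcl X \<alpha>" by (rule someI)
  then have s: "simP X \<alpha> (SOME \<beta>. \<beta> \<in> pcl X \<alpha>)" by (simp add: pcl_def)
  have v': "vrep e (SOME \<beta>. \<beta> \<in> pcl X \<alpha>) f" using vrep_simP[OF assms s] .
  have "pcl X (SOME \<beta>. \<beta> \<in> pcl X \<alpha>) = pcl X \<alpha>" using pclI[OF s] by simp
  then show ?thesis
    using lmor_eq[OF v' assms] ent_left_iff[OF v(3,1)] v Leq_refl by (simp add: pLM_def ei_ent)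
qed

lemma vrep_iff:
  assumes "e \<in> carr E" "f \<in> carr E" "\<alpha> \<in> Mor G"
  shows "vrep e \<alpha> f \<longleftrightarrow> pmul X (ent X e) (pcl X \<alpha>) = pcl X \<alpha> \<and> pmul X (pcl X \<alpha>) (ent X f) = pcl X \<alpha>"
  using assms ent_left_iff ent_right_iff unfolding vrep_def by simp

lemma LG_ext: "Dom (LG X) \<in> extensional (Mor (LG X))" "Cod (LG X) \<in> extensional (Mor (LG X))"
  "Idn (LG X) \<in> extensional (Obj (LG X))" "Cmp (LG X) \<in> extensional (Mor (LG X))"
  "m \<in> Mor (LG X) \<Longrightarrow> Cmp (LG X) m \<in> extensional {n \<in> Mor (LG X). Dom (LG X) n = Cod (LG X) m}"
  by (auto simp: LG_def Let_def extensional_def)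

lemma valid_rep:
  assumes "A \<in> pS X" "s \<in> pS X" "B \<in> pS X" "pmul X A A = A" "pmul X B B = B" "pmul X A s = s" "pmul X s B = s"
  obtains e \<alpha> f where "A = ent X e" "s = pcl X \<alpha>" "B = ent X f" "vrep e \<alpha> f"
proof -
  obtain e where e: "e \<in> carr E" "A = ent X e" using idempotent_ent[OF assms(1,4)] .
  obtain f where f: "f \<in> carr E" "B = ent X f" using idempotent_ent[OF assms(3,5)] .
  obtain \<alpha> where a: "\<alpha> \<in> Mor G" "s = pcl X \<alpha>" using assms(2) by (auto simp: pS_def)
  show ?thesis using that e f a vrep_iff[OF e(1) f(1) a(1)] assms(6,7) by blast
qed

lemma vrep_valid:
  assumes "vrep e \<alpha> f"
  shows "ent X e \<in> pS X" "pcl X \<alpha> \<in> pS X" "ent X f \<in> pS X" "pmul X (ent X e) (ent X e) = ent X e"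
    "pmul X (ent X f) (ent X f) = ent X f" "pmul X (ent X e) (pcl X \<alpha>) = pcl X \<alpha>" "pmul X (pcl X \<alpha>) (ent X f) = pcl X \<alpha>"
  using vrepD[OF assms] vrep_iff[of e f \<alpha>] assms ent_in pcl_in ent_le_l lle_refl by auto

text \<open>
  Every morphism of \<open>L\<^sub>G\<close> has the form \<open>[e,\<alpha>,f\<rangle>\<close>, so the
  operations of \<open>L\<^sub>G\<close> are read off from representatives.
\<close>

theorem LG_semigroup_category: "semigroup_category (pS X) (pmul X) (LG X) (plc X) (pLM X)"
proof (intro semigroup_category.intro semigroup semigroup_category_axioms.intro)
  interpret S: regular_semigroup "pS X" "pmul X" by (rule semigroup)
  show "Obj (LG X) = plc X ` {e \<in> pS X. pmul X e e = e}"
    unfolding idempotents LG_Obj image_image using plc_ent by simp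
  show plc_eq: "plc X e = plc X f \<longleftrightarrow> pmul X e f = e \<and> pmul X f e = f"
    if h: "e \<in> pS X" "f \<in> pS X" "pmul X e e = e" "pmul X f f = f" for e f
  proof -
    obtain a where a: "a \<in> carr E" "e = ent X a" using idempotent_ent[OF h(1,3)] .
    obtain b where b: "b \<in> carr E" "f = ent X b" using idempotent_ent[OF h(2,4)] .
    show ?thesis using a b lcl_eq[OF b(1), of a] ent_le_l[OF a(1) b(1)] ent_le_l[OF b(1) a(1)] by (simp add: plc_ent Leq_def)
  qed
  show "Mor (LG X) = {pLM X e s f | e s f. e \<in> pS X \<and> s \<in> pS X \<and> f \<in> pS X \<and> pmul X e e = e \<and> pmul X f f = f \<and>
      pmul X e s = s \<and> pmul X s f = s}" (is "_ = ?M")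
  proof (intro equalityI subsetI)
    fix m assume "m \<in> Mor (LG X)"
    then obtain e \<alpha> f where "vrep e \<alpha> f" "m = lmor X e \<alpha> f" unfolding LG_Mor by blast
    then show "m \<in> ?M" using vrep_valid[of e \<alpha> f] pLM_lmor[of e \<alpha> f] by (intro CollectI) metis
  next
    fix m assume "m \<in> ?M"
    then obtain e s f where *: "m = pLM X e s f" "e \<in> pS X" "s \<in> pS X" "f \<in> pS X" "pmul X e e = e" "pmul X f f = f"
      "pmul X e s = s" "pmul X s f = s" by blast
    obtain a \<alpha> b where "e = ent X a" "s = pcl X \<alpha>" "f = ent X b" "vrep a \<alpha> b" using valid_rep[OF *(2-8)] .
    then show "m \<in> Mor (LG X)" unfolding LG_Mor using * pLM_lmor by auto
  qed
  show "pLM X e s f = pLM X e' s' f' \<longleftrightarrow> plc X e = plc X e' \<and> plc X f = plc X f' \<and> s = pmul X e s'"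
    if h: "e \<in> pS X" "s \<in> pS X" "f \<in> pS X" "pmul X e e = e" "pmul X f f = f" "pmul X e s = s" "pmul X s f = s"
      "e' \<in> pS X" "s' \<in> pS X" "f' \<in> pS X" "pmul X e' e' = e'" "pmul X f' f' = f'" "pmul X e' s' = s'" "pmul X s' f' = s'"
    for e s f e' s' f'
  proof -
    obtain a \<alpha> b where 1: "e = ent X a" "s = pcl X \<alpha>" "f = ent X b" "vrep a \<alpha> b" using valid_rep[OF h(1-7)] .
    obtain a' \<alpha>' b' where 2: "e' = ent X a'" "s' = pcl X \<alpha>'" "f' = ent X b'" "vrep a' \<alpha>' b'" using valid_rep[OF h(8-14)] .
    show ?thesis using 1 2 lmor_eq[OF 1(4) 2(4)] vrepD[OF 1(4)] vrepD[OF 2(4)] by (simp add: pLM_lmor plc_ent lcl_eq)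
  qed
  show "Dom (LG X) \<in> extensional (Mor (LG X))" "Cod (LG X) \<in> extensional (Mor (LG X))"
    "Idn (LG X) \<in> extensional (Obj (LG X))" "Cmp (LG X) \<in> extensional (Mor (LG X))"
    "\<And>m. m \<in> Mor (LG X) \<Longrightarrow> Cmp (LG X) m \<in> extensional {n \<in> Mor (LG X). Dom (LG X) n = Cod (LG X) m}"
    by (fact LG_ext)+
  show "Dom (LG X) (pLM X e s f) = plc X e \<and> Cod (LG X) (pLM X e s f) = plc X f"
    if h: "e \<in> pS X" "s \<in> pS X" "f \<in> pS X" "pmul X e e = e" "pmul X f f = f" "pmul X e s = s" "pmul X s f = s" for e s f
  proof -
    obtain a \<alpha> b where 1: "e = ent X a" "s = pcl X \<alpha>" "f = ent X b" "vrep a \<alpha> b" using valid_rep[OF h] .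
    then show ?thesis using LG_Dom[OF 1(4)] vrepD[OF 1(4)] by (simp add: pLM_lmor plc_ent)
  qed
  show "Idn (LG X) (plc X e) = pLM X e e e" if h: "e \<in> pS X" "pmul X e e = e" for e
  proof -
    obtain a where a: "a \<in> carr E" "e = ent X a" using idempotent_ent[OF h] .
    then show ?thesis using LG_Idn[OF a(1)] pLM_lmor[OF vrep_Idn[OF a(1) lle_refl[OF a(1)]]]
      by (simp add: plc_ent) (simp add: ent_def)
  qed
  show "pLM X e s f \<cdot>\<^bsub>LG X\<^esub> pLM X f t g = pLM X e (pmul X s t) g"
    if h: "e \<in> pS X" "s \<in> pS X" "f \<in> pS X" "t \<in> pS X" "g \<in> pS X" "pmul X e e = e" "pmul X f f = f" "pmul X g g = g"
      "pmul X e s = s" "pmul X s f = s" "pmul X f t = t" "pmul X t g = t" for e s f t g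
  proof -
    obtain a \<alpha> b where 1: "e = ent X a" "s = pcl X \<alpha>" "f = ent X b" "vrep a \<alpha> b" using valid_rep[OF h(1,2,3,6,7,9,10)] .
    obtain b' \<beta> c where 2: "f = ent X b'" "t = pcl X \<beta>" "g = ent X c" "vrep b' \<beta> c" using valid_rep[OF h(3,4,5,7,8,11,12)] .
    have bb: "b' = b" using ent_inj[OF vrepD(1)[OF 2(4)] vrepD(2)[OF 1(4)]] 1(3) 2(1) by simp
    note v2 = 2(4)[unfolded bb]
    note d1 = vrepD[OF 1(4)] and d2 = vrepD[OF v2]
    obtain k where k: "k \<in> sandwich E (rg \<alpha>) (dm \<beta>)" using sandwich_ex[of "rg \<alpha>" "dm \<beta>"] d1 d2 by auto
    show ?thesis
      using LG_Cmp[OF 1(4) v2 k] pLM_lmor[OF 1(4)] pLM_lmor[OF v2] pLM_lmor[OF vrep_circ[OF 1(4) v2 k]]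
        pmul_pcl[OF d1(3) d2(3) k] 1 2(2,3) by simp
  qed
  show "Incl (LG X) = {pLM X e e f | e f. e \<in> pS X \<and> f \<in> pS X \<and> pmul X e e = e \<and> pmul X f f = f \<and> pmul X e f = e}" (is "_ = ?I")
  proof (intro equalityI subsetI)
    fix m assume "m \<in> Incl (LG X)"
    then obtain e f where *: "lle E e f" "m = lmor X e (Idn G e) f" unfolding LG_Incl by blast
    have c: "e \<in> carr E" "f \<in> carr E" using lle_carr[OF *(1)] by auto
    have "m = pLM X (ent X e) (ent X e) (ent X f)"
      using pLM_lmor[OF vrep_Idn[OF c(1) *(1)]] * by (simp add: ent_def)
    then show "m \<in> ?I" using c ent_in ent_le_l lle_refl *(1) by (intro CollectI) metis
  next
    fix m assume "m \<in> ?I"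
    then obtain e f where *: "m = pLM X e e f" "e \<in> pS X" "f \<in> pS X" "pmul X e e = e" "pmul X f f = f" "pmul X e f = e" by blast
    obtain a where a: "a \<in> carr E" "e = ent X a" using idempotent_ent[OF *(2,4)] .
    obtain b where b: "b \<in> carr E" "f = ent X b" using idempotent_ent[OF *(3,5)] .
    have l: "lle E a b" using ent_le_l[OF a(1) b(1)] * a b by simp
    have "m = lmor X a (Idn G a) b" using pLM_lmor[OF vrep_Idn[OF a(1) l]] * a b by (simp add: ent_def)
    then show "m \<in> Incl (LG X)" unfolding LG_Incl using l by blast
  qed
qed

end

subsection \<open>Normality\<close>

context semigroup_category
begin

definition idem :: "'s \<Rightarrow> bool" where "idem e \<longleftrightarrow> e \<in> S \<and> e \<otimes> e = e"

definition valid :: "'s \<Rightarrow> 's \<Rightarrow> 's \<Rightarrow> bool" where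
  "valid e s f \<longleftrightarrow> e \<in> S \<and> s \<in> S \<and> f \<in> S \<and> e \<otimes> e = e \<and> f \<otimes> f = f \<and> e \<otimes> s = s \<and> s \<otimes> f = s"

lemma idemD [simp]: "idem e \<Longrightarrow> e \<in> S" "idem e \<Longrightarrow> e \<otimes> e = e"
  by (simp_all add: idem_def)

lemma validD [simp]: "valid e s f \<Longrightarrow> s \<in> S" "valid e s f \<Longrightarrow> e \<otimes> s = s" "valid e s f \<Longrightarrow> s \<otimes> f = s"
  and valid_idem: "valid e s f \<Longrightarrow> idem e" "valid e s f \<Longrightarrow> idem f"
  unfolding valid_def idem_def by simp_all

lemma validI: "idem e \<Longrightarrow> s \<in> S \<Longrightarrow> idem f \<Longrightarrow> e \<otimes> s = s \<Longrightarrow> s \<otimes> f = s \<Longrightarrow> valid e s f"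
  unfolding valid_def idem_def by simp

lemma valid_same: "idem e \<Longrightarrow> valid e e e" by (intro validI) simp_all

declare closed [simp]

lemma absorb:
  assumes "a \<in> S" "b \<in> S" "c \<in> S" "a \<otimes> b = d"
  shows "a \<otimes> (b \<otimes> c) = d \<otimes> c"
  using mul_assoc[OF assms(1-3)] assms(4) by simp

lemma lc_iff: "idem e \<Longrightarrow> idem f \<Longrightarrow> lc e = lc f \<longleftrightarrow> e \<otimes> f = e \<and> f \<otimes> e = f"
  using lc_eq[of e f] by simp

lemma LM_iff: "valid e s f \<Longrightarrow> valid e' s' f' \<Longrightarrow> LM e s f = LM e' s' f' \<longleftrightarrow> lc e = lc e' \<and> lc f = lc f' \<and> s = e \<otimes> s'"
  unfolding valid_def by (elim conjE) (rule LM_eq)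

lemma LM_inj: "valid e s f \<Longrightarrow> valid e t f \<Longrightarrow> LM e s f = LM e t f \<longleftrightarrow> s = t"
  using LM_iff[of e s f e t f] by simp

lemma Mor_iff: "m \<in> Mor C \<longleftrightarrow> (\<exists>e s f. valid e s f \<and> m = LM e s f)"
  unfolding Mor_C valid_def by blast

lemma Obj_iff: "a \<in> Obj C \<longleftrightarrow> (\<exists>e. idem e \<and> a = lc e)"
  unfolding Obj_C idem_def by blast

lemma lc_Obj: "idem e \<Longrightarrow> lc e \<in> Obj C" using Obj_iff by blast

lemma LM_hom: assumes "valid e s f" shows "LM e s f \<in> hom C (lc e) (lc f)"
  using assms Mor_iff Dom_Cod_LM[of e s f] unfolding hom_def valid_def by auto

text \<open>
  Every hom-set can be described with generators fixed in advance for the two left ideals.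
\<close>

lemma LM_change:
  assumes v: "valid e s f" and e': "idem e'" "lc e = lc e'" and f': "idem f'" "lc f = lc f'"
  shows "valid e' (e' \<otimes> s) f'" "LM e s f = LM e' (e' \<otimes> s) f'"
proof -
  note i = valid_idem[OF v]
  have ee: "e \<otimes> e' = e" "f \<otimes> f' = f" using e' f' i lc_iff by simp_all
  have "s \<otimes> f' = s \<otimes> f \<otimes> f'" using v by simp
  also have "\<dots> = s" using v i f'(1) ee(2) by (simp add: mul_assoc del: validD(3)) simp
  finally have sf: "s \<otimes> f' = s" .
  show v': "valid e' (e' \<otimes> s) f'"
    using e'(1) f'(1) i v sf by (intro validI) (simp_all add: mul_assoc absorb)
  have "e \<otimes> (e' \<otimes> s) = s" using absorb[of e e' s e] ee i v e'(1) by simp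
  then show "LM e s f = LM e' (e' \<otimes> s) f'" using LM_iff[OF v v'] e'(2) f'(2) by simp
qed

lemma hom_iff:
  assumes "idem e" "idem f"
  shows "m \<in> hom C (lc e) (lc f) \<longleftrightarrow> (\<exists>s. valid e s f \<and> m = LM e s f)"
proof
  assume "m \<in> hom C (lc e) (lc f)"
  then obtain e' s f' where *: "valid e' s f'" "m = LM e' s f'" "Dom C m = lc e" "Cod C m = lc f"
    using Mor_iff by (auto simp: hom_def)
  then have "lc e' = lc e" "lc f' = lc f" using LM_hom[OF *(1)] by (auto simp: hom_def)
  then show "\<exists>s. valid e s f \<and> m = LM e s f" using LM_change[OF *(1) assms(1) _ assms(2)] *(2) by blast
qed (use LM_hom in blast)

lemma homE:
  assumes "m \<in> hom C (lc e) (lc f)" "idem e" "idem f"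
  obtains s where "valid e s f" "m = LM e s f"
  using assms hom_iff by blast

lemma valid_cmp: "valid e s f \<Longrightarrow> valid f t g \<Longrightarrow> valid e (s \<otimes> t) g"
  unfolding valid_def using absorb[of e s t s] mul_assoc[of s t g] by simp

lemma LM_cmp: "valid e s f \<Longrightarrow> valid f t g \<Longrightarrow> LM e s f \<cdot>\<^bsub>C\<^esub> LM f t g = LM e (s \<otimes> t) g"
  unfolding valid_def by (elim conjE) (rule Cmp_LM)

lemma Idn_lc: "idem e \<Longrightarrow> Idn C (lc e) = LM e e e"
  using Idn_LM by simp

lemma hom_Obj: "m \<in> hom C a b \<Longrightarrow> a \<in> Obj C \<and> b \<in> Obj C"
proof -
  assume m: "m \<in> hom C a b"
  then obtain e s f where *: "valid e s f" "m = LM e s f" using Mor_iff by (auto simp: hom_def)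
  then have "a = lc e" "b = lc f" using LM_hom[OF *(1)] m by (auto simp: hom_def)
  then show ?thesis using lc_Obj valid_idem[OF *(1)] by simp
qed

lemma hom_cases:
  assumes "m \<in> hom C a b"
  obtains e s f where "a = lc e" "b = lc f" "valid e s f" "m = LM e s f"
  using assms hom_Obj[OF assms] Obj_iff hom_iff by metis

lemma category: "category C"
proof (rule categoryI)
  show "Dom C f \<in> Obj C" "Cod C f \<in> Obj C" if "f \<in> Mor C" for f
    using hom_Obj[OF Mor_hom[OF that]] by auto
  show "Idn C a \<in> hom C a a" if "a \<in> Obj C" for a
    using that Obj_iff Idn_lc LM_hom[OF valid_same] by auto
  show "f \<cdot>\<^bsub>C\<^esub> g \<in> hom C a c" if fg: "f \<in> hom C a b" "g \<in> hom C b c" for f g a b c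
  proof -
    obtain x s y where 1: "a = lc x" "b = lc y" "valid x s y" "f = LM x s y" using hom_cases[OF fg(1)] .
    obtain z where z: "idem z" "c = lc z" using hom_Obj[OF fg(2)] Obj_iff by blast
    obtain t where t: "valid y t z" "g = LM y t z" using fg(2) 1(2) z valid_idem[OF 1(3)] homE by metis
    show ?thesis using LM_cmp[OF 1(3) t(1)] LM_hom[OF valid_cmp[OF 1(3) t(1)]] 1 t z by simp
  qed
  show "Idn C a \<cdot>\<^bsub>C\<^esub> f = f" "f \<cdot>\<^bsub>C\<^esub> Idn C b = f" if f: "f \<in> hom C a b" for f a b
  proof -
    obtain x s y where 1: "a = lc x" "b = lc y" "valid x s y" "f = LM x s y" using hom_cases[OF f] .
    note i = valid_idem[OF 1(3)]
    show "Idn C a \<cdot>\<^bsub>C\<^esub> f = f" "f \<cdot>\<^bsub>C\<^esub> Idn C b = f"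
      using 1 i LM_cmp[OF valid_same[OF i(1)] 1(3)] LM_cmp[OF 1(3) valid_same[OF i(2)]] by (simp_all add: Idn_lc)
  qed
  show "(f \<cdot>\<^bsub>C\<^esub> g) \<cdot>\<^bsub>C\<^esub> h = f \<cdot>\<^bsub>C\<^esub> (g \<cdot>\<^bsub>C\<^esub> h)"
    if fgh: "f \<in> hom C a b" "g \<in> hom C b c" "h \<in> hom C c d" for f g h a b c d
  proof -
    obtain x s y where 1: "a = lc x" "b = lc y" "valid x s y" "f = LM x s y" using hom_cases[OF fgh(1)] .
    obtain z where z: "idem z" "c = lc z" using hom_Obj[OF fgh(2)] Obj_iff by blast
    obtain w where w: "idem w" "d = lc w" using hom_Obj[OF fgh(3)] Obj_iff by blast
    obtain t where t: "valid y t z" "g = LM y t z" using fgh(2) 1(2) z valid_idem[OF 1(3)] homE by metis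
    obtain u where u: "valid z u w" "h = LM z u w" using fgh(3) z w homE by metis
    show ?thesis
      using LM_cmp[OF 1(3) t(1)] LM_cmp[OF t(1) u(1)] LM_cmp[OF valid_cmp[OF 1(3) t(1)] u(1)]
        LM_cmp[OF 1(3) valid_cmp[OF t(1) u(1)]] mul_assoc[of s t u] 1 t u by simp
  qed
qed (fact ext_C)+

lemma Incl_iff: "m \<in> Incl C \<longleftrightarrow> (\<exists>e f. idem e \<and> idem f \<and> e \<otimes> f = e \<and> m = LM e e f)"
  unfolding Incl_C idem_def by blast

lemma Incl_valid: "idem e \<Longrightarrow> idem f \<Longrightarrow> e \<otimes> f = e \<Longrightarrow> valid e e f"
  by (intro validI) simp_all

lemma Incl_hom:
  assumes "m \<in> Incl C" "m \<in> hom C a b"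
  obtains e f where "a = lc e" "b = lc f" "idem e" "idem f" "e \<otimes> f = e" "m = LM e e f"
proof -
  obtain e f where *: "idem e" "idem f" "e \<otimes> f = e" "m = LM e e f" using assms(1) Incl_iff by blast
  then have "a = lc e" "b = lc f" using assms(2) LM_hom[OF Incl_valid[OF *(1-3)]] by (auto simp: hom_def)
  then show ?thesis using that * by blast
qed

lemma Incl_hom_at:
  assumes "m \<in> Incl C" "m \<in> hom C (lc e) (lc f)" "idem e" "idem f"
  shows "e \<otimes> f = e" "m = LM e e f"
proof -
  obtain a b where *: "lc e = lc a" "lc f = lc b" "idem a" "idem b" "a \<otimes> b = a" "m = LM a a b"
    using Incl_hom[OF assms(1,2)] .
  have ea: "e \<otimes> a = e" "b \<otimes> f = b" using lc_iff * assms by auto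
  have S: "e \<in> S" "a \<in> S" "b \<in> S" "f \<in> S" using * assms by simp_all
  have "e \<otimes> b = e" using mul_assoc[OF S(1,2,3)] *(5) ea(1) by simp
  then show ef: "e \<otimes> f = e" using mul_assoc[OF S(1,3,4)] ea(2) by simp
  show "m = LM e e f" using LM_change(2)[OF Incl_valid[OF *(3-5)] assms(3) _ assms(4)] * ea by simp
qed

lemma with_subobjects: "category_with_subobjects C"
  unfolding category_with_subobjects_def
proof (intro conjI ballI impI category)
  show Mor: "Incl C \<subseteq> Mor C" using Incl_iff Mor_iff Incl_valid by blast
  have split: "\<exists>e f. idem e \<and> idem f \<and> Dom C m = lc e \<and> Cod C m = lc f \<and> e \<otimes> f = e \<and> m = LM e e f" if m: "m \<in> Incl C" for m
    using Incl_hom[OF m Mor_hom] m Mor by (metis subsetD)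
  show "Idn C c \<in> Incl C" if "c \<in> Obj C" for c
    using that Obj_iff Incl_iff Idn_lc idemD(2) by metis
  show "f \<cdot>\<^bsub>C\<^esub> g \<in> Incl C" if fg: "f \<in> Incl C" "g \<in> Incl C" "Cod C f = Dom C g" for f g
  proof -
    obtain a b where 1: "idem a" "idem b" "Cod C f = lc b" "a \<otimes> b = a" "f = LM a a b" using split[OF fg(1)] by blast
    obtain c where c: "idem c" "Cod C g = lc c" using split[OF fg(2)] by blast
    have g: "g \<in> hom C (lc b) (lc c)" using fg Mor 1 c by (auto simp: hom_def)
    note 2 = Incl_hom_at[OF fg(2) g 1(2) c(1)]
    have "f \<cdot>\<^bsub>C\<^esub> g = LM a (a \<otimes> b) c" unfolding 1(5) 2(2) by (rule LM_cmp) (use 1 2 c Incl_valid in auto)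
    moreover have "a \<otimes> c = a" using absorb[of a b c a] 1 2(1) c mul_assoc by (metis idemD(1))
    ultimately show ?thesis using 1 c Incl_iff by metis
  qed
  show uniq: "f = g" if fg: "f \<in> Incl C" "g \<in> Incl C" "Dom C f = Dom C g \<and> Cod C f = Cod C g" for f g
  proof -
    obtain a b where 1: "idem a" "idem b" "Dom C f = lc a" "Cod C f = lc b" "f = LM a a b" using split[OF fg(1)] by blast
    have "g \<in> hom C (lc a) (lc b)" using fg Mor 1 by (auto simp: hom_def)
    then show ?thesis using Incl_hom_at(2)[OF fg(2) _ 1(1,2)] 1(5) by simp
  qed
  show "f = Idn C (Dom C f)"
    if fg: "f \<in> Incl C" "g \<in> Incl C" "Cod C f = Dom C g \<and> Cod C g = Dom C f \<and> f \<cdot>\<^bsub>C\<^esub> g = Idn C (Dom C f) \<and> g \<cdot>\<^bsub>C\<^esub> f = Idn C (Cod C f)"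
    for f g
  proof -
    obtain a b where 1: "idem a" "idem b" "Dom C f = lc a" "Cod C f = lc b" "a \<otimes> b = a" "f = LM a a b" using split[OF fg(1)] by blast
    have "g \<in> hom C (lc b) (lc a)" using fg Mor 1 by (auto simp: hom_def)
    then have "b \<otimes> a = b" using Incl_hom_at(1)[OF fg(2) _ 1(2,1)] by simp
    then have "lc b = lc a" using lc_iff 1 by simp
    then show ?thesis using LM_iff[OF Incl_valid[OF 1(1,2,5)] valid_same[OF 1(1)]] 1 by (simp add: Idn_lc)
  qed
  show "monic C f" if f: "f \<in> Incl C" for f
    unfolding monic_def
  proof (intro conjI ballI impI)
    show "f \<in> Mor C" using f Mor by blast
    fix g h assume gh: "g \<in> Mor C" "h \<in> Mor C" "Cod C g = Dom C f \<and> Cod C h = Dom C f \<and> Dom C g = Dom C h \<and> g \<cdot>\<^bsub>C\<^esub> f = h \<cdot>\<^bsub>C\<^esub> f"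
    obtain a b where 1: "idem a" "idem b" "Dom C f = lc a" "a \<otimes> b = a" "f = LM a a b" using split[OF f] by blast
    obtain c where c: "idem c" "Dom C g = lc c" using hom_Obj[OF Mor_hom[OF gh(1)]] Obj_iff by blast
    obtain s where s: "valid c s a" "g = LM c s a" using homE[of g c a] gh 1 c by (auto simp: hom_def)
    obtain t where t: "valid c t a" "h = LM c t a" using homE[of h c a] gh 1 c by (auto simp: hom_def)
    note v = Incl_valid[OF 1(1,2,4)]
    have "LM c (s \<otimes> a) b = LM c (t \<otimes> a) b" using gh(3) LM_cmp[OF s(1) v] LM_cmp[OF t(1) v] s t 1(5) by simp
    then have "s \<otimes> a = t \<otimes> a" using LM_inj valid_cmp[OF s(1) v] valid_cmp[OF t(1) v] by blast
    then show "g = h" using s t by simp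
  qed
  show "h \<in> Incl C" if fgh: "f \<in> Incl C" "g \<in> Incl C" "h \<in> Mor C" "Cod C h = Dom C g \<and> f = h \<cdot>\<^bsub>C\<^esub> g" for f g h
  proof -
    obtain a b where 1: "idem a" "idem b" "Dom C g = lc a" "Cod C g = lc b" "a \<otimes> b = a" "g = LM a a b" using split[OF fgh(2)] by blast
    obtain c where c: "idem c" "Dom C h = lc c" using hom_Obj[OF Mor_hom[OF fgh(3)]] Obj_iff by blast
    obtain s where s: "valid c s a" "h = LM c s a" using homE[of h c a] fgh 1 c by (auto simp: hom_def)
    note v = Incl_valid[OF 1(1,2,5)]
    have f: "f = LM c s b" using fgh(4) LM_cmp[OF s(1) v] s 1(6) by simp
    have vf: "valid c s b" using valid_cmp[OF s(1) v] s(1) by simp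
    have "f = LM c c b" using Incl_hom_at(2)[OF fgh(1) _ c(1) 1(2)] LM_hom[OF vf] f by simp
    moreover have "c \<otimes> b = c" using Incl_hom_at(1)[OF fgh(1) _ c(1) 1(2)] LM_hom[OF vf] f by simp
    ultimately have sc: "s = c" using LM_inj[OF vf Incl_valid[OF c(1) 1(2)]] f by simp
    then have "c \<otimes> a = c" using s(1) by (metis validD(3))
    then show ?thesis using s(2) sc c(1) 1(1) Incl_iff by blast
  qed
qed

text \<open>
  With an inverse \<open>t\<close> of \<open>s\<close>, chosen such that \<open>t = te\<close>, the
  idempotents \<open>u = st\<close> and \<open>w = ts\<close> factor the translation by \<open>s\<close> as
  the retraction \<open>Se \<rightarrow> Su\<close>, an isomorphism \<open>Su \<rightarrow> Sw\<close> with
  inverse given by \<open>t\<close>, and the inclusion of \<open>Sw\<close> in \<open>Sf\<close>.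
\<close>

lemma factorization:
  assumes v: "valid e s f"
  obtains q u j where "normal_factorization C (LM e s f) q u j"
proof -
  note i = valid_idem[OF v]
  obtain t where t: "t \<in> S" "s \<otimes> t \<otimes> s = s" "t \<otimes> s \<otimes> t = t" using inverse_ex[of s] v by auto
  have tst: "s \<otimes> (t \<otimes> s) = s" "t \<otimes> (s \<otimes> t) = t" using t mul_assoc v by simp_all
  \<comment> \<open>Still satisfies \<open>s t' s = s\<close> and \<open>t' s t' = t'\<close>, and is absorbed by
    \<open>e\<close> on the right.\<close>
  define t' where "t' = t \<otimes> e"
  have t'S: "t' \<in> S" unfolding t'_def using t i by simp
  have t's: "t' \<otimes> s = t \<otimes> s" unfolding t'_def using t i v by (simp add: mul_assoc)
  define u where "u = s \<otimes> t'"
  define w where "w = t \<otimes> s"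
  have S: "s \<in> S" "u \<in> S" "w \<in> S" "e \<in> S" "f \<in> S" unfolding u_def w_def using v i t t'S by simp_all
  have us: "u \<otimes> s = s" unfolding u_def using mul_assoc[OF S(1) t'S S(1)] t's tst by simp
  have t'u: "t' \<otimes> u = t'"
  proof -
    have "t' \<otimes> u = (t' \<otimes> s) \<otimes> t'" unfolding u_def using mul_assoc[OF t'S S(1) t'S] by simp
    also have "\<dots> = (t \<otimes> s) \<otimes> (t \<otimes> e)" unfolding t's by (simp only: t'_def)
    also have "\<dots> = t \<otimes> s \<otimes> t \<otimes> e" by (rule mul_assoc[symmetric]) (use t(1) S in simp_all)
    also have "\<dots> = t'" by (simp only: t(3) t'_def)
    finally show ?thesis .
  qed
  have uu: "u \<otimes> u = u" using mul_assoc[OF S(1) t'S S(2)] t'u by (simp add: u_def)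
  have eu: "e \<otimes> u = u" unfolding u_def using absorb[OF S(4) S(1) t'S] v by simp
  have t'e: "t' \<otimes> e = t'" unfolding t'_def using t S i mul_assoc[of t e e] by simp
  have ue: "u \<otimes> e = u" unfolding u_def using mul_assoc[OF S(1) t'S S(4)] t'e by simp
  have sw: "s \<otimes> w = s" unfolding w_def by (rule tst)
  have wt: "w \<otimes> t' = t'" using t'u t's mul_assoc[OF t'S S(1) t'S] by (simp add: u_def w_def)
  have ww: "w \<otimes> w = w" unfolding w_def using mul_assoc[OF t(1) S(1), of "t \<otimes> s"] t S tst by simp
  have wf: "w \<otimes> f = w" unfolding w_def using mul_assoc[OF t(1) S(1,5)] v by simp
  have wt's: "t' \<otimes> s = w" using t's by (simp add: w_def)
  have iu: "idem u" "idem w" unfolding idem_def using S uu ww by simp_all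
  have vs: "valid e u u" "valid u u e" "valid u s w" "valid w t' u" "valid w w f"
    using i iu S uu eu ue us sw t'S t'u wt ww wf by (intro validI; simp)+
  have "splits C (LM u u e) (LM e u u)"
    unfolding splits_def using LM_hom[OF vs(1)] LM_hom[OF vs(2)] LM_cmp[OF vs(2,1)] Incl_iff iu i ue uu Idn_lc[OF iu(1)]
    by (auto simp: hom_def)
  then have "retraction C (LM e u u)" unfolding retraction_def by blast
  moreover have "is_iso C (LM u s w)"
    by (rule is_isoI[OF category LM_hom[OF vs(3)] LM_hom[OF vs(4)]])
      (use LM_cmp[OF vs(3,4)] LM_cmp[OF vs(4,3)] Idn_lc iu wt's in \<open>simp_all add: u_def[symmetric]\<close>)
  moreover have "LM w w f \<in> Incl C" using Incl_iff iu i wf by blast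
  moreover have "LM e s f = (LM e u u \<cdot>\<^bsub>C\<^esub> LM u s w) \<cdot>\<^bsub>C\<^esub> LM w w f"
    using LM_cmp[OF vs(1,3)] LM_cmp[OF valid_cmp[OF vs(1,3)] vs(5)] us sw by simp
  ultimately have "normal_factorization C (LM e s f) (LM e u u) (LM u s w) (LM w w f)"
    unfolding normal_factorization_def using LM_hom[OF vs(1)] LM_hom[OF vs(3)] LM_hom[OF vs(5)] by (simp add: hom_def)
  then show ?thesis using that by blast
qed

text \<open>
  The principal cone at \<open>e\<close>: its component at \<open>Sg\<close> is \<open>x \<mapsto> xe\<close>,
  which is translation by \<open>ge\<close>.
\<close>

definition pcone :: "'s \<Rightarrow> 'o \<Rightarrow> 'm" where
  "pcone e = (\<lambda>a\<in>Obj C. THE m. \<exists>g. idem g \<and> a = lc g \<and> m = LM g (g \<otimes> e) e)"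

lemma pcone_valid: "idem g \<Longrightarrow> idem e \<Longrightarrow> valid g (g \<otimes> e) e"
  by (rule validI) (simp_all add: mul_assoc absorb)

lemma pcone_lc:
  assumes "idem g" "idem e"
  shows "pcone e (lc g) = LM g (g \<otimes> e) e"
proof -
  have "(THE m. \<exists>g'. idem g' \<and> lc g = lc g' \<and> m = LM g' (g' \<otimes> e) e) = LM g (g \<otimes> e) e"
  proof (rule the_equality)
    show "\<exists>g'. idem g' \<and> lc g = lc g' \<and> LM g (g \<otimes> e) e = LM g' (g' \<otimes> e) e" using assms by blast
    fix m assume "\<exists>g'. idem g' \<and> lc g = lc g' \<and> m = LM g' (g' \<otimes> e) e"
    then obtain g' where g': "idem g'" "lc g = lc g'" "m = LM g' (g' \<otimes> e) e" by blast
    have "g' \<otimes> g = g'" using lc_iff[OF assms(1) g'(1)] g'(2) by simp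
    then have "g' \<otimes> (g \<otimes> e) = g' \<otimes> e" using absorb[of g' g e g'] assms g'(1) by simp
    then show "m = LM g (g \<otimes> e) e"
      using LM_iff[OF pcone_valid[OF g'(1) assms(2)] pcone_valid[OF assms]] g' by simp
  qed
  then show ?thesis using lc_Obj[OF assms(1)] by (simp add: pcone_def)
qed

lemma pcone_cone: assumes e: "idem e" shows "is_cone C (lc e) (pcone e)" "pcone e (lc e) = Idn C (lc e)"
proof -
  show id: "pcone e (lc e) = Idn C (lc e)" using pcone_lc[OF e e] e Idn_lc by simp
  show "is_cone C (lc e) (pcone e)"
  proof (rule is_coneI[OF lc_Obj[OF e] _ _ _ _ lc_Obj[OF e]])
    show "pcone e \<in> extensional (Obj C)" by (simp add: pcone_def)
    show "pcone e c \<in> hom C c (lc e)" if "c \<in> Obj C" for c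
      using that Obj_iff pcone_lc[OF _ e] LM_hom[OF pcone_valid[OF _ e]] by auto
    show "j \<cdot>\<^bsub>C\<^esub> pcone e b = pcone e a" if j: "j \<in> Incl C" "j \<in> hom C a b" for j a b
    proof -
      obtain g f where *: "a = lc g" "b = lc f" "idem g" "idem f" "g \<otimes> f = g" "j = LM g g f" using Incl_hom[OF j] .
      have "g \<otimes> (f \<otimes> e) = g \<otimes> e" using absorb[of g f e g] * e by simp
      then show ?thesis using * pcone_lc[OF *(3) e] pcone_lc[OF *(4) e]
          LM_cmp[OF Incl_valid[OF *(3-5)] pcone_valid[OF *(4) e]] by simp
    qed
    show "Incl C \<subseteq> Mor C" using Incl_iff Mor_iff Incl_valid by blast
    show "is_iso C (pcone e (lc e))" unfolding id by (rule is_iso_Idn[OF category lc_Obj[OF e]])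
  qed
qed

text \<open>
  Right translation by \<open>fe\<close> retracts \<open>Sf\<close> to a subobject \<open>Se\<close>, and the
  principal cone at \<open>e\<close> is an idempotent cone with apex \<open>Se\<close>.
\<close>

theorem normal: "normal_category C"
  unfolding normal_category_def
proof (intro conjI ballI with_subobjects)
  show "\<exists>q u j. normal_factorization C f q u j" if "f \<in> Mor C" for f
    using that Mor_iff factorization by metis
  show "\<exists>q. splits C j q" if j: "j \<in> Incl C" for j
  proof -
    obtain e f where *: "idem e" "idem f" "e \<otimes> f = e" "j = LM e e f" using j Incl_iff by blast
    note v = Incl_valid[OF *(1-3)] and w = pcone_valid[OF *(2,1)]
    have "e \<otimes> (f \<otimes> e) = e" using absorb[of e f e e] * by simp
    then have "splits C j (LM f (f \<otimes> e) e)"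
      unfolding splits_def using j *(4) LM_hom[OF v] LM_hom[OF w] LM_cmp[OF v w] Idn_lc[OF *(1)] by (simp add: hom_def)
    then show ?thesis by blast
  qed
  show "\<exists>\<gamma>. idempotent_cone C \<gamma> \<and> apex C \<gamma> = c" if c: "c \<in> Obj C" for c
  proof -
    obtain e where e: "idem e" "c = lc e" using c Obj_iff by blast
    note p = pcone_cone[OF e(1)]
    show ?thesis using p apexI[OF p(1)] e unfolding idempotent_cone_def cone_def by (intro exI[of _ "pcone e"]) auto
  qed
qed

end

sublocale semigroup_category \<subseteq> N: normal_cat C
  by unfold_locales (rule normal)

context semigroup_category
begin

text \<open>
  Idempotents that generate the same right ideal have principal cones that differ by an isomorphism of their
  apexes.
\<close>

lemma pcone_R:
  assumes e: "idem e" and f: "idem f" and R: "e \<otimes> f = f" "f \<otimes> e = e"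
  shows "LM e f f \<in> hom C (lc e) (lc f)" "is_iso C (LM e f f)" "pcone f = cone_comp C (pcone e) (LM e f f)"
proof -
  have v: "valid e f f" "valid f e e" using e f R by (intro validI; simp)+
  show h: "LM e f f \<in> hom C (lc e) (lc f)" by (rule LM_hom[OF v(1)])
  show "is_iso C (LM e f f)"
    by (rule is_isoI[OF category h LM_hom[OF v(2)]]) (use LM_cmp[OF v] LM_cmp[OF v(2,1)] Idn_lc e f R in simp_all)
  show "pcone f = cone_comp C (pcone e) (LM e f f)"
  proof (rule extensionalityI[of _ "Obj C"])
    show "pcone f \<in> extensional (Obj C)" "cone_comp C (pcone e) (LM e f f) \<in> extensional (Obj C)"
      by (simp_all add: pcone_def cone_comp_def)
    fix a assume a: "a \<in> Obj C"
    then obtain g where g: "idem g" "a = lc g" using Obj_iff by blast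
    have "g \<otimes> e \<otimes> f = g \<otimes> f" using mul_assoc[of g e f] g e f R by simp
    then show "pcone f a = cone_comp C (pcone e) (LM e f f) a"
      using a g pcone_lc[OF g(1) e] pcone_lc[OF g(1) f] LM_cmp[OF pcone_valid[OF g(1) e] v(1)] by (simp add: cone_comp_def)
  qed
qed

lemma H_pcone_R:
  assumes "idem e" "idem f" "e \<otimes> f = f" "f \<otimes> e = e"
  shows "H_functor C (pcone e) = H_functor C (pcone f)"
  using N.H_functor_iso[OF pcone_cone(1)[OF assms(1)] pcone_R(2,1)[OF assms]] pcone_R(3)[OF assms]
  by (simp only:)

text \<open>
  The hypotheses say that \<open>eS = e'S\<close> and \<open>fS = f'S\<close>, and that \<open>s\<close> and
  \<open>s'\<close> induce the same left translation \<open>eS \<rightarrow> fS\<close>.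
\<close>

lemma nt_R:
  assumes e: "idem e" "idem e'" "e \<otimes> e' = e'" "e' \<otimes> e = e" and f: "idem f" "idem f'" "f \<otimes> f' = f'" "f' \<otimes> f = f"
    and s: "valid f s e" "valid f' s' e'" "s = s' \<otimes> e"
  shows "nt C (pcone e') (pcone f') (LM f' s' e') = nt C (pcone e) (pcone f) (LM f s e)"
proof -
  note u = pcone_R[OF e] and v = pcone_R[OF f]
  have ve: "valid e e' e'" "valid f f' f'" using e f by (intro validI; simp)+
  have "s \<otimes> e' = f' \<otimes> s'" unfolding s(3) using s(1,2) e mul_assoc[of s' e e'] by simp
  then have "LM f s e \<cdot>\<^bsub>C\<^esub> LM e e' e' = LM f f' f' \<cdot>\<^bsub>C\<^esub> LM f' s' e'"
    using LM_cmp[OF s(1) ve(1)] LM_cmp[OF ve(2) s(2)] by simp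
  from N.nt_iso[OF pcone_cone(1)[OF e(1)] u(2,1) pcone_cone(1)[OF f(1)] v(2,1) LM_hom[OF s(1)] LM_hom[OF s(2)] this]
  show ?thesis unfolding u(3) v(3) .
qed

end

section \<open>The cross-connection of a regular semigroup\<close>

text \<open>
  For a fully faithful functor, the requirement that ideals be mapped isomorphically reduces to their objects.
\<close>

lemma local_isomorphismI:
  assumes F: "is_functor D N F" and incl: "inclusion_preserving D N F" and ff: "fully_faithful D N F"
    and bij: "\<And>c. c \<in> Obj D \<Longrightarrow> bij_betw (FO F) {d. subobj D d c} {S. subobj N S (FO F c)}"
  shows "local_isomorphism D N F"
  unfolding local_isomorphism_def
proof (intro conjI ballI F incl ff)
  fix c assume c: "c \<in> Obj D"
  note D = func_cat1[OF F] and N = func_cat2[OF F]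
  let ?A = "{d. subobj D d c}" and ?B = "{S. subobj N S (FO F c)}"
  have sub: "?A \<subseteq> Obj D" "?B \<subseteq> Obj N" unfolding subobj_def using cat_homO1[OF D] cat_homO1[OF N] by blast+
  let ?F = "restrict_func (ideal D c) F"
  have app: "d \<in> ?A \<Longrightarrow> FO ?F d = FO F d" "f \<in> hom (ideal D c) a b \<Longrightarrow> FM ?F f = FM F f" for d f a b
    by (auto simp: restrict_func_def ideal_def full_sub_simps hom_def)
  have FB: "FO F d \<in> ?B" if "d \<in> ?A" for d using bij[OF c] that unfolding bij_betw_def by blast
  have hom1: "f \<in> hom (ideal D c) a b \<longleftrightarrow> f \<in> hom D a b \<and> a \<in> ?A \<and> b \<in> ?A" for f a b
    unfolding ideal_def full_sub_hom ..
  have hom2: "f \<in> hom (ideal N (FO F c)) a b \<longleftrightarrow> f \<in> hom N a b \<and> a \<in> ?B \<and> b \<in> ?B" for f a b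
    unfolding ideal_def full_sub_hom ..
  have ObjA: "Obj (ideal D c) = ?A" "Obj (ideal N (FO F c)) = ?B" by (simp_all add: ideal_def full_sub_simps)
  have Ffun: "is_functor (ideal D c) (ideal N (FO F c)) ?F"
  proof (rule is_functorI)
    show cats: "category (ideal D c)" "category (ideal N (FO F c))"
      unfolding ideal_def using full_sub_category[OF D sub(1)] full_sub_category[OF N sub(2)] .
    show "FO ?F \<in> extensional (Obj (ideal D c))" "FM ?F \<in> extensional (Mor (ideal D c))" by (simp_all add: restrict_func_def)
    show "FO ?F a \<in> Obj (ideal N (FO F c))" if "a \<in> Obj (ideal D c)" for a
      using that FB app(1) unfolding ObjA by simp
    show "FM ?F f \<in> hom (ideal N (FO F c)) (FO ?F a) (FO ?F b)" if f: "f \<in> hom (ideal D c) a b" for a b f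
      using f func_hom[OF F, of f a b] FB[of a] FB[of b] app(1)[of a] app(1)[of b] app(2)[OF f] unfolding hom1 hom2 by simp
    show "FM ?F (Idn (ideal D c) a) = Idn (ideal N (FO F c)) (FO ?F a)" if a: "a \<in> Obj (ideal D c)" for a
      using app(2)[OF cat_Idn[OF cats(1) a]] a FB[of a] app(1)[of a] func_id[OF F, of a] sub(1)
      unfolding ObjA by (auto simp: ideal_def full_sub_simps)
    show "FM ?F (f \<cdot>\<^bsub>ideal D c\<^esub> g) = FM ?F f \<cdot>\<^bsub>ideal N (FO F c)\<^esub> FM ?F g"
      if f: "f \<in> hom (ideal D c) a b" and g: "g \<in> hom (ideal D c) b k" for a b k f g
    proof -
      have "f \<cdot>\<^bsub>ideal D c\<^esub> g = f \<cdot>\<^bsub>D\<^esub> g"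
        unfolding ideal_def by (rule full_sub_cmp[OF f[unfolded ideal_def] g[unfolded ideal_def]])
      moreover have "FM F f \<cdot>\<^bsub>ideal N (FO F c)\<^esub> FM F g = FM F f \<cdot>\<^bsub>N\<^esub> FM F g"
        unfolding ideal_def
        by (rule full_sub_cmp[where a="FO F a" and b="FO F b" and c="FO F k"])
          (use f g func_hom[OF F] FB in \<open>auto simp: hom1 full_sub_hom\<close>)
      ultimately show ?thesis
        using app(2)[OF cat_cmp[OF cats(1) f g]] app(2)[OF f] app(2)[OF g] func_cmp[OF F, of f a b g k] f g
        unfolding hom1 by simp
    qed
  qed
  have bo: "bij_betw (FO ?F) (Obj (ideal D c)) (Obj (ideal N (FO F c)))"
    unfolding ObjA using bij[OF c] by (subst bij_betw_cong[of _ _ "FO F"]) (simp_all add: app(1))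
  have bm: "bij_betw (FM ?F) (Mor (ideal D c)) (Mor (ideal N (FO F c)))"
  proof (rule bij_betw_imageI)
    show "inj_on (FM ?F) (Mor (ideal D c))"
    proof (rule inj_onI)
      fix f g assume f: "f \<in> Mor (ideal D c)" and g: "g \<in> Mor (ideal D c)" and eq: "FM ?F f = FM ?F g"
      obtain a b where fh: "f \<in> hom (ideal D c) a b" using Mor_hom[OF f] by blast
      obtain a' b' where gh: "g \<in> hom (ideal D c) a' b'" using Mor_hom[OF g] by blast
      have e: "FM F f = FM F g" using eq app(2)[OF fh] app(2)[OF gh] by simp
      have "FO F a = FO F a'" "FO F b = FO F b'"
        using func_hom[OF F, of f a b] func_hom[OF F, of g a' b'] fh gh e unfolding hom1 by (auto simp: hom_def)
      then have ab: "a = a'" "b = b'" using bij[OF c] fh gh unfolding bij_betw_def inj_on_def hom1 by blast+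
      have "bij_betw (FM F) (hom D a b) (hom N (FO F a) (FO F b))"
        using ff fh sub(1) unfolding fully_faithful_def hom1 by blast
      then show "f = g" using fh gh ab e unfolding hom1 bij_betw_def inj_on_def by blast
    qed
    show "FM ?F ` Mor (ideal D c) = Mor (ideal N (FO F c))"
    proof (intro equalityI subsetI)
      fix t assume t0: "t \<in> Mor (ideal N (FO F c))"
      obtain S T where t: "t \<in> hom (ideal N (FO F c)) S T" using Mor_hom[OF t0] by blast
      have im: "FO F ` ?A = ?B" using bij[OF c] by (simp add: bij_betw_def)
      have "S \<in> FO F ` ?A" "T \<in> FO F ` ?A" using t unfolding im hom2 by simp_all
      then obtain a b where ab: "a \<in> ?A" "b \<in> ?A" "S = FO F a" "T = FO F b" by blast
      have "bij_betw (FM F) (hom D a b) (hom N (FO F a) (FO F b))"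
        using ff ab sub(1) unfolding fully_faithful_def by blast
      then have "t \<in> FM F ` hom D a b" using t ab(3,4) unfolding hom2 bij_betw_def by simp
      then obtain f where f: "f \<in> hom D a b" "t = FM F f" by blast
      then have fh: "f \<in> hom (ideal D c) a b" using ab hom1 by blast
      show "t \<in> FM ?F ` Mor (ideal D c)" using app(2)[OF fh] f hom_MorD[OF fh] by force
    qed (use func_Mor[OF Ffun] in blast)
  qed
  show "cat_isomorphism (ideal D c) (ideal N (FO F c)) ?F" unfolding cat_isomorphism_def using Ffun bo bm by blast
qed

text \<open>
  Categories of principal left and right ideals of one regular semigroup, joined by \<open>\<Gamma>\<close>.
  The right ideals of \<open>S\<close> are the left ideals of the opposite semigroup: \<open>rc e\<close>
  stands for \<open>eS\<close>, and \<open>RM e s f\<close> for the map \<open>x \<mapsto> sx\<close> from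
  \<open>eS\<close> to \<open>fS\<close>, where \<open>s \<in> fSe\<close>.
\<close>

locale cross_semigroup = L: semigroup_category S mul C lc LM + R: semigroup_category S "\<lambda>a b. mul b a" D rc RM
  for S :: "'s set" and mul :: "'s \<Rightarrow> 's \<Rightarrow> 's" (infixl "\<otimes>" 70)
    and C :: "('o, 'm) scat" and lc LM and D :: "('p, 'q) scat" and rc RM +
  fixes \<Gamma> :: "('p, 'q, ('o, 'm, 'o \<Rightarrow> 'm) setfunctor, ('o, 'm, 'o \<Rightarrow> 'm) setnatt) func"
  assumes Gamma_ext: "FO \<Gamma> \<in> extensional (Obj D)" "FM \<Gamma> \<in> extensional (Mor D)"
    and Gamma_O: "e \<in> S \<Longrightarrow> e \<otimes> e = e \<Longrightarrow> FO \<Gamma> (rc e) = H_functor C (L.pcone e)"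
    and Gamma_M: "L.valid f s e \<Longrightarrow> FM \<Gamma> (RM e s f) = nt C (L.pcone e) (L.pcone f) (LM f s e)"
begin

\<comment> \<open>The rewrite rules of the two sides describe the same predicates and would loop together.\<close>
declare R.validD [simp del] R.idemD [simp del] R.closed [simp del]

lemma idem_R: "R.idem e \<longleftrightarrow> L.idem e"
  unfolding L.idem_def R.idem_def ..

lemma valid_R: "R.valid e s f \<longleftrightarrow> L.valid f s e"
  unfolding L.valid_def R.valid_def by blast

lemma Gamma_obj: "L.idem e \<Longrightarrow> FO \<Gamma> (rc e) = H_functor C (L.pcone e)"
  by (rule Gamma_O) simp_all

lemma rc_iff: "L.idem e \<Longrightarrow> L.idem f \<Longrightarrow> rc e = rc f \<longleftrightarrow> f \<otimes> e = e \<and> e \<otimes> f = f"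
  using R.lc_iff[of e f] unfolding idem_R .

text \<open>
  If \<open>fS \<subseteq> eS\<close>, the principal cone at \<open>f\<close> is the one at \<open>e\<close>
  followed by the split epimorphism \<open>x \<mapsto> xf\<close> from \<open>Se\<close> to \<open>Sf\<close>.
  It follows that the \<open>H\<close>-functor of the first is a subfunctor of that of the second.
\<close>

lemma pcone_cmp:
  assumes e: "L.idem e" and f: "L.idem f" and ef: "e \<otimes> f = f"
  shows "L.valid e f f" "L.pcone f = cone_comp C (L.pcone e) (LM e f f)" "split_epi C (LM e f f)"
proof -
  show v: "L.valid e f f" using e f ef by (intro L.validI) simp_all
  note w = L.pcone_valid[OF f e]
  show "L.pcone f = cone_comp C (L.pcone e) (LM e f f)"
  proof (rule extensionalityI[of _ "Obj C"])
    show "L.pcone f \<in> extensional (Obj C)" "cone_comp C (L.pcone e) (LM e f f) \<in> extensional (Obj C)"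
      by (simp_all add: L.pcone_def cone_comp_def)
    fix a assume a: "a \<in> Obj C"
    then obtain g where g: "L.idem g" "a = lc g" using L.Obj_iff by blast
    have "g \<otimes> e \<otimes> f = g \<otimes> f" using L.mul_assoc[of g e f] g e f ef by simp
    then show "L.pcone f a = cone_comp C (L.pcone e) (LM e f f) a"
      using a g L.pcone_lc[OF g(1) e] L.pcone_lc[OF g(1) f] L.LM_cmp[OF L.pcone_valid[OF g(1) e] v] by (simp add: cone_comp_def)
  qed
  have "f \<otimes> e \<otimes> f = f" using L.mul_assoc[of f e f] e f ef by simp
  then show "split_epi C (LM e f f)"
    using split_epiI[OF L.LM_hom[OF v] L.LM_hom[OF w]] L.LM_cmp[OF w v] L.Idn_lc[OF f] by simp
qed

lemma Gamma_functor: "is_functor D (normal_dual C) \<Gamma>"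
proof (rule is_functorI[OF R.category L.N.normal_dual_category Gamma_ext])
  show "FO \<Gamma> a \<in> Obj (normal_dual C)" if "a \<in> Obj D" for a
    using that R.Obj_iff idem_R Gamma_obj L.N.H_functor_Obj[OF L.pcone_cone(1)] by auto
  show "FM \<Gamma> f \<in> hom (normal_dual C) (FO \<Gamma> a) (FO \<Gamma> b)" if "f \<in> hom D a b" for a b f
    using that
  proof (cases rule: R.hom_cases)
    case (1 e s k)
    then have v: "L.valid k s e" using valid_R by simp
    note i = L.valid_idem[OF v]
    show ?thesis
      using L.N.nt_natt[OF L.pcone_cone(1)[OF i(2)] L.pcone_cone(1)[OF i(1)] L.LM_hom[OF v]] 1 Gamma_M[OF v]
        Gamma_obj[OF i(1)] Gamma_obj[OF i(2)] by simp
  qed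
  show "FM \<Gamma> (Idn D a) = Idn (normal_dual C) (FO \<Gamma> a)" if a: "a \<in> Obj D" for a
  proof -
    obtain e where e: "L.idem e" "a = rc e" using a R.Obj_iff idem_R by blast
    have "Idn D a = RM e e e" using R.Idn_lc[of e] e idem_R by simp
    then show ?thesis
      using Gamma_M[OF L.valid_same[OF e(1)]] L.N.nt_id[OF L.pcone_cone(1)[OF e(1)]] L.Idn_lc[OF e(1)]
        Gamma_obj[OF e(1)] e(2) by simp
  qed
  show "FM \<Gamma> (f \<cdot>\<^bsub>D\<^esub> g) = FM \<Gamma> f \<cdot>\<^bsub>normal_dual C\<^esub> FM \<Gamma> g" if fg: "f \<in> hom D a b" "g \<in> hom D b c" for a b c f g
  proof -
    obtain x s y where 1: "a = rc x" "b = rc y" "R.valid x s y" "f = RM x s y" using R.hom_cases[OF fg(1)] .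
    obtain z where z: "R.idem z" "c = rc z" using R.hom_Obj[OF fg(2)] R.Obj_iff by blast
    obtain t where t: "R.valid y t z" "g = RM y t z" using fg(2) 1(2) z R.valid_idem[OF 1(3)] R.homE by metis
    note v = 1(3)[unfolded valid_R] and w = t(1)[unfolded valid_R]
    note c = L.pcone_cone(1)[OF L.valid_idem(2)[OF v]] L.pcone_cone(1)[OF L.valid_idem(1)[OF v]] L.pcone_cone(1)[OF L.valid_idem(1)[OF w]]
    show ?thesis
      using R.LM_cmp[OF 1(3) t(1)] Gamma_M[OF v] Gamma_M[OF w] Gamma_M[OF L.valid_cmp[OF w v]] L.LM_cmp[OF w v]
        L.N.nt_cmp[OF c L.LM_hom[OF v] L.LM_hom[OF w]] 1(4) t(2) by simp
  qed
qed

lemma Gamma_incl: "inclusion_preserving D (normal_dual C) \<Gamma>"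
  unfolding inclusion_preserving_def
proof
  fix j assume "j \<in> Incl D"
  then obtain f e where *: "L.idem f" "L.idem e" "e \<otimes> f = f" "j = RM f f e" using R.Incl_iff idem_R by auto
  note p = pcone_cmp[OF *(2,1,3)]
  note h = L.LM_hom[OF p(1)]
  note ce = L.pcone_cone(1)[OF *(2)] and cf = L.pcone_cone(1)[OF *(1)]
  let ?t = "nt C (L.pcone f) (L.pcone e) (LM e f f)"
  have t: "FM \<Gamma> j = ?t" using Gamma_M[OF p(1)] *(4) by simp
  have "H_set C (L.pcone f) a \<subseteq> H_set C (L.pcone e) a \<and>
      (\<forall>\<sigma>\<in>H_set C (L.pcone f) a. psi C (L.pcone e) (LM e f f \<cdot>\<^bsub>C\<^esub> eta C (L.pcone f) a \<sigma>) = \<sigma>)" for a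
  proof -
    have eq: "psi C (L.pcone e) (LM e f f \<cdot>\<^bsub>C\<^esub> eta C (L.pcone f) a \<sigma>) = \<sigma>" if s: "\<sigma> \<in> H_set C (L.pcone f) a" for \<sigma>
    proof -
      note eh = L.N.eta_hom[OF cf s]
      obtain b where b: "epi_component C (eta C (L.pcone f) a \<sigma>) \<in> hom C (lc f) b" using L.N.epi_componentE[OF eh(1)] by metis
      show ?thesis
        using L.N.epi_component_cmp[OF h p(3) eh(1)] L.N.cone_comp_assoc[OF ce h b] p(2) eh(2) by simp
    qed
    have "\<sigma> \<in> H_set C (L.pcone e) a" if s: "\<sigma> \<in> H_set C (L.pcone f) a" for \<sigma>
      using eq[OF s] L.N.H_set_eq[OF ce] L.N.cmp[OF h L.N.eta_hom(1)[OF cf s]] by (metis imageI)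
    then show ?thesis using eq by blast
  qed
  then show "FM \<Gamma> j \<in> Incl (normal_dual C)"
    unfolding t L.N.normal_dual_Incl using hom_MorD[OF L.N.nt_natt[OF cf ce h]]
    by (auto simp: nt_def L.N.H_functor_app(1) intro!: restrict_ext)
qed

lemma Gamma_full: "fully_faithful D (normal_dual C) \<Gamma>"
  unfolding fully_faithful_def
proof (intro ballI)
  fix a b assume "a \<in> Obj D" "b \<in> Obj D"
  then obtain e f where ef: "a = rc e" "b = rc f" "L.idem e" "L.idem f" using R.Obj_iff idem_R by auto
  note c = L.pcone_cone(1)[OF ef(3)] L.pcone_cone(1)[OF ef(4)]
  note nb = L.N.nt_bij[OF c]
  have homD: "m \<in> hom D a b \<longleftrightarrow> (\<exists>s. L.valid f s e \<and> m = RM e s f)" for m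
    using R.hom_iff[of e f m] ef idem_R valid_R by simp
  have H: "FO \<Gamma> a = H_functor C (L.pcone e)" "FO \<Gamma> b = H_functor C (L.pcone f)" using Gamma_obj ef by simp_all
  show "bij_betw (FM \<Gamma>) (hom D a b) (hom (normal_dual C) (FO \<Gamma> a) (FO \<Gamma> b))"
    unfolding H
  proof (rule bij_betw_imageI)
    show "inj_on (FM \<Gamma>) (hom D a b)"
    proof (rule inj_onI)
      fix m n assume mn: "m \<in> hom D a b" "n \<in> hom D a b" "FM \<Gamma> m = FM \<Gamma> n"
      obtain s where s: "L.valid f s e" "m = RM e s f" using mn(1) homD by blast
      obtain t where t: "L.valid f t e" "n = RM e t f" using mn(2) homD by blast
      have "nt C (L.pcone e) (L.pcone f) (LM f s e) = nt C (L.pcone e) (L.pcone f) (LM f t e)"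
        using mn(3) s t Gamma_M by simp
      then have "LM f s e = LM f t e" using nb L.LM_hom[OF s(1)] L.LM_hom[OF t(1)] unfolding bij_betw_def inj_on_def by blast
      then show "m = n" using L.LM_inj[OF s(1) t(1)] s t by simp
    qed
    show "FM \<Gamma> ` hom D a b = hom (normal_dual C) (H_functor C (L.pcone e)) (H_functor C (L.pcone f))"
    proof (intro equalityI subsetI)
      fix t assume "t \<in> hom (normal_dual C) (H_functor C (L.pcone e)) (H_functor C (L.pcone f))"
      then obtain m where m: "m \<in> hom C (lc f) (lc e)" "t = nt C (L.pcone e) (L.pcone f) m"
        using nb unfolding bij_betw_def by blast
      obtain s where s: "L.valid f s e" "m = LM f s e" using L.homE[OF m(1) ef(4,3)] .
      then have "t = FM \<Gamma> (RM e s f)" using m(2) Gamma_M[OF s(1)] by simp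
      then show "t \<in> FM \<Gamma> ` hom D a b" using homD s(1) by blast
    qed (use func_hom[OF Gamma_functor, of _ a b] H in auto)
  qed
qed

lemma subobj_rc:
  assumes "L.idem e" "L.idem f"
  shows "subobj D (rc f) (rc e) \<longleftrightarrow> e \<otimes> f = f"
proof
  assume "subobj D (rc f) (rc e)"
  then obtain j where "j \<in> Incl D" "j \<in> hom D (rc f) (rc e)" unfolding subobj_def by blast
  then show "e \<otimes> f = f" using R.Incl_hom_at(1)[of j f e] assms idem_R by simp
next
  assume "e \<otimes> f = f"
  then show "subobj D (rc f) (rc e)"
    using R.Incl_iff[of "RM f f e"] R.LM_hom[OF R.Incl_valid[of f e]] assms idem_R unfolding subobj_def by blast
qed

text \<open>
  If the principal cone at \<open>f\<close> belongs to the \<open>H\<close>-functor of that at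
  \<open>g\<close>, it is that cone followed by a translation; at the object \<open>Se\<close> this says
  \<open>f = gt\<close>.
\<close>

lemma H_pcone_inj:
  assumes e: "L.idem e" and f: "L.idem f" "e \<otimes> f = f" and g: "L.idem g" "e \<otimes> g = g"
    and eq: "H_functor C (L.pcone f) = H_functor C (L.pcone g)"
  shows "g \<otimes> f = f"
proof -
  note cf = L.pcone_cone(1)[OF f(1)] and cg = L.pcone_cone(1)[OF g(1)]
  have "L.pcone f \<in> H_set C (L.pcone f) (lc f)"
    using L.N.psi_id[OF cf] L.N.Idn[OF L.lc_Obj[OF f(1)]] L.N.H_set_eq[OF cf] by (metis imageI)
  then have "L.pcone f \<in> H_set C (L.pcone g) (lc f)" using eq L.N.H_functor_app(1)[OF L.lc_Obj[OF f(1)]] by metis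
  then obtain m where m: "m \<in> hom C (lc g) (lc f)" "L.pcone f = psi C (L.pcone g) m" using L.N.H_set_eq[OF cg] by blast
  obtain b where b: "epi_component C m \<in> hom C (lc g) b" using L.N.epi_componentE[OF m(1)] by metis
  have at: "L.pcone f (lc e) = L.pcone g (lc e) \<cdot>\<^bsub>C\<^esub> epi_component C m"
    using m(2) L.N.cone_comp_app[OF L.lc_Obj[OF e]] by metis
  have "L.pcone f (lc e) \<in> hom C (lc e) b" unfolding at by (rule L.N.cmp[OF is_coneD(3)[OF cg L.lc_Obj[OF e]] b])
  then have "b = lc f" using is_coneD(3)[OF cf L.lc_Obj[OF e]] by (auto simp: hom_def)
  then obtain t where t: "L.valid g t f" "epi_component C m = LM g t f" using L.homE[of _ g f] b f(1) g(1) by metis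
  have "LM e f f = LM e (g \<otimes> t) f"
    using at L.pcone_lc[OF e f(1)] L.pcone_lc[OF e g(1)] L.LM_cmp[OF L.pcone_valid[OF e g(1)] t(1)] t(2) f(2) g(2) by simp
  then have "f = t"
    using L.LM_inj[of e f f t] L.pcone_valid[OF e f(1)] L.valid_cmp[OF L.pcone_valid[OF e g(1)] t(1)] f(2) g(2) t(1) by simp
  then show ?thesis using t(1) by (metis L.validD(2))
qed

text \<open>
  A subfunctor given by a cone \<open>\<gamma>\<close> with apex \<open>Sg'\<close> contains
  \<open>\<gamma>\<close>, so \<open>\<gamma>\<close> is the principal cone at \<open>e\<close> followed by a
  translation by some \<open>s\<close> that has a section, given by \<open>t\<close> with
  \<open>ts = g'\<close>. The idempotent \<open>u = st\<close> lies in \<open>eS\<close>, and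
  \<open>\<gamma>\<close> is the principal cone at \<open>u\<close> followed by the isomorphism
  \<open>Su \<rightarrow> Sg'\<close>.
\<close>

lemma sub_H_functor:
  assumes e: "L.idem e" and S: "subobj (normal_dual C) T (H_functor C (L.pcone e))"
  obtains u where "L.idem u" "e \<otimes> u = u" "T = H_functor C (L.pcone u)"
proof -
  note ce = L.pcone_cone(1)[OF e]
  obtain j where j: "j \<in> Incl (normal_dual C)" "j \<in> hom (normal_dual C) T (H_functor C (L.pcone e))"
    using S unfolding subobj_def by blast
  then obtain \<gamma> where g: "cone C \<gamma>" "T = H_functor C \<gamma>" using L.N.normal_dual_hom L.N.normal_dual_Obj by blast
  define d where "d = apex C \<gamma>"
  have cg: "is_cone C d \<gamma>" unfolding d_def by (rule cone_apex[OF g(1)])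
  note dO = is_coneD(1)[OF cg]
  obtain g' where g': "L.idem g'" "d = lc g'" using dO L.Obj_iff by blast
  have "H_set C \<gamma> d \<subseteq> H_set C (L.pcone e) d"
    using j dO g(2) unfolding L.N.normal_dual_Incl L.N.normal_dual_hom by (auto simp: L.N.H_functor_app(1))
  moreover have "\<gamma> \<in> H_set C \<gamma> d" using L.N.psi_id[OF cg] L.N.Idn[OF dO] L.N.H_set_eq[OF cg] by (metis imageI)
  ultimately obtain m where m: "m \<in> hom C (lc e) d" "\<gamma> = psi C (L.pcone e) m" using L.N.H_set_eq[OF ce] by blast
  obtain b where b: "epi_component C m \<in> hom C (lc e) b" "split_epi C (epi_component C m)" using L.N.epi_componentE[OF m(1)] by metis
  have at: "\<gamma> a = L.pcone e a \<cdot>\<^bsub>C\<^esub> epi_component C m" if "a \<in> Obj C" for a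
    using m(2) L.N.cone_comp_app[OF that] by metis
  have "\<gamma> (lc e) \<in> hom C (lc e) b"
    unfolding at[OF L.lc_Obj[OF e]] by (rule L.N.cmp[OF is_coneD(3)[OF ce L.lc_Obj[OF e]] b(1)])
  then have "b = lc g'" using is_coneD(3)[OF cg L.lc_Obj[OF e]] g'(2) by (auto simp: hom_def)
  then obtain s where s: "L.valid e s g'" "epi_component C m = LM e s g'" using L.homE[of _ e g'] b(1) e g'(1) by metis
  obtain k where k: "k \<in> hom C (lc g') (lc e)" "k \<cdot>\<^bsub>C\<^esub> LM e s g' = Idn C (lc g')"
    using split_epiE[OF b(2)[unfolded s(2)] L.LM_hom[OF s(1)]] .
  obtain t where t: "L.valid g' t e" "k = LM g' t e" using L.homE[OF k(1) g'(1) e] .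
  have "LM g' (t \<otimes> s) g' = LM g' g' g'" using k(2) t(2) L.LM_cmp[OF t(1) s(1)] L.Idn_lc[OF g'(1)] by simp
  then have ts: "t \<otimes> s = g'" using L.LM_inj[OF L.valid_cmp[OF t(1) s(1)] L.valid_same[OF g'(1)]] by simp
  define u where "u = s \<otimes> t"
  have S: "s \<in> S" "t \<in> S" "e \<in> S" "g' \<in> S" "u \<in> S" unfolding u_def using s t e g' by simp_all
  have us: "u \<otimes> s = s" unfolding u_def using L.mul_assoc[OF S(1,2,1)] ts s(1) by simp
  have tu: "t \<otimes> u = t" unfolding u_def using L.absorb[OF S(2,1,2) ts] t(1) by simp
  have uu: "u \<otimes> u = u" using L.mul_assoc[OF S(1,2,5)] tu by (simp add: u_def)
  have iu: "L.idem u" unfolding L.idem_def using S(5) uu by simp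
  have eu: "e \<otimes> u = u" unfolding u_def using L.absorb[OF S(3,1,2)] s(1) by simp
  have v: "L.valid u s g'" using L.validI[OF iu S(1) g'(1) us] s(1) by simp
  have v': "L.valid g' t u" using L.validI[OF g'(1) S(2) iu _ tu] t(1) by simp
  have iso: "is_iso C (LM u s g')"
    by (rule is_isoI[OF L.category L.LM_hom[OF v] L.LM_hom[OF v']])
      (use L.LM_cmp[OF v v'] L.LM_cmp[OF v' v] L.Idn_lc iu g'(1) ts in \<open>simp_all add: u_def[symmetric]\<close>)
  have "\<gamma> = cone_comp C (L.pcone u) (LM u s g')"
  proof (rule extensionalityI[of _ "Obj C"])
    show "\<gamma> \<in> extensional (Obj C)" "cone_comp C (L.pcone u) (LM u s g') \<in> extensional (Obj C)"
      using is_coneD(2)[OF cg] by (simp_all add: cone_comp_def)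
    fix a assume a: "a \<in> Obj C"
    then obtain h where h: "L.idem h" "a = lc h" using L.Obj_iff by blast
    have "h \<otimes> e \<otimes> s = h \<otimes> u \<otimes> s" using L.mul_assoc[of h e s] L.mul_assoc[of h u s] h(1) S us s(1) by simp
    then show "\<gamma> a = cone_comp C (L.pcone u) (LM u s g') a"
      using at[OF a] s(2) h L.pcone_lc[OF h(1) e] L.pcone_lc[OF h(1) iu] L.LM_cmp[OF L.pcone_valid[OF h(1) e] s(1)]
        L.LM_cmp[OF L.pcone_valid[OF h(1) iu] v] a by (simp add: cone_comp_def)
  qed
  then have "T = H_functor C (L.pcone u)"
    using L.N.H_functor_iso[OF L.pcone_cone(1)[OF iu] iso L.LM_hom[OF v]] g(2) by simp
  then show ?thesis using that iu eu by blast
qed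

lemma Gamma_local_isomorphism: "local_isomorphism D (normal_dual C) \<Gamma>"
proof (rule local_isomorphismI[OF Gamma_functor Gamma_incl Gamma_full])
  fix c assume "c \<in> Obj D"
  then obtain e where e: "L.idem e" "c = rc e" using R.Obj_iff idem_R by blast
  have mem: "d \<in> {d. subobj D d c} \<longleftrightarrow> (\<exists>f. L.idem f \<and> e \<otimes> f = f \<and> d = rc f)" for d
  proof
    assume d: "d \<in> {d. subobj D d c}"
    then obtain j where "j \<in> hom D d c" unfolding subobj_def by blast
    then obtain f where f: "L.idem f" "d = rc f" using R.hom_Obj R.Obj_iff idem_R by blast
    then show "\<exists>f. L.idem f \<and> e \<otimes> f = f \<and> d = rc f" using d subobj_rc[OF e(1) f(1)] e(2) by blast
  qed (use subobj_rc[OF e(1)] e(2) in blast)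
  have H: "FO \<Gamma> c = H_functor C (L.pcone e)" using Gamma_obj e by simp
  show "bij_betw (FO \<Gamma>) {d. subobj D d c} {S. subobj (normal_dual C) S (FO \<Gamma> c)}"
  proof (rule bij_betw_imageI)
    show "inj_on (FO \<Gamma>) {d. subobj D d c}"
    proof (rule inj_onI)
      fix d d' assume "d \<in> {d. subobj D d c}" "d' \<in> {d. subobj D d c}" and eq: "FO \<Gamma> d = FO \<Gamma> d'"
      then obtain f g where f: "L.idem f" "e \<otimes> f = f" "d = rc f" and g: "L.idem g" "e \<otimes> g = g" "d' = rc g"
        using mem by blast
      have h: "H_functor C (L.pcone f) = H_functor C (L.pcone g)" using eq f g Gamma_obj by simp
      show "d = d'"
        using rc_iff[OF f(1) g(1)] H_pcone_inj[OF e(1) f(1,2) g(1,2) h] H_pcone_inj[OF e(1) g(1,2) f(1,2) h[symmetric]] f g by simp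
    qed
    show "FO \<Gamma> ` {d. subobj D d c} = {S. subobj (normal_dual C) S (FO \<Gamma> c)}"
    proof (intro equalityI subsetI)
      fix T assume "T \<in> FO \<Gamma> ` {d. subobj D d c}"
      then obtain d where d: "T = FO \<Gamma> d" "subobj D d c" by blast
      then obtain j where "j \<in> Incl D" "j \<in> hom D d c" unfolding subobj_def by blast
      then show "T \<in> {S. subobj (normal_dual C) S (FO \<Gamma> c)}"
        using Gamma_incl func_hom[OF Gamma_functor] d(1) unfolding inclusion_preserving_def subobj_def by blast
    next
      fix T assume "T \<in> {S. subobj (normal_dual C) S (FO \<Gamma> c)}"
      then have "subobj (normal_dual C) T (H_functor C (L.pcone e))" using H by simp
      then obtain u where u: "L.idem u" "e \<otimes> u = u" "T = H_functor C (L.pcone u)" using sub_H_functor[OF e(1)] by blast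
      then have "rc u \<in> {d. subobj D d c}" using mem by blast
      then show "T \<in> FO \<Gamma> ` {d. subobj D d c}" using u(3) Gamma_obj[OF u(1)] by (metis imageI)
    qed
  qed
qed

abbreviation "XC \<equiv> \<lparr> xD = D, xC = C, xG = \<Gamma> \<rparr>"

theorem cross_connection: "cross_connection XC"
  unfolding cross_connection_def
proof (intro conjI ballI)
  show "normal_category (xD XC)" "normal_category (xC XC)" "local_isomorphism (xD XC) (normal_dual (xC XC)) (xG XC)"
    using R.normal L.normal Gamma_local_isomorphism by simp_all
  fix c assume "c \<in> Obj (xC XC)"
  then obtain e where e: "L.idem e" "c = lc e" using L.Obj_iff by auto
  note p = L.pcone_cone[OF e(1)]
  have "cone C (L.pcone e)" "is_iso C (L.pcone e (lc e))"
    using p(1) is_iso_Idn[OF L.category L.lc_Obj[OF e(1)]] by (auto simp: cone_def p(2))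
  then have "c \<in> M_set (xC XC) (FO (xG XC) (rc e))"
    unfolding M_set_def using e Gamma_obj[OF e(1)] L.lc_Obj[OF e(1)] by auto
  then show "\<exists>d\<in>Obj (xD XC). c \<in> M_set (xC XC) (FO (xG XC) d)" using R.lc_Obj[of e] e(1) idem_R by auto
qed

sublocale X: xcon XC
  by unfold_locales (rule cross_connection)

lemma xcone_lc:
  assumes "L.idem e"
  shows "(lc e, rc e) \<in> xE XC" "xcone XC (lc e) (rc e) = L.pcone e"
  using X.xcone_eqI[of "lc e" "rc e" "L.pcone e"] L.pcone_cone[OF assms] L.lc_Obj[OF assms] R.lc_Obj[of e]
    Gamma_obj[OF assms] assms idem_R by simp_all

text \<open>
  For a pair with objects \<open>Sf\<close> and \<open>eS\<close>, the idempotent cone of the pair and the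
  principal cone at \<open>e\<close> are obtained from each other by translations with some \<open>s\<close>
  and \<open>t\<close>. Then \<open>st = e\<close> and \<open>fs = f\<close>, so \<open>s\<close> is an
  idempotent with \<open>Ss = Sf\<close> and \<open>sS = eS\<close>.
\<close>

lemma xE_iff: "(c, d) \<in> xE XC \<longleftrightarrow> (\<exists>e. L.idem e \<and> c = lc e \<and> d = rc e)"
proof
  assume E: "(c, d) \<in> xE XC"
  obtain f where f: "L.idem f" "c = lc f" using X.xE_Obj[OF E] L.Obj_iff by auto
  obtain e where e: "L.idem e" "d = rc e" using X.xE_Obj[OF E] R.Obj_iff idem_R by auto
  define \<gamma> where "\<gamma> = xcone XC c d"
  have g: "is_cone C (lc f) \<gamma>" "\<gamma> (lc f) = Idn C (lc f)" "H_functor C \<gamma> = H_functor C (L.pcone e)"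
    using X.xcone_spec[OF E] f e Gamma_obj[OF e(1)] unfolding \<gamma>_def idempotent_cone_def by auto
  note ce = L.pcone_cone[OF e(1)]
  note fO = L.lc_Obj[OF f(1)] and eO = L.lc_Obj[OF e(1)]
  have HS: "H_set C \<gamma> a = H_set C (L.pcone e) a" if "a \<in> Obj C" for a
    using g(3) L.N.H_functor_app(1)[OF that] by metis
  have "\<gamma> \<in> H_set C \<gamma> (lc f)" using L.N.psi_id[OF g(1)] L.N.Idn[OF fO] L.N.H_set_eq[OF g(1)] by (metis imageI)
  then obtain m where m: "m \<in> hom C (lc e) (lc f)" "\<gamma> = psi C (L.pcone e) m"
    unfolding HS[OF fO] L.N.H_set_eq[OF ce(1)] by blast
  have "L.pcone e \<in> H_set C (L.pcone e) (lc e)"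
    using L.N.psi_id[OF ce(1)] L.N.Idn[OF eO] L.N.H_set_eq[OF ce(1)] by (metis imageI)
  then obtain n where n: "n \<in> hom C (lc f) (lc e)" "L.pcone e = psi C \<gamma> n"
    unfolding HS[OF eO, symmetric] L.N.H_set_eq[OF g(1)] by blast
  obtain b where b: "epi_component C m \<in> hom C (lc e) b" using L.N.epi_componentE[OF m(1)] by metis
  obtain b' where b': "epi_component C n \<in> hom C (lc f) b'" using L.N.epi_componentE[OF n(1)] by metis
  have at: "\<gamma> a = L.pcone e a \<cdot>\<^bsub>C\<^esub> epi_component C m" "L.pcone e a = \<gamma> a \<cdot>\<^bsub>C\<^esub> epi_component C n" if "a \<in> Obj C" for a
    using m(2) n(2) L.N.cone_comp_app[OF that] by metis+
  have "\<gamma> (lc f) \<in> hom C (lc f) b" unfolding at(1)[OF fO] by (rule L.N.cmp[OF is_coneD(3)[OF ce(1) fO] b])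
  then have "b = lc f" using is_coneD(3)[OF g(1) fO] by (auto simp: hom_def)
  then obtain s where s: "L.valid e s f" "epi_component C m = LM e s f" using L.homE[of _ e f] b e(1) f(1) by metis
  have "L.pcone e (lc f) \<in> hom C (lc f) b'" unfolding at(2)[OF fO] by (rule L.N.cmp[OF is_coneD(3)[OF g(1) fO] b'])
  then have "b' = lc e" using is_coneD(3)[OF ce(1) fO] by (auto simp: hom_def)
  then obtain t where t: "L.valid f t e" "epi_component C n = LM f t e" using L.homE[of _ f e] b' e(1) f(1) by metis
  have ge: "\<gamma> (lc e) = LM e s f"
    using at(1)[OF eO] L.pcone_lc[OF e(1) e(1)] L.LM_cmp[OF L.valid_same[OF e(1)] s(1)] s e(1) by simp
  have "LM e e e = LM e (s \<otimes> t) e" using at(2)[OF eO] ge ce(2) L.Idn_lc[OF e(1)] L.LM_cmp[OF s(1) t(1)] t(2) by simp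
  then have st: "s \<otimes> t = e" using L.LM_inj[OF L.valid_same[OF e(1)] L.valid_cmp[OF s(1) t(1)]] by simp
  have "LM f f f = LM f (f \<otimes> e \<otimes> s) f"
    using at(1)[OF fO] g(2) L.Idn_lc[OF f(1)] L.pcone_lc[OF f(1) e(1)] L.LM_cmp[OF L.pcone_valid[OF f(1) e(1)] s(1)] s(2) by simp
  then have "f = f \<otimes> e \<otimes> s"
    using L.LM_inj[OF L.valid_same[OF f(1)] L.valid_cmp[OF L.pcone_valid[OF f(1) e(1)] s(1)]] by blast
  also have "f \<otimes> e \<otimes> s = f \<otimes> s" using L.mul_assoc[of f e s] e(1) f(1) s(1) by simp
  finally have fs: "f \<otimes> s = f" ..
  have S: "s \<in> S" "t \<in> S" "f \<in> S" "e \<in> S" using s t e f by simp_all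
  have ss: "s \<otimes> s = s" using L.mul_assoc[OF S(1,3,1)] fs s(1) by simp
  have ids: "L.idem s" unfolding L.idem_def using S(1) ss by simp
  have "s \<otimes> e = e" using L.absorb[OF S(1,1,2) ss] st by simp
  then have "rc s = rc e" using rc_iff[OF ids e(1)] s(1) by simp
  moreover have "lc s = lc f" using L.lc_iff[OF ids f(1)] fs s(1) by simp
  ultimately show "\<exists>e. L.idem e \<and> c = lc e \<and> d = rc e" using ids f(2) e(2) by metis
qed (use xcone_lc in blast)

text \<open>
  By the Yoneda correspondence both morphisms determine natural transformations between the same
  \<open>H\<close>-functors, and these are parametrized by \<open>eSe'\<close>.
\<close>

lemma linked_iff_same:
  assumes e: "L.idem e" "L.idem e'" and s: "L.valid e s e'" and t: "L.valid e t e'"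
  shows "linked XC (lc e) (rc e) (lc e') (rc e') (LM e s e') (RM e' t e) \<longleftrightarrow> s = t"
proof -
  have f: "LM e s e' \<in> hom (xC XC) (lc e) (lc e')" using L.LM_hom[OF s] by simp
  have g: "RM e' t e \<in> hom (xD XC) (rc e') (rc e)" using R.LM_hom[of e' t e] t valid_R by simp
  have "linked XC (lc e) (rc e) (lc e') (rc e') (LM e s e') (RM e' t e)
      \<longleftrightarrow> nt C (L.pcone e') (L.pcone e) (LM e t e') = nt C (L.pcone e') (L.pcone e) (LM e s e')"
    using X.linked_iff[OF xcone_lc(1)[OF e(1)] xcone_lc(1)[OF e(2)] f g] xcone_lc(2)[OF e(1)] xcone_lc(2)[OF e(2)]
      Gamma_M[OF t] by simp
  also have "\<dots> \<longleftrightarrow> LM e t e' = LM e s e'"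
    by (rule inj_on_eq_iff[OF bij_betw_imp_inj_on[OF L.N.nt_bij[OF L.pcone_cone(1)[OF e(2)] L.pcone_cone(1)[OF e(1)]]]
          L.LM_hom[OF t] L.LM_hom[OF s]])
  finally show ?thesis using L.LM_inj[OF t s] by auto
qed

lemma R_pcone_rc: "L.idem e \<Longrightarrow> L.idem g \<Longrightarrow> R.pcone e (rc g) = RM g (e \<otimes> g) e"
  using R.pcone_lc[of g e] idem_R by simp

text \<open>
  Linking is equality of the translating elements on both sides, and the components of the principal cones in
  question are the translations by \<open>ee'\<close> on either side.
\<close>

theorem is_dual_opposite:
  assumes "cross_semigroup S (\<lambda>a b. b \<otimes> a) D rc RM C lc LM \<Delta>"
  shows "is_dual XC \<lparr> xD = C, xC = D, xG = \<Delta> \<rparr>"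
proof -
  interpret Y: cross_semigroup S "\<lambda>a b. b \<otimes> a" D rc RM C lc LM \<Delta> by (rule assms)
  let ?Y = "\<lparr> xD = C, xC = D, xG = \<Delta> \<rparr>"
  have E: "(c, d) \<in> xE XC \<longleftrightarrow> (d, c) \<in> xE ?Y" for c d
    unfolding xE_iff Y.xE_iff using idem_R by blast
  have main: "(\<forall>f\<in>hom (xC XC) c c'. \<forall>g\<in>hom (xD XC) d' d. linked ?Y d' c' d c g f \<longleftrightarrow> linked XC c d c' d' f g) \<and>
        linked XC c d c' d' (xcone XC c' d' c) (xcone ?Y d c d')"
    if cd: "(c, d) \<in> xE XC" "(c', d') \<in> xE XC" for c d c' d'
  proof (intro conjI ballI)
    obtain e where e: "L.idem e" "c = lc e" "d = rc e" using cd(1) xE_iff by blast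
    obtain e' where e': "L.idem e'" "c' = lc e'" "d' = rc e'" using cd(2) xE_iff by blast
    have ri: "R.idem e" "R.idem e'" using e e' idem_R by auto
    show "linked ?Y d' c' d c g f \<longleftrightarrow> linked XC c d c' d' f g" if fg: "f \<in> hom (xC XC) c c'" "g \<in> hom (xD XC) d' d" for f g
    proof -
      obtain s where s: "L.valid e s e'" "f = LM e s e'" using L.homE[of f e e'] fg(1) e e' by auto
      obtain t where t: "R.valid e' t e" "g = RM e' t e" using R.homE[of g e' e] fg(2) e e' ri by auto
      have t': "L.valid e t e'" using t(1) valid_R by blast
      have s': "R.valid e' s e" using s(1) valid_R by blast
      show ?thesis
        using linked_iff_same[OF e(1) e'(1) s(1) t'] Y.linked_iff_same[OF ri(2,1) t(1) s'] s(2) t(2) e e' by auto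
    qed
    have "xcone XC c' d' c = LM e (e \<otimes> e') e'" using xcone_lc(2)[OF e'(1)] L.pcone_lc[OF e(1) e'(1)] e e' by simp
    moreover have "xcone ?Y d c d' = RM e' (e \<otimes> e') e" using Y.xcone_lc(2)[OF ri(1)] R_pcone_rc[OF e(1) e'(1)] e e' by simp
    ultimately show "linked XC c d c' d' (xcone XC c' d' c) (xcone ?Y d c d')"
      using linked_iff_same[OF e(1) e'(1) L.pcone_valid[OF e(1) e'(1)] L.pcone_valid[OF e(1) e'(1)]] e e' by simp
  qed
  show ?thesis
    unfolding is_dual_def using Y.cross_connection E main by auto
qed

theorem is_transpose_iff:
  assumes D: "cross_semigroup S (\<lambda>a b. b \<otimes> a) D rc RM C lc LM \<Delta>"
  shows "is_transpose XC c d c' d' f g \<longleftrightarrow> (\<exists>e s e'. L.valid e s e' \<and> c = lc e \<and> d = rc e \<and> c' = lc e' \<and> d' = rc e' \<and>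
     f = LM e s e' \<and> g = RM e' s e)"
proof -
  interpret Y: cross_semigroup S "\<lambda>a b. b \<otimes> a" D rc RM C lc LM \<Delta> by (rule D)
  have dual: "dual XC = \<lparr> xD = C, xC = D, xG = \<Delta> \<rparr>" by (rule dual_eqI[OF cross_connection is_dual_opposite[OF D]])
  show ?thesis
  proof
    assume h: "is_transpose XC c d c' d' f g"
    then have h': "(c, d) \<in> xE XC" "(c', d') \<in> xE XC" "f \<in> hom C c c'" "g \<in> hom D d' d"
      "linked \<lparr> xD = C, xC = D, xG = \<Delta> \<rparr> d' c' d c g f" unfolding is_transpose_def dual by simp_all
    obtain e where e: "L.idem e" "c = lc e" "d = rc e" using h'(1) xE_iff by blast
    obtain e' where e': "L.idem e'" "c' = lc e'" "d' = rc e'" using h'(2) xE_iff by blast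
    have ri: "R.idem e" "R.idem e'" using e e' idem_R by auto
    obtain s where s: "L.valid e s e'" "f = LM e s e'" using L.homE[of f e e'] h'(3) e e' by auto
    obtain t where t: "R.valid e' t e" "g = RM e' t e" using R.homE[of g e' e] h'(4) e e' ri by auto
    have s': "R.valid e' s e" using s(1) valid_R by blast
    have "t = s" using Y.linked_iff_same[OF ri(2,1) t(1) s'] h'(5) s(2) t(2) e e' by simp
    then show "\<exists>e s e'. L.valid e s e' \<and> c = lc e \<and> d = rc e \<and> c' = lc e' \<and> d' = rc e' \<and> f = LM e s e' \<and> g = RM e' s e"
      using e e' s t by blast
  next
    assume "\<exists>e s e'. L.valid e s e' \<and> c = lc e \<and> d = rc e \<and> c' = lc e' \<and> d' = rc e' \<and> f = LM e s e' \<and> g = RM e' s e"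
    then obtain e s e' where *: "L.valid e s e'" "c = lc e" "d = rc e" "c' = lc e'" "d' = rc e'" "f = LM e s e'" "g = RM e' s e"
      by blast
    note i = L.valid_idem[OF *(1)]
    have ri: "R.idem e" "R.idem e'" using i idem_R by auto
    have s': "R.valid e' s e" using *(1) valid_R by blast
    show "is_transpose XC c d c' d' f g"
      unfolding is_transpose_def dual
      using * xcone_lc(1)[OF i(1)] xcone_lc(1)[OF i(2)] L.LM_hom[OF *(1)] R.LM_hom[OF s'] Y.linked_iff_same[OF ri(2,1) s' s'] by simp
  qed
qed

end

subsection \<open>Homomorphisms\<close>

text \<open>
  A homomorphism preserves every relation in the description of the category by \<open>lc\<close> and
  \<open>LM\<close>.
\<close>

lemma semigroup_category_functor:
  assumes S: "semigroup_category S mul C lc LM" and S': "semigroup_category S' mul' C' lc' LM'"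
    and hom: "\<And>a. a \<in> S \<Longrightarrow> \<phi> a \<in> S'" "\<And>a b. a \<in> S \<Longrightarrow> b \<in> S \<Longrightarrow> \<phi> (mul a b) = mul' (\<phi> a) (\<phi> b)"
    and ext: "FO F \<in> extensional (Obj C)" "FM F \<in> extensional (Mor C)"
    and FO: "\<And>e. e \<in> S \<Longrightarrow> mul e e = e \<Longrightarrow> FO F (lc e) = lc' (\<phi> e)"
    and FM: "\<And>e s f. semigroup_category.valid S mul e s f \<Longrightarrow> FM F (LM e s f) = LM' (\<phi> e) (\<phi> s) (\<phi> f)"
  shows "is_functor C C' F" "inclusion_preserving C C' F"
    "\<And>e. semigroup_category.idem S mul e \<Longrightarrow> semigroup_category.idem S' mul' (\<phi> e)"
    "\<And>e s f. semigroup_category.valid S mul e s f \<Longrightarrow> semigroup_category.valid S' mul' (\<phi> e) (\<phi> s) (\<phi> f)"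
proof -
  interpret L: semigroup_category S mul C lc LM by (rule S)
  interpret L': semigroup_category S' mul' C' lc' LM' by (rule S')
  show idem: "L'.idem (\<phi> e)" if "L.idem e" for e
    using that hom(1)[of e] hom(2)[of e e] unfolding L.idem_def L'.idem_def by simp
  show valid: "L'.valid (\<phi> e) (\<phi> s) (\<phi> f)" if v: "L.valid e s f" for e s f
    using L.valid_idem[OF v] idem[of e] idem[of f] v hom(1)[of s] hom(2)[of e s] hom(2)[of s f]
    by (intro L'.validI) simp_all
  have O: "FO F (lc e) = lc' (\<phi> e)" if "L.idem e" for e using FO that by simp
  show "is_functor C C' F"
  proof (rule is_functorI[OF L.category L'.category ext])
    show "FO F a \<in> Obj C'" if "a \<in> Obj C" for a using that L.Obj_iff O idem L'.lc_Obj by auto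
    show "FM F f \<in> hom C' (FO F a) (FO F b)" if f: "f \<in> hom C a b" for a b f
    proof -
      obtain e s k where *: "a = lc e" "b = lc k" "L.valid e s k" "f = LM e s k" using L.hom_cases[OF f] .
      then show ?thesis using FM[OF *(3)] L'.LM_hom[OF valid[OF *(3)]] O L.valid_idem[OF *(3)] by simp
    qed
    show "FM F (Idn C a) = Idn C' (FO F a)" if a: "a \<in> Obj C" for a
    proof -
      obtain e where e: "L.idem e" "a = lc e" using a L.Obj_iff by blast
      then show ?thesis using FM[OF L.valid_same[OF e(1)]] O L.Idn_lc[OF e(1)] L'.Idn_lc[OF idem[OF e(1)]] by simp
    qed
    show "FM F (f \<cdot>\<^bsub>C\<^esub> g) = FM F f \<cdot>\<^bsub>C'\<^esub> FM F g" if fg: "f \<in> hom C a b" "g \<in> hom C b c" for a b c f g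
    proof -
      obtain x s y where 1: "a = lc x" "b = lc y" "L.valid x s y" "f = LM x s y" using L.hom_cases[OF fg(1)] .
      obtain z where z: "L.idem z" "c = lc z" using L.hom_Obj[OF fg(2)] L.Obj_iff by blast
      obtain t where t: "L.valid y t z" "g = LM y t z" using fg(2) 1(2) z L.valid_idem[OF 1(3)] L.homE by metis
      show ?thesis
        using L.LM_cmp[OF 1(3) t(1)] L'.LM_cmp[OF valid[OF 1(3)] valid[OF t(1)]] FM[OF 1(3)] FM[OF t(1)]
          FM[OF L.valid_cmp[OF 1(3) t(1)]] hom(2)[of s t] 1(3,4) t by simp
    qed
  qed
  show "inclusion_preserving C C' F"
    unfolding inclusion_preserving_def
  proof
    fix j assume "j \<in> Incl C"
    then obtain e f where *: "L.idem e" "L.idem f" "mul e f = e" "j = LM e e f" using L.Incl_iff by blast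
    have "mul' (\<phi> e) (\<phi> f) = \<phi> e" using hom(2)[of e f] * by simp
    then show "FM F j \<in> Incl C'" using FM[OF L.Incl_valid[OF *(1-3)]] idem *(1,2,4) L'.Incl_iff by metis
  qed
qed

text \<open>
  Pairs, idempotent cones and transposes are described in the semigroup by \<open>xE_iff\<close>,
  \<open>xcone_lc\<close> and \<open>is_transpose_iff\<close>. A homomorphism preserves these descriptions.
\<close>

lemma cross_semigroup_morphism:
  assumes X: "cross_semigroup S mul C lc LM D rc RM \<Gamma>" "cross_semigroup S (\<lambda>a b. mul b a) D rc RM C lc LM \<Delta>"
    and X': "cross_semigroup S' mul' C' lc' LM' D' rc' RM' \<Gamma>'" "cross_semigroup S' (\<lambda>a b. mul' b a) D' rc' RM' C' lc' LM' \<Delta>'"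
    and hom: "\<And>a. a \<in> S \<Longrightarrow> \<phi> a \<in> S'" "\<And>a b. a \<in> S \<Longrightarrow> b \<in> S \<Longrightarrow> \<phi> (mul a b) = mul' (\<phi> a) (\<phi> b)"
    and F: "FO F \<in> extensional (Obj C)" "FM F \<in> extensional (Mor C)"
      "\<And>e. e \<in> S \<Longrightarrow> mul e e = e \<Longrightarrow> FO F (lc e) = lc' (\<phi> e)"
      "\<And>e s f. semigroup_category.valid S mul e s f \<Longrightarrow> FM F (LM e s f) = LM' (\<phi> e) (\<phi> s) (\<phi> f)"
    and K: "FO K \<in> extensional (Obj D)" "FM K \<in> extensional (Mor D)"
      "\<And>e. e \<in> S \<Longrightarrow> mul e e = e \<Longrightarrow> FO K (rc e) = rc' (\<phi> e)"
      "\<And>e s f. semigroup_category.valid S (\<lambda>a b. mul b a) e s f \<Longrightarrow> FM K (RM e s f) = RM' (\<phi> e) (\<phi> s) (\<phi> f)"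
  shows "xconn_morphism \<lparr> xD = D, xC = C, xG = \<Gamma> \<rparr> \<lparr> xD = D', xC = C', xG = \<Gamma>' \<rparr> F K"
proof -
  interpret X: cross_semigroup S mul C lc LM D rc RM \<Gamma> by (rule X(1))
  interpret X': cross_semigroup S' mul' C' lc' LM' D' rc' RM' \<Gamma>' by (rule X'(1))
  note axL = X.L.semigroup_category_axioms X'.L.semigroup_category_axioms
    and axR = X.R.semigroup_category_axioms X'.R.semigroup_category_axioms
  have fF: "is_functor C C' F" "inclusion_preserving C C' F" "\<And>e. X.L.idem e \<Longrightarrow> X'.L.idem (\<phi> e)"
    "\<And>e s f. X.L.valid e s f \<Longrightarrow> X'.L.valid (\<phi> e) (\<phi> s) (\<phi> f)"
    by ((rule semigroup_category_functor[OF axL, where \<phi>=\<phi> and F=F]; (assumption | rule hom F)+))+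
  have fK: "is_functor D D' K" "inclusion_preserving D D' K"
    by ((rule semigroup_category_functor(1,2)[OF axR, where \<phi>=\<phi> and F=K]; (assumption | rule hom K)+))+
  have O: "FO F (lc e) = lc' (\<phi> e)" "FO K (rc e) = rc' (\<phi> e)" if "X.L.idem e" for e
    using F(3) K(3) that by simp_all
  show ?thesis
  proof (rule xconn_morphismI)
    show "is_functor (xC X.XC) (xC X'.XC) F" "inclusion_preserving (xC X.XC) (xC X'.XC) F"
      "is_functor (xD X.XC) (xD X'.XC) K" "inclusion_preserving (xD X.XC) (xD X'.XC) K"
      unfolding xconn.select_convs by (fact fF fK)+
    fix c d assume cd: "(c, d) \<in> xE X.XC"
    then obtain e where e: "X.L.idem e" "c = lc e" "d = rc e" using X.xE_iff by blast
    note ie = fF(3)[OF e(1)]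
    show "(FO F c, FO K d) \<in> xE X'.XC" using e O X'.xE_iff ie by blast
    show "FM F (xcone X.XC c d c') = xcone X'.XC (FO F c) (FO K d) (FO F c')" if c': "c' \<in> Obj (xC X.XC)" for c'
    proof -
      obtain g where g: "X.L.idem g" "c' = lc g" using c' X.L.Obj_iff by auto
      show ?thesis
        using X.xcone_lc(2)[OF e(1)] X'.xcone_lc(2)[OF ie] X.L.pcone_lc[OF g(1) e(1)] X'.L.pcone_lc[OF fF(3)[OF g(1)] ie]
          F(4)[OF X.L.pcone_valid[OF g(1) e(1)]] hom(2)[of g e] e g O by simp
    qed
  next
    fix c d c' d' f g assume "is_transpose X.XC c d c' d' f g"
    then obtain e s e' where *: "X.L.valid e s e'" "c = lc e" "d = rc e" "c' = lc e'" "d' = rc e'" "f = LM e s e'" "g = RM e' s e"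
      using X.is_transpose_iff[OF X(2)] by blast
    have v': "X.R.valid e' s e" using *(1) X.valid_R by blast
    note i = X.L.valid_idem[OF *(1)]
    show "is_transpose X'.XC (FO F c) (FO K d) (FO F c') (FO K d') (FM F f) (FM K g)"
      unfolding X'.is_transpose_iff[OF X'(2)]
      using fF(4)[OF *(1)] F(4)[OF *(1)] K(4)[OF v'] O[OF i(1)] O[OF i(2)] * by blast
  qed
qed

section \<open>The cross-connection of an inductive groupoid\<close>

text \<open>
  An inductive groupoid and its opposite. Taking opposites twice restores an inductive groupoid only up to the
  values of its evaluation outside the set of chains; results that are used in both directions are therefore
  stated for a pair.
\<close>

locale op_pair = X: ind_gpd X + Y: ind_gpd Y for X Y :: "('e, 'm) indgpd" +
  assumes bY: "igb Y = opb (igb X)" and gY: "igg Y = opg (igg X)"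
    and eY: "Req (igb X) e f \<or> Leq (igb X) e f \<Longrightarrow> eps Y e f = eps X f e"
    and cY: "\<alpha> \<in> Mor (igg X) \<Longrightarrow> \<beta> \<in> Mor (igg X) \<Longrightarrow> h \<in> sandwich (igb X) (igr X \<alpha>) (igd X \<beta>) \<Longrightarrow>
       circ Y \<beta> \<alpha> h = circ X \<alpha> \<beta> h"
    and pY: "pcl Y = pcl X" and mY: "pmul Y A B = pmul X B A"

context ind_gpd
begin

lemma op_pair_opi: "op_pair X (opi X)"
proof -
  interpret op: ind_gpd "opi X" by (rule ind_gpd_opi)
  show ?thesis
  proof
    show "eps (opi X) e f = \<epsilon> f e" if "Req E e f \<or> Leq E e f" for e f using that eps_opi_R eps_opi_L by blast
  qed (simp_all add: circ_opi pcl_opi pmul_opi)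
qed

lemma op_pair_of_opi: "op_pair (opi X) X"
proof -
  interpret op: ind_gpd "opi X" by (rule ind_gpd_opi)
  show ?thesis
  proof
    show "\<epsilon> e f = eps (opi X) f e" if "Req (igb (opi X)) e f \<or> Leq (igb (opi X)) e f" for e f
      using that eps_opi_R[of f e] eps_opi_L[of f e] by (auto simp: Req_sym Leq_sym)
    show "circ X \<beta> \<alpha> h = circ (opi X) \<alpha> \<beta> h" if "\<alpha> \<in> Mor (igg (opi X))" "\<beta> \<in> Mor (igg (opi X))"
      "h \<in> sandwich (igb (opi X)) (igr (opi X) \<alpha>) (igd (opi X) \<beta>)" for \<alpha> \<beta> h
      using that circ_opi[of \<beta> \<alpha> h] by simp
  qed (simp_all add: opb_opb opg_opg pcl_opi pmul_opi)
qed

end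

context op_pair
begin

lemma simps_op [simp]: "Mor (igg Y) = Mor (igg X)" "igd Y = igr X" "igr Y = igd X" "igone Y = igone X"
  "lle (igb Y) = rle (igb X)" "rle (igb Y) = lle (igb X)" "Leq (igb Y) = Req (igb X)" "Req (igb Y) = Leq (igb X)"
  "nle (igb Y) = nle (igb X)" "carr (igb Y) = carr (igb X)" "bmul (igb Y) e f = bmul (igb X) f e"
  "sandwich (igb Y) e f = sandwich (igb X) f e"
  by (simp_all add: bY gY)

lemma pS_op: "pS Y = pS X" and ent_op: "ent Y = ent X"
  by (simp_all add: pS_def ent_def pY fun_eq_iff)

lemma cmp_op: "x \<in> Mor (igg X) \<Longrightarrow> y \<in> Mor (igg X) \<Longrightarrow> igr X y = igd X x \<Longrightarrow> x \<cdot>\<^bsub>igg Y\<^esub> y = y \<cdot>\<^bsub>igg X\<^esub> x"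
  by (simp add: gY)

lemma rcl_op: "rcl X = lcl Y"
  by (simp add: rcl_def lcl_def fun_eq_iff)

lemma qR_op: "qR X = qL Y"
  by (simp add: qR_def qL_def fun_eq_iff)

lemma simR_op: "simR X \<alpha> \<beta> \<longleftrightarrow> simL Y \<alpha> \<beta>"
proof -
  have "\<alpha> \<cdot>\<^bsub>igg X\<^esub> eps X (igr X \<alpha>) (igr X \<beta>) = eps X (igd X \<alpha>) (igd X \<beta>) \<cdot>\<^bsub>igg X\<^esub> \<beta> \<longleftrightarrow>
      \<alpha> \<cdot>\<^bsub>igg Y\<^esub> eps Y (igr Y \<alpha>) (igr Y \<beta>) = eps Y (igd Y \<alpha>) (igd Y \<beta>) \<cdot>\<^bsub>igg Y\<^esub> \<beta>"
    if a: "\<alpha> \<in> Mor (igg X)" "\<beta> \<in> Mor (igg X)" "Req (igb X) (igd X \<alpha>) (igd X \<beta>)" "Req (igb X) (igr X \<alpha>) (igr X \<beta>)"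
  proof -
    note s = X.Req_sym[OF a(3)] X.Req_sym[OF a(4)]
    have "\<alpha> \<cdot>\<^bsub>igg X\<^esub> eps X (igr X \<alpha>) (igr X \<beta>) = eps X (igd X \<alpha>) (igd X \<beta>) \<cdot>\<^bsub>igg X\<^esub> \<beta> \<longleftrightarrow>
      minv (igg X) (eps X (igd X \<alpha>) (igd X \<beta>)) \<cdot>\<^bsub>igg X\<^esub> \<alpha> = \<beta> \<cdot>\<^bsub>igg X\<^esub> minv (igg X) (eps X (igr X \<alpha>) (igr X \<beta>))"
      by (rule X.inv_swap) (use a in simp_all)
    then show ?thesis using a s by (simp add: eY cmp_op X.eps_minv_R)
  qed
  then show ?thesis unfolding simR_def simL_def by auto
qed

lemma clsR_op: "clsR X = clsL Y"
  by (simp add: clsR_def clsL_def fun_eq_iff simR_op)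

lemma lepi_op: assumes a: "\<alpha> \<in> Mor (igg X)" shows "lepi X e \<alpha> = repi Y e \<alpha>"
proof -
  have "eps Y v (igr X \<alpha>) \<cdot>\<^bsub>igg Y\<^esub> \<alpha> = \<alpha> \<cdot>\<^bsub>igg X\<^esub> eps X (igr X \<alpha>) v" if "Leq (igb X) v (igr X \<alpha>)" for v
    using that a X.Leq_sym[OF that] by (simp add: eY cmp_op)
  then show ?thesis unfolding lepi_def repi_def qR_op clsR_op by (simp cong: conj_cong)
qed

lemma rmor_op: "\<alpha> \<in> Mor (igg X) \<Longrightarrow> rmor X e \<alpha> f = lmor Y e \<alpha> f"
  by (simp add: rmor_def lmor_def lepi_op rcl_op)

lemma rrep_op: "rrep X = lrep Y"
proof (intro ext)
  fix e \<alpha> f m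
  show "rrep X e \<alpha> f m = lrep Y e \<alpha> f m"
    unfolding rrep_def lrep_def using rmor_op[of \<alpha> e f] by auto
qed

lemma lrep_Mor: "lrep Y e \<alpha> f m \<Longrightarrow> \<alpha> \<in> Mor (igg X)"
  by (simp add: lrep_def)

text \<open>
  Every constituent of \<open>R\<^sub>G\<close> is defined like that of \<open>L\<^sub>G\<close> with the two
  sides interchanged.
\<close>

theorem RG_op: "RG X = LG Y"
proof (rule scat.equality)
  show "Obj (RG X) = Obj (LG Y)" "Mor (RG X) = Mor (LG Y)" "Dom (RG X) = Dom (LG Y)" "Cod (RG X) = Cod (LG Y)"
    by (simp_all add: RG_def LG_def Let_def rrep_op rcl_op)
  show "Idn (RG X) = Idn (LG Y)"
  proof -
    have "(THE m. \<exists>e\<in>A. m = rmor X e (igone X e) e) = (THE m. \<exists>e\<in>A. m = lmor Y e (igone X e) e)"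
      if A: "A \<in> lcl Y ` carr (igb X)" for A
    proof -
      have "igone X e \<in> Mor (igg X)" if "e \<in> A" for e
        using A that X.Req_carr by (auto simp: lcl_def)
      then have "(\<exists>e\<in>A. m = rmor X e (igone X e) e) \<longleftrightarrow> (\<exists>e\<in>A. m = lmor Y e (igone X e) e)" for m
        using rmor_op by auto
      then show ?thesis by simp
    qed
    then show ?thesis by (simp add: RG_def LG_def Let_def rcl_op cong: restrict_cong)
  qed
  show "Cmp (RG X) = Cmp (LG Y)"
  proof -
    have "rmor X e (circ X \<beta> \<alpha> h) g = lmor Y e (circ Y \<alpha> \<beta> h) g"
      if "\<alpha> \<in> Mor (igg X)" "\<beta> \<in> Mor (igg X)" "h \<in> sandwich (igb X) (igr X \<beta>) (igd X \<alpha>)" for e \<alpha> \<beta> h g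
      using cY[OF that(2,1,3)] rmor_op[OF X.circ_Mor(1)[OF that(2,1,3)]] by simp
    then have "(\<exists>e1 \<alpha> g1 e2 \<beta> g2 h. lrep Y e1 \<alpha> g1 m \<and> lrep Y e2 \<beta> g2 n \<and>
          h \<in> sandwich (igb X) (igr X \<beta>) (igd X \<alpha>) \<and> k = rmor X e1 (circ X \<beta> \<alpha> h) g2) \<longleftrightarrow>
        (\<exists>e1 \<alpha> g1 e2 \<beta> g2 h. lrep Y e1 \<alpha> g1 m \<and> lrep Y e2 \<beta> g2 n \<and>
          h \<in> sandwich (igb X) (igr X \<beta>) (igd X \<alpha>) \<and> k = lmor Y e1 (circ Y \<alpha> \<beta> h) g2)" for m n k
      using lrep_Mor by (simp cong: conj_cong)
    then show ?thesis by (simp add: RG_def LG_def Let_def rrep_op rcl_op)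
  qed
  show "Incl (RG X) = Incl (LG Y)"
  proof -
    have "rmor X e (igone X e) f = lmor Y e (igone X e) f" if "rle (igb X) e f" for e f
      using rmor_op X.rle_carr[OF that] by simp
    then have "(\<exists>e f. m = rmor X e (igone X e) f \<and> rle (igb X) e f) \<longleftrightarrow>
        (\<exists>e f. m = lmor Y e (igone X e) f \<and> rle (igb X) e f)" for m by metis
    then show ?thesis by (simp add: RG_def LG_def Let_def)
  qed
qed simp

lemma vrep_op: "Y.vrep e \<alpha> f \<longleftrightarrow> X.vrep f \<alpha> e"
  by (auto simp: X.vrep_def Y.vrep_def)

lemma R_semigroup_category: "semigroup_category (pS X) (\<lambda>A B. pmul X B A) (RG X) (plc Y) (pLM Y)"
proof -
  have "pmul Y = (\<lambda>A B. pmul X B A)" by (intro ext) (rule mY)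
  then show ?thesis using Y.LG_semigroup_category by (simp add: RG_op pS_op)
qed

end

sublocale ind_gpd \<subseteq> L: semigroup_category "pS X" "pmul X" "LG X" "plc X" "pLM X"
  by (rule LG_semigroup_category)

context ind_gpd
begin

lemma idem_ent: "e \<in> carr E \<Longrightarrow> L.idem (ent X e)"
  unfolding L.idem_def using ent_in ent_le_l lle_refl by blast

lemma vrep_L: "vrep e \<alpha> f \<Longrightarrow> L.valid (ent X e) (pcl X \<alpha>) (ent X f)"
  unfolding L.valid_def by (intro conjI; rule vrep_valid; assumption)

lemma L_vrep:
  assumes "L.valid A s B"
  obtains e \<alpha> f where "A = ent X e" "s = pcl X \<alpha>" "B = ent X f" "vrep e \<alpha> f"
  using assms valid_rep unfolding L.valid_def by metis

text \<open>
  The component \<open>[g,1\<^sub>g \<circ> 1\<^sub>e,e\<rangle>\<close> of \<open>r\<^sup>e\<close> is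
  translation by the product of the idempotents of \<open>g\<close> and \<open>e\<close>.
\<close>

lemma rcone_pcone: assumes e: "e \<in> carr E" shows "rcone X e = L.pcone (ent X e)"
proof (rule extensionalityI[of _ "Obj (LG X)"])
  show "rcone X e \<in> extensional (Obj (LG X))" "L.pcone (ent X e) \<in> extensional (Obj (LG X))"
    by (simp_all add: rcone_def L.pcone_def)
  fix A assume A: "A \<in> Obj (LG X)"
  then obtain g where g: "g \<in> carr E" "A = lcl X g" unfolding LG_Obj by blast
  have eq: "lmor X g' (circ X (igone X g') (igone X e) h) e = L.pcone (ent X e) A"
    if g': "g' \<in> A" and h: "h \<in> sandwich E g' e" for g' h
  proof -
    have L: "Leq E g' g" using g' g by (simp add: lcl_def)
    have c: "g' \<in> carr E" using Leq_carr[OF L] by simp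
    note v = vrep_Idn[OF c lle_refl[OF c]] and w = vrep_Idn[OF e lle_refl[OF e]]
    have h': "h \<in> sandwich E (rg (Idn G g')) (dm (Idn G e))" using h c e by simp
    have m: "Idn G g' \<in> Mor G" "Idn G e \<in> Mor G" using c e by simp_all
    have "lcl X g' = A" using lcl_eq[OF g(1)] L g(2) by simp
    then have "L.pcone (ent X e) A = pLM X (ent X g') (pmul X (ent X g') (ent X e)) (ent X e)"
      using L.pcone_lc[OF idem_ent[OF c] idem_ent[OF e]] plc_ent[OF c] by simp
    also have "pmul X (ent X g') (ent X e) = pcl X (circ X (Idn G g') (Idn G e) h)"
      using pmul_pcl[OF m h'] by (simp add: ent_def)
    finally show ?thesis using pLM_lmor[OF vrep_circ[OF v w h']] by simp
  qed
  obtain h where h: "h \<in> sandwich E g e" using sandwich_ex[OF g(1) e] by blast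
  have gA: "g \<in> A" using g Leq_refl by (simp add: lcl_def)
  have "rcone X e A = (THE m. \<exists>g\<in>A. \<exists>h\<in>sandwich E g e. m = lmor X g (circ X (igone X g) (igone X e) h) e)"
    using A by (simp add: rcone_def)
  also have "\<dots> = L.pcone (ent X e) A"
    by (rule the_equality) (use eq gA h in metis)+
  finally show "rcone X e A = L.pcone (ent X e) A" .
qed

lemma Req_ent: "Req E e f \<Longrightarrow> pmul X (ent X e) (ent X f) = ent X f \<and> pmul X (ent X f) (ent X e) = ent X e"
  using ent_le_r Req_carr ReqD by simp

end

context op_pair
begin

text \<open>
  The definition of \<open>\<Gamma>\<^sub>G\<close> refers to representatives of \<open>\<R>\<close>-classes
  and of morphisms. By \<open>H_pcone_R\<close> and \<open>nt_R\<close> its values do not depend on them.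
\<close>

theorem cross_semigroup: "cross_semigroup (pS X) (pmul X) (LG X) (plc X) (pLM X) (RG X) (plc Y) (pLM Y) (GammaG X)"
proof (intro cross_semigroup.intro X.LG_semigroup_category R_semigroup_category cross_semigroup_axioms.intro)
  let ?H = "\<lambda>e. H_functor (LG X) (rcone X e)"
  show "FO (GammaG X) \<in> extensional (Obj (RG X))" "FM (GammaG X) \<in> extensional (Mor (RG X))"
    by (simp_all add: GammaG_def Let_def)
  show "FO (GammaG X) (plc Y A) = H_functor (LG X) (X.L.pcone A)" if A: "A \<in> pS X" "pmul X A A = A" for A
  proof -
    obtain e where e: "e \<in> carr (igb X)" "A = ent X e" using X.idempotent_ent[OF A] .
    have pl: "plc Y A = lcl Y e" using Y.plc_ent[of e] e ent_op by simp
    have O: "lcl Y e \<in> Obj (RG X)" unfolding RG_op Y.LG_Obj using e by simp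
    have eq: "?H e' = H_functor (LG X) (X.L.pcone A)" if "e' \<in> lcl Y e" for e'
    proof -
      have R: "Req (igb X) e' e" using that by (simp add: lcl_def)
      have c: "e' \<in> carr (igb X)" using X.Req_carr[OF R] by simp
      show ?thesis
        unfolding X.rcone_pcone[OF c] e(2)
        using X.L.H_pcone_R[OF X.idem_ent[OF c] X.idem_ent[OF e(1)]] X.Req_ent[OF R] by blast
    qed
    have "FO (GammaG X) (plc Y A) = (THE S. \<exists>e'\<in>lcl Y e. S = ?H e')"
      using O unfolding pl by (simp add: GammaG_def Let_def)
    also have "\<dots> = H_functor (LG X) (X.L.pcone A)"
    proof (rule the_equality)
      have "e \<in> lcl Y e" using X.Req_refl[OF e(1)] by (simp add: lcl_def)
      then show "\<exists>e'\<in>lcl Y e. H_functor (LG X) (X.L.pcone A) = ?H e'" using eq by metis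
    qed (use eq in metis)
    finally show ?thesis .
  qed
  show "FM (GammaG X) (pLM Y A s B) = nt (LG X) (X.L.pcone A) (X.L.pcone B) (pLM X B s A)"
    if v: "X.L.valid B s A" for A s B
  proof -
    obtain f \<alpha> e where r: "B = ent X f" "s = pcl X \<alpha>" "A = ent X e" "X.vrep f \<alpha> e" using X.L_vrep[OF v] .
    have vY: "Y.vrep e \<alpha> f" using r(4) vrep_op by simp
    note vd = X.vrepD[OF r(4)]
    define m where "m = lmor Y e \<alpha> f"
    have m: "pLM Y A s B = m" unfolding m_def using Y.pLM_lmor[OF vY] r by (simp add: ent_op pY)
    have mM: "m \<in> Mor (RG X)" unfolding RG_op Y.LG_Mor m_def using vY by blast
    let ?t = "\<lambda>e \<alpha> f. (?H e, ?H f, \<lambda>A\<in>Obj (LG X).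
                     (FO (?H e) A, FO (?H f) A,
                      \<lambda>\<sigma>\<in>FO (?H e) A.
                        inv_into (FO (?H f) A) (eta (LG X) (rcone X f) A)
                          (lmor X f \<alpha> e \<cdot>\<^bsub>LG X\<^esub> eta (LG X) (rcone X e) A \<sigma>)))"
    have eq: "?t e1 \<alpha>1 f1 = nt (LG X) (X.L.pcone A) (X.L.pcone B) (pLM X B s A)"
      if rr: "rrep X e1 \<alpha>1 f1 m" for e1 \<alpha>1 f1
    proof -
      have lr: "Y.vrep e1 \<alpha>1 f1 \<and> m = lmor Y e1 \<alpha>1 f1" using Y.lrep_vrep rr unfolding rrep_op by blast
      have v1: "X.vrep f1 \<alpha>1 e1" using lr vrep_op by blast
      note d1 = X.vrepD[OF v1]
      have E: "Req (igb X) e1 e" "Req (igb X) f1 f" "pcl X \<alpha>1 = pmul X (pcl X \<alpha>) (ent X e1)"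
        using Y.lmor_eq[of e1 \<alpha>1 f1 e \<alpha> f] lr vY unfolding m_def by (auto simp: pY mY ent_op)
      note i = X.idem_ent[OF d1(2)] X.idem_ent[OF vd(2)] X.idem_ent[OF d1(1)] X.idem_ent[OF vd(1)]
      note c = X.L.pcone_cone(1)[OF i(1)] X.L.pcone_cone(1)[OF i(3)]
      have h: "lmor X f1 \<alpha>1 e1 \<in> hom (LG X) (plc X (ent X f1)) (plc X (ent X e1))"
        using X.L.LM_hom[OF X.vrep_L[OF v1]] X.pLM_lmor[OF v1] by simp
      have "?t e1 \<alpha>1 f1 = nt (LG X) (X.L.pcone (ent X e1)) (X.L.pcone (ent X f1)) (lmor X f1 \<alpha>1 e1)"
        unfolding X.rcone_pcone[OF d1(1)] X.rcone_pcone[OF d1(2)] by (rule X.L.N.nt_alt[OF c h])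
      also have "\<dots> = nt (LG X) (X.L.pcone (ent X e)) (X.L.pcone (ent X f)) (pLM X (ent X f) (pcl X \<alpha>) (ent X e))"
        unfolding X.pLM_lmor[OF v1, symmetric]
        using X.L.nt_R[OF i(1,2) _ _ i(3,4) _ _ X.vrep_L[OF v1] X.vrep_L[OF r(4)] E(3)]
          X.Req_ent[OF E(1)] X.Req_ent[OF E(2)] by simp
      finally show ?thesis using r by simp
    qed
    obtain \<alpha>1 where "rrep X e \<alpha>1 f m" using Y.vrep_lrep[OF vY] unfolding rrep_op m_def by blast
    then have "\<exists>e \<alpha> f. rrep X e \<alpha> f m \<and> nt (LG X) (X.L.pcone A) (X.L.pcone B) (pLM X B s A) = ?t e \<alpha> f"
      using eq[symmetric] by (intro exI conjI)
    moreover have "t = nt (LG X) (X.L.pcone A) (X.L.pcone B) (pLM X B s A)"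
      if ex: "\<exists>e \<alpha> f. rrep X e \<alpha> f m \<and> t = ?t e \<alpha> f" for t
    proof -
      obtain e1 \<alpha>1 f1 where t: "rrep X e1 \<alpha>1 f1 m" "t = ?t e1 \<alpha>1 f1" using ex by (elim exE conjE)
      show ?thesis unfolding t(2) by (rule eq[OF t(1)])
    qed
    ultimately have "(THE t. \<exists>e \<alpha> f. rrep X e \<alpha> f m \<and> t = ?t e \<alpha> f) = nt (LG X) (X.L.pcone A) (X.L.pcone B) (pLM X B s A)"
      by (rule the_equality)
    then show ?thesis unfolding m using mM by (simp add: GammaG_def Let_def)
  qed
qed

end

theorem (in ind_gpd) cross_connection_CG: "cross_connection (CG X)"
proof -
  interpret op_pair X "opi X" by (rule op_pair_opi)
  show ?thesis using cross_semigroup.cross_connection[OF cross_semigroup] by (simp add: CG_def)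
qed

text \<open>
  The second statement, which provides the dual cross-connection, is the first one for the opposite groupoid.
\<close>

lemma (in ind_gpd) cross_semigroup_dual:
  "cross_semigroup (pS X) (pmul X) (LG X) (plc X) (pLM X) (RG X) (plc (opi X)) (pLM (opi X)) (GammaG X)"
  "cross_semigroup (pS X) (\<lambda>A B. pmul X B A) (RG X) (plc (opi X)) (pLM (opi X)) (LG X) (plc X) (pLM X) (GammaG (opi X))"
proof -
  interpret P: op_pair X "opi X" by (rule op_pair_opi)
  interpret Q: op_pair "opi X" X by (rule op_pair_of_opi)
  show "cross_semigroup (pS X) (pmul X) (LG X) (plc X) (pLM X) (RG X) (plc (opi X)) (pLM (opi X)) (GammaG X)"
    by (rule P.cross_semigroup)
  have "pmul (opi X) = (\<lambda>A B. pmul X B A)" by (intro ext) (rule P.mY)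
  then show "cross_semigroup (pS X) (\<lambda>A B. pmul X B A) (RG X) (plc (opi X)) (pLM (opi X)) (LG X) (plc X) (pLM X) (GammaG (opi X))"
    using Q.cross_semigroup by (simp only: P.RG_op Q.RG_op P.pS_op)
qed

section \<open>Functoriality\<close>

text \<open>An inductive functor, with the condition on chains reduced to chains of two elements.\<close>

locale ind_functor = X: ind_gpd X + Y: ind_gpd Y for X :: "('e, 'm) indgpd" and Y :: "('f, 'n) indgpd" +
  fixes F :: "('e, 'm, 'f, 'n) func"
  assumes F_functor: "is_functor (igg X) (igg Y) F"
    and F_order: "order_preserving (igg X) (igg Y) F"
    and F_regular: "regular_bimorphism (igb X) (igb Y) (FO F)"
    and F_eps: "Req (igb X) e f \<or> Leq (igb X) e f \<Longrightarrow> FM F (eps X e f) = eps Y (FO F e) (FO F f)"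

lemma ind_functor_of_inductive:
  assumes "inductive_groupoid X" "inductive_groupoid Y" "inductive_functor X Y F"
  shows "ind_functor X Y F"
proof -
  interpret X: ind_gpd X by (rule ind_gpd_of_inductive[OF assms(1)])
  interpret Y: ind_gpd Y by (rule ind_gpd_of_inductive[OF assms(2)])
  note f = inductive_functorD[OF assms(3)]
  show ?thesis
  proof
    show "FM F (eps X e g) = eps Y (FO F e) (FO F g)" if "Req (igb X) e g \<or> Leq (igb X) e g" for e g
      using f(5)[OF X.is_path_pair[OF that]] by (simp add: eps_def)
  qed (fact f)+
qed

text \<open>The homomorphism of semigroups induced by \<open>F\<close>.\<close>

definition pmap :: "('f, 'n) indgpd \<Rightarrow> ('e, 'm, 'f, 'n) func \<Rightarrow> 'm set \<Rightarrow> 'n set" where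
  "pmap Y F A = pcl Y (FM F (SOME \<alpha>. \<alpha> \<in> A))"

context ind_functor
begin

lemma F_bi: "bimorphism (igb X) (igb Y) (FO F)"
  using F_regular by (simp add: regular_bimorphism_def)

lemmas F_rel = bimorphism_rel[OF F_bi]

lemma F_mul: "rle (igb X) e f \<Longrightarrow> FO F (e \<odot>\<^bsub>igb X\<^esub> f) = FO F e \<odot>\<^bsub>igb Y\<^esub> FO F f"
  "lle (igb X) e f \<Longrightarrow> FO F (f \<odot>\<^bsub>igb X\<^esub> e) = FO F f \<odot>\<^bsub>igb Y\<^esub> FO F e"
proof -
  have b: "bdom (igb X) = {(e, f). lle (igb X) e f \<or> rle (igb X) e f \<or> lle (igb X) f e \<or> rle (igb X) f e}"
    using X.biordered unfolding biordered_set_def by (elim conjE)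
  show "FO F (e \<odot>\<^bsub>igb X\<^esub> f) = FO F e \<odot>\<^bsub>igb Y\<^esub> FO F f" if "rle (igb X) e f"
    by (rule bimorphismD(3)[OF F_bi]) (use that in \<open>simp add: b\<close>)
  show "FO F (f \<odot>\<^bsub>igb X\<^esub> e) = FO F f \<odot>\<^bsub>igb Y\<^esub> FO F e" if "lle (igb X) e f"
    by (rule bimorphismD(3)[OF F_bi]) (use that in \<open>simp add: b\<close>)
qed

lemma F_Mor [simp]: "\<alpha> \<in> Mor (igg X) \<Longrightarrow> FM F \<alpha> \<in> Mor (igg Y)"
  "\<alpha> \<in> Mor (igg X) \<Longrightarrow> igd Y (FM F \<alpha>) = FO F (igd X \<alpha>)"
  "\<alpha> \<in> Mor (igg X) \<Longrightarrow> igr Y (FM F \<alpha>) = FO F (igr X \<alpha>)"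
  using func_hom[OF F_functor Mor_hom] by (auto simp: hom_def)

lemma F_cmp: "x \<in> Mor (igg X) \<Longrightarrow> y \<in> Mor (igg X) \<Longrightarrow> igr X x = igd X y \<Longrightarrow>
    FM F (x \<cdot>\<^bsub>igg X\<^esub> y) = FM F x \<cdot>\<^bsub>igg Y\<^esub> FM F y"
  using func_cmp[OF F_functor, of x "igd X x" "igr X x" y "igr X y"] by (simp add: hom_def)

lemma F_carr: "e \<in> carr (igb X) \<Longrightarrow> FO F e \<in> carr (igb Y)"
  by (rule bimorphismD(1)[OF F_bi])

lemma F_Idn: "e \<in> carr (igb X) \<Longrightarrow> FM F (igone X e) = igone Y (FO F e)"
  using func_id[OF F_functor, of e] by simp

lemma F_le: "(u, x) \<in> ole (igg X) \<Longrightarrow> (FM F u, FM F x) \<in> ole (igg Y)"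
  using F_order unfolding order_preserving_def by blast

lemma F_simP: assumes "simP X \<alpha> \<beta>" shows "simP Y (FM F \<alpha>) (FM F \<beta>)"
proof (rule Y.simPI)
  note s = X.simPD[OF assms]
  show "FM F \<alpha> \<in> Mor (igg Y)" "FM F \<beta> \<in> Mor (igg Y)" using s by simp_all
  show "Req (igb Y) (igd Y (FM F \<alpha>)) (igd Y (FM F \<beta>))" "Leq (igb Y) (igr Y (FM F \<alpha>)) (igr Y (FM F \<beta>))"
    using s F_rel by simp_all
  show "FM F \<alpha> \<cdot>\<^bsub>igg Y\<^esub> eps Y (igr Y (FM F \<alpha>)) (igr Y (FM F \<beta>)) = eps Y (igd Y (FM F \<alpha>)) (igd Y (FM F \<beta>)) \<cdot>\<^bsub>igg Y\<^esub> FM F \<beta>"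
    using arg_cong[OF s(5), of "FM F"] s(1-4) F_cmp[of \<alpha> "eps X (igr X \<alpha>) (igr X \<beta>)"]
      F_cmp[of "eps X (igd X \<alpha>) (igd X \<beta>)" \<beta>] F_eps by simp
qed

text \<open>
  Regularity of the bimorphism takes care of the sandwich element, order preservation of the restrictions, and
  compatibility with evaluations of the rest.
\<close>

lemma F_circ:
  assumes a: "\<alpha> \<in> Mor (igg X)" and b: "\<beta> \<in> Mor (igg X)" and h: "h \<in> sandwich (igb X) (igr X \<alpha>) (igd X \<beta>)"
  shows "FO F h \<in> sandwich (igb Y) (igr Y (FM F \<alpha>)) (igd Y (FM F \<beta>))"
    "FM F (circ X \<alpha> \<beta> h) = circ Y (FM F \<alpha>) (FM F \<beta>) (FO F h)"
proof -
  have "FO F ` sandwich (igb X) (igr X \<alpha>) (igd X \<beta>) \<subseteq> sandwich (igb Y) (FO F (igr X \<alpha>)) (FO F (igd X \<beta>))"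
    using F_regular a b unfolding regular_bimorphism_def by simp
  then show h': "FO F h \<in> sandwich (igb Y) (igr Y (FM F \<alpha>)) (igd Y (FM F \<beta>))" using h a b by auto
  note s = X.sandwichD[OF h]
  obtain c d where *: "(c, \<alpha>) \<in> ole (igg X)" "(d, \<beta>) \<in> ole (igg X)" "igr X c = igr X \<alpha> \<odot>\<^bsub>igb X\<^esub> h"
    "igd X d = h \<odot>\<^bsub>igb X\<^esub> igd X \<beta>" "c \<in> Mor (igg X)" "d \<in> Mor (igg X)"
    "Leq (igb X) (igr X \<alpha> \<odot>\<^bsub>igb X\<^esub> h) h" "Req (igb X) h (h \<odot>\<^bsub>igb X\<^esub> igd X \<beta>)"
    "circ X \<alpha> \<beta> h = c \<cdot>\<^bsub>igg X\<^esub> (eps X (igr X \<alpha> \<odot>\<^bsub>igb X\<^esub> h) h \<cdot>\<^bsub>igg X\<^esub> (eps X h (h \<odot>\<^bsub>igb X\<^esub> igd X \<beta>) \<cdot>\<^bsub>igg X\<^esub> d))"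
    using X.circ_parts[OF a b h] .
  have m: "FO F (igr X \<alpha> \<odot>\<^bsub>igb X\<^esub> h) = FO F (igr X \<alpha>) \<odot>\<^bsub>igb Y\<^esub> FO F h"
    "FO F (h \<odot>\<^bsub>igb X\<^esub> igd X \<beta>) = FO F h \<odot>\<^bsub>igb Y\<^esub> FO F (igd X \<beta>)"
    using F_mul(2)[OF s(1)] F_mul(1)[OF s(2)] .
  have "circ Y (FM F \<alpha>) (FM F \<beta>) (FO F h) = FM F c \<cdot>\<^bsub>igg Y\<^esub>
      (eps Y (igr Y (FM F \<alpha>) \<odot>\<^bsub>igb Y\<^esub> FO F h) (FO F h) \<cdot>\<^bsub>igg Y\<^esub> (eps Y (FO F h) (FO F h \<odot>\<^bsub>igb Y\<^esub> igd Y (FM F \<beta>)) \<cdot>\<^bsub>igg Y\<^esub> FM F d))"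
    by (rule Y.circ_eqI(1)[OF _ _ h' F_le[OF *(1)] F_le[OF *(2)]]) (use a b * m in simp_all)
  also have "\<dots> = FM F (circ X \<alpha> \<beta> h)"
    unfolding *(9) using * a b m by (simp add: F_cmp F_eps)
  finally show "FM F (circ X \<alpha> \<beta> h) = circ Y (FM F \<alpha>) (FM F \<beta>) (FO F h)" by simp
qed

lemma pmap_pcl: assumes "\<alpha> \<in> Mor (igg X)" shows "pmap Y F (pcl X \<alpha>) = pcl Y (FM F \<alpha>)"
proof -
  have "\<alpha> \<in> pcl X \<alpha>" using X.simP_refl[OF assms] by (simp add: pcl_def)
  then have "(SOME \<beta>. \<beta> \<in> pcl X \<alpha>) \<in> pcl X \<alpha>" by (rule someI)
  then have "simP X \<alpha> (SOME \<beta>. \<beta> \<in> pcl X \<alpha>)" by (simp add: pcl_def)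
  then show ?thesis unfolding pmap_def using Y.pclI[OF F_simP] by metis
qed

lemma pmap_ent: "e \<in> carr (igb X) \<Longrightarrow> pmap Y F (ent X e) = ent Y (FO F e)"
  using pmap_pcl[of "igone X e"] F_Idn by (simp add: ent_def)

lemma pmap_in: "A \<in> pS X \<Longrightarrow> pmap Y F A \<in> pS Y"
  using pmap_pcl unfolding pS_def by auto

lemma pmap_mul: assumes "A \<in> pS X" "B \<in> pS X" shows "pmap Y F (pmul X A B) = pmul Y (pmap Y F A) (pmap Y F B)"
proof -
  obtain \<alpha> \<beta> where *: "\<alpha> \<in> Mor (igg X)" "\<beta> \<in> Mor (igg X)" "A = pcl X \<alpha>" "B = pcl X \<beta>" using assms by (auto simp: pS_def)
  obtain h where h: "h \<in> sandwich (igb X) (igr X \<alpha>) (igd X \<beta>)" using X.sandwich_ex[of "igr X \<alpha>" "igd X \<beta>"] * by auto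
  show ?thesis
    using X.pmul_pcl[OF *(1,2) h] Y.pmul_pcl[OF _ _ F_circ(1)[OF *(1,2) h]] F_circ(2)[OF *(1,2) h]
      pmap_pcl[OF X.circ_Mor(1)[OF *(1,2) h]] pmap_pcl * by simp
qed

lemma F_vrep: "X.vrep e \<alpha> f \<Longrightarrow> Y.vrep (FO F e) (FM F \<alpha>) (FO F f)"
  using X.vrepD[of e \<alpha> f] F_carr F_rel unfolding Y.vrep_def by simp

lemma F1_Obj: assumes e: "e \<in> carr (igb X)" shows "FO (F1 X Y F) (lcl X e) = lcl Y (FO F e)"
proof -
  have "FO (F1 X Y F) (lcl X e) = (THE B. \<exists>e'\<in>lcl X e. B = lcl Y (FO F e'))"
    using e by (simp add: F1_def X.LG_Obj)
  also have "\<dots> = lcl Y (FO F e)"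
  proof (rule the_equality)
    show "\<exists>e'\<in>lcl X e. lcl Y (FO F e) = lcl Y (FO F e')" using X.Leq_refl[OF e] by (auto simp: lcl_def)
    fix B assume "\<exists>e'\<in>lcl X e. B = lcl Y (FO F e')"
    then obtain e' where e': "Leq (igb X) e' e" "B = lcl Y (FO F e')" by (auto simp: lcl_def)
    show "B = lcl Y (FO F e)" using Y.lcl_eq[OF F_carr[OF e]] F_rel(3)[OF e'(1)] e'(2) by blast
  qed
  finally show ?thesis .
qed

lemma F1_Mor: assumes v: "X.vrep e \<alpha> f" shows "FM (F1 X Y F) (lmor X e \<alpha> f) = lmor Y (FO F e) (FM F \<alpha>) (FO F f)"
proof -
  let ?m = "lmor X e \<alpha> f"
  have m: "?m \<in> Mor (LG X)" unfolding X.LG_Mor using v by blast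
  have eq: "lmor Y (FO F e1) (FM F \<alpha>1) (FO F f1) = lmor Y (FO F e) (FM F \<alpha>) (FO F f)"
    if l: "lrep X e1 \<alpha>1 f1 ?m" for e1 \<alpha>1 f1
  proof -
    have v1: "X.vrep e1 \<alpha>1 f1" "lmor X e1 \<alpha>1 f1 = ?m" using X.lrep_vrep[OF l] by auto
    have *: "Leq (igb X) e1 e" "Leq (igb X) f1 f" "pcl X \<alpha>1 = pmul X (ent X e1) (pcl X \<alpha>)"
      using X.lmor_eq[OF v1(1) v] v1(2) by auto
    note d1 = X.vrepD[OF v1(1)] and d = X.vrepD[OF v]
    have "pcl Y (FM F \<alpha>1) = pmul Y (ent Y (FO F e1)) (pcl Y (FM F \<alpha>))"
      using arg_cong[OF *(3), of "pmap Y F"] pmap_mul[OF X.ent_in[OF d1(1)] X.pcl_in[OF d(3)]]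
        pmap_pcl[OF d1(3)] pmap_pcl[OF d(3)] pmap_ent[OF d1(1)] by simp
    then show ?thesis using Y.lmor_eq[OF F_vrep[OF v1(1)] F_vrep[OF v]] F_rel(3) * by blast
  qed
  obtain \<alpha>1 where "lrep X e \<alpha>1 f ?m" using X.vrep_lrep[OF v] by blast
  then have "(THE n. \<exists>e \<alpha> f. lrep X e \<alpha> f ?m \<and> n = lmor Y (FO F e) (FM F \<alpha>) (FO F f)) = lmor Y (FO F e) (FM F \<alpha>) (FO F f)"
    by (intro the_equality) (use eq in metis)+
  then show ?thesis using m by (simp add: F1_def)
qed

lemma F1_ext: "FO (F1 X Y F) \<in> extensional (Obj (LG X))" "FM (F1 X Y F) \<in> extensional (Mor (LG X))"
  by (simp_all add: F1_def)

lemma F1_plc: "A \<in> pS X \<Longrightarrow> pmul X A A = A \<Longrightarrow> FO (F1 X Y F) (plc X A) = plc Y (pmap Y F A)"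
  using X.idempotent_ent[of A] F1_Obj X.plc_ent Y.plc_ent F_carr pmap_ent by metis

lemma F1_pLM: assumes "X.L.valid A s B" shows "FM (F1 X Y F) (pLM X A s B) = pLM Y (pmap Y F A) (pmap Y F s) (pmap Y F B)"
proof -
  obtain e \<alpha> f where r: "A = ent X e" "s = pcl X \<alpha>" "B = ent X f" "X.vrep e \<alpha> f" using X.L_vrep[OF assms] .
  note d = X.vrepD[OF r(4)]
  show ?thesis
    using F1_Mor[OF r(4)] X.pLM_lmor[OF r(4)] Y.pLM_lmor[OF F_vrep[OF r(4)]] pmap_pcl[OF d(3)] pmap_ent[OF d(1)] pmap_ent[OF d(2)] r
    by simp
qed

text \<open>
  An inductive functor is also one between the opposite groupoids. This transfers all statements on
  \<open>F\<^sub>1\<close> to \<open>F\<^sub>2\<close>.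
\<close>

lemma ind_functor_opi: "ind_functor (opi X) (opi Y) F"
proof -
  interpret oX: ind_gpd "opi X" by (rule X.ind_gpd_opi)
  interpret oY: ind_gpd "opi Y" by (rule Y.ind_gpd_opi)
  show ?thesis
  proof
    show "is_functor (igg (opi X)) (igg (opi Y)) F"
    proof (rule is_functorI[OF oX.cat oY.cat])
      show "FO F \<in> extensional (Obj (igg (opi X)))" "FM F \<in> extensional (Mor (igg (opi X)))"
        using func_ext[OF F_functor] by simp_all
      show "FO F a \<in> Obj (igg (opi Y))" if "a \<in> Obj (igg (opi X))" for a using that F_carr by simp
      show "FM F f \<in> hom (igg (opi Y)) (FO F a) (FO F b)" if "f \<in> hom (igg (opi X)) a b" for a b f
        using that by (auto simp: hom_def)
      show "FM F (Idn (igg (opi X)) a) = Idn (igg (opi Y)) (FO F a)" if "a \<in> Obj (igg (opi X))" for a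
        using that F_Idn by simp
      show "FM F (f \<cdot>\<^bsub>igg (opi X)\<^esub> g) = FM F f \<cdot>\<^bsub>igg (opi Y)\<^esub> FM F g"
        if "f \<in> hom (igg (opi X)) a b" "g \<in> hom (igg (opi X)) b c" for a b c f g
        using that F_cmp by (auto simp: hom_def)
    qed
    show "order_preserving (igg (opi X)) (igg (opi Y)) F" using F_order by (simp add: order_preserving_def)
    show "regular_bimorphism (igb (opi X)) (igb (opi Y)) (FO F)"
      using F_regular unfolding regular_bimorphism_def bimorphism_def by auto
    show "FM F (eps (opi X) e f) = eps (opi Y) (FO F e) (FO F f)"
      if "Req (igb (opi X)) e f \<or> Leq (igb (opi X)) e f" for e f
    proof -
      have r: "Req (igb X) e f \<or> Leq (igb X) e f" using that by auto
      then have s: "Req (igb X) f e \<or> Leq (igb X) f e" "Req (igb Y) (FO F e) (FO F f) \<or> Leq (igb Y) (FO F e) (FO F f)"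
        using X.Req_sym X.Leq_sym F_rel by blast+
      show ?thesis
        using op_pair.eY[OF X.op_pair_opi r] op_pair.eY[OF Y.op_pair_opi s(2)] F_eps[OF s(1)] by simp
    qed
  qed
qed

lemma F2_F1: "F2 X Y F = F1 (opi X) (opi Y) F"
proof -
  interpret P: op_pair X "opi X" by (rule X.op_pair_opi)
  interpret Q: op_pair Y "opi Y" by (rule Y.op_pair_opi)
  have "(\<exists>e \<alpha> f. lrep (opi X) e \<alpha> f m \<and> n = rmor Y (FO F e) (FM F \<alpha>) (FO F f)) \<longleftrightarrow>
      (\<exists>e \<alpha> f. lrep (opi X) e \<alpha> f m \<and> n = lmor (opi Y) (FO F e) (FM F \<alpha>) (FO F f))" for m n
    using P.lrep_Mor Q.rmor_op by (simp cong: conj_cong)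
  then show ?thesis by (simp add: F2_def F1_def P.RG_op P.rrep_op Q.rcl_op)
qed

theorem xconn_morphism_F: "xconn_morphism (CG X) (CG Y) (F1 X Y F) (F2 X Y F)"
proof -
  interpret op: ind_functor "opi X" "opi Y" F by (rule ind_functor_opi)
  interpret P: op_pair X "opi X" by (rule X.op_pair_opi)
  interpret Q: op_pair Y "opi Y" by (rule Y.op_pair_opi)
  have pm: "pmap (opi Y) F = pmap Y F" by (simp add: pmap_def Q.pY fun_eq_iff)
  have mul: "pmul (opi X) = (\<lambda>A B. pmul X B A)" by (intro ext) (rule P.mY)
  show ?thesis
    unfolding CG_def F2_F1
  proof (rule cross_semigroup_morphism[OF X.cross_semigroup_dual Y.cross_semigroup_dual, where \<phi>="pmap Y F"])
    show "FO (F1 (opi X) (opi Y) F) \<in> extensional (Obj (RG X))" "FM (F1 (opi X) (opi Y) F) \<in> extensional (Mor (RG X))"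
      using op.F1_ext unfolding P.RG_op .
    show "FO (F1 (opi X) (opi Y) F) (plc (opi X) e) = plc (opi Y) (pmap Y F e)" if "e \<in> pS X" "pmul X e e = e" for e
      using op.F1_plc[of e] that P.pS_op P.mY pm by simp
    show "FM (F1 (opi X) (opi Y) F) (pLM (opi X) e s f) = pLM (opi Y) (pmap Y F e) (pmap Y F s) (pmap Y F f)"
      if "semigroup_category.valid (pS X) (\<lambda>a b. pmul X b a) e s f" for e s f
      using op.F1_pLM[of e s f] that unfolding mul P.pS_op pm by blast
  qed (fact pmap_in pmap_mul F1_ext F1_plc F1_pLM)+
qed

end

lemma F1_id: assumes "ind_functor X X (id_func (igg X))"
  shows "F1 X X (id_func (igg X)) = id_func (LG X)"
proof -
  interpret ind_functor X X "id_func (igg X)" by (rule assms)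
  show ?thesis
  proof (rule func_eqI[OF F1_ext(1) _ F1_ext(2)])
    show "FO (id_func (LG X)) \<in> extensional (Obj (LG X))" "FM (id_func (LG X)) \<in> extensional (Mor (LG X))"
      by (simp_all add: id_func_def)
    fix A assume A: "A \<in> Obj (LG X)"
    then obtain e where e: "e \<in> carr (igb X)" "A = lcl X e" unfolding X.LG_Obj by blast
    then show "FO (F1 X X (id_func (igg X))) A = FO (id_func (LG X)) A"
      using F1_Obj[OF e(1)] A by (simp add: id_func_simps)
  next
    fix m assume m: "m \<in> Mor (LG X)"
    then obtain e \<alpha> f where v: "X.vrep e \<alpha> f" "m = lmor X e \<alpha> f" unfolding X.LG_Mor by blast
    then show "FM (F1 X X (id_func (igg X))) m = FM (id_func (LG X)) m"
      using F1_Mor[OF v(1)] X.vrepD[OF v(1)] m by (simp add: id_func_simps)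
  qed
qed

lemma F1_comp:
  assumes F: "ind_functor X Y F" and K: "ind_functor Y Z K" and FK: "ind_functor X Z (comp_func (igg X) F K)"
  shows "F1 X Z (comp_func (igg X) F K) = comp_func (LG X) (F1 X Y F) (F1 Y Z K)"
proof -
  interpret f: ind_functor X Y F by (rule F)
  interpret k: ind_functor Y Z K by (rule K)
  interpret fk: ind_functor X Z "comp_func (igg X) F K" by (rule FK)
  show ?thesis
  proof (rule func_eqI[OF fk.F1_ext(1) comp_func_ext(1) fk.F1_ext(2) comp_func_ext(2)])
    fix A assume A: "A \<in> Obj (LG X)"
    then obtain e where e: "e \<in> carr (igb X)" "A = lcl X e" unfolding f.X.LG_Obj by blast
    then show "FO (F1 X Z (comp_func (igg X) F K)) A = FO (comp_func (LG X) (F1 X Y F) (F1 Y Z K)) A"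
      using fk.F1_Obj[OF e(1)] f.F1_Obj[OF e(1)] k.F1_Obj[OF f.F_carr[OF e(1)]] A by (simp add: comp_func_simps)
  next
    fix m assume m: "m \<in> Mor (LG X)"
    then obtain e \<alpha> g where v: "f.X.vrep e \<alpha> g" "m = lmor X e \<alpha> g" unfolding f.X.LG_Mor by blast
    then show "FM (F1 X Z (comp_func (igg X) F K)) m = FM (comp_func (LG X) (F1 X Y F) (F1 Y Z K)) m"
      using fk.F1_Mor[OF v(1)] f.F1_Mor[OF v(1)] k.F1_Mor[OF f.F_vrep[OF v(1)]] f.X.vrepD[OF v(1)] m
      by (simp add: comp_func_simps)
  qed
qed

lemma opi_func: "id_func (igg (opi X)) = id_func (igg X)" "comp_func (igg (opi X)) F K = comp_func (igg X) F K"
  by (simp_all add: id_func_def comp_func_def)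

theorem theorem4p23:
  shows "is_functor
           (IG :: (('e, 'm) indgpd, ('e, 'm) igmor) cat)
           (CC :: (('e set, ('e, 'm) tmor, 'e set, ('e, 'm) tmor) xconn,
                   ('e set, ('e, 'm) tmor, 'e set, ('e, 'm) tmor) ccmor) cat)
           \<lparr> FO = (\<lambda>X\<in>Obj IG. CG X),
             FM = (\<lambda>(X, Y, F)\<in>Mor IG. (CG X, CG Y, F1 X Y F, F2 X Y F)) \<rparr>"
    (is "is_functor _ _ ?F")
proof (rule is_functorI[OF IG_category CC_category])
  have cc: "cross_connection (CG X)" if "inductive_groupoid X" for X :: "('e, 'm) indgpd"
    using ind_gpd.cross_connection_CG[OF ind_gpd_of_inductive[OF that]] .
  have mor: "xconn_morphism (CG X) (CG Y) (F1 X Y F) (F2 X Y F)"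
    if "inductive_groupoid X" "inductive_groupoid Y" "inductive_functor X Y F" for X Y :: "('e, 'm) indgpd" and F
    using ind_functor.xconn_morphism_F[OF ind_functor_of_inductive[OF that]] .
  have app: "FO ?F X = CG X" if "inductive_groupoid X" for X using that by (simp add: IG_simps)
  have appM: "FM ?F (X, Y, F) = (CG X, CG Y, F1 X Y F, F2 X Y F)"
    if "inductive_groupoid X" "inductive_groupoid Y" "inductive_functor X Y F" for X Y F
    using that by (simp add: IG_simps)
  show "FO ?F \<in> extensional (Obj IG)" "FM ?F \<in> extensional (Mor IG)" by simp_all
  show "FO ?F X \<in> Obj CC" if "X \<in> Obj IG" for X using that cc by (simp add: IG_simps CC_simps)
  show "FM ?F m \<in> hom CC (FO ?F X) (FO ?F Y)" if m: "m \<in> hom IG X Y" for X Y m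
  proof -
    obtain F where F: "m = (X, Y, F)" "inductive_groupoid X" "inductive_groupoid Y" "inductive_functor X Y F"
      using m by (auto simp: IG_hom)
    show ?thesis unfolding F(1) appM[OF F(2-4)] app[OF F(2)] app[OF F(3)] CC_hom using cc F mor by blast
  qed
  show "FM ?F (Idn IG X) = Idn CC (FO ?F X)" if "X \<in> Obj IG" for X
  proof -
    have X: "inductive_groupoid X" using that by (simp add: IG_simps)
    note id = ind_functor_of_inductive[OF X X inductive_functor_id[OF X]]
    interpret ind_functor X X "id_func (igg X)" by (rule id)
    interpret P: op_pair X "opi X" by (rule X.op_pair_opi)
    have 1: "F1 X X (id_func (igg X)) = id_func (LG X)" by (rule F1_id[OF id])
    have "F1 (opi X) (opi X) (id_func (igg (opi X))) = id_func (LG (opi X))"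
      by (rule F1_id) (unfold opi_func, rule ind_functor_opi)
    then have 2: "F2 X X (id_func (igg X)) = id_func (RG X)" unfolding F2_F1 P.RG_op opi_func .
    show ?thesis
      unfolding IG_simps(3)[OF X] appM[OF X X inductive_functor_id[OF X]] app[OF X] CC_simps(3)[OF cc[OF X]] 1 2
      by (simp add: CG_def)
  qed
  show "FM ?F (m \<cdot>\<^bsub>IG\<^esub> n) = FM ?F m \<cdot>\<^bsub>CC\<^esub> FM ?F n" if mn: "m \<in> hom IG X Y" "n \<in> hom IG Y Z" for X Y Z m n
  proof -
    obtain F where F: "m = (X, Y, F)" "inductive_groupoid X" "inductive_groupoid Y" "inductive_functor X Y F"
      using mn(1) by (auto simp: IG_hom)
    obtain K where K: "n = (Y, Z, K)" "inductive_groupoid Z" "inductive_functor Y Z K"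
      using mn(2) by (auto simp: IG_hom)
    note FK = inductive_functor_comp[OF F(2,4) K(3)]
    have igm: "m \<in> Mor IG" "n \<in> Mor IG" using mn by (auto dest: hom_MorD)
    note f = ind_functor_of_inductive[OF F(2-4)] and k = ind_functor_of_inductive[OF F(3) K(2,3)] and fk = ind_functor_of_inductive[OF F(2) K(2) FK]
    interpret f: ind_functor X Y F by (rule f)
    interpret k: ind_functor Y Z K by (rule k)
    interpret fk: ind_functor X Z "comp_func (igg X) F K" by (rule fk)
    interpret P: op_pair X "opi X" by (rule f.X.op_pair_opi)
    have 1: "F1 X Z (comp_func (igg X) F K) = comp_func (LG X) (F1 X Y F) (F1 Y Z K)" by (rule F1_comp[OF f k fk])
    have fko: "ind_functor (opi X) (opi Z) (comp_func (igg (opi X)) F K)" using fk.ind_functor_opi by (simp only: opi_func)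
    have 2: "F2 X Z (comp_func (igg X) F K) = comp_func (RG X) (F2 X Y F) (F2 Y Z K)"
      unfolding f.F2_F1 k.F2_F1 fk.F2_F1 P.RG_op
      using F1_comp[OF f.ind_functor_opi k.ind_functor_opi fko] by (simp only: opi_func)
    have cm: "(CG X, CG Y, F1 X Y F, F2 X Y F) \<in> Mor CC" "(CG Y, CG Z, F1 Y Z K, F2 Y Z K) \<in> Mor CC"
      using cc mor F K by (auto simp: CC_simps)
    have mn': "m \<cdot>\<^bsub>IG\<^esub> n = (X, Z, comp_func (igg X) F K)" using IG_cmp igm F(1) K(1) by blast
    show ?thesis
      unfolding mn' unfolding appM[OF F(2) K(2) FK] F(1) K(1) appM[OF F(2-4)] appM[OF F(3) K(2,3)] CC_cmp[OF cm] 1 2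
      by (simp add: CG_def)
  qed
qed

end
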